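(* Let $\mathfrak f\in C^1(\mathbb{R};\mathbb{R}^{d})$ and let $A\in C^{1}(\mathbb{R};\mathbb{R}^{d\times d})$, with $A(\lambda)$ symmetric for every $\lambda\in\mathbb{R}$, be such that $a(\lambda):=A'(\lambda)$ is a positive semi-definite matrix for every $\lambda\in\mathbb{R}$. Then any bounded quasi-solution $u\in L^\infty(\mathbb{R}^{d+1}_+)$ to $$\partial_t u+\operatorname{div}_{\mathbf x}\mathfrak f(u)=D^2_{\mathbf x}\cdot A(u)$$ admits a bounded strong trace at $t=0$, i.e. there exists $u_0\in L^\infty(\mathbb{R}^{d})$ such that $$\operatorname{ess\,lim}_{t\to 0^+}u(t,\cdot)=u_0\quad\text{strongly in } L^1_{loc}(\mathbb{R}^d).$$
   Context: Notation: $\mathbb{R}^{d+1}_+:=(0,+\infty)\times\mathbb{R}^d$ with points $(t,\mathbf x)$; $D^2_{\mathbf x}\cdot B=\sum_{k,j=1}^d\partial^2_{x_kx_j}B_{kj}$ for a matrix-valued function $B$; $\operatorname{sgn}$ is the signum function. $\mathcal M(\mathbb{R}^{d+1}_+)$ denotes the space of (signed, possibly unbounded) Radon measures $\nu$ on $\mathbb{R}^{d+1}_+$ that are locally finite up to the boundary $t=0$: for every $T>0$ and compact $K\subseteq\mathbb{R}^d$, $\operatorname{Var}\nu((0,T]\times K)<\infty$, where $\operatorname{Var}\nu$ is the total variation of $\nu$. $C(\mathbb{R}_\lambda;w\star\text{-}\mathcal M(\mathbb{R}^{d+1}_+))$ is the space of maps $\lambda\mapsto\gamma(\cdot,\cdot,\lambda)\in\mathcal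 M(\mathbb{R}^{d+1}_+)$ that are continuous for the weak-$\star$ (vague) topology, where test functions are taken in $C_c([0,\infty)\times\mathbb{R}^d)$. Quasi-solution: a measurable function $u$ on $\mathbb{R}^{d+1}_+$ is a quasi-solution to $\partial_t u+\operatorname{div}_{\mathbf x}\mathfrak f(u)=D^2_{\mathbf x}\cdot A(u)$ if $u\in L^1_{loc}(\mathbb{R}^{d+1}_+)$, $\mathfrak f(u)\in L^1_{loc}(\mathbb{R}^{d+1}_+;\mathbb{R}^d)$, $A(u)\in L^1_{loc}(\mathbb{R}^{d+1}_+;\mathbb{R}^{d\times d})$, and there is $\gamma\in C(\mathbb{R}_\lambda;w\star\text{-}\mathcal M(\mathbb{R}^{d+1}_+))$ (the quasi-entropy defect measure) such that for every $\lambda\in\mathbb{R}$, in the sense of distributions on $\mathbb{R}^{d+1}_+$, $$\partial_t|u-\lambda|+\operatorname{div}_{\mathbf x}\bigl(\operatorname{sgn}(u-\lambda)(\mathfrak f(u)-\mathfrak f(\lambda))\bigr)-D^2_{\mathbf x}\cdot\bigl(\operatorname{sgn}(u-\lambda)(A(u)-A(\lambda))\bigr)=-\gamma(t,\mathbf x,\lambda).$$ Strong limit: $\operatorname{ess\,lim}_{t\to0^+}u(t,\cdot)=u_0$ in $L^1_{loc}(\mathbb{R}^d)$ means that there is a set $E\subseteq(0,\infty)$ of full Lebesgue measure such that for every relatively compact $K\subset\subset\mathbb{R}^d$, $\lim_{E\ni t\to0}\|u(t,\cdot)-u_0\|_{L^1(K)}=0$. *)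

theory Defs
  imports "HOL-Analysis.Analysis"
begin

definition half_space :: "(real \<times> 'a::euclidean_space) set" where
  "half_space = {0<..} \<times> UNIV"

definition Linfty_on :: "'a::euclidean_space set \<Rightarrow> ('a \<Rightarrow> real) \<Rightarrow> bool" where
  "Linfty_on S g \<longleftrightarrow>
     g \<in> borel_measurable (lebesgue_on S) \<and> (\<exists>M. AE x in lebesgue_on S. \<bar>g x\<bar> \<le> M)"

definition L1loc_on ::
    "'a::euclidean_space set \<Rightarrow> ('a \<Rightarrow> 'b::{banach, second_countable_topology}) \<Rightarrow> bool" where
  "L1loc_on S g \<longleftrightarrow> (\<forall>K. compact K \<and> K \<subseteq> S \<longrightarrow> g absolutely_integrable_on K)"

definition dir_deriv :: "'a::euclidean_space \<Rightarrow> ('a \<Rightarrow> real) \<Rightarrow> 'a \<Rightarrow> real" where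
  "dir_deriv e \<phi> z = frechet_derivative \<phi> (at z) e"

fun Ck :: "nat \<Rightarrow> ('a::euclidean_space \<Rightarrow> real) \<Rightarrow> bool" where
  "Ck 0 \<phi> \<longleftrightarrow> continuous_on UNIV \<phi>"
| "Ck (Suc k) \<phi> \<longleftrightarrow> (\<forall>z. \<phi> differentiable (at z)) \<and> (\<forall>e\<in>Basis. Ck k (dir_deriv e \<phi>))"

text \<open>Test functions on an open set, extended by zero to the whole space.\<close>

definition test_functions :: "'a::euclidean_space set \<Rightarrow> ('a \<Rightarrow> real) set" where
  "test_functions S =
     {\<phi>. (\<forall>k. Ck k \<phi>) \<and> compact (closure {z. \<phi> z \<noteq> 0}) \<and> closure {z. \<phi> z \<noteq> 0} \<subseteq> S}"

text \<open>Continuous, compactly supported functions on \<open>[0,\<infinity>) \<times> \<real>\<^sup>d\<close>, which need not vanish at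
  \<open>t = 0\<close>; values at \<open>t < 0\<close> are irrelevant.\<close>

definition Cc_closed_half_space :: "(real \<times> 'a::euclidean_space \<Rightarrow> real) set" where
  "Cc_closed_half_space =
     {\<phi>. continuous_on ({0..} \<times> UNIV) \<phi> \<and>
         (\<exists>K. compact K \<and> (\<forall>z \<in> {0..} \<times> UNIV - K. \<phi> z = 0))}"

text \<open>A signed, possibly unbounded Radon measure \<open>\<nu>\<close> is represented by its Jordan decomposition
  \<open>(\<nu>\<^sup>+, \<nu>\<^sup>-)\<close> into mutually singular positive Borel measures, both of which may have infinite
  total mass. Thus \<open>Var \<nu> = \<nu>\<^sup>+ + \<nu>\<^sup>-\<close>. Regularity of the two parts is automatic for
  locally finite Borel measures on the half-space.\<close>

type_synonym 'a signed_measure = "'a measure \<times> 'a measure"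

definition mutually_singular :: "'a measure \<Rightarrow> 'a measure \<Rightarrow> bool" where
  "mutually_singular P N \<longleftrightarrow>
     (\<exists>S \<in> sets P. emeasure P S = 0 \<and> emeasure N (space N - S) = 0)"

definition variation :: "'a signed_measure \<Rightarrow> 'a set \<Rightarrow> ennreal" where
  "variation \<nu> B = emeasure (fst \<nu>) B + emeasure (snd \<nu>) B"

definition signed_integral :: "'a signed_measure \<Rightarrow> ('a \<Rightarrow> real) \<Rightarrow> real" where
  "signed_integral \<nu> \<phi> = (LINT z|fst \<nu>. \<phi> z) - (LINT z|snd \<nu>. \<phi> z)"

definition radon_half_space :: "(real \<times> 'a::euclidean_space) signed_measure set" where
  "radon_half_space =
     {\<nu>. sets (fst \<nu>) = sets (restrict_space borel half_space) \<and>
         sets (snd \<nu>) = sets (restrict_space borel half_space) \<and>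
         mutually_singular (fst \<nu>) (snd \<nu>) \<and>
         (\<forall>T>0. \<forall>K. compact K \<longrightarrow> variation \<nu> ({0<..T} \<times> K) < \<infinity>)}"

definition weak_star_continuous ::
    "(real \<Rightarrow> (real \<times> 'a::euclidean_space) signed_measure) \<Rightarrow> bool" where
  "weak_star_continuous \<gamma> \<longleftrightarrow>
     (\<forall>\<phi> \<in> Cc_closed_half_space. continuous_on UNIV (\<lambda>l. signed_integral (\<gamma> l) \<phi>))"

text \<open>Pairings of the distributions \<open>\<partial>\<^sub>t g\<close>, \<open>div\<^sub>x F\<close> and
  \<open>D\<^sup>2\<^sub>x \<cdot> B = \<Sum>\<^sub>k\<^sub>j \<partial>\<^sup>2 B\<^sub>k\<^sub>j / \<partial>x\<^sub>k \<partial>x\<^sub>j\<close> with a test function.\<close>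

definition dist_dt :: "(real \<times> (real^'d) \<Rightarrow> real) \<Rightarrow> (real \<times> (real^'d) \<Rightarrow> real) \<Rightarrow> real" where
  "dist_dt g \<phi> = - (LINT z:half_space|lebesgue. g z * dir_deriv (1, 0) \<phi> z)"

definition dist_div :: "(real \<times> (real^'d) \<Rightarrow> real^'d) \<Rightarrow> (real \<times> (real^'d) \<Rightarrow> real) \<Rightarrow> real" where
  "dist_div F \<phi> =
     - (\<Sum>k\<in>UNIV. LINT z:half_space|lebesgue. F z $ k * dir_deriv (0, axis k 1) \<phi> z)"

definition dist_D2 :: "(real \<times> (real^'d) \<Rightarrow> real^'d^'d) \<Rightarrow> (real \<times> (real^'d) \<Rightarrow> real) \<Rightarrow> real" where
  "dist_D2 B \<phi> =
     (\<Sum>k\<in>UNIV. \<Sum>j\<in>UNIV. LINT z:half_space|lebesgue.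
        B z $ k $ j * dir_deriv (0, axis k 1) (dir_deriv (0, axis j 1) \<phi>) z)"

definition quasi_solution ::
    "(real \<Rightarrow> real^'d) \<Rightarrow> (real \<Rightarrow> real^'d^'d) \<Rightarrow> (real \<times> (real^'d) \<Rightarrow> real) \<Rightarrow> bool" where
  "quasi_solution f A u \<longleftrightarrow>
     u \<in> borel_measurable (lebesgue_on half_space) \<and>
     L1loc_on half_space u \<and>
     L1loc_on half_space (\<lambda>z. f (u z)) \<and>
     L1loc_on half_space (\<lambda>z. A (u z)) \<and>
     (\<exists>\<gamma>. (\<forall>l. \<gamma> l \<in> radon_half_space) \<and> weak_star_continuous \<gamma> \<and>
        (\<forall>l. \<forall>\<phi> \<in> test_functions half_space.
           dist_dt (\<lambda>z. \<bar>u z - l\<bar>) \<phi>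
           + dist_div (\<lambda>z. sgn (u z - l) *\<^sub>R (f (u z) - f l)) \<phi>
           - dist_D2 (\<lambda>z. sgn (u z - l) *\<^sub>R (A (u z) - A l)) \<phi>
           = - signed_integral (\<gamma> l) \<phi>))"

definition positive_semidefinite :: "real^'d^'d \<Rightarrow> bool" where
  "positive_semidefinite M \<longleftrightarrow> transpose M = M \<and> (\<forall>\<xi>. 0 \<le> \<xi> \<bullet> (M *v \<xi>))"

text \<open>The integrability clause makes the \<open>L\<^sup>1(K)\<close>-norms meaningful: slices of a Lebesgue
  measurable function need only be measurable for almost every \<open>t\<close>, and the Bochner integral of a
  non-integrable function is \<open>0\<close> by convention.\<close>

definition strong_trace :: "(real \<times> 'a::euclidean_space \<Rightarrow> real) \<Rightarrow> ('a \<Rightarrow> real) \<Rightarrow> bool" where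
  "strong_trace u u0 \<longleftrightarrow>
     (\<exists>E. E \<subseteq> {0<..} \<and> {0<..} - E \<in> null_sets lebesgue \<and>
        (\<forall>K \<in> sets lebesgue. compact (closure K) \<longrightarrow>
           (\<forall>t\<in>E. (\<lambda>x. u (t, x) - u0 x) absolutely_integrable_on K) \<and>
           ((\<lambda>t. LINT x:K|lebesgue. \<bar>u (t, x) - u0 x\<bar>) \<longlongrightarrow> 0) (at 0 within E)))"

end

theory Submission
  imports Defs "HOL-Probability.Probability"
begin

text \<open>Testing with functions that do not vanish at \<open>t = 0\<close> turns the equation for each level \<open>l\<close> into a
 balance law on the closed half space that contains the weak trace of \<open>\<bar>u - l\<bar>\<close>. Half the difference
 quotient of the laws at \<open>p\<close> and \<open>p + kap\<close> concerns a bounded function \<open>v\<close>, increasing in \<open>u\<close>, with fluxes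
 that are almost linear in \<open>v\<close>: the curve \<open>(1, f', A')\<close> restricted to \<open>(p, p + eps)\<close> spans a space
 with a basis of finitely many of its own points \<open>j\<close>, so the law is a combination of the linear operators
 with symbols \<open>sigma j xi = \<Sum>l. (s j l \<bullet> xi)^2 + \<i> (b j \<bullet> xi)\<close> in which the operator at the base
 point dominates. After damping by \<open>exp (- t / T)\<close> the Fourier transform of \<open>v\<close> minus its trace is small
 in \<open>L^2\<close>, relative to \<open>T\<close>, on the region of frequencies where \<open>sigma j\<close> is the largest of the symbols. This uses
 \<open>Re sigma j \<ge> 0\<close> and an interpolation between total variation and a negative norm for the defect
 measure. The regions cover all frequencies, whence averages over \<open>0 < t < T\<close> of the distance of \<open>v\<close> to
 its trace tend to zero. Moving the level \<open>p\<close> through the range of \<open>u\<close> in small steps gives the same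
 for \<open>u\<close>, and as the distances to a fixed function have essential limits at \<open>t = 0\<close>, the averages
 can be removed.\<close>

hide_fact (open) Henstock_Kurzweil_Integration.integral_cong Henstock_Kurzweil_Integration.integral_add
 Henstock_Kurzweil_Integration.integral_diff Henstock_Kurzweil_Integration.integrable_add
 Henstock_Kurzweil_Integration.integrable_diff Henstock_Kurzweil_Integration.integrable_sum
 Henstock_Kurzweil_Integration.integral_sum Henstock_Kurzweil_Integration.integral_nonneg
 Henstock_Kurzweil_Integration.integrable_cong Henstock_Kurzweil_Integration.integral_cnj
 Henstock_Kurzweil_Integration.integrable_bound

text \<open>The fluxes may be degenerate, even affine on intervals, so nonlinearity yields no
  compactness and the strong trace must already exist for linear equations. There it does because
  symbols have nonnegative real part: damping at scale \<open>T\<close> keeps them at least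
  \<open>1 / T\<close> in modulus, and the difference between \<open>v\<close> and a smooth
  substitute of its trace, extended by zero to \<open>t < 0\<close>, has a source of small mass. A
  nonlinear flux brings several symbols, and an error \<open>om\<close> multiplied by a symbol
  larger than the one being inverted would be fatal. This forces one base level per frequency
  region, just above \<open>p\<close>. Two facts permit it. The span of the velocity curve to the
  right of \<open>p\<close> has constant dimension near \<open>p\<close>, so base points can
  approach \<open>p\<close> without losing the span. The integrals of the traces of the difference
  quotients are bounded over all step sizes, and a step that nearly attains their supremum bounds
  the price of moving from \<open>p\<close> to a base point. An error \<open>eps\<close> per unit of
  level then adds up to a multiple of \<open>eps\<close>, the range of \<open>u\<close> being
  bounded.\<close>

abbreviation LebInt (binder "LB " 60) where "LebInt f == lebesgue_integral lborel f"
abbreviation "Borel == borel_measurable borel"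
abbreviation "L1 == integrable lborel"
abbreviation "hs == indicator half_space"
abbreviation "dd == dir_deriv"
abbreviation "cor == complex_of_real"
abbreviation LimSeq (infixr "---->" 60) where "f ----> l == f \<longlonglongrightarrow> l"
abbreviation (input) EvR (binder "EV " 10) where "EvR P == eventually P (at_right (0::real))"

section \<open>Gaussian kernels\<close>

lemma lborel_integral_prod_Basis:
 fixes h :: "'e::euclidean_space => real => 'k::{real_normed_field,banach,second_countable_topology}"
 assumes "!!b. b \<in> Basis ==> L1 (h b)"
 shows "L1 (%x::'e. \<Prod>b\<in>Basis. h b (x \<bullet> b))" (is ?goalA)
  and "(LB x. (\<Prod>b\<in>Basis. h b (x \<bullet> b))) = (\<Prod>b\<in>Basis. LB t. h b t)" (is ?goalB)
proof -
 interpret product_sigma_finite "%b::'e. lborel :: real measure" by standard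
 have m[measurable]: "h b \<in> Borel" if "b \<in> Basis" for b
  using borel_measurable_integrable[OF assms[OF that]] by simp
 have m2: "(%f. \<Sum>b\<in>Basis. f b *\<^sub>R b) \<in> (\<Pi>\<^sub>M b\<in>(Basis::'e set). (lborel::real measure)) \<rightarrow>\<^sub>M (borel::'e measure)"
  by measurable
 have m3: "(%x::'e. \<Prod>b\<in>Basis. h b (x \<bullet> b)) \<in> Borel" by measurable
 have eq: "(\<Prod>b\<in>Basis. h b ((\<Sum>c\<in>Basis. f c *\<^sub>R c) \<bullet> b)) = (\<Prod>b\<in>Basis. h b (f b))" for f :: "'e => real"
  by (intro prod.cong refl) simp
 show ?goalA
  by (subst lborel_eq, subst integrable_distr_eq[OF m2 m3], unfold eq)
    (intro product_integrable_prod assms finite_Basis)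
 show ?goalB
  by (subst lborel_eq, subst integral_distr[OF m2 m3], unfold eq)
    (intro product_integral_prod assms finite_Basis)
qed

lemma norm_cis_mult [simp]: "cmod (cis a * z) = cmod z" "cmod (z * cis a) = cmod z"
 by (simp_all add: norm_mult)

lemma borel_measurable_cis [measurable]: "cis \<in> Borel"
 by (intro borel_measurable_continuous_onI continuous_intros)

lemma integrable_std_gauss: "L1 (%x. exp (- (x::real)\<^sup>2 / 2))"
proof -
 have "L1 (%x. sqrt (2 * pi) * std_normal_density x)"
  by (intro integrable_mult_right integrable_normal_density) auto
 thus ?thesis by (simp add: std_normal_density_def)
qed

text \<open>The characteristic function of the standard normal law, rescaled by \<open>e\<close>.
  The result is again a normal density, of standard deviation \<open>e\<close>, which makes
  \<open>gauss\<close> and \<open>normal_kernel\<close> a transform pair.\<close>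

lemma gauss_integral_1d:
 assumes e: "0 < e"
 shows "L1 (%x::real. cis (x * t) * of_real (exp (- (e * x)\<^sup>2 / 2)))"
  and "(LB x. cis (x * t) * of_real (exp (- (e * x)\<^sup>2 / 2))) = of_real (2 * pi * normal_density 0 e t)" (is ?goalB)
proof -
 let ?t1 = "LB x. cis (x * t / e) * of_real (exp (- x\<^sup>2 / 2))"
 let ?t2 = "%x. std_normal_density x *\<^sub>R iexp ((t / e) * x)"
 let ?t3 = "%x. exp (- (e * x)\<^sup>2 / 2)"
 have i1: "L1 (%x::real. cis (x * t / e) * of_real (exp (- x\<^sup>2 / 2)))"
  by (rule integrable_bound[OF integrable_std_gauss]) auto
 have i2: "L1 (%x::real. cis (e * x * t / e) * of_real (?t3 x))"
  using lborel_integrable_real_affine[OF i1, of e 0] e by (simp add: mult.assoc)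
 thus "L1 (%x::real. cis (x * t) * of_real (?t3 x))"
  using e by simp
 have c: "(CLINT x|std_normal_distribution. iexp ((t / e) * x)) = cor (exp (- ((t/e)^2) / 2))"
  using fun_cong[OF char_std_normal_distribution, of "t/e"] by (simp add: char_def)
 have "?t1 =
   (LB x. sqrt (2 * pi) *\<^sub>R (?t2 x))"
  by (intro integral_cong refl)
   (simp add: std_normal_density_def cis_conv_exp scaleR_conv_of_real mult_ac)
 also have "\<dots> = sqrt (2 * pi) *\<^sub>R (LB x. (?t2 x))"
  by (simp del: scaleR_scaleR)
 also have "(LB x. (?t2 x)) = (CLINT x|std_normal_distribution. iexp ((t / e) * x))"
  by (subst integral_density) (auto simp: normal_density_nonneg)
 finally have A: "?t1 =
   sqrt (2 * pi) *\<^sub>R cor (exp (- ((t/e)^2) / 2))"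
  unfolding c .
 have "?t1 =
  e *\<^sub>R (LB x. cis (x * t) * of_real (?t3 x))"
  using lborel_integral_real_affine[of e "%x. cis (x * t / e) * of_real (exp (- x\<^sup>2 / 2))" 0] e by simp
 hence "(LB x. cis (x * t) * of_real (?t3 x)) =
   of_real (sqrt (2 * pi) / e * exp (- ((t/e)^2) / 2))"
  using e unfolding A by (simp add: scaleR_conv_of_real field_simps)
 also have "sqrt (2 * pi) / e * exp (- ((t/e)^2) / 2) = 2 * pi * normal_density 0 e t"
 proof -
  have "2 * pi = sqrt (2 * pi) * sqrt (2 * pi)" by simp
  thus ?thesis using e unfolding normal_density_def
   by (simp add: real_sqrt_mult power_divide divide_simps)
 qed
 finally show ?goalB .
qed

text \<open>A summability factor: it increases to 1 as \<open>e\<close> decreases to 0, while its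
  transform, up to a power of \<open>2 * pi\<close> the function \<open>normal_kernel e\<close>, is
  a probability density that concentrates at 0.\<close>

definition gauss :: "real => 'e::euclidean_space => real" where
 "gauss e x = exp (- (e * norm x)\<^sup>2 / 2)"

definition normal_kernel :: "real => 'e::euclidean_space => real" where
 "normal_kernel e x = (\<Prod>b\<in>Basis. normal_density 0 e (x \<bullet> b))"

lemma gauss_prod: "gauss e x = (\<Prod>b\<in>Basis. exp (- (e * (x \<bullet> b))\<^sup>2 / 2))"
proof -
 have "(norm x)^2 = (\<Sum>b\<in>Basis. (x \<bullet> b)^2)"
  by (simp add: norm_eq_sqrt_inner euclidean_inner[of x x] power2_eq_square sum_nonneg)
 hence "- (e * norm x)\<^sup>2 / 2 = (\<Sum>b\<in>Basis. - (e * (x \<bullet> b))\<^sup>2 / 2)"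
  by (simp add: power_mult_distrib sum_distrib_left sum_negf sum_divide_distrib)
 thus ?thesis unfolding gauss_def by (simp add: exp_sum)
qed

lemma cis_sum: "finite A ==> cis (\<Sum>a\<in>A. g a) = (\<Prod>a\<in>A. cis (g a))"
 by (induction A rule: finite_induct) (auto simp: cis_mult[symmetric])

lemma cis_gauss_prod:
 "cis (x \<bullet> y) * of_real (gauss e x) = (\<Prod>b\<in>Basis. cis ((x \<bullet> b) * (y \<bullet> b)) * of_real (exp (- (e * (x \<bullet> b))\<^sup>2 / 2)))"
 for x y :: "'e::euclidean_space"
 by (subst euclidean_inner) (simp add: gauss_prod cis_sum prod.distrib)

lemma gauss_integral:
 fixes y :: "'e::euclidean_space"
 assumes e: "0 < e"
 shows "L1 (%x. cis (x \<bullet> y) * of_real (gauss e x))" (is ?goalA)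
  and "(LB x. cis (x \<bullet> y) * of_real (gauss e x)) = of_real ((2 * pi) ^ DIM('e) * normal_kernel e y)" (is ?goalB)
proof -
 note L = lborel_integral_prod_Basis[where ?'e='e and h = "%b x. cis (x * (y \<bullet> b)) * of_real (exp (- (e * x)\<^sup>2 / 2))", OF gauss_integral_1d(1)[OF e]]
 show ?goalA
  unfolding cis_gauss_prod by (rule L(1))
 show ?goalB
  unfolding cis_gauss_prod
  by (subst L(2)) (simp_all only: gauss_integral_1d(2)[OF e] normal_kernel_def of_real_prod[symmetric] prod.distrib prod_constant, simp add: power_mult_distrib)
qed

lemma gauss_nonneg [simp]: "0 <= gauss e x" and gauss_le_1 [simp]: "gauss e x <= 1"
 by (auto simp: gauss_def)

lemma borel_measurable_gauss [measurable]: "gauss e \<in> Borel"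
 unfolding gauss_def by measurable

lemma borel_measurable_normal_kernel [measurable]: "normal_kernel e \<in> Borel"
 unfolding normal_kernel_def by measurable

lemma integrable_gauss: "0 < e ==> L1 (gauss e)"
 using gauss_integral(1)[of e 0, THEN integrable_norm] by (simp add: norm_mult)

lemma normal_kernel_nonneg [simp]: "0 <= normal_kernel e x"
 by (auto simp: normal_kernel_def intro!: prod_nonneg)

lemma normal_kernel_integral:
 assumes e: "0 < e"
 shows "L1 (normal_kernel e :: 'e::euclidean_space => real)"
  and "(LB x. normal_kernel e (x::'e)) = 1" (is ?goalB)
proof -
 note L = lborel_integral_prod_Basis[where ?'e='e and h = "%b x. normal_density 0 e x"]
 show "L1 (normal_kernel e :: 'e => real)"
  unfolding normal_kernel_def using e by (intro L(1)) auto
 show ?goalB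
  unfolding normal_kernel_def using e by (subst L(2)) auto
qed

text \<open>This class is stable under sums, translations and products with bounded functions and
  lies in every \<open>L^p\<close>. All functions transformed below belong to it, so the transform
  is always an absolutely convergent integral and no extension to \<open>L^2\<close> by density is
  needed.\<close>

definition bsupp :: "('e::euclidean_space => real) => bool" where
 "bsupp f \<longleftrightarrow> f \<in> Borel \<and> (\<exists>B. \<forall>x. \<bar>f x\<bar> <= B) \<and> (\<exists>R. \<forall>x. R < norm x --> f x = 0)"

lemma bsuppE:
 assumes "bsupp f"
 obtains B R where "0 < B" "0 < R" "!!x. \<bar>f x\<bar> <= B" "!!x. R < norm x ==> f x = 0" "f \<in> Borel"
proof -
 from assms obtain B R where "!!x. \<bar>f x\<bar> <= B" "!!x. R < norm x ==> f x = 0" "f \<in> Borel"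
  by (auto simp: bsupp_def)
 thus ?thesis
  by (intro that[of "max B 1" "max R 1"]) (auto simp: le_max_iff_disj)
qed

lemma bsupp_mult:
 assumes "bsupp f" "g \<in> Borel" "!!x. \<bar>g x\<bar> <= C"
 shows "bsupp (%x. f x * g x)"
proof -
 obtain B R where "0 < B" "0 < R" "!!x. \<bar>f x\<bar> <= B" "!!x. R < norm x ==> f x = 0" and [measurable]: "f \<in> Borel"
  using bsuppE[OF assms(1)] by blast
 moreover have "\<bar>f x * g x\<bar> <= B * C" for x
  unfolding abs_mult using \<open>0 < B\<close> \<open>!!x. \<bar>f x\<bar> <= B\<close> assms(3)[of x] by (intro mult_mono) auto
 moreover have "(%x. f x * g x) \<in> Borel"
  using assms(2) by measurable
 ultimately show ?thesis unfolding bsupp_def by (metis mult_zero_left)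
qed

lemma bsupp_add:
 assumes "bsupp f" "bsupp g"
 shows "bsupp (%x. f x + g x)"
proof -
 obtain B R where 1: "!!x. \<bar>f x\<bar> <= B" "!!x. R < norm x ==> f x = 0" and [measurable]: "f \<in> Borel"
  using bsuppE[OF assms(1)] by metis
 obtain B' R' where 2: "!!x. \<bar>g x\<bar> <= B'" "!!x. R' < norm x ==> g x = 0" and [measurable]: "g \<in> Borel"
  using bsuppE[OF assms(2)] by metis
 have "\<bar>f x + g x\<bar> <= B + B'" for x using 1(1)[of x] 2(1)[of x] by linarith
 moreover have "f x + g x = 0" if "max R R' < norm x" for x using that 1(2)[of x] 2(2)[of x] by simp
 moreover have "(%x. f x + g x) \<in> Borel" by measurable
 ultimately show ?thesis unfolding bsupp_def by blast
qed

lemma bsupp_cmult: "bsupp f ==> bsupp (%x. c * f x)"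
 using bsupp_mult[of f "%_. c" "\<bar>c\<bar>"] by (simp add: mult.commute)

lemma bsupp_0 [simp]: "bsupp (%_. 0)"
 by (auto simp: bsupp_def)

lemma bsupp_sum:
 "(!!i. i \<in> I ==> bsupp (f i)) ==> bsupp (%x. \<Sum>i\<in>I. f i x)"
 by (induction I rule: infinite_finite_induct) (auto intro: bsupp_add)

lemma bsupp_diff: "bsupp f ==> bsupp g ==> bsupp (%x. f x - g x)"
 using bsupp_add[OF _ bsupp_cmult[of g "-1"]] by simp

lemma bsupp_measurable: "bsupp f ==> f \<in> Borel"
 by (simp add: bsupp_def)

lemma bsupp_integrable:
 assumes "bsupp (f :: 'e::euclidean_space => real)"
 shows "L1 f"
proof -
 obtain B R where *: "0 < B" "0 < R" "!!x. \<bar>f x\<bar> <= B" "!!x. R < norm x ==> f x = 0" and [measurable]: "f \<in> Borel"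
  using bsuppE[OF assms] by blast
 have "L1 (%x::'e. B * indicator (cball 0 R) x)"
  by (intro integrable_mult_right integrable_real_indicator emeasure_bounded_finite) auto
 moreover have "norm (f x) <= norm (B * indicator (cball 0 R) x)" for x
  using *(1) *(3)[of x] *(4)[of x] by (cases "R < norm x") (auto simp: indicator_def dist_norm)
 ultimately show ?thesis
  by (intro integrable_bound[where f="%x::'e. B * indicator (cball 0 R) x" and g=f] AE_I2) auto
qed

lemma bsupp_sq: "bsupp f ==> bsupp (%x. (f x)^2)"
 unfolding power2_eq_square by (metis bsuppE bsupp_mult)

lemma bsupp_abs: "bsupp f ==> bsupp (%x. \<bar>f x\<bar>)"
 unfolding bsupp_def by (auto intro: borel_measurable_abs)

lemma bsupp_translate:
 assumes "bsupp f" shows "bsupp (%x. f (x + h))"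
proof -
 obtain B R where 1: "!!x. \<bar>f x\<bar> <= B" "!!x. R < norm x ==> f x = 0" and [measurable]: "f \<in> Borel"
  using bsuppE[OF assms(1)] by metis
 have "f (x + h) = 0" if "R + norm h < norm x" for x
  using that norm_triangle_ineq4[of "x + h" h] by (intro 1(2)) auto
 moreover have "(%x. f (x + h)) \<in> Borel" by measurable
 ultimately show ?thesis using 1(1) unfolding bsupp_def by blast
qed

lemma lborel_integral_translate:
 fixes f :: "'e::euclidean_space => 'b::{banach,second_countable_topology}"
 assumes "f \<in> Borel"
 shows "(LB x. f (x + h)) = (LB x. f x)"
proof -
 have "(LB x. f x) = (LINT x|distr lborel borel ((+) h). f x)"
  by (simp add: lborel_distr_plus)
 also have "\<dots> = (LB x. f (h + x))"
  by (rule integral_distr) (use assms in auto)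
 finally show ?thesis by (simp add: add.commute)
qed

text \<open>A measurable function is an almost everywhere limit of continuous ones. Clamping these
  to \<open>[-B, B]\<close> and cutting them off beyond the support preserves the limit, because
  \<open>f\<close> satisfies the same restrictions, and supplies a majorant for dominated
  convergence.\<close>

lemma L1_approx_continuous:
 fixes f :: "'e::euclidean_space => real"
 assumes "bsupp f" "0 < eps" "!!x. \<bar>f x\<bar> <= B"
 obtains g where "continuous_on UNIV g" "bsupp g" "!!x. \<bar>g x\<bar> <= B" "(LB x. \<bar>f x - g x\<bar>) < eps"
proof -
 obtain R where *: "0 < R" "!!x. R < norm x ==> f x = 0" and m[measurable]: "f \<in> Borel"
  using bsuppE[OF assms(1)] by metis
 have B0: "0 <= B" using assms(3)[of 0] by linarith
 have "f measurable_on UNIV"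
  by (subst measurable_on_iff_borel_measurable) (auto simp: lebesgue_on_UNIV_eq intro: measurable_completion)
 then obtain N g where N: "negligible N" and gc: "!!n. continuous_on UNIV (g n)"
  and gl: "!!x. x \<notin> N ==> (%n. g n x) ----> f x"
  unfolding measurable_on_def by auto
 define cut where "cut x = max 0 (min 1 (R + 1 - norm x))" for x :: 'e
 define h where "h n x = max (-B) (min B (g n x)) * cut x" for n x
 have hc: "continuous_on UNIV (h n)" for n
  unfolding h_def cut_def by (intro continuous_intros gc)
 have cut: "0 <= cut x" "cut x <= 1" for x by (auto simp: cut_def)
 have hB: "\<bar>h n x\<bar> <= B" for n x
 proof -
  have "\<bar>h n x\<bar> <= B * 1" unfolding h_def abs_mult using cut[of x] B0 by (intro mult_mono) auto
  thus ?thesis by simp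
 qed
 have h0: "h n x = 0" if "R + 1 < norm x" for n x using that by (simp add: h_def cut_def)
 have [measurable]: "h n \<in> Borel" for n
  using hc by (rule borel_measurable_continuous_onI)
 have hs: "bsupp (h n)" for n
  unfolding bsupp_def using hB h0[of _ n] by (intro conjI exI[of _ B] exI[of _ "R + 1"]) auto
 have hl: "(%n. h n x) ----> f x" if "x \<notin> N" for x
 proof -
  have "(%n. h n x) ----> max (-B) (min B (f x)) * cut x"
   unfolding h_def by (intro tendsto_intros gl that)
  also have "max (-B) (min B (f x)) * cut x = f x"
   using assms(3)[of x] *(2)[of x] by (cases "R < norm x") (auto simp: cut_def)
  finally show ?thesis .
 qed
 have int: "L1 (%x::'e. 2 * B * indicator (cball 0 (R+1)) x)"
  by (intro integrable_mult_right integrable_real_indicator emeasure_bounded_finite) auto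
 have "(%n. LB x. \<bar>f x - h n x\<bar>) ----> (LB x::'e. 0)"
 proof (rule integral_dominated_convergence[OF _ _ int])
  have "N \<in> null_sets lebesgue" using N by (simp add: negligible_iff_null_sets)
  hence "AE x in lborel. x \<notin> N"
   by (metis AE_completion_iff AE_not_in)
  thus "AE x in lborel. (%n. \<bar>f x - h n x\<bar>) ----> 0"
  proof (eventually_elim)
   case (elim x)
   from tendsto_diff[OF tendsto_const[of "f x"] hl[OF elim]] show ?case
    by (simp add: tendsto_rabs_zero)
  qed
  show "AE x in lborel. norm \<bar>f x - h n x\<bar> <= 2 * B * indicator (cball 0 (R + 1)) x" for n
  proof (intro AE_I2)
   fix x show "norm \<bar>f x - h n x\<bar> <= 2 * B * indicator (cball 0 (R + 1)) x"
    using hB[of n x] assms(3)[of x] h0[of x n] *(2)[of x] B0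
    by (cases "R + 1 < norm x") (auto simp: indicator_def dist_norm)
  qed
 qed auto
 hence "(%n. LB x. \<bar>f x - h n x\<bar>) ----> 0" by simp
 then obtain n where "\<bar>LB x. \<bar>f x - h n x\<bar>\<bar> < eps"
  using assms(2) by (metis (mono_tags, lifting) LIMSEQ_D diff_zero le_refl real_norm_def)
 thus ?thesis by (intro that[of "h n"] hc hs hB) auto
qed

section \<open>Exchange of integrals under a product majorant\<close>

lemma integrable_pair_dominated:
 fixes f :: "'a \<times> 'b => 'k::{banach,second_countable_topology}"
 assumes "sigma_finite_measure M1" "sigma_finite_measure M2"
  and [measurable]: "f \<in> borel_measurable (M1 \<Otimes>\<^sub>M M2)" and g: "integrable M1 g" and h: "integrable M2 h"
  and le: "!!x y. norm (f (x, y)) <= g x * h y"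
 shows "integrable (M1 \<Otimes>\<^sub>M M2) f"
proof -
 interpret sigma_finite_measure M1 by fact
 interpret M2: sigma_finite_measure M2 by fact
 interpret P: pair_sigma_finite M1 M2 ..
 have gm[measurable]: "g \<in> borel_measurable M1" "h \<in> borel_measurable M2"
  using g h by auto
 have "integrable (M1 \<Otimes>\<^sub>M M2) (%(x, y). g x * h y :: real)"
 proof (rule P.Fubini_integrable)
  show "integrable M1 (%x. LINT y|M2. norm (case (x, y) of (x, y) => g x * h y))"
   using g by (simp add: abs_mult)
 qed (use h in \<open>auto\<close>)
 thus ?thesis
  by (rule integrable_bound) (auto intro!: AE_I2 order_trans[OF le])
qed

lemma Fubini_dominated:
 fixes f :: "'a => 'b => 'k::{banach,second_countable_topology}"
 assumes "sigma_finite_measure M1" "sigma_finite_measure M2"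
  and "case_prod f \<in> borel_measurable (M1 \<Otimes>\<^sub>M M2)" and "integrable M1 g" and "integrable M2 h"
  and "!!x y. norm (f x y) <= g x * h y"
 shows "(LINT y|M2. LINT x|M1. f x y) = (LINT x|M1. LINT y|M2. f x y)"
proof -
 interpret sigma_finite_measure M1 by fact
 interpret M2: sigma_finite_measure M2 by fact
 interpret P: pair_sigma_finite M1 M2 ..
 show ?thesis
  by (intro P.Fubini_integral integrable_pair_dominated[OF assms(1-5)]) (use assms(6) in auto)
qed

section \<open>Fourier transforms\<close>

definition ft :: "('e::euclidean_space => real) => 'e => complex" where
 "ft f xi = (LB x. cis (- (xi \<bullet> x)) * of_real (f x))"

lemma integrable_cis_mult:
 fixes H :: "'a => complex"
 assumes "integrable M H" "p \<in> borel_measurable M"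
 shows "integrable M (%x. cis (p x) * H x)"
proof -
 have [measurable]: "H \<in> borel_measurable M" "p \<in> borel_measurable M" using assms by auto
 show ?thesis
  by (rule integrable_bound[OF assms(1)]) auto
qed

lemma borel_measurable_fourier:
 fixes io :: "'a => 'e::euclidean_space" and g :: "'a => complex"
 assumes "sigma_finite_measure M" and [measurable]: "io \<in> borel_measurable M" "g \<in> borel_measurable M"
 shows "(%xi. LINT x|M. cis (- (xi \<bullet> io x)) * g x) \<in> Borel"
proof -
 interpret sigma_finite_measure M by fact
 show ?thesis by measurable
qed

lemma norm_fourier_le:
 fixes g :: "'a => complex"
 assumes "integrable M g"
 shows "cmod (LINT x|M. cis (p x) * g x) <= (LINT x|M. cmod (g x))"
proof -
 have "cmod (LINT x|M. cis (p x) * g x) <= (LINT x|M. cmod (cis (p x) * g x))"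
  by (rule integral_norm_bound)
 thus ?thesis by simp
qed

lemma sigma_finite_lborel: "sigma_finite_measure lborel" ..

lemma borel_measurable_ft [measurable (raw)]:
 "f \<in> Borel ==> ft f \<in> Borel"
 unfolding ft_def[abs_def] by (intro borel_measurable_fourier sigma_finite_lborel) auto

lemma ft_bounded:
 assumes "bsupp f" shows "cmod (ft f xi) <= (LB x. \<bar>f x\<bar>)"
proof -
 have "L1 (%x. cor (f x))"
  using bsupp_integrable[OF assms] by simp
 from norm_fourier_le[OF this, of "%x. - (xi \<bullet> x)"] show ?thesis by (simp add: ft_def)
qed

lemma ft_add: "bsupp f ==> bsupp g ==> ft (%x. f x + g x) xi = ft f xi + ft g xi"
 unfolding ft_def
 by (subst integral_add[symmetric])
  (auto simp: distrib_left intro!: integrable_cis_mult bsupp_integrable)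

lemma ft_cmult: "ft (%x. c * f x) xi = of_real c * ft f xi"
 unfolding ft_def by (subst integral_mult_right_zero[symmetric]) (simp add: mult_ac)

lemma ft_diff: "bsupp f ==> bsupp g ==> ft (%x. f x - g x) xi = ft f xi - ft g xi"
 using ft_add[OF _ bsupp_cmult[of g "-1"], of f xi] ft_cmult[of "-1" g xi] by simp

lemma integrable_gauss_mult:
 assumes "0 < e" and [measurable]: "G \<in> Borel" and "!!xi. cmod (G xi) <= C"
 shows "L1 (%xi::'e::euclidean_space. G xi * of_real (gauss e xi))"
proof (rule integrable_bound)
 show "L1 (%xi::'e. C * gauss e xi)" by (intro integrable_mult_right integrable_gauss assms(1))
 have "0 <= C" using assms(3)[of 0] norm_ge_zero order_trans by blast
 thus "AE xi in lborel. norm (G xi * of_real (gauss e xi)) <= norm (C * gauss e (xi::'e))"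
  using assms(3) by (intro AE_I2) (auto simp: norm_mult intro!: mult_right_mono)
qed auto

lemma normal_kernel_integral_translate:
 assumes "0 < e"
 shows "L1 (%x. normal_kernel e (x - z))"
  and "(LB x. normal_kernel e (x - (z::'e::euclidean_space))) = 1"
proof -
 have "(LB x. normal_kernel e (x - z)) = (LB x::'e. normal_kernel e x)"
  using lborel_integral_translate[of "normal_kernel e" "-z"] by simp
 thus 1: "(LB x. normal_kernel e (x - (z::'e::euclidean_space))) = 1"
  using normal_kernel_integral[OF assms, where ?'e='e] by simp
 thus "L1 (%x. normal_kernel e (x - z))"
  using not_integrable_integral_eq by fastforce
qed

text \<open>Inversion regularised by a Gaussian. \<open>ft f\<close> need not be integrable, but
  with the factor \<open>gauss e\<close> the double integral converges absolutely, and Fubini leaves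
  an average of \<open>f\<close> against a probability density centred at \<open>z\<close>.\<close>

lemma ft_gauss_inverse:
 fixes f :: "'e::euclidean_space => real"
 assumes f: "bsupp f" and e: "0 < e"
 shows "(LB xi. cis (- (xi \<bullet> z)) * (cnj (ft f xi) * of_real (gauss e xi))) =
   of_real ((2 * pi) ^ DIM('e) * (LB x. f x * normal_kernel e (x - z)))"
proof -
 have [measurable]: "f \<in> Borel" using f by (rule bsupp_measurable)
 have "(LB xi. cis (- (xi \<bullet> z)) * (cnj (ft f xi) * of_real (gauss e xi))) =
  (LB xi. LB x. cis (xi \<bullet> (x - z)) * of_real (f x) * of_real (gauss e xi))"
 proof (intro integral_cong refl)
  fix xi :: 'e
  have "cnj (ft f xi) = (LB x. cis (xi \<bullet> x) * of_real (f x))"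
   unfolding ft_def by (subst integral_cnj[symmetric]) (simp add: cis_cnj)
  hence "cis (- (xi \<bullet> z)) * (cnj (ft f xi) * of_real (gauss e xi)) =
   (LB x. (cis (- (xi \<bullet> z)) * of_real (gauss e xi)) * (cis (xi \<bullet> x) * of_real (f x)))"
   by (simp only: integral_mult_right_zero) (simp add: mult_ac)
  also have "\<dots> = (LB x. cis (xi \<bullet> (x - z)) * of_real (f x) * of_real (gauss e xi))"
  proof (intro integral_cong refl)
   fix x
   have "cis (- (xi \<bullet> z)) * cis (xi \<bullet> x) = cis (xi \<bullet> (x - z))"
    by (simp add: cis_mult inner_diff_right)
   thus "(cis (- (xi \<bullet> z)) * of_real (gauss e xi)) * (cis (xi \<bullet> x) * of_real (f x)) =
     cis (xi \<bullet> (x - z)) * of_real (f x) * of_real (gauss e xi)"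
    by (metis (no_types, lifting) mult.assoc mult.commute)
  qed
  finally show "cis (- (xi \<bullet> z)) * (cnj (ft f xi) * of_real (gauss e xi)) = \<dots>" .
 qed
 also have "\<dots> = (LB x. LB xi. cis (xi \<bullet> (x - z)) * of_real (f x) * of_real (gauss e xi))"
  by (intro Fubini_dominated[where g="%x. \<bar>f x\<bar>" and h="gauss e"] sigma_finite_lborel integrable_abs
    bsupp_integrable f integrable_gauss e) (auto simp: norm_mult)
 also have "\<dots> = (LB x. of_real (f x) * (LB xi. cis (xi \<bullet> (x - z)) * of_real (gauss e xi)))"
  by (subst integral_mult_right_zero[symmetric]) (simp add: mult_ac)
 also have "\<dots> = (LB x. of_real (f x * ((2 * pi) ^ DIM('e) * normal_kernel e (x - z))))"
  by (subst gauss_integral(2)[OF e]) simp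
 also have "\<dots> = of_real ((2 * pi) ^ DIM('e) * (LB x. f x * normal_kernel e (x - z)))"
  by (subst integral_complex_of_real, subst integral_mult_right_zero[symmetric]) (simp add: mult_ac)
 finally show ?thesis .
qed

text \<open>The bound is uniform in \<open>e\<close> because the kernel has mass one. This
  uniformity allows a sup bound on \<open>f\<close> to be used on the frequency side and the
  Gaussian to be removed afterwards.\<close>

lemma ft_gauss_inverse_bound:
 fixes f :: "'e::euclidean_space => real"
 assumes f: "bsupp f" and e: "0 < e" and B: "!!x. \<bar>f x\<bar> <= B"
 shows "cmod (LB xi. cis (- (xi \<bullet> z)) * (cnj (ft f xi) * of_real (gauss e xi))) <= (2 * pi) ^ DIM('e) * B"
proof -
 have [measurable]: "f \<in> Borel" using f by (rule bsupp_measurable)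
 have "\<bar>LB x. f x * normal_kernel e (x - z)\<bar> <= (LB x. B * normal_kernel e (x - z))"
  using normal_kernel_integral_translate(1)[OF e, of z] B
  by (intro integral_abs_bound_integral[where g="%x. B * normal_kernel e (x - z)"] integrable_bound[where f="%x. B * normal_kernel e (x - z)" and g="%x. f x * normal_kernel e (x - z)"])
   (auto simp: abs_mult intro!: mult_right_mono order_trans[OF B])
 also have "\<dots> = B" using normal_kernel_integral_translate(2)[OF e, of z] by simp
 finally show ?thesis
  unfolding ft_gauss_inverse[OF f e] by (simp add: abs_mult del: of_real_mult)
qed

lemma borel_measurable_cnj [measurable]: "cnj \<in> Borel"
 by (intro borel_measurable_continuous_onI continuous_intros)

text \<open>The map \<open>io\<close> places an abstract measure space into the space of
  \<open>z\<close>: the identity for measures on space-time, the inclusion of the initial hyperplane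
  for boundary layers, and a ray for resolvents. One Fubini argument serves all three.\<close>

lemma fourier_pairing:
 fixes io :: "'a => 'e::euclidean_space" and g :: "'a => complex" and H :: "'e => complex"
 assumes M: "sigma_finite_measure M" and io[measurable]: "io \<in> borel_measurable M" and g: "integrable M g" and H: "L1 H"
 shows "(LB xi. (LINT x|M. cis (- (xi \<bullet> io x)) * g x) * H xi) =
  (LINT x|M. g x * (LB xi. cis (- (xi \<bullet> io x)) * H xi))"
proof -
 have [measurable]: "g \<in> borel_measurable M" "H \<in> Borel" using g H by auto
 have "(LB xi. (LINT x|M. cis (- (xi \<bullet> io x)) * g x) * H xi) =
   (LB xi. (LINT x|M. cis (- (xi \<bullet> io x)) * g x * H xi))"
  by (subst integral_mult_left_zero[symmetric]) simp
 also have "\<dots> = (LINT x|M. LB xi. cis (- (xi \<bullet> io x)) * g x * H xi)"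
  by (intro Fubini_dominated[where g="%x. cmod (g x)" and h="%xi. cmod (H xi)"] M sigma_finite_lborel integrable_norm g H)
   (auto simp: norm_mult)
 also have "\<dots> = (LINT x|M. g x * (LB xi. cis (- (xi \<bullet> io x)) * H xi))"
  by (subst integral_mult_right_zero[symmetric]) (simp add: mult_ac)
 finally show ?thesis .
qed

section \<open>Autocorrelation and the Plancherel identity\<close>

definition autocorr :: "('e::euclidean_space => real) => 'e => real" where
 "autocorr f w = (LB z. f z * f (z + w))"

lemma autocorr_le:
 assumes f: "bsupp f"
 shows "\<bar>autocorr f w\<bar> <= (LB z. (f z)^2)"
proof -
 note fm[measurable] = bsupp_measurable[OF f]
 have i: "bsupp (%z. (f z)^2)" "bsupp (%z. (f (z + w))^2)"
  by (intro bsupp_sq bsupp_translate f)+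
 have "\<bar>f z * f (z + w)\<bar> <= ((f z)^2 + (f (z + w))^2) / 2" for z
  using sum_squares_bound[of "\<bar>f z\<bar>" "\<bar>f (z+w)\<bar>"] by (simp add: abs_mult)
 hence "\<bar>autocorr f w\<bar> <= (LB z. ((f z)^2 + (f (z + w))^2) / 2)"
  unfolding autocorr_def using i[THEN bsupp_integrable]
  by (intro integral_abs_bound_integral integrable_bound[where f="%z. ((f z)^2 + (f (z + w))^2) / 2" and g="%z. f z * f (z + w)"]) auto
 also have "\<dots> = ((LB z. (f z)^2) + (LB z. (f (z + w))^2)) / 2"
  using i[THEN bsupp_integrable] by simp
 also have "(LB z. (f (z + w))^2) = (LB z. (f z)^2)"
  by (rule lborel_integral_translate) measurable
 finally show ?thesis by simp
qed

lemma translation_continuous_L1: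
 fixes f :: "'e::euclidean_space => real"
 assumes f: "bsupp f" and w: "w ----> 0"
 shows "(%n. LB z. \<bar>f (z + w n) - f z\<bar>) ----> 0"
proof (rule LIMSEQ_I)
 fix r :: real assume r: "0 < r"
 obtain B where B: "!!x. \<bar>f x\<bar> <= B" using bsuppE[OF f] by metis
 note fm[measurable] = bsupp_measurable[OF f]
 obtain g where gc: "continuous_on UNIV g" and g: "bsupp g" and "!!x. \<bar>g x\<bar> <= B"
  and ga: "(LB x. \<bar>f x - g x\<bar>) < r/4"
  using L1_approx_continuous[OF f _ B, of "r/4"] r by (metis divide_pos_pos zero_less_numeral)
 note gm[measurable] = bsupp_measurable[OF g]
 obtain C R where C: "0 < C" "!!x. \<bar>g x\<bar> <= C" and R: "!!x. R < norm x ==> g x = 0" using bsuppE[OF g] by metis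
 from w have "Bseq w" by (intro convergent_imp_Bseq convergentI)
 then obtain K where K: "!!n. norm (w n) <= K" by (auto simp: Bseq_def)
 have int: "L1 (%x::'e. 2 * C * indicator (cball 0 (R+K)) x)"
  by (intro integrable_mult_right integrable_real_indicator emeasure_bounded_finite) auto
 have "(%n. LB z. \<bar>g (z + w n) - g z\<bar>) ----> (LB z::'e. 0)"
 proof (rule integral_dominated_convergence[OF _ _ int])
  show "AE z in lborel. (%n. \<bar>g (z + w n) - g z\<bar>) ----> 0"
  proof (intro AE_I2)
   fix z
   have "(%n. z + w n) ----> z + 0" by (intro tendsto_intros w)
   hence "(%n. g (z + w n)) ----> g z"
    using gc by (intro continuous_on_tendsto_compose[OF gc]) auto
   thus "(%n. \<bar>g (z + w n) - g z\<bar>) ----> 0"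
    using tendsto_rabs_zero LIM_zero by blast
  qed
  show "AE z in lborel. norm \<bar>g (z + w n) - g z\<bar> <= 2 * C * indicator (cball 0 (R + K)) z" for n
  proof (intro AE_I2)
   fix z
   show "norm \<bar>g (z + w n) - g z\<bar> <= 2 * C * indicator (cball 0 (R + K)) z"
   proof (cases "norm z <= R + K")
    case True thus ?thesis using C(2)[of "z + w n"] C(2)[of z] by (simp add: indicator_def)
   next
    case False
    moreover have "norm z <= norm (z + w n) + norm (w n)"
     using norm_triangle_ineq4[of "z + w n" "w n"] by simp
    ultimately have "R < norm z" "R < norm (z + w n)"
     using K[of n] norm_ge_zero[of "w n"] by linarith+
    thus ?thesis using C R by (simp add: indicator_def)
   qed
  qed
 qed auto
 hence "(%n. LB z. \<bar>g (z + w n) - g z\<bar>) ----> 0" by simp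
 then obtain N where N: "!!n. N <= n ==> \<bar>LB z. \<bar>g (z + w n) - g z\<bar>\<bar> < r/4"
  using LIMSEQ_D[of _ 0 "r/4"] r by fastforce
 have "\<bar>LB z. \<bar>f (z + w n) - f z\<bar>\<bar> < r" if "N <= n" for n
 proof -
  have bs: "bsupp (%z. \<bar>f (z + w n) - g (z + w n)\<bar>)" "bsupp (%z. \<bar>g (z + w n) - g z\<bar>)" "bsupp (%z. \<bar>f z - g z\<bar>)"
    "bsupp (%z. \<bar>f (z + w n) - f z\<bar>)"
   by (intro bsupp_abs bsupp_diff bsupp_translate f g)+
  note bi = bs[THEN bsupp_integrable]
  have "(LB z. \<bar>f (z + w n) - f z\<bar>) <=
    (LB z. \<bar>f (z + w n) - g (z + w n)\<bar> + \<bar>g (z + w n) - g z\<bar> + \<bar>f z - g z\<bar>)"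
   using bi by (intro integral_mono) auto
  also have "\<dots> = (LB z. \<bar>f (z + w n) - g (z + w n)\<bar>) + (LB z. \<bar>g (z + w n) - g z\<bar>) + (LB z. \<bar>f z - g z\<bar>)"
   using bi by simp
  also have "(LB z. \<bar>f (z + w n) - g (z + w n)\<bar>) = (LB z. \<bar>f z - g z\<bar>)"
   by (rule lborel_integral_translate[where f="%z. \<bar>f z - g z\<bar>"]) measurable
  finally have "(LB z. \<bar>f (z + w n) - f z\<bar>) < r"
   using N[OF that] ga by linarith
  moreover have "0 <= (LB z. \<bar>f (z + w n) - f z\<bar>)" by simp
  ultimately show ?thesis by linarith
 qed
 thus "\<exists>no. \<forall>n\<ge>no. norm ((LB z. \<bar>f (z + w n) - f z\<bar>) - 0) < r" by auto
qed

lemma autocorr_tendsto: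
 assumes f: "bsupp f" and w: "w ----> 0"
 shows "(%n. autocorr f (w n)) ----> (LB z. (f z)^2)"
proof -
 obtain B where B: "0 < B" "!!x. \<bar>f x\<bar> <= B" using bsuppE[OF f] by metis
 note fm[measurable] = bsupp_measurable[OF f]
 have "norm (autocorr f (w n) - (LB z. (f z)^2)) <= B * (LB z. \<bar>f (z + w n) - f z\<bar>)" for n
 proof -
  have bs: "bsupp (%z. f z * f (z + w n))" "bsupp (%z. (f z)^2)" "bsupp (%z. \<bar>f (z + w n) - f z\<bar>)"
   using B bsupp_translate[OF f]
   by (auto intro!: bsupp_abs bsupp_diff bsupp_mult[where C=B] bsupp_translate bsupp_sq f)
  have "autocorr f (w n) - (LB z. (f z)^2) = (LB z. f z * (f (z + w n) - f z))"
   unfolding autocorr_def using bs[THEN bsupp_integrable]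
   by (subst integral_diff[symmetric]) (auto simp: algebra_simps power2_eq_square)
  also have "\<bar>\<dots>\<bar> <= (LB z. B * \<bar>f (z + w n) - f z\<bar>)"
  proof (rule integral_abs_bound_integral)
   show "L1 (%z. f z * (f (z + w n) - f z))"
    using integrable_diff[OF bs(1,2)[THEN bsupp_integrable]]
    by (simp add: algebra_simps power2_eq_square)
   show "L1 (%z. B * \<bar>f (z + w n) - f z\<bar>)"
    using bs(3)[THEN bsupp_integrable] by simp
  qed (use B in \<open>auto simp: abs_mult intro!: mult_right_mono\<close>)
  finally show ?thesis by simp
 qed
 moreover have "(%n. B * (LB z. \<bar>f (z + w n) - f z\<bar>)) ----> B * 0"
  by (intro tendsto_intros translation_continuous_L1 f w)
 ultimately have "(%n. autocorr f (w n) - (LB z. (f z)^2)) ----> 0"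
  by (intro Lim_null_comparison[where f="%n. autocorr f (w n) - (LB z. (f z)^2)"]) (auto intro!: always_eventually)
 thus ?thesis by (simp add: LIM_zero_iff)
qed

lemma lborel_integral_scaleR:
 fixes f :: "'e::euclidean_space => real"
 assumes [measurable]: "f \<in> Borel" and c: "0 < c"
 shows "(LB x. f x) = c ^ DIM('e) * (LB x. f (c *\<^sub>R x))"
proof -
 have "(LB x. f x) = (LINT x|density (distr lborel borel (%x. 0 + c *\<^sub>R x)) (%_. \<bar>c\<bar>^DIM('e)). f x)"
  using c by (subst lborel_affine[of c 0]) auto
 also have "\<dots> = (LINT x|distr lborel borel (%x::'e. 0 + c *\<^sub>R x). \<bar>c\<bar>^DIM('e) *\<^sub>R f x)"
  by (subst integral_density) auto
 also have "\<dots> = (LB x. \<bar>c\<bar>^DIM('e) *\<^sub>R f (0 + c *\<^sub>R x))"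
  by (rule integral_distr) auto
 finally show ?thesis using c by simp
qed

lemma normal_kernel_scale:
 assumes "0 < e"
 shows "e ^ DIM('e) * normal_kernel e (e *\<^sub>R (x::'e::euclidean_space)) = normal_kernel 1 x"
proof -
 have "e * normal_density 0 e (e * t) = normal_density 0 1 t" for t
  using assms by (simp add: normal_density_def real_sqrt_mult power_mult_distrib)
 hence "(\<Prod>b\<in>(Basis::'e set). e * normal_density 0 e (e * (x \<bullet> b))) = (\<Prod>b\<in>(Basis::'e set). normal_density 0 1 (x \<bullet> b))"
  by simp
 thus ?thesis by (simp add: normal_kernel_def prod.distrib)
qed

text \<open>Write the square as \<open>ft f xi\<close> times its conjugate, apply the regularised
  inverse to the conjugate and exchange integrals. The substitution \<open>x = z + w\<close>,
  followed by scaling \<open>w\<close> by \<open>e\<close>, leaves a fixed Gaussian in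
  \<open>w\<close> and moves the dependence on \<open>e\<close> into the autocorrelation.\<close>

lemma ft_gauss_energy:
 fixes f :: "'e::euclidean_space => real"
 assumes f: "bsupp f" and e: "0 < e"
 shows "L1 (%xi. (cmod (ft f xi))^2 * gauss e xi)"
  and "(LB xi. (cmod (ft f xi))^2 * gauss e xi) = (2 * pi) ^ DIM('e) * (LB w. autocorr f (e *\<^sub>R w) * normal_kernel 1 w)" (is ?goalB)
proof -
 let ?t1 = "%z. LB x. f x * normal_kernel e (x - z)"
 note fm[measurable] = bsupp_measurable[OF f]
 obtain B where B: "0 < B" "!!x. \<bar>f x\<bar> <= B" using bsuppE[OF f] by metis
 have H: "L1 (%xi. cnj (ft f xi) * of_real (gauss e xi))"
  by (rule integrable_gauss_mult[OF e]) (use ft_bounded[OF f] in auto)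
 have H2: "L1 (%xi. cor ((cmod (ft f xi))^2) * of_real (gauss e xi))"
  by (rule integrable_gauss_mult[OF e, where C="(LB x. \<bar>f x\<bar>)^2"]) (use ft_bounded[OF f] in \<open>auto simp: norm_power intro!: power_mono\<close>)
 thus 1: "L1 (%xi. (cmod (ft f xi))^2 * gauss e xi)"
  by (simp only: of_real_mult[symmetric] complex_of_real_integrable_eq)
 have "cor (LB xi. (cmod (ft f xi))^2 * gauss e xi) =
   (LB xi. ft f xi * (cnj (ft f xi) * of_real (gauss e xi)))"
  unfolding integral_complex_of_real[symmetric]
  by (intro integral_cong refl) (simp only: of_real_mult complex_norm_square mult.assoc)
 also have "\<dots> = (LB z. of_real (f z) * (LB xi. cis (- (xi \<bullet> z)) * (cnj (ft f xi) * of_real (gauss e xi))))"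
  using fourier_pairing[where io="%z. z" and g="%x. cor (f x)", OF sigma_finite_lborel _ _ H] bsupp_integrable[OF f]
  by (simp add: ft_def)
 also have "\<dots> = (LB z. of_real ((2 * pi) ^ DIM('e) * (f z * (?t1 z))))"
  by (subst ft_gauss_inverse[OF f e]) (simp add: mult_ac)
 also have "\<dots> = of_real ((2 * pi) ^ DIM('e) * (LB z. f z * (?t1 z)))"
  by (subst integral_complex_of_real, subst integral_mult_right_zero) simp
 also have "(LB z. f z * (?t1 z)) =
   (LB z. LB w. f z * f (z + w) * normal_kernel e w)"
 proof (intro integral_cong refl)
  fix z
  have "(?t1 z) = (LB w. f (w + z) * normal_kernel e (w + z - z))"
   by (rule lborel_integral_translate[symmetric]) measurable
  thus "f z * (?t1 z) = (LB w. f z * f (z + w) * normal_kernel e w)"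
   by (simp add: add.commute mult.assoc)
 qed
 also have "\<dots> = (LB w. LB z. f z * f (z + w) * normal_kernel e w)"
 proof (rule Fubini_dominated[where g="normal_kernel e" and h="%z. B * \<bar>f z\<bar>"], rule sigma_finite_lborel, rule sigma_finite_lborel)
  show "norm (f z * f (z + w) * normal_kernel e w) <= normal_kernel e w * (B * \<bar>f z\<bar>)" for z w
   using mult_left_mono[OF mult_right_mono[OF B(2)[of "z + w"], of "\<bar>f z\<bar>"], of "normal_kernel e w"]
   by (simp add: abs_mult mult_ac)
  show "L1 (%z. B * \<bar>f z\<bar>)" using bsupp_integrable[OF f] by simp
 qed (use normal_kernel_integral[OF e] in auto)
 also have "\<dots> = (LB w. autocorr f w * normal_kernel e w)"
  unfolding autocorr_def by (subst integral_mult_left_zero[symmetric]) simp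
 also have "\<dots> = e ^ DIM('e) * (LB w. autocorr f (e *\<^sub>R w) * normal_kernel e (e *\<^sub>R w))"
  unfolding autocorr_def by (rule lborel_integral_scaleR[OF _ e]) measurable
 also have "\<dots> = (LB w. autocorr f (e *\<^sub>R w) * normal_kernel 1 w)"
  by (subst integral_mult_right_zero[symmetric]) (simp add: normal_kernel_scale[OF e, symmetric] mult_ac)
 finally show ?goalB
  by (simp only: of_real_eq_iff)
qed

lemma nn_integral_gauss_LIMSEQ:
 fixes h :: "'e::euclidean_space => real"
 assumes [measurable]: "h \<in> Borel" and h: "!!xi. 0 <= h xi"
 shows "(%n. \<integral>\<^sup>+xi. ennreal (h xi * gauss (1 / real (Suc n)) xi) \<partial>lborel) ----> (\<integral>\<^sup>+xi. ennreal (h xi) \<partial>lborel)"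
proof (rule nn_integral_LIMSEQ)
 show "incseq (%n xi. ennreal (h xi * gauss (1 / real (Suc n)) xi))"
 proof (intro monoI le_funI ennreal_leI mult_left_mono h)
  fix m n :: nat and xi :: 'e assume "m <= n"
  hence "1 / real (Suc n) <= 1 / real (Suc m)" by (simp add: frac_le)
  hence "(1 / real (Suc n) * norm xi)^2 <= (1 / real (Suc m) * norm xi)^2"
   by (intro power_mono mult_right_mono) auto
  thus "gauss (1 / real (Suc m)) xi <= gauss (1 / real (Suc n)) xi" by (simp add: gauss_def)
 qed
 show "(%n. ennreal (h xi * gauss (1 / real (Suc n)) xi)) ----> ennreal (h xi)" for xi
 proof (intro tendsto_ennrealI)
  have "(%n. h xi * gauss (1 / real (Suc n)) xi) ----> h xi * exp (- (0 * norm xi)\<^sup>2 / 2)"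
   unfolding gauss_def by (intro tendsto_intros lim_1_over_n[THEN LIMSEQ_Suc]) auto
  thus "(%n. h xi * gauss (1 / real (Suc n)) xi) ----> h xi" by simp
 qed
qed auto

text \<open>The regularised energies converge monotonically on the frequency side. On the other side
  convergence is dominated, since \<open>autocorr f\<close> is bounded and continuous at 0 with the
  square integral as its value. Finiteness of the energy is part of the conclusion.\<close>

theorem plancherel:
 fixes f :: "'e::euclidean_space => real"
 assumes f: "bsupp f"
 shows "(\<integral>\<^sup>+xi. ennreal ((cmod (ft f xi))^2) \<partial>lborel) = ennreal ((2 * pi) ^ DIM('e) * (LB x. (f x)^2))"
proof (rule LIMSEQ_unique)
 note fm[measurable] = bsupp_measurable[OF f]
 define e where "e n = 1 / real (Suc n)" for n
 have e: "0 < e n" for n by (simp add: e_def)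
 have e0: "e ----> 0" unfolding e_def by (rule lim_1_over_n[THEN LIMSEQ_Suc])
 let ?F = "%n xi. ennreal ((cmod (ft f xi))^2 * gauss (e n) xi)"
 show "(%n. \<integral>\<^sup>+xi. ?F n xi \<partial>lborel) ----> (\<integral>\<^sup>+xi. ennreal ((cmod (ft f xi))^2) \<partial>lborel)"
  unfolding e_def by (rule nn_integral_gauss_LIMSEQ) auto
 have "(%n. LB w. autocorr f (e n *\<^sub>R w) * normal_kernel 1 w) ----> (LB w::'e. (LB x. (f x)^2) * normal_kernel 1 w)"
 proof (rule integral_dominated_convergence[where w="%w. (LB x. (f x)^2) * normal_kernel 1 w"])
  show "AE w in lborel. (%n. autocorr f (e n *\<^sub>R w) * normal_kernel 1 w) ----> (LB x. (f x)^2) * normal_kernel 1 w"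
  proof (intro AE_I2 tendsto_intros autocorr_tendsto f)
   fix w :: 'e
   have "(%n. e n *\<^sub>R w) ----> 0 *\<^sub>R w" by (intro tendsto_intros e0)
   thus "(%n. e n *\<^sub>R w) ----> 0" by simp
  qed
  show "AE w in lborel. norm (autocorr f (e n *\<^sub>R w) * normal_kernel 1 w) <= (LB x. (f x)^2) * normal_kernel 1 w" for n
   using autocorr_le[OF f] by (intro AE_I2) (auto simp: abs_mult intro!: mult_right_mono)
 qed (use normal_kernel_integral[of 1, where ?'e='e] in \<open>auto simp: autocorr_def\<close>)
 hence "(%n. LB w. autocorr f (e n *\<^sub>R w) * normal_kernel 1 w) ----> (LB x. (f x)^2)"
  using normal_kernel_integral(2)[of 1, where ?'e='e] by simp
 hence "(%n. ennreal ((2 * pi) ^ DIM('e) * (LB w. autocorr f (e n *\<^sub>R w) * normal_kernel 1 w))) ----> ennreal ((2 * pi) ^ DIM('e) * (LB x. (f x)^2))"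
  by (intro tendsto_ennrealI tendsto_intros)
 moreover have "(\<integral>\<^sup>+xi. ?F n xi \<partial>lborel) = ennreal ((2 * pi) ^ DIM('e) * (LB w. autocorr f (e n *\<^sub>R w) * normal_kernel 1 w))" for n
  unfolding ft_gauss_energy(2)[OF f e, symmetric]
  by (rule nn_integral_eq_integral[OF ft_gauss_energy(1)[OF f e]]) auto
 ultimately show "(%n. \<integral>\<^sup>+xi. ?F n xi \<partial>lborel) ----> ennreal ((2 * pi) ^ DIM('e) * (LB x. (f x)^2))"
  by simp
qed

section \<open>Fourier multipliers\<close>

text \<open>Three norms read on the frequency side: the sup norm of a function, the total variation
  of a measure by duality with it, and the norm of an operator on bounded functions. Only pairings
  with integrable \<open>H\<close> occur, so neither measures nor convolutions have to be
  exhibited.\<close>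

definition fbound :: "('e::euclidean_space => complex) => real => bool" where
 "fbound H K \<longleftrightarrow> L1 H \<and> (\<forall>z. cmod (LB xi. cis (- (xi \<bullet> z)) * H xi) <= K)"

definition measure_transform :: "('e::euclidean_space => complex) => real => bool" where
 "measure_transform Ga m \<longleftrightarrow> Ga \<in> Borel \<and> (\<exists>C. \<forall>xi. cmod (Ga xi) <= C) \<and>
   (\<forall>H K. fbound H K --> cmod (LB xi. Ga xi * H xi) <= m * K)"

definition multiplier :: "real => ('e::euclidean_space => complex) => bool" where
 "multiplier c M \<longleftrightarrow> M \<in> Borel \<and> (\<exists>C. \<forall>xi. cmod (M xi) <= C) \<and>
   (\<forall>H K. fbound H K --> fbound (%xi. H xi * M xi) (c * K))"

lemma fbound_nonneg: "fbound H K ==> 0 <= K"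
 unfolding fbound_def by (meson norm_ge_zero order_trans)

lemma fbound_mono: "fbound H K ==> K <= K' ==> fbound H K'"
 unfolding fbound_def by (meson order_trans)

lemma fbound_add:
 assumes "fbound H K" "fbound H' K'" shows "fbound (%xi. H xi + H' xi) (K + K')"
proof -
 have i: "L1 (%xi. cis (- (xi \<bullet> z)) * H xi)" "L1 (%xi. cis (- (xi \<bullet> z)) * H' xi)" for z
  using assms by (auto simp: fbound_def intro!: integrable_cis_mult)
 have "cmod (LB xi. cis (- (xi \<bullet> z)) * (H xi + H' xi)) <= K + K'" for z
  using assms norm_triangle_le[of "LB xi. cis (- (xi \<bullet> z)) * H xi" "LB xi. cis (- (xi \<bullet> z)) * H' xi" "K + K'"]
  by (simp add: distrib_left i fbound_def add_mono)
 thus ?thesis using assms unfolding fbound_def by auto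
qed

lemma fbound_cmult:
 assumes "fbound H K" shows "fbound (%xi. a * H xi) (cmod a * K)"
proof -
 have "(LB xi. cis (- (xi \<bullet> z)) * (a * H xi)) = a * (LB xi. cis (- (xi \<bullet> z)) * H xi)" for z
  by (subst integral_mult_right_zero[symmetric]) (simp add: mult_ac)
 thus ?thesis using assms by (auto simp: fbound_def norm_mult intro!: mult_left_mono)
qed

lemma fbound_0: "fbound (%_. 0) 0"
 by (simp add: fbound_def)

lemma fbound_sum: "(!!i. i \<in> I ==> fbound (H i) (K i)) ==> fbound (%xi. \<Sum>i\<in>I. H i xi) (\<Sum>i\<in>I. K i)"
 by (induction I rule: infinite_finite_induct) (auto intro: fbound_add fbound_0)

lemma multiplierD: "multiplier c M ==> fbound H K ==> fbound (%xi. H xi * M xi) (c * K)"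
 by (simp add: multiplier_def)

lemma multiplier_measurable [measurable_dest]: "multiplier c M ==> M \<in> Borel"
 by (simp add: multiplier_def)

lemma multiplier_mult:
 assumes "multiplier c M" "multiplier d N" shows "multiplier (d * c) (%xi. M xi * N xi)"
proof -
 obtain C D where C: "!!xi. cmod (M xi) <= C" and D: "!!xi. cmod (N xi) <= D"
  using assms by (auto simp: multiplier_def)
 have "0 <= C" using C norm_ge_zero order_trans by blast
 hence "cmod (M xi * N xi) <= C * D" for xi
  unfolding norm_mult using C D by (intro mult_mono) auto
 moreover have "(%xi. M xi * N xi) \<in> Borel"
  using assms by (auto simp: multiplier_def)
 moreover have "fbound (%xi. H xi * (M xi * N xi)) (d * c * K)" if "fbound H K" for H K
  using multiplierD[OF assms(2) multiplierD[OF assms(1) that]] by (simp add: mult.assoc)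
 ultimately show ?thesis by (auto simp: multiplier_def)
qed

lemma multiplier_add:
 assumes "multiplier c M" "multiplier d N" shows "multiplier (c + d) (%xi. M xi + N xi)"
proof -
 obtain C D where C: "!!xi. cmod (M xi) <= C" and D: "!!xi. cmod (N xi) <= D"
  using assms by (auto simp: multiplier_def)
 have "cmod (M xi + N xi) <= C + D" for xi
  using C[of xi] D[of xi] norm_triangle_ineq[of "M xi" "N xi"] by linarith
 moreover have "(%xi. M xi + N xi) \<in> Borel"
  using assms by (auto simp: multiplier_def)
 moreover have "fbound (%xi. H xi * (M xi + N xi)) ((c + d) * K)" if "fbound H K" for H K
  using fbound_add[OF multiplierD[OF assms(1) that] multiplierD[OF assms(2) that]] by (simp add: algebra_simps)
 ultimately show ?thesis by (auto simp: multiplier_def)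
qed

lemma multiplier_cmult:
 assumes "multiplier c M" shows "multiplier (cmod a * c) (%xi. a * M xi)"
proof -
 obtain C where C: "!!xi. cmod (M xi) <= C" using assms by (auto simp: multiplier_def)
 have "cmod (a * M xi) <= cmod a * C" for xi
  unfolding norm_mult using C by (intro mult_left_mono) auto
 moreover have "(%xi. a * M xi) \<in> Borel"
  using assms by (auto simp: multiplier_def)
 moreover have "fbound (%xi. H xi * (a * M xi)) (cmod a * c * K)" if "fbound H K" for H K
  using fbound_cmult[OF multiplierD[OF assms that], of a] by (simp add: mult_ac)
 ultimately show ?thesis by (auto simp: multiplier_def)
qed

lemma multiplier_1: "multiplier 1 (%_. 1)"
 by (auto simp: multiplier_def)

lemma multiplier_0: "multiplier 0 (%_. 0)"
 by (auto simp: multiplier_def fbound_0)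

lemma multiplier_sum: "(!!i. i \<in> I ==> multiplier (c i) (M i)) ==> multiplier (\<Sum>i\<in>I. c i) (%xi. \<Sum>i\<in>I. M i xi)"
 by (induction I rule: infinite_finite_induct) (auto intro: multiplier_add multiplier_0)

lemma multiplier_prod: "(!!i. i \<in> I ==> multiplier 1 (M i)) ==> multiplier 1 (%xi. \<Prod>i\<in>I. M i xi)"
proof (induction I rule: infinite_finite_induct)
 case (insert i I)
 thus ?case using multiplier_mult[of 1 "M i" 1 "%xi. \<Prod>i\<in>I. M i xi"] by simp
qed (simp_all add: multiplier_1)

text \<open>On the other side of the transform this is the convolution of a bounded function with a
  measure: each value is an integral of translates, so the sup norm grows at most by the total
  mass.\<close>

lemma fbound_fourier:
 fixes io :: "'a => 'e::euclidean_space" and g :: "'a => complex"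
 assumes M: "sigma_finite_measure M" and io: "io \<in> borel_measurable M" and g: "integrable M g" and H: "fbound H K"
 shows "cmod (LB xi. cis (- (xi \<bullet> z)) * (H xi * (LINT x|M. cis (- (xi \<bullet> io x)) * g x))) <= (LINT x|M. cmod (g x)) * K"
proof -
 let ?t1 = "%x. LB xi. cis (- (xi \<bullet> io x)) * (cis (- (xi \<bullet> z)) * H xi)"
 have [measurable]: "io \<in> borel_measurable M" "g \<in> borel_measurable M" "H \<in> Borel" using io g H by (auto simp: fbound_def)
 interpret sigma_finite_measure M by fact
 have i: "L1 (%xi. cis (- (xi \<bullet> z)) * H xi)"
  using H by (auto simp: fbound_def intro!: integrable_cis_mult)
 have b: "cmod (?t1 x) <= K" for x
 proof -
  have eq: "cis (- (xi \<bullet> io x)) * (cis (- (xi \<bullet> z)) * H xi) = cis (- (xi \<bullet> (io x + z))) * H xi" for xi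
   unfolding mult.assoc[symmetric] cis_mult by (simp add: inner_add_right)
  show ?thesis unfolding eq using H by (simp add: fbound_def)
 qed
 have "(LB xi. cis (- (xi \<bullet> z)) * (H xi * (LINT x|M. cis (- (xi \<bullet> io x)) * g x))) =
  (LB xi. (LINT x|M. cis (- (xi \<bullet> io x)) * g x) * (cis (- (xi \<bullet> z)) * H xi))"
  by (simp add: mult_ac)
 also have "\<dots> = (LINT x|M. g x * (?t1 x))"
  by (rule fourier_pairing[OF M io g i])
 also have "cmod \<dots> <= (LINT x|M. cmod (g x) * K)"
 proof (rule order_trans[OF integral_norm_bound integral_mono])
  have "(%x. LB xi. cis (- (xi \<bullet> io x)) * (cis (- (xi \<bullet> z)) * H xi)) \<in> borel_measurable M"
   by measurable
  thus "integrable M (%x. cmod (g x * (?t1 x)))"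
   using b g fbound_nonneg[OF H]
   by (intro integrable_norm integrable_bound[where f="%x. cmod (g x) * K" and g="%x. g x * (?t1 x)"])
    (auto simp: norm_mult intro!: mult_left_mono)
 qed (use g b in \<open>auto simp: norm_mult intro!: mult_left_mono\<close>)
 finally show ?thesis by simp
qed

lemma multiplier_fourier:
 fixes io :: "'a => 'e::euclidean_space" and g :: "'a => complex"
 assumes M: "sigma_finite_measure M" and io: "io \<in> borel_measurable M" and g: "integrable M g"
 shows "multiplier (LINT x|M. cmod (g x)) (%xi. LINT x|M. cis (- (xi \<bullet> io x)) * g x)"
proof -
 let ?t1 = "%xi. LINT x|M. cis (- (xi \<bullet> io x)) * g x"
 have [measurable]: "(%xi. LINT x|M. cis (- (xi \<bullet> io x)) * g x) \<in> Borel"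
  using g by (intro borel_measurable_fourier M io) auto
 have bd: "cmod (?t1 xi) <= (LINT x|M. cmod (g x))" for xi
  by (rule norm_fourier_le[OF g])
 have "L1 (%xi. H xi * (?t1 xi))" if H: "fbound H K" for H K
 proof (rule integrable_bound)
  have Hi: "L1 H" using H by (simp add: fbound_def)
  thus "L1 (%xi. cmod (H xi) * (LINT x|M. cmod (g x)))" by simp
  have [measurable]: "H \<in> Borel" using Hi by auto
  show "(%xi. H xi * (?t1 xi)) \<in> borel_measurable lborel" by measurable
  have "0 <= (LINT x|M. cmod (g x))" by simp
  thus "AE xi in lborel. norm (H xi * (?t1 xi)) <= norm (cmod (H xi) * (LINT x|M. cmod (g x)))"
   using bd by (intro AE_I2) (auto simp: norm_mult intro!: mult_left_mono)
 qed
 thus ?thesis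
  unfolding multiplier_def using bd fbound_fourier[OF M io g] by (auto simp: fbound_def)
qed

lemma measure_transform_fourier:
 fixes io :: "'a => 'e::euclidean_space" and g :: "'a => complex"
 assumes M: "sigma_finite_measure M" and io: "io \<in> borel_measurable M" and g: "integrable M g"
 shows "measure_transform (%xi. LINT x|M. cis (- (xi \<bullet> io x)) * g x) (LINT x|M. cmod (g x))"
proof -
 have "(%xi. LINT x|M. cis (- (xi \<bullet> io x)) * g x) \<in> Borel"
  using g by (intro borel_measurable_fourier M io) auto
 thus ?thesis
  unfolding measure_transform_def using fbound_fourier[OF M io g, of _ _ 0]
  by (intro conjI exI[of _ "LINT x|M. cmod (g x)"] allI impI norm_fourier_le[OF g]) (auto simp: mult.commute)
qed

lemma measure_transform_add:
 assumes "measure_transform M c" "measure_transform N d" shows "measure_transform (%xi. M xi + N xi) (c + d)"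
proof -
 obtain C D where C: "!!xi. cmod (M xi) <= C" and D: "!!xi. cmod (N xi) <= D"
  using assms by (auto simp: measure_transform_def)
 have m[measurable]: "M \<in> Borel" "N \<in> Borel"
  using assms by (auto simp: measure_transform_def)
 have "cmod (M xi + N xi) <= C + D" for xi
  using C[of xi] D[of xi] norm_triangle_ineq[of "M xi" "N xi"] by linarith
 moreover have "cmod (LB xi. (M xi + N xi) * H xi) <= (c + d) * K" if H: "fbound H K" for H K
 proof -
  have Hi: "L1 H" using H by (simp add: fbound_def)
  hence [measurable]: "H \<in> Borel" by auto
  have "L1 (%xi. M xi * H xi)"
   using C by (intro integrable_bound[OF integrable_mult_right[OF Hi, of "of_real C"]] AE_I2)
    (auto simp: norm_mult intro!: mult_right_mono intro: order_trans[OF C abs_ge_self])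
  moreover have "L1 (%xi. N xi * H xi)"
   using D by (intro integrable_bound[OF integrable_mult_right[OF Hi, of "of_real D"]] AE_I2)
    (auto simp: norm_mult intro!: mult_right_mono intro: order_trans[OF D abs_ge_self])
  ultimately have "(LB xi. (M xi + N xi) * H xi) = (LB xi. M xi * H xi) + (LB xi. N xi * H xi)"
   by (simp add: distrib_right)
  moreover have "cmod (LB xi. M xi * H xi) <= c * K" "cmod (LB xi. N xi * H xi) <= d * K"
   using assms H by (auto simp: measure_transform_def)
  ultimately show ?thesis
   using norm_triangle_ineq[of "LB xi. M xi * H xi" "LB xi. N xi * H xi"] by (simp add: distrib_right)
 qed
 ultimately show ?thesis using m by (auto simp: measure_transform_def)
qed

lemma measure_transform_cmult:
 assumes "measure_transform M c" shows "measure_transform (%xi. a * M xi) (cmod a * c)"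
proof -
 obtain C where C: "!!xi. cmod (M xi) <= C" using assms by (auto simp: measure_transform_def)
 have "cmod (a * M xi) <= cmod a * C" for xi
  unfolding norm_mult using C by (intro mult_left_mono) auto
 moreover have "(%xi. a * M xi) \<in> Borel"
  using assms by (auto simp: measure_transform_def)
 moreover have "cmod (LB xi. a * M xi * H xi) <= cmod a * c * K" if "fbound H K" for H K
  using assms that unfolding mult.assoc integral_mult_right_zero norm_mult
  by (intro mult_left_mono) (auto simp: measure_transform_def)
 ultimately show ?thesis by (auto simp: measure_transform_def)
qed

section \<open>Resolvents as averages of translations\<close>

lemma exponential_transform:
 fixes y :: real
 shows "L1 (%s::real. cor (indicator {0<..} s * exp (- s)))"
  and "(LB s. cmod (cor (indicator {0<..} s * exp (- s)))) = 1"
  and "(LB s. cis (- (y * s)) * cor (indicator {0<..} s * exp (- s))) = 1 / (1 + \<i> * of_real y)"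
proof -
 let ?t1 = "%s. indicator {0<..} s * exp (- s)"
 have ei: "einterval 0 \<infinity> = {0<..}" by (auto simp: einterval_def zero_ereal_def)
 have t: "((%x::real. exp (- x)) \<longlongrightarrow> 0) at_top"
  by (intro filterlim_compose[OF exp_at_bot] filterlim_uminus_at_bot_at_top)
 note FTC = interval_integral_FTC_nonneg[where F = "%s. - exp (- s)" and f="%s. exp (- s)" and A="-1" and B=0 and a=0 and b="\<infinity>"]
 have F1: "DERIV (%s. - exp (- s)) x :> exp (- x)" for x :: real
  by (auto intro!: derivative_eq_intros)
 have F2: "(((%s::real. - exp (- s)) \<circ> real_of_ereal) \<longlongrightarrow> - 1) (at_right 0)"
 proof -
  have "((%s::real. - exp (- s)) \<longlongrightarrow> - exp (- 0)) (at_right 0)" by (intro tendsto_intros)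
  thus ?thesis by (simp add: zero_ereal_def ereal_tendsto_simps)
 qed
 have F3: "(((%s::real. - exp (- s)) \<circ> real_of_ereal) \<longlongrightarrow> 0) (at_left \<infinity>)"
  using tendsto_minus[OF t] by (simp add: ereal_tendsto_simps)
 have R: "set_integrable lborel (einterval 0 \<infinity>) (%s::real. exp (- s))"
  and R2: "(LBINT s=0..\<infinity>. exp (- s)) = (0::real) - (- 1)"
  by (rule FTC; (intro F1 F2 F3)?; simp)+
 have R1: "L1 (%s::real. indicator {0<..} s * exp (- s))"
  using R by (simp add: set_integrable_def ei)
 thus I: "L1 (%s::real. cor (?t1 s))"
  by (simp only: complex_of_real_integrable_eq)
 have "(LB s. cmod (cor (?t1 s))) = (LBINT s=0..\<infinity>. exp (- s))"
  by (simp add: interval_lebesgue_integral_def ei set_lebesgue_integral_def abs_mult norm_mult)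
 thus "(LB s. cmod (cor (?t1 s))) = 1" using R2 by simp
 let ?c = "1 + \<i> * of_real y"
 have c0: "?c \<noteq> 0" by (simp add: complex_eq_iff)
 have eq: "cis (- (y * s)) * cor (?t1 s) = indicator {0<..} s *\<^sub>R exp (- ?c * of_real s)" for s
 proof -
  have "exp (- ?c * of_real s) = exp (of_real (- s)) * cis (- (y * s))"
   by (simp add: cis_conv_exp exp_add[symmetric] algebra_simps)
  also have "exp (of_real (- s)) = cor (exp (- s))" by (rule exp_of_real)
  finally show ?thesis by (simp add: scaleR_conv_of_real)
 qed
 have I2: "L1 (%s. indicator {0<..} s *\<^sub>R exp (- ?c * of_real s))"
  using integrable_cis_mult[OF I, of "%s. - (y * s)"] unfolding eq by simp
 have "(LBINT s=0..\<infinity>. exp (- ?c * of_real s)) = 0 - (- 1 / ?c)"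
 proof (rule interval_integral_FTC_integrable[where F = "%s. - exp (- ?c * of_real s) / ?c"])
  show "((%s. - exp (- ?c * of_real s) / ?c) has_vector_derivative exp (- ?c * of_real x)) (at x)" for x
   using c0 by (auto intro!: derivative_eq_intros has_vector_derivative_real_field simp: divide_simps)
    (simp add: algebra_simps)
  show "set_integrable lborel (einterval 0 \<infinity>) (%s. exp (- ?c * of_real s))"
   using I2 by (simp add: set_integrable_def ei)
  have "(%s. - exp (- ?c * of_real s) / ?c) \<midarrow>0\<rightarrow> - exp (- ?c * of_real 0) / ?c"
   by (intro tendsto_intros) (use c0 in auto)
  hence "((%s. - exp (- ?c * of_real s) / ?c) \<longlongrightarrow> - 1 / ?c) (at_right 0)"
   by (auto intro: tendsto_mono[OF at_le])
  thus "(((%s. - exp (- ?c * of_real s) / ?c) \<circ> real_of_ereal) \<longlongrightarrow> - 1 / ?c) (at_right 0)"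
   by (simp add: zero_ereal_def ereal_tendsto_simps)
  have "((%s. - exp (- ?c * of_real s) / ?c) \<longlongrightarrow> 0) at_top"
  proof (rule Lim_null_comparison)
   show "\<forall>\<^sub>F s in at_top. norm (- exp (- ?c * of_real s) / ?c) <= exp (- s) / cmod ?c"
    by (auto simp: norm_divide norm_mult)
   show "((%s. exp (- s) / cmod ?c) \<longlongrightarrow> 0) at_top"
    using tendsto_divide[OF t tendsto_const, of "cmod ?c"] c0 by simp
  qed
  thus "(((%s. - exp (- ?c * of_real s) / ?c) \<circ> real_of_ereal) \<longlongrightarrow> 0) (at_left \<infinity>)"
   by (simp add: ereal_tendsto_simps)
 qed (auto intro!: continuous_intros)
 thus "(LB s. cis (- (y * s)) * cor (?t1 s)) = 1 / ?c"
  unfolding eq by (simp add: interval_lebesgue_integral_def ei set_lebesgue_integral_def)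
qed

text \<open>The exponential law on the half-line has mass one and transform
  \<open>1 / (1 + \<i> * y)\<close>, so the resolvent in direction \<open>v\<close> averages
  translates along a ray. Its norm on bounded functions is therefore at most 1, whatever the length
  of \<open>v\<close>.\<close>

lemma multiplier_resolvent: "multiplier 1 (%xi. 1 / (1 + \<i> * of_real (v \<bullet> xi)))"
proof -
 have "multiplier (LB s. cmod (cor (indicator {0<..} s * exp (- s))))
   (%xi. LB s. cis (- (xi \<bullet> (s *\<^sub>R v))) * cor (indicator {0<..} s * exp (- s)))"
  by (intro multiplier_fourier sigma_finite_lborel exponential_transform(1)) auto
 moreover have "(LB s. cis (- (xi \<bullet> (s *\<^sub>R v))) * cor (indicator {0<..} s * exp (- s))) = 1 / (1 + \<i> * of_real (v \<bullet> xi))" for xi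
  using exponential_transform(3)[of "v \<bullet> xi"] by (simp add: inner_commute mult.commute)
 ultimately show ?thesis unfolding exponential_transform(2) by simp
qed

section \<open>Energy on frequency regions\<close>

lemma resolvent_identities:
 fixes y :: real
 shows "(1 / (1 + \<i> * of_real y)) * (1 / (1 + \<i> * of_real (- y))) = cor (1 / (1 + y^2))" (is ?goalA)
  and "(\<i> / 2) * (1 / (1 + \<i> * of_real y) + - 1 * (1 / (1 + \<i> * of_real (- y)))) = cor (y * (1 / (1 + y^2)))" (is ?goalB)
  and "1 + - 1 * cor (1 / (1 + y^2)) = cor (y^2 * (1 / (1 + y^2)))" (is ?goalC)
proof -
 have p: "1 + y^2 > 0" by (simp add: add_pos_nonneg)
 hence n: "1 + \<i> * of_real y \<noteq> 0" "1 - \<i> * of_real y \<noteq> 0" "1 + (of_real y)^2 \<noteq> (0::complex)"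
  by (auto simp: complex_eq_iff)
 have m: "(1 + \<i> * of_real y) * (1 - \<i> * of_real y) = 1 + (of_real y)^2"
  by (simp add: algebra_simps power2_eq_square)
 show ?goalA
  using m by simp
 have "(\<i> / 2) * (1 / (1 + \<i> * of_real y) + - 1 * (1 / (1 - \<i> * of_real y))) =
   (\<i> / 2) * ((1 - \<i> * of_real y) - (1 + \<i> * of_real y)) / ((1 + \<i> * of_real y) * (1 - \<i> * of_real y))"
  using n by (simp add: field_simps)
 also have "\<dots> = of_real y / (1 + (of_real y)^2)"
  unfolding m by (simp add: algebra_simps)
 also have "\<dots> = cor (y * (1 / (1 + y^2)))" by simp
 finally show ?goalB
  by (simp only: of_real_minus mult_minus_right add_uminus_conv_diff)
 have "1 - 1 / (1 + y^2) = y^2 * (1 / (1 + y^2))" using p by (simp add: field_simps)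
 from arg_cong[OF this, of cor]
 show ?goalC
  by simp
qed

text \<open>The product of the resolvents for \<open>v\<close> and \<open>- v\<close> is the Lorentz
  factor, half their difference times \<open>\<i>\<close> carries one power of
  \<open>v \<bullet> xi\<close>, and one minus the Lorentz factor carries two. The bounds 1, 1, 2
  follow from the triangle inequality.\<close>

lemma multiplier_lorentz:
 shows "multiplier 1 (%xi. cor (1 / (1 + (v \<bullet> xi)^2)))"
  and "multiplier 1 (%xi. cor ((v \<bullet> xi) * (1 / (1 + (v \<bullet> xi)^2))))" (is ?goalB)
  and "multiplier 2 (%xi. cor ((v \<bullet> xi)^2 * (1 / (1 + (v \<bullet> xi)^2))))" (is ?goalC)
proof -
 note R = multiplier_resolvent[of v] multiplier_resolvent[of "- v", unfolded inner_minus_left]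
 show 1: "multiplier 1 (%xi. cor (1 / (1 + (v \<bullet> xi)^2)))"
  using multiplier_mult[OF R] unfolding resolvent_identities by simp
 show ?goalB
  using multiplier_cmult[OF multiplier_add[OF R(1) multiplier_cmult[OF R(2), of "-1"]], of "\<i> / 2"]
  unfolding resolvent_identities by (simp add: norm_divide)
 show ?goalC
  using multiplier_add[OF multiplier_1 multiplier_cmult[OF 1, of "-1"]]
  unfolding resolvent_identities by simp
qed

section \<open>Symbols and anisotropic damping of frequencies\<close>

locale symbols =
 fixes J :: "'j set" and b :: "'j => 'e::euclidean_space" and s :: "'j => 'l::finite => 'e"
 assumes finJ: "finite J"
begin

definition symbol :: "'j => 'e => complex" where
 "symbol j xi = cor (\<Sum>l\<in>UNIV. (s j l \<bullet> xi)^2) + \<i> * cor (b j \<bullet> xi)"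

text \<open>Parabolic scaling: a drift has order one, a diffusion vector order one half.
  \<open>None\<close> stands for the drift of the index and \<open>Some l\<close> for its diffusion
  vectors.\<close>

definition scaled :: "real => 'j \<times> 'l option => 'e" where
 "scaled al p = (case snd p of None => al *\<^sub>R b (fst p) | Some l => sqrt al *\<^sub>R s (fst p) l)"

text \<open>A substitute for the indicator of the frequencies at which all symbols are at most of
  order \<open>1 / al\<close>. In the product form one factor absorbs a linear or quadratic
  expression in its own direction, while the other factors remain a multiplier of norm one.\<close>

definition damp :: "real => 'e => real" where
 "damp al xi = (\<Prod>p\<in>J \<times> UNIV. 1 / (1 + (scaled al p \<bullet> xi)^2))"

lemma damp_nonneg: "0 <= damp al xi"
 unfolding damp_def by (intro prod_nonneg) auto

lemma damp_le_1: "damp al xi <= 1"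
 unfolding damp_def by (intro prod_le_1) (auto simp: divide_le_eq add_pos_nonneg)

lemma borel_measurable_damp [measurable]: "damp al \<in> Borel"
 unfolding damp_def[abs_def] by measurable

lemma borel_measurable_symbol [measurable]: "symbol j \<in> Borel"
 unfolding symbol_def[abs_def] by measurable

lemma multiplier_damp: "multiplier 1 (%xi. cor (damp al xi))"
 unfolding damp_def of_real_prod by (intro multiplier_prod multiplier_lorentz)

lemma multiplier_scaled_damp:
 assumes p: "p \<in> J \<times> UNIV"
 shows "multiplier 1 (%xi. cor ((scaled al p \<bullet> xi) * damp al xi))" (is ?goalA)
  and "multiplier 2 (%xi. cor ((scaled al p \<bullet> xi)^2 * damp al xi))" (is ?goalB)
proof -
 have fin: "finite (J \<times> (UNIV :: 'l option set))" using finJ by simp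
 let ?rest = "%xi. \<Prod>q\<in>J \<times> UNIV - {p}. cor (1 / (1 + (scaled al q \<bullet> xi)^2))"
 have r: "multiplier 1 ?rest" by (intro multiplier_prod multiplier_lorentz)
 have eq: "cor (c * damp al xi) = cor (c * (1 / (1 + (scaled al p \<bullet> xi)^2))) * ?rest xi" for c xi
  unfolding damp_def prod.remove[OF fin p] by simp
 show ?goalA
  unfolding eq using multiplier_mult[OF multiplier_lorentz(2) r] by simp
 show ?goalB
  unfolding eq using multiplier_mult[OF multiplier_lorentz(3) r] by simp
qed

lemma multiplier_s_damp:
 assumes "j \<in> J" "0 < al"
 shows "multiplier (1 / sqrt al) (%xi. cor ((s j l \<bullet> xi) * damp al xi))" (is ?goalA)
  and "multiplier (2 / al) (%xi. cor ((s j l \<bullet> xi)^2 * damp al xi))"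
  and "multiplier (1 / al) (%xi. cor ((b j \<bullet> xi) * damp al xi))" (is ?goalC)
proof -
 have p: "(j, Some l) \<in> J \<times> UNIV" "(j, None) \<in> J \<times> UNIV" using assms by auto
 show ?goalA
  using multiplier_cmult[OF multiplier_scaled_damp(1)[OF p(1), of al], of "of_real (1 / sqrt al)"] assms
  unfolding of_real_mult[symmetric] by (simp add: scaled_def norm_divide)
 have "1 / al * ((scaled al (j, Some l) \<bullet> xi)^2 * damp al xi) = (s j l \<bullet> xi)^2 * damp al xi" for xi
  using assms by (simp add: scaled_def power_mult_distrib)
 thus "multiplier (2 / al) (%xi. cor ((s j l \<bullet> xi)^2 * damp al xi))"
  using multiplier_cmult[OF multiplier_scaled_damp(2)[OF p(1), of al], of "of_real (1 / al)"] assms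
  unfolding of_real_mult[symmetric] by (simp add: norm_divide)
 show ?goalC
  using multiplier_cmult[OF multiplier_scaled_damp(1)[OF p(2), of al], of "of_real (1 / al)"] assms
  unfolding of_real_mult[symmetric] by (simp add: scaled_def norm_divide)
qed

text \<open>Each square costs \<open>2 / al\<close>, the drift \<open>1 / al\<close>, and
  \<open>1 / T\<close> is at most \<open>1 / al\<close>; hence the constant
  \<open>2 * CARD('l) + 2\<close>. The conjugate and the sign are those in which the equation is
  used for \<open>cnj (Ga xi)\<close>.\<close>

lemma multiplier_symbol_damp:
 assumes "j \<in> J" "0 < al" "al <= T"
 shows "multiplier ((2 * CARD('l) + 2) / al) (%xi. - (cnj (symbol j xi) + of_real (1 / T)) * cor (damp al xi))"
proof -
 let ?t1 = "%xi. -1 * ((\<Sum>l\<in>UNIV. cor ((s j l \<bullet> xi)^2 * damp al xi)) + (- \<i>) * cor ((b j \<bullet> xi) * damp al xi)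
    + of_real (1 / T) * cor (damp al xi))"
 let ?t2 = "%xi. - (cnj (symbol j xi) + of_real (1 / T)) * cor (damp al xi)"
 have T: "0 < T" using assms by linarith
 have "multiplier (cmod (-1) * ((\<Sum>l\<in>(UNIV::'l set). 2 / al) + cmod (- \<i>) * (1 / al) + cmod (of_real (1 / T)) * 1))
   ?t1"
  by (intro multiplier_cmult multiplier_add multiplier_sum multiplier_s_damp multiplier_damp assms)
 also have "?t1 = ?t2"
  by (simp add: symbol_def fun_eq_iff of_real_sum[symmetric] sum_distrib_right[symmetric] del: of_real_sum) (simp add: algebra_simps)
 finally have M: "multiplier (cmod (-1) * ((\<Sum>l\<in>(UNIV::'l set). 2 / al) + cmod (- \<i>) * (1 / al) + cmod (of_real (1 / T)) * 1))
   ?t2" .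
 have "cmod (-1) * ((\<Sum>l\<in>(UNIV::'l set). 2 / al) + cmod (- \<i>) * (1 / al) + cmod (of_real (1 / T)) * 1) = real (2 * CARD('l) + 1) / al + 1 / T"
  using T by (simp add: norm_divide add_divide_distrib)
 also have "\<dots> <= (2 * CARD('l) + 2) / al"
  using assms frac_le[of 1 1 al T] by (simp add: add_divide_distrib)
 finally have le: "cmod (-1) * ((\<Sum>l\<in>(UNIV::'l set). 2 / al) + cmod (- \<i>) * (1 / al) + cmod (of_real (1 / T)) * 1) <= (2 * CARD('l) + 2) / al" .
 show ?thesis
  unfolding multiplier_def
  using M fbound_mono mult_right_mono[OF le] fbound_nonneg unfolding multiplier_def by blast
qed

lemma fbound_ft_gauss:
 fixes f :: "'e => real"
 assumes "bsupp f" "0 < e" "!!x. \<bar>f x\<bar> <= B"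
 shows "fbound (%xi. cnj (ft f xi) * of_real (gauss e xi)) ((2 * pi) ^ DIM('e) * B)"
 unfolding fbound_def
proof (intro conjI allI)
 note fm[measurable] = bsupp_measurable[OF assms(1)]
 show "L1 (%xi. cnj (ft f xi) * of_real (gauss e xi))"
  by (rule integrable_gauss_mult[OF assms(2)]) (use ft_bounded[OF assms(1)] in auto)
 show "cmod (LB xi. cis (- (xi \<bullet> z)) * (cnj (ft f xi) * of_real (gauss e xi))) <= (2 * pi) ^ DIM('e) * B" for z
  by (rule ft_gauss_inverse_bound[OF assms])
qed

text \<open>An interpolation in the spirit of Murat's lemma: the transform of a measure which is small in
 total variation and lies in an anisotropic negative Sobolev space built on bounded functions is
 small in the corresponding \<open>L^2\<close>-based space.\<close>

lemma damped_measure_energy: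
 fixes V :: "'j => 'e => real" and N :: "'e => real"
 assumes al: "0 < al" "al <= T" and Ga: "measure_transform Ga m" and m: "0 <= m"
  and V: "!!j. j \<in> J ==> bsupp (V j)" "!!j x. j \<in> J ==> \<bar>V j x\<bar> <= B"
  and N: "bsupp N" "!!x. T * \<bar>N x\<bar> <= B"
  and g: "!!j l. j \<in> J ==> bsupp (g j l)" "!!j l x. j \<in> J ==> sqrt T * \<bar>g j l x\<bar> <= B"
  and eq: "!!xi. Ga xi = - (\<Sum>j\<in>J. (symbol j xi + of_real (1 / T)) * ft (V j) xi) + ft N xi
    - \<i> * (\<Sum>j\<in>J. \<Sum>l\<in>UNIV. of_real (s j l \<bullet> xi) * ft (g j l) xi)"
 shows "(\<integral>\<^sup>+xi. ennreal ((cmod (Ga xi))^2 * damp al xi) \<partial>lborel) <=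
   ennreal (m * ((2 * pi) ^ DIM('e) * B * (card J * (3 * CARD('l) + 2) + 1) / al))"
proof -
 let ?t1 = "card J * (3 * CARD('l) + 2) + 1"
 let ?t2 = "cmod \<i> * (1 / sqrt al)"
 let ?t3 = "%e. LB xi. Ga xi * (cnj (Ga xi) * of_real (damp al xi) * of_real (gauss e xi))"
 have T: "0 < T" using al by linarith
 let ?P = "(2 * pi) ^ DIM('e)"
 have P: "0 <= ?P" by simp
 have B: "0 <= B" using N(2)[of 0] T by (smt (verit) abs_ge_zero mult_nonneg_nonneg)
 obtain C where C: "!!xi. cmod (Ga xi) <= C" and [measurable]: "Ga \<in> Borel"
  using Ga by (auto simp: measure_transform_def)
 let ?H = "%e f xi. cnj (ft f xi) * cor (gauss e xi)"
 \<comment> \<open>\<open>Ga\<close> enters the energy twice. One factor is kept as the transform of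
   a measure of mass \<open>m\<close>; for the conjugate factor the equation is inserted, and after
   damping each of its terms is the transform of a function of sup norm of order
   \<open>B / al\<close>.\<close>
 have cnjG: "cnj (Ga xi) * of_real (damp al xi) * of_real (gauss e xi) =
  (\<Sum>j\<in>J. ?H e (V j) xi * (- (cnj (symbol j xi) + of_real (1 / T)) * of_real (damp al xi))) +
  ?H e N xi * of_real (damp al xi) +
  (\<Sum>j\<in>J. \<Sum>l\<in>UNIV. ?H e (g j l) xi * (\<i> * of_real ((s j l \<bullet> xi) * damp al xi)))" for e xi
  unfolding eq
  by (simp add: sum_negf[symmetric] sum_distrib_left sum_distrib_right algebra_simps) (simp add: sum_negf)
 have fb: "fbound (%xi. cnj (Ga xi) * of_real (damp al xi) * of_real (gauss e xi)) (?P * B * ?t1 / al)"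
  if e: "0 < e" for e
 proof -
  have "fbound (%xi. cnj (Ga xi) * of_real (damp al xi) * of_real (gauss e xi))
   ((\<Sum>j\<in>J. (2 * CARD('l) + 2) / al * (?P * B)) + 1 * (?P * (B / T)) + (\<Sum>j\<in>J. \<Sum>l\<in>(UNIV::'l set). ?t2 * (?P * (B / sqrt T))))"
   unfolding cnjG
  proof (intro fbound_add fbound_sum)
   fix j assume j: "j \<in> J"
   show "fbound (%xi. ?H e (V j) xi * (- (cnj (symbol j xi) + of_real (1 / T)) * of_real (damp al xi))) ((2 * CARD('l) + 2) / al * (?P * B))"
    by (intro multiplierD[OF multiplier_symbol_damp] fbound_ft_gauss j al V e)
  next
   show "fbound (%xi. ?H e N xi * of_real (damp al xi)) (1 * (?P * (B / T)))"
    using N(2) T by (intro multiplierD[OF multiplier_damp] fbound_ft_gauss N e) (auto simp: field_simps)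
  next
   fix j l assume j: "j \<in> J"
   show "fbound (%xi. ?H e (g j l) xi * (\<i> * of_real ((s j l \<bullet> xi) * damp al xi))) (?t2 * (?P * (B / sqrt T)))"
    using g(2)[OF j] T by (intro multiplierD[OF multiplier_cmult[OF multiplier_s_damp(1)]] fbound_ft_gauss g j e al) (auto simp: field_simps)
  qed
  moreover have "(\<Sum>j\<in>J. (2 * CARD('l) + 2) / al * (?P * B)) + 1 * (?P * (B / T)) + (\<Sum>j\<in>J. \<Sum>l\<in>(UNIV::'l set). ?t2 * (?P * (B / sqrt T)))
    <= ?P * B * ?t1 / al"
  proof -
   \<comment> \<open>The hypotheses weigh \<open>g\<close> by \<open>sqrt T\<close> and
     \<open>N\<close> by \<open>T\<close> precisely so that, for every \<open>al\<close> up to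
     \<open>T\<close>, all three kinds of terms cost the same \<open>B / al\<close>.\<close>
   have "sqrt al * sqrt al <= sqrt al * sqrt T" using al by (intro mult_left_mono) auto
   hence "al <= sqrt al * sqrt T" using al by simp
   hence 1: "?P * B / (sqrt al * sqrt T) <= ?P * B / al"
    using al P B by (intro divide_left_mono) (auto intro!: mult_pos_pos mult_nonneg_nonneg)
   have 2: "?P * B / T <= ?P * B / al" using al P B T by (intro divide_left_mono) auto
   have "(\<Sum>j\<in>J. (2 * CARD('l) + 2) / al * (?P * B)) + 1 * (?P * (B / T)) + (\<Sum>j\<in>J. \<Sum>l\<in>(UNIV::'l set). ?t2 * (?P * (B / sqrt T)))
    = card J * (2 * CARD('l) + 2) * (?P * B / al) + ?P * B / T + card J * CARD('l) * (?P * B / (sqrt al * sqrt T))"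
    by (simp add: algebra_simps add_divide_distrib)
   also have "\<dots> <= card J * (2 * CARD('l) + 2) * (?P * B / al) + ?P * B / al + card J * CARD('l) * (?P * B / al)"
    using 1 2 by (intro add_mono mult_left_mono) auto
   also have "\<dots> = ?P * B * ?t1 / al"
    using al by (simp add: field_simps)
   finally show ?thesis .
  qed
  ultimately show ?thesis by (rule fbound_mono)
 qed
 define h where "h xi = (cmod (Ga xi))^2 * damp al xi" for xi
 have h0: "0 <= h xi" for xi by (simp add: h_def damp_nonneg)
 have [measurable]: "h \<in> Borel" unfolding h_def[abs_def] by measurable
 have "(\<integral>\<^sup>+xi. ennreal (h xi * gauss e xi) \<partial>lborel) <= ennreal (m * (?P * B * ?t1 / al))" if e: "0 < e" for e
 proof -
  have C0: "0 <= C" using C norm_ge_zero order_trans by blast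
  have "h xi <= C^2 * 1" for xi
   unfolding h_def by (intro mult_mono power_mono C damp_le_1 damp_nonneg) auto
  hence "L1 (%xi. cor (h xi) * of_real (gauss e xi))"
   by (intro integrable_gauss_mult[OF e, where C="C^2"]) (auto simp: h0)
  hence hi: "L1 (%xi. h xi * gauss e xi)"
   by (simp only: of_real_mult[symmetric] complex_of_real_integrable_eq)
  have "cor (LB xi. h xi * gauss e xi) = (?t3 e)"
   unfolding integral_complex_of_real[symmetric]
   by (intro integral_cong refl) (simp only: h_def of_real_mult complex_norm_square mult.assoc)
  moreover have "cmod (?t3 e) <= m * (?P * B * ?t1 / al)"
   using Ga fb[OF e] unfolding measure_transform_def by blast
  ultimately have "(LB xi. h xi * gauss e xi) <= m * (?P * B * ?t1 / al)"
   by (metis abs_le_D1 norm_of_real)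
  thus ?thesis
   by (subst nn_integral_eq_integral[OF hi]) (auto simp: h0 intro!: ennreal_leI)
 qed
 \<comment> \<open>The bound does not depend on \<open>e\<close>, so monotone convergence removes
   the Gaussian.\<close>
 thus ?thesis
  unfolding h_def[symmetric]
  by (intro LIMSEQ_le_const2[OF nn_integral_gauss_LIMSEQ]) (auto simp: h0)
qed

section \<open>Summation over dyadic scales\<close>

definition weight :: "real => 'e => real" where
 "weight T xi = 1 / T + (\<Sum>j\<in>J. cmod (symbol j xi))"

lemma borel_measurable_weight [measurable]: "weight T \<in> Borel"
 unfolding weight_def[abs_def] by measurable

lemma weight_pos: "0 < T ==> 0 < weight T xi"
 unfolding weight_def by (intro add_pos_nonneg sum_nonneg) auto

lemma weight_ge: "1 / T <= weight T xi"
 unfolding weight_def by (simp add: sum_nonneg)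

lemma symbol_le_weight:
 assumes "j \<in> J" "0 < T"
 shows "cmod (symbol j xi) <= weight T xi" "cmod (symbol j xi + of_real (1 / T)) <= weight T xi"
  "\<bar>b j \<bullet> xi\<bar> <= weight T xi" (is ?goalC) "(s j l \<bullet> xi)^2 <= weight T xi" (is ?goalD)
proof -
 have 1: "cmod (symbol j xi) <= (\<Sum>j\<in>J. cmod (symbol j xi))"
  using finJ assms by (intro member_le_sum) auto
 thus 2: "cmod (symbol j xi) <= weight T xi"
  using assms by (simp add: weight_def add_increasing)
 have "cmod (symbol j xi + of_real (1 / T)) <= cmod (symbol j xi) + 1 / T"
  using norm_triangle_ineq[of "symbol j xi" "of_real (1 / T)"] assms by (simp add: norm_divide)
 thus "cmod (symbol j xi + of_real (1 / T)) <= weight T xi"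
  using 1 by (simp add: weight_def)
 show ?goalC
  using 2 abs_Im_le_cmod[of "symbol j xi"] by (simp add: symbol_def)
 have "(s j l \<bullet> xi)^2 <= (\<Sum>l\<in>UNIV. (s j l \<bullet> xi)^2)"
  by (intro member_le_sum) auto
 also have "\<dots> = Re (symbol j xi)" by (simp add: symbol_def)
 also have "\<dots> <= cmod (symbol j xi)" by (rule complex_Re_le_cmod)
 finally show ?goalD using 2 by linarith
qed

text \<open>At a scale at most \<open>1 / weight T xi\<close> every scaled component of
  \<open>xi\<close> has square at most 1, so each of the \<open>card J * (CARD('l) + 1)\<close>
  factors is at least one half.\<close>

lemma damp_ge:
 assumes T: "0 < T" and al: "0 < al" "al * weight T xi <= 1"
 shows "(1/2) ^ (card J * (CARD('l) + 1)) <= damp al xi"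
proof -
 have "1 / 2 <= 1 / (1 + (scaled al p \<bullet> xi)^2)" if "p \<in> J \<times> UNIV" for p
 proof -
  obtain j o' where p: "p = (j, o')" "j \<in> J" using \<open>p \<in> J \<times> UNIV\<close> by auto
  have "(scaled al p \<bullet> xi)^2 <= 1"
  proof (cases o')
   case None
   have "\<bar>al * (b j \<bullet> xi)\<bar> <= al * weight T xi"
    using symbol_le_weight(3)[OF p(2) T, of xi] al(1) by (simp add: abs_mult)
   thus ?thesis using al(2) p None by (simp add: scaled_def abs_square_le_1)
  next
   case (Some l)
   have "al * (s j l \<bullet> xi)^2 <= al * weight T xi"
    using symbol_le_weight(4)[OF p(2) T, of l xi] al(1) by simp
   hence "al * (s j l \<bullet> xi)^2 <= 1" using al(2) by linarith
   thus ?thesis using al(1) p Some by (simp add: scaled_def power_mult_distrib)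
  qed
  thus ?thesis by (intro divide_left_mono) (auto intro!: mult_pos_pos add_pos_nonneg)
 qed
 hence "(\<Prod>p\<in>J \<times> (UNIV :: 'l option set). 1 / 2 :: real) <= damp al xi"
  unfolding damp_def by (intro prod_mono) auto
 thus ?thesis by (simp add: card_cartesian_product)
qed

lemma dyadic_scale:
 assumes "0 < x" "x <= (T::real)"
 obtains n :: nat where "T / 2 ^ n <= x" "x <= 2 * (T / 2 ^ n)"
proof -
 have "\<exists>n::nat. T / 2 ^ n <= x"
 proof -
  obtain n where "(1/2) ^ n < x / T" using real_arch_pow_inv[of "x / T" "1/2"] assms by auto
  thus ?thesis using assms by (intro exI[of _ n]) (auto simp: field_simps power_divide)
 qed
 define n where "n = (LEAST n. T / 2 ^ n <= x)"
 have n: "T / 2 ^ n <= x" unfolding n_def by (rule LeastI_ex) fact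
 show ?thesis
 proof (cases n)
  case 0 thus ?thesis using n assms by (intro that[of 0]) auto
 next
  case (Suc k)
  hence "\<not> T / 2 ^ k <= x" unfolding n_def by (metis lessI not_less_Least)
  thus ?thesis using n Suc by (intro that[of n]) auto
 qed
qed

text \<open>Each frequency is assigned a dyadic scale \<open>T / 2 ^ n\<close> comparable to
  \<open>1 / weight T xi\<close>, at which the damping is bounded below. Scale \<open>al\<close>
  enters with the factor \<open>al^2\<close> against the cost \<open>1 / al\<close> of
  \<open>damped_measure_energy\<close>, so the scales form a geometric series with sum
  \<open>2 * T\<close>. The 8 is this 2 times the 4 from squaring the dyadic loss.\<close>

lemma damped_measure_weighted_energy:
 fixes V :: "'j => 'e => real" and N :: "'e => real"
 assumes T: "0 < T" and Ga: "measure_transform Ga m" and m: "0 <= m"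
  and V: "!!j. j \<in> J ==> bsupp (V j)" "!!j x. j \<in> J ==> \<bar>V j x\<bar> <= B"
  and N: "bsupp N" "!!x. T * \<bar>N x\<bar> <= B"
  and g: "!!j l. j \<in> J ==> bsupp (g j l)" "!!j l x. j \<in> J ==> sqrt T * \<bar>g j l x\<bar> <= B"
  and eq: "!!xi. Ga xi = - (\<Sum>j\<in>J. (symbol j xi + of_real (1 / T)) * ft (V j) xi) + ft N xi
    - \<i> * (\<Sum>j\<in>J. \<Sum>l\<in>UNIV. of_real (s j l \<bullet> xi) * ft (g j l) xi)"
 shows "(\<integral>\<^sup>+xi. ennreal ((cmod (Ga xi) / weight T xi)^2) \<partial>lborel) <=
   ennreal (8 * 2 ^ (card J * (CARD('l) + 1)) * (2 * pi) ^ DIM('e) * (card J * (3 * CARD('l) + 2) + 1) * (m * B * T))"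
proof -
 let ?t1 = "card J * (3 * CARD('l) + 2) + 1"
 let ?P = "(2 * pi) ^ DIM('e)"
 let ?k = "card J * (CARD('l) + 1)"
 define c where "c = m * (?P * B * ?t1)"
 have B: "0 <= B" using N(2)[of 0] T by (smt (verit) abs_ge_zero mult_nonneg_nonneg)
 have c0: "0 <= c" unfolding c_def using B m by (intro mult_nonneg_nonneg) auto
 define a where "a n = T / 2 ^ n" for n :: nat
 have a: "0 < a n" "a n <= T" for n using T by (auto simp: a_def divide_le_eq mult_le_cancel_left1)
 have [measurable]: "Ga \<in> Borel" using Ga by (auto simp: measure_transform_def)
 have "(cmod (Ga xi) / weight T xi)^2 <= (\<Sum>n\<le>n'. 4 * 2 ^ ?k * (a n)^2 * ((cmod (Ga xi))^2 * damp (a n) xi))"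
  if n': "a n' <= 1 / weight T xi" "1 / weight T xi <= 2 * a n'" for xi n'
 proof -
  have w: "0 < weight T xi" by (rule weight_pos[OF T])
  have "(1/2) ^ ?k <= damp (a n') xi"
   using n'(1) w by (intro damp_ge[OF T a(1)]) (auto simp: field_simps)
  hence d: "1 <= 2 ^ ?k * damp (a n') xi" by (simp add: field_simps power_divide)
  have "(1 / weight T xi)^2 <= (2 * a n')^2" using n'(2) w by (intro power_mono) auto
  also have "\<dots> = 4 * (a n')^2 * 1" by (simp add: power_mult_distrib)
  also have "\<dots> <= 4 * (a n')^2 * (2 ^ ?k * damp (a n') xi)" using d by (intro mult_left_mono) auto
  finally have "(cmod (Ga xi))^2 * (1 / weight T xi)^2 <= (cmod (Ga xi))^2 * (4 * (a n')^2 * (2 ^ ?k * damp (a n') xi))"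
   by (intro mult_left_mono) auto
  hence "(cmod (Ga xi) / weight T xi)^2 <= 4 * 2 ^ ?k * (a n')^2 * ((cmod (Ga xi))^2 * damp (a n') xi)"
   by (simp add: power_divide mult_ac)
  also have "\<dots> <= (\<Sum>n\<le>n'. 4 * 2 ^ ?k * (a n)^2 * ((cmod (Ga xi))^2 * damp (a n) xi))"
   by (rule member_le_sum[of n' "{..n'}"]) (auto simp: damp_nonneg)
  finally show ?thesis .
 qed note ptw = this
 let ?F = "%n xi. ennreal (4 * 2 ^ ?k * (a n)^2 * ((cmod (Ga xi))^2 * damp (a n) xi))"
 have "ennreal ((cmod (Ga xi) / weight T xi)^2) <= (\<Sum>n. ?F n xi)" for xi
 proof -
  have "1 / weight T xi <= T" using weight_ge[of T xi] weight_pos[OF T, of xi] T by (simp add: field_simps)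
  then obtain n' where n': "a n' <= 1 / weight T xi" "1 / weight T xi <= 2 * a n'"
   using dyadic_scale[of "1 / weight T xi" T] weight_pos[OF T, of xi] unfolding a_def by auto
  have "ennreal ((cmod (Ga xi) / weight T xi)^2) <= (\<Sum>n\<le>n'. ?F n xi)"
   using ptw[OF n'] by (subst sum_ennreal) (auto simp: damp_nonneg intro!: ennreal_leI)
  also have "\<dots> <= (\<Sum>n. ?F n xi)" by (rule sum_le_suminf) auto
  finally show ?thesis .
 qed
 hence "(\<integral>\<^sup>+xi. ennreal ((cmod (Ga xi) / weight T xi)^2) \<partial>lborel) <= (\<integral>\<^sup>+xi. (\<Sum>n. ?F n xi) \<partial>lborel)"
  by (intro nn_integral_mono) auto
 also have "\<dots> = (\<Sum>n. \<integral>\<^sup>+xi. ?F n xi \<partial>lborel)"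
  by (rule nn_integral_suminf) measurable
 also have "\<dots> <= (\<Sum>n. ennreal (4 * 2 ^ ?k * c * a n))"
 proof (intro suminf_le)
  fix n
  have "(\<integral>\<^sup>+xi. ?F n xi \<partial>lborel) = ennreal (4 * 2 ^ ?k * (a n)^2) * (\<integral>\<^sup>+xi. ennreal ((cmod (Ga xi))^2 * damp (a n) xi) \<partial>lborel)"
   by (subst nn_integral_cmult[symmetric]) (auto simp: ennreal_mult[symmetric] damp_nonneg)
  also have "\<dots> <= ennreal (4 * 2 ^ ?k * (a n)^2) * ennreal (m * (?P * B * ?t1 / a n))"
   by (intro mult_left_mono damped_measure_energy[OF a Ga m V N g eq]) auto
  also have "\<dots> = ennreal (4 * 2 ^ ?k * (a n)^2 * (c / a n))"
   using c0 a[of n] by (subst ennreal_mult[symmetric]) (auto simp: c_def)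
  also have "4 * 2 ^ ?k * (a n)^2 * (c / a n) = 4 * 2 ^ ?k * c * a n"
   using a[of n] by (simp add: power2_eq_square)
  finally show "(\<integral>\<^sup>+xi. ?F n xi \<partial>lborel) <= ennreal (4 * 2 ^ ?k * c * a n)" .
 qed auto
 also have "\<dots> = ennreal (8 * 2 ^ ?k * c * T)"
 proof (rule suminf_ennreal_eq)
  show "0 <= 4 * 2 ^ ?k * c * a n" for n using c0 a[of n] by simp
  have "(%n. (1/2::real) ^ n) sums 2" using geometric_sums[of "1/2::real"] by simp
  from sums_mult[OF this, of "4 * 2 ^ ?k * c * T"]
  show "(%n. 4 * 2 ^ ?k * c * a n) sums (8 * 2 ^ ?k * c * T)"
   by (simp add: a_def power_divide mult_ac)
 qed
 also have "8 * 2 ^ ?k * c * T = 8 * 2 ^ ?k * ?P * ?t1 * (m * B * T)"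
  by (simp add: c_def mult_ac)
 finally show ?thesis .
qed

section \<open>Regions in which one symbol dominates\<close>

definition region :: "'j => 'e set" where
 "region i = {xi. \<forall>j\<in>J. cmod (symbol j xi) <= cmod (symbol i xi)}"

lemma region_measurable [measurable]: "region i \<in> sets borel"
 unfolding region_def using finJ by measurable

lemma region_cover:
 assumes "J \<noteq> {}" shows "\<exists>i\<in>J. xi \<in> region i"
proof -
 have "Max ((%j. cmod (symbol j xi)) ` J) \<in> (%j. cmod (symbol j xi)) ` J"
  using finJ assms by (intro Max_in) auto
 then obtain i where "i \<in> J" "cmod (symbol i xi) = Max ((%j. cmod (symbol j xi)) ` J)" by auto
 thus ?thesis using finJ by (intro bexI[of _ i]) (auto simp: region_def)
qed

text \<open>Because the real part of the symbol is nonnegative, adding \<open>1 / T\<close> cannot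
  cancel it, and the modulus of the sum controls both \<open>cmod (symbol i xi)\<close> and
  \<open>1 / T\<close>. On the region the remaining symbols are at most the dominating one.\<close>

lemma weight_le_symbol:
 assumes "0 < T" "i \<in> J" "xi \<in> region i"
 shows "weight T xi <= 2 * card J * cmod (symbol i xi + of_real (1 / T))"
proof -
 let ?x = "cmod (symbol i xi)" and ?S = "cmod (symbol i xi + of_real (1 / T))"
 have J1: "1 <= real (card J)" using assms(2) finJ by (metis One_nat_def Suc_leI card_gt_0_iff empty_iff of_nat_1 of_nat_mono)
 have re: "0 <= Re (symbol i xi)" by (simp add: symbol_def sum_nonneg)
 have "?x^2 + (1 / T)^2 <= ?S^2"
  using re assms(1) by (simp add: cmod_power2 power2_sum algebra_simps)
 moreover have "(?x + 1 / T)^2 <= 2 * (?x^2 + (1 / T)^2)"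
  using sum_squares_bound[of ?x "1 / T"] by (simp add: power2_sum)
 ultimately have "(?x + 1 / T)^2 <= 2 * ?S^2" by (meson mult_left_mono order_trans zero_le_numeral)
 also have "\<dots> <= 4 * ?S^2" by (intro mult_right_mono) auto
 finally have "(?x + 1 / T)^2 <= 4 * ?S^2" .
 hence "(?x + 1 / T)^2 <= (2 * ?S)^2" unfolding power_mult_distrib by simp
 hence 1: "?x + 1 / T <= 2 * ?S" by (rule power2_le_imp_le) simp
 have "weight T xi <= 1 / T + (\<Sum>j\<in>J. ?x)"
  unfolding weight_def using assms(3) by (intro add_left_mono sum_mono) (auto simp: region_def)
 also have "\<dots> <= card J * (1 / T) + card J * ?x"
  using mult_right_mono[OF J1, of "1 / T"] assms(1) by simp
 also have "\<dots> = card J * (?x + 1 / T)" by (simp add: algebra_simps)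
 also have "\<dots> <= card J * (2 * ?S)" using 1 by (intro mult_left_mono) auto
 finally show ?thesis by (simp add: mult_ac)
qed

text \<open>Solve the identity for its term of index \<open>i\<close> and divide by the weight. All
  other coefficients become bounded: \<open>1 \<le> weight T xi * T\<close> pays for the zero order
  term, and it also improves the bound \<open>sqrt (weight T xi)\<close> for
  \<open>s j l \<bullet> xi\<close> to \<open>weight T xi * sqrt T\<close>. The 16 is the square of
  the 2 in \<open>weight_le_symbol\<close> times 4 for the four groups of terms.\<close>

lemma region_pointwise:
 fixes v :: "'j => complex" and gamma n :: complex and d :: "'j => 'l => complex"
 assumes T: "0 < T" and i: "i \<in> J" "xi \<in> region i"
  and eq: "gamma = - (\<Sum>j\<in>J. (symbol j xi + of_real (1 / T)) * v j) + n
    - \<i> * (\<Sum>j\<in>J. \<Sum>l\<in>UNIV. of_real (s j l \<bullet> xi) * d j l)"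
 shows "(cmod (v i))^2 <= 16 * (real (card J))^2 * ((1 + card J) * (1 + CARD('l))) *
  ((cmod gamma / weight T xi)^2 + (\<Sum>j\<in>J - {i}. (cmod (v j))^2) + T^2 * (cmod n)^2 + T * (\<Sum>j\<in>J. \<Sum>l\<in>UNIV. (cmod (d j l))^2))"
proof -
 let ?t1 = "\<Sum>j\<in>J. \<Sum>l\<in>UNIV. of_real (s j l \<bullet> xi) * d j l"
 let ?t2 = "\<Sum>j\<in>J. \<Sum>l\<in>UNIV. (cmod (d j l))^2"
 let ?t3 = "\<Sum>j\<in>J - {i}. (cmod (v j))^2"
 let ?t4 = "\<Sum>p\<in>J \<times> UNIV. (sqrt T * cmod (d (fst p) (snd p)))^2"
 let ?w = "weight T xi" and ?S = "%j. symbol j xi + of_real (1 / T)"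
 have w: "0 < ?w" by (rule weight_pos[OF T])
 have wT: "1 <= ?w * T" using weight_ge[of T xi] T by (simp add: field_simps)
 let ?A = "cmod gamma / ?w" and ?X = "\<Sum>j\<in>J - {i}. cmod (v j)" and ?n = "T * cmod n"
  and ?D = "\<Sum>p\<in>J \<times> UNIV. sqrt T * cmod (d (fst p) (snd p))"
 have "(\<Sum>j\<in>J. ?S j * v j) = ?S i * v i + (\<Sum>j\<in>J - {i}. ?S j * v j)"
  using finJ i by (simp add: sum.remove)
 hence "?S i * v i = - gamma - (\<Sum>j\<in>J - {i}. ?S j * v j) + n - \<i> * ?t1"
  using eq by (simp add: algebra_simps)
 hence "cmod (?S i * v i) <= cmod gamma + cmod (\<Sum>j\<in>J - {i}. ?S j * v j) + cmod n + cmod (\<i> * ?t1)"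
  by (metis (no_types, lifting) add_mono_thms_linordered_semiring(1) norm_minus_cancel norm_triangle_le norm_triangle_le_diff order_refl)
 also have "cmod (\<Sum>j\<in>J - {i}. ?S j * v j) <= (\<Sum>j\<in>J - {i}. ?w * cmod (v j))"
  using symbol_le_weight(2)[OF _ T]
  by (intro order_trans[OF norm_sum] sum_mono) (auto simp: norm_mult intro!: mult_right_mono simp del: of_real_divide)
 also have "cmod n <= ?w * ?n" using wT mult_right_mono[OF wT, of "cmod n"] by (simp add: mult_ac)
 also have "cmod (\<i> * ?t1) <= ?w * ?D"
 proof -
  have "cmod (\<i> * ?t1) <= (\<Sum>j\<in>J. \<Sum>l\<in>UNIV. cmod (of_real (s j l \<bullet> xi) * d j l))"
   unfolding norm_mult[of \<i>] norm_ii mult_1 by (intro order_trans[OF norm_sum] sum_mono norm_sum)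
  also have "\<dots> <= (\<Sum>j\<in>J. \<Sum>l\<in>UNIV. ?w * (sqrt T * cmod (d j l)))"
  proof (intro sum_mono)
   fix j l assume j: "j \<in> J"
   have "\<bar>s j l \<bullet> xi\<bar> <= sqrt ?w" using symbol_le_weight(4)[OF j T, of l xi] by (intro real_le_rsqrt) simp
   also have "\<dots> <= sqrt (?w * (?w * T))" using wT w by (intro real_sqrt_le_mono) simp
   also have "\<dots> = ?w * sqrt T" using w by (simp add: real_sqrt_mult)
   finally show "cmod (of_real (s j l \<bullet> xi) * d j l) <= ?w * (sqrt T * cmod (d j l))"
    unfolding norm_mult norm_of_real mult.assoc[symmetric] by (intro mult_right_mono) auto
  qed
  also have "\<dots> = ?w * ?D" by (simp add: sum.cartesian_product sum_distrib_left case_prod_beta)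
  finally show ?thesis .
 qed
 also have "cmod gamma + (\<Sum>j\<in>J - {i}. ?w * cmod (v j)) + ?w * ?n + ?w * ?D = ?w * (?A + ?X + ?n + ?D)"
  using w by (simp add: distrib_left sum_distrib_left)
 finally have "cmod (?S i) * cmod (v i) <= ?w * (?A + ?X + ?n + ?D)"
  by (simp add: norm_mult)
 hence "2 * card J * (cmod (?S i) * cmod (v i)) <= 2 * card J * (?w * (?A + ?X + ?n + ?D))"
  by (intro mult_left_mono) auto
 moreover have "?w * cmod (v i) <= 2 * card J * cmod (?S i) * cmod (v i)"
  by (intro mult_right_mono weight_le_symbol[OF T i]) auto
 ultimately have "?w * cmod (v i) <= ?w * (2 * card J * (?A + ?X + ?n + ?D))"
  by (simp add: mult_ac)
 hence "cmod (v i) <= 2 * card J * (?A + ?X + ?n + ?D)" using w by simp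
 hence "(cmod (v i))^2 <= (2 * card J * (?A + ?X + ?n + ?D))^2" by (intro power_mono) auto
 also have "\<dots> = 4 * (real (card J))^2 * (?A + ?X + ?n + ?D)^2" by (simp add: power_mult_distrib)
 also have "\<dots> <= 4 * (real (card J))^2 * (4 * (?A^2 + ?X^2 + ?n^2 + ?D^2))"
 proof (intro mult_left_mono)
  have "(a + b + c + e)^2 <= 4 * (a^2 + b^2 + c^2 + e^2)" for a b c e :: real
   using sum_squares_bound[of a b] sum_squares_bound[of a c] sum_squares_bound[of a e]
    sum_squares_bound[of b c] sum_squares_bound[of b e] sum_squares_bound[of c e]
   by (simp add: power2_eq_square algebra_simps)
  thus "(?A + ?X + ?n + ?D)^2 <= 4 * (?A^2 + ?X^2 + ?n^2 + ?D^2)" .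
 qed auto
 also have "\<dots> <= 4 * (real (card J))^2 * (4 * (((1 + card J) * (1 + CARD('l))) * (?A^2 + ?t3 + ?n^2 + T * ?t2)))"
 proof (intro mult_left_mono)
  let ?Q = "real ((1 + card J) * (1 + CARD('l)))"
  have Q: "1 <= ?Q" "real (card J) <= ?Q" "real (card J * CARD('l)) <= ?Q"
   by (simp_all add: algebra_simps)
  have "?X^2 <= ?t3 * real (card (J - {i}))" by (rule sum_squared_le_sum_of_squares)
  also have "\<dots> <= ?t3 * ?Q"
  proof -
   have "card (J - {i}) <= card J" using finJ by (intro card_mono) auto
   hence "real (card (J - {i})) <= ?Q" by (intro order_trans[OF _ Q(2)]) simp
   thus ?thesis by (intro mult_left_mono sum_nonneg) auto
  qed
  finally have X: "?X^2 <= ?Q * ?t3" by (simp add: mult.commute)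
  have "?D^2 <= ?t4 * real (card (J \<times> (UNIV :: 'l set)))"
   by (rule sum_squared_le_sum_of_squares)
  also have "\<dots> <= ?t4 * ?Q"
   using Q(3) by (intro mult_left_mono sum_nonneg) (auto simp: card_cartesian_product)
  also have "?t4 = T * ?t2"
   using T by (simp add: power_mult_distrib sum.cartesian_product sum_distrib_left case_prod_beta)
  finally have D: "?D^2 <= ?Q * (T * ?t2)" by (simp add: mult.commute)
  have "1 * ?A^2 <= ?Q * ?A^2" "1 * ?n^2 <= ?Q * ?n^2" using Q(1) by (intro mult_right_mono; simp)+
  thus "?A^2 + ?X^2 + ?n^2 + ?D^2 <= ?Q * (?A^2 + ?t3 + ?n^2 + T * ?t2)"
   using X D by (simp only: distrib_left mult_1)
 qed auto
 finally show ?thesis by (simp add: power_mult_distrib mult.assoc)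
qed

text \<open>It depends on the cardinality of \<open>J\<close>, the number of diffusion vectors and
  the dimension, but neither on the vectors nor on \<open>T\<close>; the smallness parameters can
  therefore be chosen after it.\<close>

definition region_const :: real where
 "region_const = 16 * (real (card J))^2 * ((1 + card J) * (1 + CARD('l))) *
   (8 * 2 ^ (card J * (CARD('l) + 1)) * (2 * pi) ^ DIM('e) * (card J * (3 * CARD('l) + 2) + 1))"

lemma region_const_nonneg: "0 <= region_const"
 unfolding region_const_def by (intro mult_nonneg_nonneg) auto

text \<open>The functions \<open>V j\<close> with \<open>j \<noteq> i\<close> enter only through
  their \<open>L^2\<close> norms, because on the region their symbols are dominated by the one that
  is divided out. In the application these functions are small while \<open>V i\<close> is
  not.\<close>

theorem region_energy:
 fixes V :: "'j => 'e => real" and N :: "'e => real"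
 assumes T: "0 < T" and Ga: "measure_transform Ga m" and m: "0 <= m"
  and V: "!!j. j \<in> J ==> bsupp (V j)" "!!j x. j \<in> J ==> \<bar>V j x\<bar> <= B"
  and N: "bsupp N" "!!x. T * \<bar>N x\<bar> <= B"
  and g: "!!j l. j \<in> J ==> bsupp (g j l)" "!!j l x. j \<in> J ==> sqrt T * \<bar>g j l x\<bar> <= B"
  and eq: "!!xi. Ga xi = - (\<Sum>j\<in>J. (symbol j xi + of_real (1 / T)) * ft (V j) xi) + ft N xi
    - \<i> * (\<Sum>j\<in>J. \<Sum>l\<in>UNIV. of_real (s j l \<bullet> xi) * ft (g j l) xi)"
  and i: "i \<in> J"
 shows "(\<integral>\<^sup>+xi. ennreal (indicator (region i) xi * (cmod (ft (V i) xi))^2) \<partial>lborel) <=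
   ennreal (region_const * (m * B * T + (\<Sum>j\<in>J - {i}. LB x. (V j x)^2) + T^2 * (LB x. (N x)^2)
    + T * (\<Sum>j\<in>J. \<Sum>l\<in>UNIV. LB x. (g j l x)^2)))"
proof -
 let ?t1 = "%Q. Q * (m * B * T) + (\<Sum>j\<in>J - {i}. Q * (LB x. (V j x)^2))
   + T^2 * (Q * (LB x. (N x)^2)) + T * (\<Sum>j\<in>J. \<Sum>l\<in>UNIV. Q * (LB x. (g j l x)^2))"
 let ?t2 = "\<Sum>j\<in>J - {i}. \<integral>\<^sup>+xi. ennreal ((cmod (ft (V j) xi))^2) \<partial>lborel"
 define K where "K = 16 * (real (card J))^2 * ((1 + card J) * (1 + CARD('l)))"
 define P where "P = (2 * pi) ^ DIM('e)"
 define Q where "Q = 8 * 2 ^ (card J * (CARD('l) + 1)) * P * (card J * (3 * CARD('l) + 2) + 1)"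
 have K0: "0 <= K" by (simp add: K_def)
 have P0: "0 <= P" by (simp add: P_def)
 \<comment> \<open>Plancherel's constant \<open>P\<close> is enlarged to \<open>Q\<close>, so that a
   single constant multiplies all terms.\<close>
 have PQ: "P <= Q"
 proof -
  define a where "a = (2::real) ^ (card J * (CARD('l) + 1))"
  define c where "c = real (card J * (3 * CARD('l) + 2) + 1)"
  have Qeq: "Q = 8 * ((a * c) * P)" by (simp add: Q_def a_def c_def mult_ac)
  have "1 * 1 <= a * c" by (intro mult_mono) (auto simp: a_def c_def)
  from mult_right_mono[OF this P0] have "P <= (a * c) * P" by simp
  thus ?thesis unfolding Qeq using P0 by linarith
 qed
 have B: "0 <= B" using N(2)[of 0] T by (smt (verit) abs_ge_zero mult_nonneg_nonneg)
 have Vm[measurable]: "V j \<in> Borel" if "j \<in> J" for j using V(1)[OF that] by (rule bsupp_measurable)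
 have gm[measurable]: "g j l \<in> Borel" if "j \<in> J" for j l using g(1)[OF that] by (rule bsupp_measurable)
 have Nm[measurable]: "N \<in> Borel" using N(1) by (rule bsupp_measurable)
 have [measurable]: "Ga \<in> Borel" using Ga by (auto simp: measure_transform_def)
 let ?f1 = "%xi. ennreal ((cmod (Ga xi) / weight T xi)^2)"
  and ?f2 = "%xi. \<Sum>j\<in>J - {i}. ennreal ((cmod (ft (V j) xi))^2)"
  and ?f3 = "%xi. ennreal (T^2) * ennreal ((cmod (ft N xi))^2)"
  and ?f4 = "%xi. ennreal T * (\<Sum>j\<in>J. \<Sum>l\<in>UNIV. ennreal ((cmod (ft (g j l) xi))^2))"
 have s2: "(\<integral>\<^sup>+xi. ?f2 xi \<partial>lborel) = ?t2"
  by (rule nn_integral_sum) auto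
 have "ennreal (indicator (region i) xi * (cmod (ft (V i) xi))^2) <= ennreal K * (?f1 xi + ?f2 xi + ?f3 xi + ?f4 xi)" for xi
 proof (cases "xi \<in> region i")
  case True
  have "ennreal K * (?f1 xi + ?f2 xi + ?f3 xi + ?f4 xi) = ennreal (K * ((cmod (Ga xi) / weight T xi)^2 + (\<Sum>j\<in>J - {i}. (cmod (ft (V j) xi))^2) + T^2 * (cmod (ft N xi))^2 + T * (\<Sum>j\<in>J. \<Sum>l\<in>UNIV. (cmod (ft (g j l) xi))^2)))"
   using K0 T by (simp add: sum_nonneg ennreal_mult ennreal_plus)
  thus ?thesis
   using region_pointwise[OF T i True eq] True by (auto intro!: ennreal_leI simp: K_def)
 qed simp
 hence "(\<integral>\<^sup>+xi. ennreal (indicator (region i) xi * (cmod (ft (V i) xi))^2) \<partial>lborel) <= (\<integral>\<^sup>+xi. ennreal K * (?f1 xi + ?f2 xi + ?f3 xi + ?f4 xi) \<partial>lborel)"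
  by (intro nn_integral_mono) auto
 also have "\<dots> = ennreal K * ((\<integral>\<^sup>+xi. ?f1 xi \<partial>lborel) + ?t2
   + ennreal (T^2) * (\<integral>\<^sup>+xi. ennreal ((cmod (ft N xi))^2) \<partial>lborel)
   + ennreal T * (\<Sum>j\<in>J. \<Sum>l\<in>UNIV. \<integral>\<^sup>+xi. ennreal ((cmod (ft (g j l) xi))^2) \<partial>lborel))"
  using s2 by (simp add: nn_integral_cmult nn_integral_add nn_integral_sum del: sum_ennreal)
 also have "\<dots> <= ennreal K * (ennreal (Q * (m * B * T)) + (\<Sum>j\<in>J - {i}. ennreal (Q * (LB x. (V j x)^2)))
   + ennreal (T^2) * ennreal (Q * (LB x. (N x)^2))
   + ennreal T * (\<Sum>j\<in>J. \<Sum>l\<in>UNIV. ennreal (Q * (LB x. (g j l x)^2))))"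
 proof (intro mult_left_mono add_mono sum_mono)
  show "(\<integral>\<^sup>+xi. ?f1 xi \<partial>lborel) <= ennreal (Q * (m * B * T))"
   unfolding Q_def P_def by (rule damped_measure_weighted_energy[OF T Ga m V N g eq])
 qed (auto simp: plancherel V N g intro!: ennreal_leI mult_right_mono PQ[unfolded P_def power_mult_distrib])
 also have "\<dots> = ennreal (K * (?t1 Q))"
 proof -
  have Q0: "0 <= Q" using P0 PQ by linarith
  thus ?thesis
   using K0 m B T by (simp add: sum_nonneg ennreal_mult ennreal_plus sum_ennreal[symmetric] del: sum_ennreal)
 qed
 also have "K * (?t1 Q) =
   region_const * (m * B * T + (\<Sum>j\<in>J - {i}. LB x. (V j x)^2) + T^2 * (LB x. (N x)^2)
    + T * (\<Sum>j\<in>J. \<Sum>l\<in>UNIV. LB x. (g j l x)^2))"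
  unfolding region_const_def K_def[symmetric] P_def[symmetric] Q_def[symmetric] sum_distrib_left[symmetric]
  by (simp add: algebra_simps)
 finally show ?thesis .
qed

end

section \<open>Smooth functions and test functions\<close>

lemma dir_deriv_eq: "(phi has_derivative D) (at z) ==> dd e phi z = D e"
 unfolding dir_deriv_def by (metis frechet_derivative_at)

lemma has_derivative_dir_deriv:
 assumes "phi differentiable (at z)"
 shows "(phi has_derivative (%e. dd e phi z)) (at z)"
 using frechet_derivative_works[THEN iffD1, OF assms] by (simp add: dir_deriv_def[abs_def])

lemma dir_deriv_linear:
 assumes "phi differentiable (at z)"
 shows "linear (%e. dd e phi z)"
 using has_derivative_dir_deriv[OF assms] by (rule has_derivative_linear)

lemma dir_deriv_Basis:
 assumes "phi differentiable (at z)"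
 shows "dd e phi z = (\<Sum>b\<in>Basis. (e \<bullet> b) * dd b phi z)"
proof -
 have "dd (\<Sum>b\<in>Basis. (e \<bullet> b) *\<^sub>R b) phi z = (\<Sum>b\<in>Basis. (e \<bullet> b) *\<^sub>R dd b phi z)"
  by (simp only: linear_sum[OF dir_deriv_linear[OF assms]] linear_scale[OF dir_deriv_linear[OF assms]])
 thus ?thesis by (simp add: euclidean_representation)
qed

lemma Ck_Suc_imp: "Ck (Suc k) phi ==> Ck k phi"
proof (induction k arbitrary: phi)
 case 0
 thus ?case by (auto simp: continuous_on_eq_continuous_at differentiable_imp_continuous_within)
next
 case (Suc k)
 thus ?case by (auto simp del: Ck.simps simp add: Ck.simps(2)[of "Suc k"] Ck.simps(2)[of k])
qed

lemma Ck_const: "Ck k (%z. c)"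
proof (induction k arbitrary: c)
 case (Suc k)
 have "dd e (%z. c) = (%z. 0)" for e :: 'a
  by (intro ext, subst dir_deriv_eq[OF has_derivative_const]) simp
 thus ?case using Suc by simp
qed simp

lemma Ck_add: "Ck k phi ==> Ck k psi ==> Ck k (%z. phi z + psi z)"
proof (induction k arbitrary: phi psi)
 case (Suc k)
 hence d: "phi differentiable (at z)" "psi differentiable (at z)" for z by auto
 have "dd e (%z. phi z + psi z) = (%z. dd e phi z + dd e psi z)" for e
  by (intro ext dir_deriv_eq has_derivative_add has_derivative_dir_deriv d)
 thus ?case using Suc by simp
qed (simp add: continuous_on_add)

lemma Ck_mult: "Ck k phi ==> Ck k psi ==> Ck k (%z. phi z * psi z)"
proof (induction k arbitrary: phi psi)
 case (Suc k)
 hence d: "phi differentiable (at z)" "psi differentiable (at z)" for z by auto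
 have "dd e (%z. phi z * psi z) = (%z. phi z * dd e psi z + dd e phi z * psi z)" for e
  by (intro ext dir_deriv_eq has_derivative_mult has_derivative_dir_deriv d)
 moreover have "Ck k (%z. phi z * dd e psi z + dd e phi z * psi z)" if "e \<in> Basis" for e
  using Suc.prems that by (intro Ck_add Suc.IH Ck_Suc_imp[OF Suc.prems(1)] Ck_Suc_imp[OF Suc.prems(2)]) auto
 ultimately show ?case using d by simp
qed (simp add: continuous_on_mult)

definition smooth :: "('a::euclidean_space => real) => bool" where
 "smooth phi \<longleftrightarrow> (\<forall>k. Ck k phi)"

named_theorems smooth_intros

lemma smooth_const [smooth_intros]: "smooth (%z. c)"
 by (simp add: smooth_def Ck_const)

lemma smooth_add [smooth_intros]: "smooth phi ==> smooth psi ==> smooth (%z. phi z + psi z)"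
 by (simp add: smooth_def Ck_add)

lemma smooth_mult [smooth_intros]: "smooth phi ==> smooth psi ==> smooth (%z. phi z * psi z)"
 by (simp add: smooth_def Ck_mult)

lemma smooth_sum [smooth_intros]: "(!!i. i \<in> I ==> smooth (phi i)) ==> smooth (%z. \<Sum>i\<in>I. phi i z)"
 by (induction I rule: infinite_finite_induct) (auto intro: smooth_intros)

lemma smooth_prod [smooth_intros]: "(!!i. i \<in> I ==> smooth (phi i)) ==> smooth (%z. \<Prod>i\<in>I. phi i z)"
 by (induction I rule: infinite_finite_induct) (auto intro: smooth_intros)

lemma smooth_differentiable: "smooth phi ==> phi differentiable (at z)"
 unfolding smooth_def by (metis Ck.simps(2))

lemma smooth_continuous: "smooth phi ==> continuous_on UNIV phi"
 unfolding smooth_def by (metis Ck.simps(1))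

lemma smooth_measurable [measurable_dest]: "smooth phi ==> phi \<in> Borel"
 by (intro borel_measurable_continuous_onI smooth_continuous)

lemma smooth_dir_deriv [smooth_intros]:
 assumes "smooth phi" shows "smooth (dd e phi)"
proof -
 have "smooth (dd b phi)" if "b \<in> Basis" for b
  using assms that unfolding smooth_def by (metis Ck.simps(2))
 moreover have "dd e phi = (%z. \<Sum>b\<in>Basis. (e \<bullet> b) * dd b phi z)"
  using dir_deriv_Basis smooth_differentiable[OF assms] by blast
 ultimately show ?thesis by (auto intro!: smooth_intros)
qed

lemma dir_deriv_add:
 "smooth phi ==> smooth psi ==> dd e (%z. phi z + psi z) = (%z. dd e phi z + dd e psi z)"
 by (intro ext dir_deriv_eq has_derivative_add has_derivative_dir_deriv smooth_differentiable)

lemma dir_deriv_mult: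
 "smooth phi ==> smooth psi ==> dd e (%z. phi z * psi z) = (%z. phi z * dd e psi z + dd e phi z * psi z)"
 by (intro ext dir_deriv_eq has_derivative_mult has_derivative_dir_deriv smooth_differentiable)

lemma dir_deriv_cmult:
 "smooth phi ==> dd e (%z. c * phi z) = (%z. c * dd e phi z)"
 by (intro ext dir_deriv_eq has_derivative_mult_right has_derivative_dir_deriv smooth_differentiable)

text \<open>A tower of functions, each the derivative of the one before, becomes smooth on the whole
  space after an affine map by one induction. Sines, exponentials, \<open>flat_exp\<close> and
  compositions with smooth functions of one variable are all instances.\<close>

lemma smooth_affine_comp:
 fixes D :: "nat => real => real"
 assumes D: "!!k x. (D k has_real_derivative D (Suc k) x) (at x)"
 shows "smooth (%z. D k (v \<bullet> z + c))"
  and "dd e (%z. D k (v \<bullet> z + c)) = (%z. (v \<bullet> e) * D (Suc k) (v \<bullet> z + c))"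
proof -
 let ?t1 = "%k. %z. D k (v \<bullet> z + c)"
 have hd: "((?t1 k) has_derivative (%e. (v \<bullet> e) * D (Suc k) (v \<bullet> z + c))) (at z)" for k z
 proof -
  have "((%z. v \<bullet> z + c) has_derivative (%e. v \<bullet> e)) (at z)"
   by (auto intro!: derivative_eq_intros)
  from DERIV_compose_FDERIV[OF D this] show ?thesis by (simp add: mult.commute)
 qed
 show dd: "dd e (?t1 k) = (%z. (v \<bullet> e) * D (Suc k) (v \<bullet> z + c))" for k e
  using dir_deriv_eq[OF hd] by blast
 have "Ck n (?t1 k)" for n
 proof (induction n arbitrary: k)
  case 0
  have "isCont (?t1 k) z" for z
   using hd[of k z] has_derivative_continuous by blast
  thus ?case by (simp add: continuous_on_eq_continuous_at)
 next
  case (Suc n)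
  have "Ck n (%z. (v \<bullet> e) * D (Suc k) (v \<bullet> z + c))" for e by (intro Ck_mult Ck_const Suc)
  thus ?case using hd unfolding Ck.simps dd differentiable_def by blast
 qed
 thus "smooth (?t1 k)" by (simp add: smooth_def)
qed

lemma smooth_sin_affine:
 shows "smooth (%z. sin (v \<bullet> z + c))" (is ?goalA) "dd e (%z. sin (v \<bullet> z + c)) = (%z. (v \<bullet> e) * sin (v \<bullet> z + (c + pi / 2)))"
proof -
 define D where "D k x = sin (x + real k * (pi / 2))" for k x
 have D: "(D k has_real_derivative D (Suc k) x) (at x)" for k x
 proof -
  have c: "sin (y + pi / 2) = cos y" for y :: real by (simp add: sin_add)
  have "x + real (Suc k) * (pi / 2) = (x + real k * (pi / 2)) + pi / 2" by (simp add: algebra_simps)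
  hence "D (Suc k) x = cos (x + real k * (pi / 2))"
   unfolding D_def by (simp only: c)
  thus ?thesis unfolding D_def by (auto intro!: derivative_eq_intros)
 qed
 show ?goalA "dd e (%z. sin (v \<bullet> z + c)) = (%z. (v \<bullet> e) * sin (v \<bullet> z + (c + pi / 2)))"
  using smooth_affine_comp(1)[of D 0 v c, OF D] smooth_affine_comp(2)[of D e 0 v c, OF D] by (simp_all add: D_def add.assoc)
qed

lemma smooth_cos_sin:
 shows "smooth (%z. cos (v \<bullet> z))" (is ?goalA) "smooth (%z. sin (v \<bullet> z))"
  "dd e (%z. cos (v \<bullet> z)) = (%z. - (v \<bullet> e) * sin (v \<bullet> z))" (is ?goalC)
  "dd e (%z. sin (v \<bullet> z)) = (%z. (v \<bullet> e) * cos (v \<bullet> z))" (is ?goalD)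
proof -
 have c: "cos x = sin (x + pi / 2)" for x :: real by (simp add: sin_add)
 have s: "sin (x + (pi / 2 + pi / 2)) = - sin x" for x :: real by simp
 show ?goalA "smooth (%z. sin (v \<bullet> z))"
  using smooth_sin_affine(1)[of v "pi/2"] smooth_sin_affine(1)[of v 0] by (simp_all add: c)
 show ?goalC
  unfolding c smooth_sin_affine(2) s by simp
 show ?goalD
  using smooth_sin_affine(2)[of e v 0] by (simp add: c)
qed

lemma smooth_exp:
 shows "smooth (%z. exp (v \<bullet> z))" "dd e (%z. exp (v \<bullet> z)) = (%z. (v \<bullet> e) * exp (v \<bullet> z))"
 using smooth_affine_comp(1)[of "%_. exp" 0 v 0] smooth_affine_comp(2)[of "%_. exp" e 0 v 0] by (auto intro!: derivative_eq_intros)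

lemma smooth_inner [smooth_intros]: "smooth (%z. v \<bullet> z)"
proof -
 define D where "D k x = (if k = 0 then x else if k = 1 then 1 else (0::real))" for k :: nat and x
 have "(D k has_real_derivative D (Suc k) x) (at x)" for k x
  unfolding D_def by (cases "k = 0"; cases "k = 1") (auto intro!: derivative_eq_intros)
 from smooth_affine_comp(1)[of D 0 v 0, OF this] show ?thesis by (simp add: D_def)
qed

lemma smooth_polynomial: "real_polynomial_function p ==> smooth p"
proof (induction rule: real_polynomial_function.induct)
 case (linear f)
 have f: "f z = (\<Sum>b\<in>Basis. (b \<bullet> z) * f b)" for z
 proof -
  have l: "Real_Vector_Spaces.linear f" using linear by (rule bounded_linear.linear)
  have "f (\<Sum>b\<in>Basis. (z \<bullet> b) *\<^sub>R b) = (\<Sum>b\<in>Basis. (z \<bullet> b) *\<^sub>R f b)"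
   by (simp only: linear_sum[OF l] linear_scale[OF l])
  thus ?thesis
   unfolding euclidean_representation real_scaleR_def by (simp only: inner_commute[of z])
 qed
 have "smooth (%z. \<Sum>b\<in>Basis. (b \<bullet> z) * f b)" by (intro smooth_intros)
 also have "(%z. \<Sum>b\<in>Basis. (b \<bullet> z) * f b) = f" by (rule ext) (rule f[symmetric])
 finally show ?case .
qed (auto intro: smooth_intros)

lemma smooth_real_deriv:
 fixes g :: "real => real"
 assumes "smooth g" shows "(g has_real_derivative dd 1 g x) (at x)"
proof -
 have l: "linear (%e. dd e g x)" by (intro dir_deriv_linear smooth_differentiable assms)
 have "dd e g x = dd 1 g x * e" for e
  using linear_scale[OF l, of e 1] by (simp only: real_scaleR_def mult_1_right mult.commute[of e])
 hence eq: "(%e. dd e g x) = (*) (dd 1 g x)" by (intro ext)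
 show ?thesis
  using has_derivative_dir_deriv[OF smooth_differentiable[OF assms], of x]
  unfolding eq has_field_derivative_def .
qed

lemma smooth_real_comp:
 fixes g :: "real => real"
 assumes "smooth g"
 shows "smooth (%z. g (v \<bullet> z + c))" (is ?goalA) "dd e (%z. g (v \<bullet> z + c)) = (%z. (v \<bullet> e) * dd 1 g (v \<bullet> z + c))"
proof -
 define D where "D k = (dd 1 ^^ k) g" for k
 have sm: "smooth (D k)" for k
  by (induction k) (auto simp: D_def assms intro: smooth_intros)
 have "(D k has_real_derivative D (Suc k) x) (at x)" for k x
  using smooth_real_deriv[OF sm, of k x] by (simp add: D_def)
 from smooth_affine_comp(1)[of D 0 v c, OF this] smooth_affine_comp(2)[of D e 0 v c, OF this]
 show ?goalA "dd e (%z. g (v \<bullet> z + c)) = (%z. (v \<bullet> e) * dd 1 g (v \<bullet> z + c))"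
  by (simp_all add: D_def)
qed

lemma poly_exp_tendsto_0: "((%x::real. poly p x * exp (- x)) \<longlongrightarrow> 0) at_top"
proof -
 have "((%x::real. \<Sum>i\<le>degree p. coeff p i * (x ^ i / exp x)) \<longlongrightarrow> (\<Sum>i\<le>degree p. coeff p i * 0)) at_top"
  by (intro tendsto_intros tendsto_power_div_exp_0)
 moreover have "(\<Sum>i\<le>degree p. coeff p i * (x ^ i / exp x)) = poly p x * exp (- x)" for x
  unfolding poly_altdef sum_distrib_right by (intro sum.cong refl) (simp add: exp_minus divide_inverse)
 ultimately show ?thesis by simp
qed

section \<open>A smooth function that is flat at zero\<close>

definition flat_exp :: "real => real" where
 "flat_exp t = (if t <= 0 then 0 else exp (- 1 / t))"

text \<open>For positive \<open>t\<close> the derivatives are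
  \<open>poly (p k) (1 / t) * exp (- 1 / t)\<close>, where one differentiation multiplies
  \<open>p k - pderiv (p k)\<close> by the square of the variable. At 0 the difference quotients
  from the right are a polynomial times a decaying exponential in \<open>1 / t\<close> and tend to
  0.\<close>

lemma smooth_flat_exp: "smooth flat_exp"
proof -
 define p :: "nat => real poly" where "p k = rec_nat 1 (%_ q. [:0, 0, 1:] * (q - pderiv q)) k" for k
 have p: "p 0 = 1" "p (Suc k) = [:0, 0, 1:] * (p k - pderiv (p k))" for k by (simp_all add: p_def)
 define D where "D k t = (if t <= 0 then 0 else poly (p k) (1 / t) * exp (- 1 / t))" for k and t :: real
 have "(D k has_real_derivative D (Suc k) t) (at t)" for k t
 proof -
  consider "t < 0" | "t = 0" | "0 < t" by linarith
  thus ?thesis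
  proof cases
   case 1
   have "((%t. 0) has_real_derivative 0) (at t)" by simp
   hence "(D k has_real_derivative 0) (at t)"
    by (rule has_field_derivative_transform_within_open[of _ _ _ "{..<0}"]) (use 1 in \<open>auto simp: D_def\<close>)
   thus ?thesis using 1 by (simp add: D_def)
  next
   case 3
   have "((%t. poly (p k) (1 / t) * exp (- 1 / t)) has_real_derivative
     poly (p k) (1 / t) * (exp (- 1 / t) * (1 / t^2)) + poly (pderiv (p k)) (1 / t) * (- 1 / t^2) * exp (- 1 / t)) (at t)"
   proof (rule derivative_eq_intros)
    show "((%t. poly (p k) (1 / t)) has_real_derivative poly (pderiv (p k)) (1 / t) * (- 1 / t^2)) (at t)"
     by (rule DERIV_chain2[OF poly_DERIV]) (use 3 in \<open>auto intro!: derivative_eq_intros simp: power2_eq_square\<close>)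
    show "((%t. exp (- 1 / t)) has_real_derivative exp (- 1 / t) * (1 / t^2)) (at t)"
     by (rule DERIV_chain2[OF DERIV_exp]) (use 3 in \<open>auto intro!: derivative_eq_intros simp: power2_eq_square\<close>)
   qed simp
   also have "poly (p k) (1 / t) * (exp (- 1 / t) * (1 / t^2)) + poly (pderiv (p k)) (1 / t) * (- 1 / t^2) * exp (- 1 / t) = D (Suc k) t"
    using 3 by (simp add: D_def p power2_eq_square algebra_simps)
   finally have "((%t. poly (p k) (1 / t) * exp (- 1 / t)) has_real_derivative D (Suc k) t) (at t)" .
   thus ?thesis
    by (rule has_field_derivative_transform_within_open[of _ _ _ "{0<..}"]) (use 3 in \<open>auto simp: D_def\<close>)
  next
   case 2
   have "((%h. D k h / h) \<longlongrightarrow> 0) (at 0)"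
   proof (rule filterlim_split_at)
    show "((%h. D k h / h) \<longlongrightarrow> 0) (at_left 0)"
     by (rule tendsto_eventually) (auto simp: D_def eventually_at_filter)
    have "((%h::real. poly ([:0, 1:] * p k) (inverse h) * exp (- inverse h)) \<longlongrightarrow> 0) (at_right 0)"
     by (rule filterlim_compose[OF poly_exp_tendsto_0 filterlim_inverse_at_top_right])
    moreover have "\<forall>\<^sub>F h in at_right 0. poly ([:0, 1:] * p k) (inverse h) * exp (- inverse h) = D k h / h"
     unfolding eventually_at_filter by (auto simp: D_def divide_inverse)
    ultimately show "((%h. D k h / h) \<longlongrightarrow> 0) (at_right 0)"
     by (rule Lim_transform_eventually)
   qed
   thus ?thesis using 2 by (simp add: DERIV_def D_def)
  qed
 qed
 from smooth_affine_comp(1)[of D 0 "1::real" 0, OF this] have "smooth (D 0)" by simp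
 also have "D 0 = flat_exp" by (auto simp: D_def flat_exp_def p fun_eq_iff)
 finally show ?thesis .
qed

lemma flat_exp_bounds: "0 <= flat_exp t" "flat_exp t <= 1" "t <= 0 ==> flat_exp t = 0" "0 < t ==> 0 < flat_exp t"
 by (auto simp: flat_exp_def)

lemma mono_flat_exp: "s <= t ==> flat_exp s <= flat_exp t"
 by (auto simp: flat_exp_def field_simps)

lemma flat_exp_tendsto_1: "0 < t ==> (%n. flat_exp (real n * t - 1)) ----> 1"
proof -
 assume t: "0 < t"
 have l: "filterlim (%n. real n * t - 1) at_top sequentially"
 proof -
  have "filterlim (%n. - 1 + t * real n) at_top sequentially"
   by (intro filterlim_tendsto_add_at_top[OF tendsto_const] filterlim_tendsto_pos_mult_at_top[OF tendsto_const t] filterlim_real_sequentially)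
  thus ?thesis by (simp add: algebra_simps)
 qed
 hence "((%n. exp (- inverse (real n * t - 1))) ----> exp (- 0))"
  by (intro tendsto_intros filterlim_compose[OF tendsto_inverse_0_at_top[OF filterlim_ident]])
 moreover have "\<forall>\<^sub>F n in sequentially. exp (- inverse (real n * t - 1)) = flat_exp (real n * t - 1)"
  using filterlim_at_top_dense[THEN iffD1, OF l, rule_format, of 0]
  by eventually_elim (auto simp: flat_exp_def divide_inverse)
 ultimately show ?thesis by (simp add: tendsto_cong)
qed

text \<open>On space-time these functions, unlike those in \<open>test_functions half_space\<close>,
  may be nonzero at \<open>t = 0\<close>, which is how the trace becomes visible.\<close>

definition test_fun :: "('a::euclidean_space => real) => bool" where
 "test_fun phi \<longleftrightarrow> smooth phi \<and> (\<exists>R. \<forall>z. R < norm z --> phi z = 0)"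

lemma test_fun_smooth: "test_fun phi ==> smooth phi"
 by (simp add: test_fun_def)

lemma test_funE:
 assumes "test_fun phi" obtains R where "0 < R" "!!z. R < norm z ==> phi z = 0"
proof -
 from assms obtain R where "!!z. R < norm z ==> phi z = 0" by (auto simp: test_fun_def)
 thus ?thesis by (intro that[of "max R 1"]) auto
qed

lemma test_fun_bsupp:
 assumes "test_fun phi" shows "bsupp phi"
proof -
 obtain R where R: "0 < R" "!!z. R < norm z ==> phi z = 0" using test_funE[OF assms] by blast
 have c: "continuous_on UNIV phi" using assms by (intro smooth_continuous test_fun_smooth)
 hence "compact (phi ` cball 0 R)"
  by (intro compact_continuous_image) (auto intro: continuous_on_subset)
 then obtain B where B: "!!z. z \<in> cball 0 R ==> \<bar>phi z\<bar> <= B"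
  by (metis bounded_real compact_imp_bounded image_eqI)
 have "\<bar>phi z\<bar> <= max B 0" for z using B[of z] R(2)[of z] by (cases "R < norm z") (auto simp: dist_norm)
 thus ?thesis
  unfolding bsupp_def using R(2) borel_measurable_continuous_onI[OF c] by auto
qed

lemma test_fun_integrable: "test_fun phi ==> L1 phi"
 by (intro bsupp_integrable test_fun_bsupp)

lemma test_fun_add: "test_fun phi ==> test_fun psi ==> test_fun (%z. phi z + psi z)"
proof -
 assume a: "test_fun phi" "test_fun psi"
 obtain R R' where "!!z. R < norm z ==> phi z = 0" "!!z. R' < norm z ==> psi z = 0"
  using a by (metis test_funE)
 hence "\<forall>z. max R R' < norm z --> phi z + psi z = 0" by auto
 thus ?thesis using a unfolding test_fun_def by (blast intro: smooth_intros)
qed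

lemma test_fun_mult1: "test_fun phi ==> smooth psi ==> test_fun (%z. phi z * psi z)"
 unfolding test_fun_def by (metis mult_zero_left smooth_mult)

lemma test_fun_mult2: "test_fun phi ==> smooth psi ==> test_fun (%z. psi z * phi z)"
 unfolding test_fun_def by (metis mult_zero_right smooth_mult)

lemma dir_deriv_zero:
 assumes "open S" "z \<in> S" "!!z. z \<in> S ==> phi z = 0"
 shows "dd e phi z = 0"
proof -
 have "((%_. 0::real) has_derivative (%_. 0)) (at z)" by simp
 hence "(phi has_derivative (%_. 0)) (at z)"
  by (rule has_derivative_transform_within_open[OF _ assms(1,2)]) (simp add: assms(3))
 thus ?thesis by (rule dir_deriv_eq)
qed

lemma test_fun_dir_deriv: "test_fun phi ==> test_fun (dd e phi)"
proof -
 assume t: "test_fun phi"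
 obtain R where R: "!!z. R < norm z ==> phi z = 0" using test_funE[OF t] by blast
 have "open {z::'a. R < norm z}" by (intro open_Collect_less continuous_intros)
 hence "\<forall>z. R < norm z --> dd e phi z = 0" using R by (auto intro!: dir_deriv_zero)
 thus ?thesis using t unfolding test_fun_def by (blast intro: smooth_intros)
qed

lemma test_fun_bounded: "test_fun phi ==> \<exists>B>0. \<forall>z. \<bar>phi z\<bar> <= B"
 by (metis bsuppE test_fun_bsupp)

text \<open>A product over coordinates, so that smoothness does not involve the norm. The support is
  a cube, whence the dimension in \<open>bump_zero\<close>.\<close>

definition bump :: "real => 'a::euclidean_space => real" where
 "bump a x = (\<Prod>b\<in>Basis. flat_exp (1 + (x \<bullet> b) / a) * flat_exp (1 - (x \<bullet> b) / a))"

lemma bump_nonneg: "0 <= bump a x" and bump_le_1: "bump a x <= 1"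
 unfolding bump_def
 by (auto intro!: prod_nonneg prod_le_1 mult_nonneg_nonneg mult_le_one flat_exp_bounds)

lemma bump_pos:
 assumes "norm x < a" shows "0 < bump a x"
proof -
 have a: "0 < a" using assms norm_ge_zero[of x] by linarith
 have "\<bar>x \<bullet> b\<bar> < a" if "b \<in> Basis" for b using Basis_le_norm[OF that, of x] assms by linarith
 hence "\<bar>(x \<bullet> b) / a\<bar> < 1" if "b \<in> Basis" for b using that a by simp
 thus ?thesis unfolding bump_def
  by (intro prod_pos mult_pos_pos flat_exp_bounds(4)) (smt (verit, best))+
qed

lemma bump_zero:
 assumes "0 < (a::real)" "a * DIM('a) < norm x" shows "bump a (x :: 'a::euclidean_space) = 0"
proof -
 have "\<exists>b\<in>Basis. a < \<bar>x \<bullet> b\<bar>"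
 proof (rule ccontr)
  assume "\<not> ?thesis"
  hence "(\<Sum>b\<in>Basis. \<bar>x \<bullet> b\<bar>) <= (\<Sum>b\<in>(Basis::'a set). a)" by (intro sum_mono) auto
  thus False using norm_le_l1[of x] assms by (simp add: mult.commute)
 qed
 then obtain b where b: "b \<in> Basis" "1 < \<bar>(x \<bullet> b) / a\<bar>" using assms by auto
 hence "flat_exp (1 + (x \<bullet> b) / a) * flat_exp (1 - (x \<bullet> b) / a) = 0"
  by (cases "0 <= (x \<bullet> b) / a") (auto intro!: flat_exp_bounds(3))
 thus ?thesis unfolding bump_def using b by (intro prod_zero) auto
qed

lemma test_fun_bump:
 assumes "0 < a" shows "test_fun (bump a :: 'a::euclidean_space => real)"
proof -
 have "smooth (%x::'a. \<Prod>b\<in>Basis. flat_exp ((b /\<^sub>R a) \<bullet> x + 1) * flat_exp ((- b /\<^sub>R a) \<bullet> x + 1))"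
  by (intro smooth_intros smooth_real_comp smooth_flat_exp)
 moreover have "(%x::'a. \<Prod>b\<in>Basis. flat_exp ((b /\<^sub>R a) \<bullet> x + 1) * flat_exp ((- b /\<^sub>R a) \<bullet> x + 1)) = bump a"
  by (auto simp: bump_def fun_eq_iff inner_commute divide_inverse mult.commute add.commute intro!: prod.cong)
 ultimately have "smooth (bump a :: 'a => real)" by simp
 thus ?thesis unfolding test_fun_def using bump_zero[OF assms] by blast
qed

section \<open>Approximation by smooth functions\<close>

lemma polynomial_approx:
 fixes g :: "'a::euclidean_space => real"
 assumes "continuous_on UNIV g" "0 < eps"
 obtains p where "smooth p" "!!x. norm x <= R ==> \<bar>g x - p x\<bar> < eps"
proof -
 obtain p where "real_polynomial_function p" "!!x. x \<in> cball 0 R ==> \<bar>g x - p x\<bar> < eps"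
  using Stone_Weierstrass_real_polynomial_function[of "cball 0 R" g eps] assms continuous_on_subset[OF assms(1)]
  by (metis compact_cball subset_UNIV)
 thus ?thesis by (intro that[of p] smooth_polynomial) auto
qed

text \<open>Continuous approximation in \<open>L^1\<close> is followed by a polynomial approximation
  on a ball that carries \<open>phi\<close>. The bound \<open>B + 1\<close> is claimed only where
  \<open>phi\<close> is nonzero, since the polynomial grows elsewhere; under the weight
  \<open>phi\<close> this is enough, and no mollification occurs.\<close>

lemma smooth_weighted_approx:
 fixes f :: "'a::euclidean_space => real"
 assumes f[measurable]: "f \<in> Borel" and B: "!!x. \<bar>f x\<bar> <= B" and phi: "test_fun phi" and eps: "0 < eps"
 obtains w where "smooth w" "!!x. phi x \<noteq> 0 ==> \<bar>w x\<bar> <= B + 1" "(LB x. \<bar>phi x * (f x - w x)\<bar>) <= eps"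
proof -
 obtain R where R: "0 < R" "!!x. R < norm x ==> phi x = 0" using test_funE[OF phi] by blast
 obtain C where C: "0 < C" "!!x. \<bar>phi x\<bar> <= C" using test_fun_bounded[OF phi] by blast
 note phim[measurable] = bsupp_measurable[OF test_fun_bsupp[OF phi]]
 define f1 where "f1 x = indicator (cball 0 R) x * f x" for x
 have f1: "bsupp f1" "\<bar>f1 x\<bar> <= B" for x
 proof -
  show *: "\<bar>f1 x\<bar> <= B" for x using B[of x] by (auto simp: f1_def indicator_def)
  have "f1 x = 0" if "R < norm x" for x using that by (simp add: f1_def indicator_def)
  moreover have "f1 \<in> Borel" unfolding f1_def[abs_def] by (intro borel_measurable_times borel_measurable_indicator f) auto
  ultimately show "bsupp f1" using * unfolding bsupp_def by blast
 qed
 define eps1 where "eps1 = eps / (2 * C)"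
 have eps1: "0 < eps1" using eps C by (simp add: eps1_def)
 define I where "I = (LB x. \<bar>phi x\<bar>)"
 have I0: "0 <= I" by (simp add: I_def)
 define eps2 where "eps2 = min 1 (eps / (2 * (I + 1)))"
 have eps2: "0 < eps2" "eps2 <= 1" "eps2 * I <= eps / 2"
 proof -
  show "0 < eps2" "eps2 <= 1" using eps I0 by (auto simp: eps2_def)
  have "eps2 * I <= eps / (2 * (I + 1)) * I" using I0 by (intro mult_right_mono) (auto simp: eps2_def)
  also have "\<dots> <= eps / 2" using I0 eps by (simp add: field_simps)
  finally show "eps2 * I <= eps / 2" .
 qed
 obtain g where g: "continuous_on UNIV g" "bsupp g" "!!x. \<bar>g x\<bar> <= B" "(LB x. \<bar>f1 x - g x\<bar>) < eps1"
  using L1_approx_continuous[OF f1(1) eps1 f1(2)] by blast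
 obtain p where p: "smooth p" "!!x. norm x <= R ==> \<bar>g x - p x\<bar> < eps2"
  using polynomial_approx[OF g(1) eps2(1)] by blast
 note [measurable] = smooth_measurable[OF p(1)] bsupp_measurable[OF g(2)] bsupp_measurable[OF f1(1)]
 have i1: "L1 (%x. C * \<bar>f1 x - g x\<bar>)"
  using bsupp_integrable[OF bsupp_diff[OF f1(1) g(2)]] by simp
 have i2: "L1 (%x. eps2 * \<bar>phi x\<bar>)" using test_fun_integrable[OF phi] by simp
 have le: "\<bar>phi x * (f x - p x)\<bar> <= C * \<bar>f1 x - g x\<bar> + eps2 * \<bar>phi x\<bar>" for x
 proof (cases "norm x <= R")
  case True
  hence "\<bar>f x - p x\<bar> <= \<bar>f1 x - g x\<bar> + eps2" using p(2)[OF True] by (simp add: f1_def)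
  hence "\<bar>phi x\<bar> * \<bar>f x - p x\<bar> <= \<bar>phi x\<bar> * (\<bar>f1 x - g x\<bar> + eps2)" by (intro mult_left_mono) auto
  also have "\<dots> <= C * \<bar>f1 x - g x\<bar> + eps2 * \<bar>phi x\<bar>"
   using mult_right_mono[OF C(2)[of x], of "\<bar>f1 x - g x\<bar>"] by (simp add: algebra_simps)
  finally show ?thesis by (simp add: abs_mult)
 next
  case False
  thus ?thesis using R(2)[of x] C by simp
 qed
 have "(LB x. \<bar>phi x * (f x - p x)\<bar>) <= (LB x. C * \<bar>f1 x - g x\<bar> + eps2 * \<bar>phi x\<bar>)"
  using le by (intro integral_mono integrable_bound[OF integrable_add[OF i1 i2]] integrable_add i1 i2) (auto intro: order_trans[OF _ abs_ge_self])
 also have "\<dots> = C * (LB x. \<bar>f1 x - g x\<bar>) + eps2 * I"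
  using i1 i2 by (simp add: I_def)
 also have "\<dots> <= C * eps1 + eps / 2" using g(4) C eps2(3) by (intro add_mono mult_left_mono) auto
 also have "\<dots> = eps" using C by (simp add: eps1_def)
 finally have "(LB x. \<bar>phi x * (f x - p x)\<bar>) <= eps" .
 moreover have "\<bar>p x\<bar> <= B + 1" if "phi x \<noteq> 0" for x
 proof -
  have "norm x <= R" using that R(2)[of x] by force
  thus ?thesis using p(2)[of x] g(3)[of x] eps2(2) by linarith
 qed
 ultimately show ?thesis using p(1) by (intro that)
qed

text \<open>Truncate \<open>f\<close> to a bounded function on a ball and divide by a bump that is
  bounded below there. The quotient is approximated in the space weighted by the bump, and
  multiplying back yields smoothness and compact support at once.\<close>

lemma L1_approx_test_fun:
 fixes f :: "'a::euclidean_space => real"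
 assumes f: "L1 f" and eps: "0 < eps"
 obtains phi where "test_fun phi" "(LB x. \<bar>f x - phi x\<bar>) < eps"
proof -
 have fm[measurable]: "f \<in> Borel" using f by auto
 define F where "F n x = (if norm x <= real n \<and> \<bar>f x\<bar> <= real n then f x else 0)" for n x
 have Fm[measurable]: "F n \<in> Borel" for n unfolding F_def[abs_def] by measurable
 have "(%n. LB x. \<bar>f x - F n x\<bar>) ----> (LB x::'a. 0)"
 proof (rule integral_dominated_convergence[where w="%x. \<bar>f x\<bar>"])
  show "AE x in lborel. (%n. \<bar>f x - F n x\<bar>) ----> 0"
  proof (intro AE_I2 tendsto_eventually)
   fix x
   obtain N :: nat where "max (norm x) \<bar>f x\<bar> <= real N" using real_arch_simple by blast
   thus "\<forall>\<^sub>F n in sequentially. \<bar>f x - F n x\<bar> = 0"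
    unfolding eventually_sequentially by (intro exI[of _ N]) (auto simp: F_def)
  qed
 qed (use f in \<open>auto simp: F_def\<close>)
 hence "(%n. LB x. \<bar>f x - F n x\<bar>) ----> 0" by simp
 from LIMSEQ_D[OF this, of "eps / 4"] eps obtain n where n: "(LB x. \<bar>f x - F n x\<bar>) < eps / 4" by fastforce
 have Fs: "bsupp (F n)" unfolding bsupp_def
  by (intro conjI Fm exI[of _ "real n"]) (auto simp: F_def)
 have FB: "\<bar>F n x\<bar> <= real n" for x by (auto simp: F_def)
 define a where "a = real n + 1"
 have a: "0 < a" by (simp add: a_def)
 let ?phi = "bump a :: 'a => real"
 have "\<exists>c>0. \<forall>x\<in>cball 0 (real n). c <= ?phi x"
 proof -
  have "continuous_on (cball 0 (real n)) ?phi"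
   using smooth_continuous[OF test_fun_smooth[OF test_fun_bump[OF a]]] continuous_on_subset by blast
  from continuous_attains_inf[OF compact_cball _ this] obtain y where "y \<in> cball 0 (real n)" "\<forall>x\<in>cball 0 (real n). ?phi y <= ?phi x"
   by force
  thus ?thesis by (intro exI[of _ "?phi y"]) (auto intro!: bump_pos simp: a_def)
 qed
 then obtain c where c: "0 < c" "!!x. norm x <= real n ==> c <= ?phi x" by (auto simp: dist_norm)
 define G where "G x = F n x / max (?phi x) c" for x
 note bm[measurable] = bsupp_measurable[OF test_fun_bsupp[OF test_fun_bump[OF a]]]
 have Gm: "G \<in> Borel" unfolding G_def[abs_def] by measurable
 have GB: "\<bar>G x\<bar> <= real n / c" for x
  unfolding G_def abs_divide using c FB[of x] by (intro frac_le) auto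
 obtain w where w: "smooth w" "(LB x. \<bar>?phi x * (G x - w x)\<bar>) <= eps / 4"
  using smooth_weighted_approx[OF Gm GB test_fun_bump[OF a], of "eps / 4"] eps by (metis divide_pos_pos zero_less_numeral)
 have pG: "?phi x * G x = F n x" for x
 proof (cases "norm x <= real n")
  case True thus ?thesis using c(1) c(2)[of x] by (simp add: G_def)
 next
  case False thus ?thesis by (simp add: G_def F_def)
 qed
 have tf: "test_fun (%x. ?phi x * w x)" by (intro test_fun_mult1 test_fun_bump a w)
 have i: "L1 (%x. \<bar>F n x - ?phi x * w x\<bar>)" "L1 (%x. \<bar>f x - F n x\<bar>)" "L1 (%x. \<bar>f x - ?phi x * w x\<bar>)"
  using f bsupp_integrable[OF Fs] test_fun_integrable[OF tf] by auto
 have "(LB x. \<bar>f x - ?phi x * w x\<bar>) <= (LB x. \<bar>f x - F n x\<bar> + \<bar>F n x - ?phi x * w x\<bar>)"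
  using i by (intro integral_mono) auto
 also have "\<dots> = (LB x. \<bar>f x - F n x\<bar>) + (LB x. \<bar>F n x - ?phi x * w x\<bar>)" using i by simp
 also have "(%x. \<bar>F n x - ?phi x * w x\<bar>) = (%x. \<bar>?phi x * (G x - w x)\<bar>)"
  by (simp add: pG[symmetric] algebra_simps)
 finally have "(LB x. \<bar>f x - ?phi x * w x\<bar>) < eps" using n w(2) eps by linarith
 thus ?thesis using tf by (intro that)
qed

section \<open>Integration by parts and essential limits\<close>

lemma difference_quotient_bound:
 fixes g :: "'a::euclidean_space => real"
 assumes "smooth g" "!!z. \<bar>dd e g z\<bar> <= C" "0 < h"
 shows "\<bar>(g (z + h *\<^sub>R e) - g z) / h\<bar> <= C"
proof -
 have hd: "((%s. g (z + s *\<^sub>R e)) has_real_derivative dd e g (z + s *\<^sub>R e)) (at s)" for s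
 proof -
  have l: "linear (%e. dd e g (z + s *\<^sub>R e'))" for e' by (intro dir_deriv_linear smooth_differentiable assms)
  have "((%s. z + s *\<^sub>R e) has_derivative (%r. r *\<^sub>R e)) (at s)" by (auto intro!: derivative_eq_intros)
  from has_derivative_compose[OF this has_derivative_dir_deriv[OF smooth_differentiable[OF assms(1)]]]
  have "((%s. g (z + s *\<^sub>R e)) has_derivative (%r. dd (r *\<^sub>R e) g (z + s *\<^sub>R e))) (at s)" by simp
  moreover have "(%r. dd (r *\<^sub>R e) g (z + s *\<^sub>R e)) = (*) (dd e g (z + s *\<^sub>R e))"
   by (intro ext) (simp only: linear_scale[OF l] real_scaleR_def mult.commute)
  ultimately show ?thesis by (simp add: has_field_derivative_def)
 qed
 obtain s where "g (z + h *\<^sub>R e) - g (z + 0 *\<^sub>R e) = (h - 0) * dd e g (z + s *\<^sub>R e)"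
  using MVT2[of 0 h "%s. g (z + s *\<^sub>R e)" "%s. dd e g (z + s *\<^sub>R e)"] hd assms(3) by blast
 thus ?thesis using assms by simp
qed

lemma dir_deriv_LIMSEQ:
 fixes g :: "'a::euclidean_space => real"
 assumes "smooth g"
 shows "(%n. (g (z + (1 / real (Suc n)) *\<^sub>R e) - g z) / (1 / real (Suc n))) ----> dd e g z"
proof -
 have l: "linear (%e. dd e g z)" by (intro dir_deriv_linear smooth_differentiable assms)
 have "((%s. z + s *\<^sub>R e) has_derivative (%r. r *\<^sub>R e)) (at 0)" by (auto intro!: derivative_eq_intros)
 from has_derivative_compose[OF this, of g "%e. dd e g z"] has_derivative_dir_deriv[OF smooth_differentiable[OF assms(1)], of z]
 have "((%s. g (z + s *\<^sub>R e)) has_derivative (%r. dd (r *\<^sub>R e) g z)) (at 0)" by simp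
 moreover have "(%r. dd (r *\<^sub>R e) g z) = (*) (dd e g z)"
  by (intro ext) (simp only: linear_scale[OF l] real_scaleR_def mult.commute)
 ultimately have "((%s. g (z + s *\<^sub>R e)) has_real_derivative dd e g z) (at 0)" by (simp add: has_field_derivative_def)
 hence "((%h. (g (z + h *\<^sub>R e) - g z) / h) \<longlongrightarrow> dd e g z) (at 0)"
  by (simp add: DERIV_def)
 moreover have "filterlim (%n. 1 / real (Suc n)) (at 0) sequentially"
  using lim_1_over_n[THEN LIMSEQ_Suc] by (intro filterlim_atI) (auto simp: always_eventually)
 ultimately show ?thesis by (rule filterlim_compose)
qed

text \<open>Translation along \<open>e\<close> preserves both Lebesgue measure and \<open>S\<close>,
  so every difference quotient of \<open>g\<close> in this direction has integral zero over
  \<open>S\<close>, and the limit passes under the integral. This is integration by parts for the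
  tangential directions of the half space.\<close>

lemma integral_dir_deriv_invariant:
 fixes g :: "'a::euclidean_space => real" and S :: "'a set"
 assumes g: "test_fun g" and S[measurable]: "S \<in> sets borel" and inv: "!!z s. z + s *\<^sub>R e \<in> S \<longleftrightarrow> z \<in> S"
 shows "(LB z. indicator S z * dd e g z) = 0"
proof -
 have sm: "smooth g" using g by (rule test_fun_smooth)
 have tg: "test_fun (dd e g)" by (rule test_fun_dir_deriv[OF g])
 obtain C where C: "0 < C" "!!z. \<bar>dd e g z\<bar> <= C" using test_fun_bounded[OF tg] by blast
 obtain R where R: "0 < R" "!!z. R < norm z ==> g z = 0" using test_funE[OF g] by blast
 note [measurable] = bsupp_measurable[OF test_fun_bsupp[OF g]] bsupp_measurable[OF test_fun_bsupp[OF tg]]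
 let ?h = "%n. 1 / real (Suc n)"
 have int: "L1 (%x::'a. C * indicator (cball 0 (R + norm e)) x)"
  by (intro integrable_mult_right integrable_real_indicator emeasure_bounded_finite) auto
 have "(%n. LB z. indicator S z * ((g (z + ?h n *\<^sub>R e) - g z) / ?h n)) ----> (LB z. indicator S z * dd e g z)"
 proof (rule integral_dominated_convergence[OF _ _ int])
  show "AE z in lborel. (%n. indicator S z * ((g (z + ?h n *\<^sub>R e) - g z) / ?h n)) ----> indicator S z * dd e g z"
   by (intro AE_I2 tendsto_mult tendsto_const dir_deriv_LIMSEQ sm)
  show "AE z in lborel. norm (indicator S z * ((g (z + ?h n *\<^sub>R e) - g z) / ?h n)) <= C * indicator (cball 0 (R + norm e)) z" for n
  proof (intro AE_I2)
   fix z
   show "norm (indicator S z * ((g (z + ?h n *\<^sub>R e) - g z) / ?h n)) <= C * indicator (cball 0 (R + norm e)) z"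
   proof (cases "norm z <= R + norm e")
    case True
    have "norm (indicator S z * ((g (z + ?h n *\<^sub>R e) - g z) / ?h n)) <= 1 * \<bar>(g (z + ?h n *\<^sub>R e) - g z) / ?h n\<bar>"
     unfolding real_norm_def abs_mult[of "indicator S z"] by (intro mult_right_mono) (auto simp: indicator_def)
    also have "\<dots> <= C" using difference_quotient_bound[OF sm C(2), of "?h n" z] by simp
    finally show ?thesis using True by (simp add: indicator_def)
   next
    case False
    have "norm z <= norm (z + ?h n *\<^sub>R e) + norm (?h n *\<^sub>R e)"
     using norm_triangle_ineq4[of "z + ?h n *\<^sub>R e" "?h n *\<^sub>R e"] by simp
    moreover have "norm (?h n *\<^sub>R e) <= 1 * norm e" unfolding norm_scaleR by (intro mult_right_mono) auto
    ultimately have "R < norm (z + ?h n *\<^sub>R e)" "R < norm z" using False norm_ge_zero[of e] by linarith+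
    thus ?thesis using R C by (simp add: indicator_def)
   qed
  qed
 qed measurable
 moreover have "(LB z. indicator S z * ((g (z + ?h n *\<^sub>R e) - g z) / ?h n)) = 0" for n
 proof -
  have bs: "bsupp (%z. g z * indicator S z)"
   by (rule bsupp_mult[where C=1, OF test_fun_bsupp[OF g]]) (auto simp: indicator_def)
  have eq: "g (z + ?h n *\<^sub>R e) * indicator S (z + ?h n *\<^sub>R e) = g (z + ?h n *\<^sub>R e) * indicator S z" for z
   using inv[of z "?h n"] by (simp add: indicator_def)
  have "(LB z. g (z + ?h n *\<^sub>R e) * indicator S z) = (LB z. g z * indicator S z)"
   using lborel_integral_translate[OF bsupp_measurable[OF bs], of "?h n *\<^sub>R e"] unfolding eq .
  moreover have "L1 (%z. g (z + ?h n *\<^sub>R e) * indicator S z)"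
   using bsupp_integrable[OF bsupp_translate[OF bs, of "?h n *\<^sub>R e"]] unfolding eq .
  ultimately have "(LB z. g (z + ?h n *\<^sub>R e) * indicator S z - g z * indicator S z) = 0"
   using bsupp_integrable[OF bs] by simp
  hence "real (Suc n) * (LB z. g (z + ?h n *\<^sub>R e) * indicator S z - g z * indicator S z) = 0" by simp
  thus ?thesis
   unfolding integral_mult_right_zero[symmetric] by (simp add: algebra_simps)
 qed
 ultimately show ?thesis by (simp add: LIMSEQ_const_iff)
qed

lemma half_space_measurable [measurable]: "{z :: real \<times> 'a::euclidean_space. 0 < fst z} \<in> sets borel"
 by (intro borel_open open_Collect_less continuous_intros)

lemma half_space_eq: "half_space = {z. 0 < fst z}"
 by (auto simp: half_space_def)

lemma half_space_borel [measurable]: "half_space \<in> sets borel"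
 unfolding half_space_eq by measurable

lemma integral_dir_deriv_x:
 fixes g :: "real \<times> 'a::euclidean_space => real"
 assumes "test_fun g"
 shows "(LB z. hs z * dd (0, y) g z) = 0"
 by (rule integral_dir_deriv_invariant[OF assms half_space_borel]) (auto simp: half_space_eq)

lemma lborel_integral_prod:
 fixes f :: "real \<times> 'a::euclidean_space => real"
 assumes "L1 f"
 shows "(LB z. f z) = (LB x. LB t. f (t, x))" (is ?goalA)
  and "(LB z. f z) = (LB t. LB x. f (t, x))"
proof -
 have i: "integrable (lborel \<Otimes>\<^sub>M lborel) (%(t, x). f (t, x))" using assms by (simp add: lborel_prod)
 show ?goalA
  "(LB z. f z) = (LB t. LB x. f (t, x))"
  using lborel_pair.integral_snd[OF i] lborel_pair.integral_fst[OF i] by (simp_all add: lborel_prod)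
qed

lemma test_fun_slice_t:
 fixes g :: "real \<times> 'a::euclidean_space => real"
 assumes "smooth g"
 shows "((%t. g (t, x)) has_real_derivative dd (1, 0) g (t, x)) (at t)"
proof -
 have l: "linear (%e. dd e g (t, x))" by (intro dir_deriv_linear smooth_differentiable assms)
 have "((%t. (t, x)) has_derivative (%r. (r, 0))) (at t)" by (auto intro!: derivative_eq_intros)
 from has_derivative_compose[OF this has_derivative_dir_deriv[OF smooth_differentiable[OF assms(1)]]]
 have "((%t. g (t, x)) has_derivative (%r. dd (r, 0) g (t, x))) (at t)" .
 moreover have "dd (r, 0) g (t, x) = dd (1, 0) g (t, x) * r" for r
  using linear_scale[OF l, of r "(1, 0)"]
  by (simp only: scaleR_Pair real_scaleR_def mult_1_right scaleR_zero_right mult.commute[of r])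
 hence "(%r. dd (r, 0) g (t, x)) = (*) (dd (1, 0) g (t, x))" by (intro ext)
 ultimately show ?thesis by (simp only: has_field_derivative_def)
qed

lemma integral_dir_deriv_t:
 fixes g :: "real \<times> 'a::euclidean_space => real"
 assumes g: "test_fun g"
 shows "(LB z. hs z * dd (1, 0) g z) = - (LB x. g (0, x))"
proof -
 have sm: "smooth g" using g by (rule test_fun_smooth)
 have tg: "test_fun (dd (1, 0) g)" by (rule test_fun_dir_deriv[OF g])
 obtain R where R: "0 < R" "!!z. R < norm z ==> g z = 0" "!!z. R < norm z ==> dd (1, 0) g z = 0"
 proof -
  obtain R1 where "0 < R1" "!!z. R1 < norm z ==> g z = 0" using test_funE[OF g] by blast
  moreover obtain R2 where "!!z. R2 < norm z ==> dd (1, 0) g z = 0" using test_funE[OF tg] by blast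
  ultimately show ?thesis by (intro that[of "max R1 R2"]) auto
 qed
 have i: "L1 (%z. hs z * dd (1, 0) g z)"
  using bsupp_integrable[OF bsupp_mult[where C=1 and g="hs", OF test_fun_bsupp[OF tg]]]
  by (auto simp: mult.commute indicator_def)
 have "(LB t. hs (t, x) * dd (1, 0) g (t, x)) = - g (0, x)" for x
 proof -
  have n: "\<bar>t\<bar> <= norm (t, x)" for t using norm_fst_le[of t x] by simp
  have "AE t in lborel. t \<noteq> (0::real)" by (rule AE_lborel_singleton)
  hence "(LB t. hs (t, x) * dd (1, 0) g (t, x)) = (LB t. dd (1, 0) g (t, x) * indicator {0..R + 1} t)"
  proof (intro integral_cong_AE)
   have [measurable]: "dd (1, 0) g \<in> Borel" by (rule bsupp_measurable[OF test_fun_bsupp[OF tg]])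
   have *: "(%t. (t, x)) \<in> borel \<rightarrow>\<^sub>M borel" by (intro borel_measurable_continuous_onI continuous_intros)
   show "(%t. hs (t, x) * dd (1, 0) g (t, x)) \<in> borel_measurable lborel"
    by (simp add: half_space_eq measurable_compose[OF *])
   show "(%t. dd (1, 0) g (t, x) * indicator {0..R + 1} t) \<in> borel_measurable lborel"
    by (intro borel_measurable_times borel_measurable_indicator) (auto intro: measurable_compose[OF *])
  next
   show "AE t in lborel. hs (t, x) * dd (1, 0) g (t, x) = dd (1, 0) g (t, x) * indicator {0..R + 1} t"
    using \<open>AE t in lborel. t \<noteq> (0::real)\<close>
   proof eventually_elim
    case (elim t)
    show ?case
    proof (cases "R + 1 < t")
     case True
     hence "R < norm (t, x)" using n[of t] by linarith
     thus ?thesis using R(3) by simp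
    next
     case False thus ?thesis using elim by (auto simp: half_space_eq indicator_def)
    qed
   qed
  qed
  also have "\<dots> = g (R + 1, x) - g (0, x)"
  proof (rule integral_FTC_Icc_real)
   show "isCont (%t. dd (1, 0) g (t, x)) t" for t
   proof -
    have "continuous_on UNIV (%t. dd (1, 0) g (t, x))"
     by (rule continuous_on_compose2[OF smooth_continuous[OF test_fun_smooth[OF tg]]]) (auto intro!: continuous_intros)
    thus ?thesis by (simp add: continuous_on_eq_continuous_at)
   qed
  qed (use R test_fun_slice_t[OF sm] in auto)
  also have "g (R + 1, x) = 0" using R(1) n[of "R + 1"] by (intro R(2)) linarith
  finally show ?thesis by simp
 qed
 thus ?thesis using lborel_integral_prod(1)[OF i] by simp
qed

section \<open>Essential limits at time zero\<close>

definition ess_lim0 :: "(real => real) => real => bool" where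
 "ess_lim0 m L \<longleftrightarrow> (\<forall>eps>0. \<exists>dl>0. AE t in lborel. 0 < t \<and> t < dl --> \<bar>m t - L\<bar> < eps)"

lemma ess_lim0_const: "ess_lim0 (%t. c) c"
 by (auto simp: ess_lim0_def intro: exI[of _ 1])

lemma ess_lim0_tendsto: "(m \<longlongrightarrow> L) (at_right 0) ==> ess_lim0 m L"
 unfolding ess_lim0_def
proof (intro allI impI)
 fix eps :: real assume "(m \<longlongrightarrow> L) (at_right 0)" "0 < eps"
 hence "\<forall>\<^sub>F t in at_right 0. \<bar>m t - L\<bar> < eps" by (simp add: tendsto_iff dist_real_def)
 thus "\<exists>dl>0. AE t in lborel. 0 < t \<and> t < dl --> \<bar>m t - L\<bar> < eps"
  unfolding eventually_at_right_field by auto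
qed

lemma ess_lim0_add:
 assumes "ess_lim0 m L" "ess_lim0 n K" shows "ess_lim0 (%t. m t + n t) (L + K)"
 unfolding ess_lim0_def
proof (intro allI impI)
 fix eps :: real assume "0 < eps"
 hence e: "0 < eps / 2" by simp
 obtain d1 where d1: "0 < d1" "AE t in lborel. 0 < t \<and> t < d1 --> \<bar>m t - L\<bar> < eps / 2" using assms(1) e unfolding ess_lim0_def by blast
 obtain d2 where d2: "0 < d2" "AE t in lborel. 0 < t \<and> t < d2 --> \<bar>n t - K\<bar> < eps / 2" using assms(2) e unfolding ess_lim0_def by blast
 have "AE t in lborel. 0 < t \<and> t < min d1 d2 --> \<bar>m t + n t - (L + K)\<bar> < eps"
  using d1(2) d2(2) by eventually_elim (smt (verit) field_sum_of_halves)
 thus "\<exists>dl>0. AE t in lborel. 0 < t \<and> t < dl --> \<bar>m t + n t - (L + K)\<bar> < eps"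
  using d1(1) d2(1) by (intro exI[of _ "min d1 d2"]) auto
qed

lemma ess_lim0_cmult:
 assumes "ess_lim0 m L" shows "ess_lim0 (%t. c * m t) (c * L)"
 unfolding ess_lim0_def
proof (intro allI impI)
 fix eps :: real assume "0 < eps"
 hence e: "0 < eps / (\<bar>c\<bar> + 1)" by simp
 obtain d1 where d1: "0 < d1" "AE t in lborel. 0 < t \<and> t < d1 --> \<bar>m t - L\<bar> < eps / (\<bar>c\<bar> + 1)" using assms e unfolding ess_lim0_def by blast
 have cx: "\<bar>c * x - c * L\<bar> < eps" if "\<bar>x - L\<bar> < eps / (\<bar>c\<bar> + 1)" for x
 proof -
  have "\<bar>c * x - c * L\<bar> <= (\<bar>c\<bar> + 1) * \<bar>x - L\<bar>"
   by (simp add: right_diff_distrib[symmetric] abs_mult distrib_right)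
  also have "\<dots> < eps" using that by (simp add: field_simps)
  finally show ?thesis .
 qed
 have "AE t in lborel. 0 < t \<and> t < d1 --> \<bar>c * m t - c * L\<bar> < eps"
  using d1(2) by eventually_elim (blast intro: cx)
 thus "\<exists>dl>0. AE t in lborel. 0 < t \<and> t < dl --> \<bar>c * m t - c * L\<bar> < eps"
  using d1(1) by blast
qed

lemma ess_lim0_diff: "ess_lim0 m L ==> ess_lim0 n K ==> ess_lim0 (%t. m t - n t) (L - K)"
 using ess_lim0_add[OF _ ess_lim0_cmult[of n K "-1"]] by simp

lemma ess_lim0_sum: "(!!i. i \<in> I ==> ess_lim0 (m i) (L i)) ==> ess_lim0 (%t. \<Sum>i\<in>I. m i t) (\<Sum>i\<in>I. L i)"
 by (induction I rule: infinite_finite_induct) (auto intro: ess_lim0_add ess_lim0_const)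

lemma AE_interval_exists:
 assumes "AE t in lborel. 0 < t \<and> t < dl --> P t" "0 < (dl::real)"
 obtains t where "0 < t" "t < dl" "P t"
proof (rule ccontr)
 assume "\<not> thesis"
 hence "AE t in lborel. t \<notin> {0<..<dl}" using assms(1) that by (auto elim!: AE_mp)
 hence "{0<..<dl} \<in> null_sets lborel" by (subst AE_iff_null_sets) auto
 thus False using assms(2) by (simp add: null_sets_def)
qed

lemma ess_lim0_le:
 assumes "ess_lim0 m L" "ess_lim0 n K" "AE t in lborel. 0 < t --> m t <= n t" shows "L <= K"
proof (rule field_le_epsilon)
 fix eps :: real assume "0 < eps"
 then obtain d where d: "0 < d" "AE t in lborel. 0 < t \<and> t < d --> \<bar>n t - m t - (K - L)\<bar> < eps"
  using ess_lim0_diff[OF assms(2,1)] unfolding ess_lim0_def by blast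
 hence "AE t in lborel. 0 < t \<and> t < d --> \<bar>n t - m t - (K - L)\<bar> < eps \<and> m t <= n t"
  using assms(3) by eventually_elim auto
 from AE_interval_exists[OF this d(1)] obtain t where "\<bar>n t - m t - (K - L)\<bar> < eps" "m t <= n t" by blast
 thus "L <= K + eps" by linarith
qed

lemma ess_lim0_unique: "ess_lim0 m L ==> ess_lim0 m K ==> L = K"
 using ess_lim0_le[of m L m K] ess_lim0_le[of m K m L] by auto

text \<open>The constant \<open>c\<close> may vary with \<open>eps\<close>. Times at which two of
  the almost everywhere estimates hold together show that the constants form a Cauchy
  sequence.\<close>

lemma ess_lim0_Cauchy:
 assumes "!!eps. 0 < eps ==> \<exists>dl>0. \<exists>c. AE t in lborel. 0 < t \<and> t < dl --> \<bar>m t - c\<bar> <= eps"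
 shows "\<exists>L. ess_lim0 m L"
proof -
 have "\<forall>n::nat. \<exists>dl c. 0 < dl \<and> (AE t in lborel. 0 < t \<and> t < dl --> \<bar>m t - c\<bar> <= 1 / real (Suc n))"
 proof
  fix n :: nat
  have "0 < 1 / real (Suc n)" by simp
  from assms[OF this] show "\<exists>dl c. 0 < dl \<and> (AE t in lborel. 0 < t \<and> t < dl --> \<bar>m t - c\<bar> <= 1 / real (Suc n))" by blast
 qed
 from choice[OF this] obtain dl where "\<forall>n. \<exists>c. 0 < dl n \<and> (AE t in lborel. 0 < t \<and> t < dl n --> \<bar>m t - c\<bar> <= 1 / real (Suc n))" ..
 from choice[OF this] obtain c where dc0: "\<forall>n. 0 < dl n \<and> (AE t in lborel. 0 < t \<and> t < dl n --> \<bar>m t - c n\<bar> <= 1 / real (Suc n))" ..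
 have dc: "0 < dl n" "AE t in lborel. 0 < t \<and> t < dl n --> \<bar>m t - c n\<bar> <= 1 / real (Suc n)" for n
  using dc0 by blast+
 have cc: "\<bar>c n - c k\<bar> <= 1 / real (Suc n) + 1 / real (Suc k)" for n k
 proof -
  have "AE t in lborel. 0 < t \<and> t < min (dl n) (dl k) --> \<bar>m t - c n\<bar> <= 1 / real (Suc n) \<and> \<bar>m t - c k\<bar> <= 1 / real (Suc k)"
   using dc(2)[of n] dc(2)[of k] by eventually_elim auto
  moreover have "0 < min (dl n) (dl k)" using dc(1)[of n] dc(1)[of k] by simp
  ultimately obtain t where "\<bar>m t - c n\<bar> <= 1 / real (Suc n)" "\<bar>m t - c k\<bar> <= 1 / real (Suc k)"
   by (rule AE_interval_exists) blast
  thus ?thesis by linarith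
 qed
 have l0: "(%n. 1 / real (Suc n)) ----> 0" by (rule lim_1_over_n[THEN LIMSEQ_Suc])
 have "Cauchy c"
 proof (rule metric_CauchyI)
  fix e :: real assume "0 < e"
  then obtain M where M: "1 / real (Suc M) < e / 2" using reals_Archimedean[of "e / 2"] by (auto simp: inverse_eq_divide)
  have "1 / real (Suc n) <= 1 / real (Suc M)" if "M <= n" for n using that by (simp add: frac_le)
  hence "dist (c n) (c k) < e" if "M <= n" "M <= k" for n k
   using cc[of n k] M that by (smt (verit, best) dist_real_def field_sum_of_halves)
  thus "\<exists>M. \<forall>m\<ge>M. \<forall>n\<ge>M. dist (c m) (c n) < e" by blast
 qed
 then obtain L where L: "c ----> L" by (metis Cauchy_convergent_iff convergent_def)
 have "ess_lim0 m L" unfolding ess_lim0_def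
 proof (intro allI impI)
  fix eps :: real assume e: "0 < eps"
  have "\<forall>\<^sub>F n in sequentially. \<bar>c n - L\<bar> < eps / 2" using tendstoD[OF L half_gt_zero[OF e]] by (simp only: dist_real_def)
  moreover have "\<forall>\<^sub>F n in sequentially. 1 / real (Suc n) < eps / 2" by (rule order_tendstoD(2)[OF l0 half_gt_zero[OF e]])
  ultimately have "\<forall>\<^sub>F n in sequentially. \<bar>c n - L\<bar> < eps / 2 \<and> 1 / real (Suc n) < eps / 2" by eventually_elim auto
  then obtain n where n: "\<bar>c n - L\<bar> < eps / 2" "1 / real (Suc n) < eps / 2" unfolding eventually_sequentially by blast
  have "AE t in lborel. 0 < t \<and> t < dl n --> \<bar>m t - L\<bar> < eps"
   using dc(2)[of n] by eventually_elim (use n in \<open>smt (verit) field_sum_of_halves\<close>)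
  thus "\<exists>dl>0. AE t in lborel. 0 < t \<and> t < dl --> \<bar>m t - L\<bar> < eps" using dc(1) by blast
 qed
 thus ?thesis by blast
qed

section \<open>Functions of time whose derivative is a small measure\<close>

lemma smooth_antiderivative:
 fixes G g :: "real => real"
 assumes G: "!!x. (G has_real_derivative g x) (at x)" and g: "smooth g"
 shows "smooth G" "dd 1 G = g"
proof -
 have hd: "(G has_derivative (*) (g x)) (at x)" for x using G by (simp add: has_field_derivative_def)
 show d: "dd 1 G = g" by (rule ext) (simp add: dir_deriv_eq[OF hd])
 have "Ck k G" for k
 proof (cases k)
  case 0
  have "isCont G x" for x using G DERIV_isCont by blast
  thus ?thesis using 0 by (simp add: continuous_on_eq_continuous_at)
 next
  case (Suc n)
  thus ?thesis using g d hd by (auto simp: smooth_def differentiable_def)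
 qed
 thus "smooth G" by (simp add: smooth_def)
qed

text \<open>Vanishing mean is what makes the primitive return to zero. This links
  \<open>deriv_bound\<close>, which tests against derivatives of test functions, with testing
  against arbitrary smooth densities of mean zero; the \<open>L^1\<close> norm of the density bounds
  the sup norm of the primitive.\<close>

lemma test_fun_antiderivative:
 fixes rho :: "real => real"
 assumes rho: "smooth rho" and supp: "!!t. rho t \<noteq> 0 ==> a <= t \<and> t <= b" and ab: "a <= b" and int: "(LB t. rho t) = 0"
 obtains th where "test_fun th" "dd 1 th = rho" "!!t. th t \<noteq> 0 ==> a <= t \<and> t <= b" "!!t. \<bar>th t\<bar> <= (LB t. \<bar>rho t\<bar>)"
proof -
 have tf: "test_fun rho" unfolding test_fun_def
 proof (intro conjI rho exI[of _ "max \<bar>a\<bar> \<bar>b\<bar>"] allI impI)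
  fix z :: real assume "max \<bar>a\<bar> \<bar>b\<bar> < norm z" thus "rho z = 0" using supp[of z] by force
 qed
 have cont: "continuous_on UNIV rho" by (rule smooth_continuous[OF rho])
 have ic: "isCont rho t" for t using cont by (simp add: continuous_on_eq_continuous_at)
 obtain G where G: "!!x. (G has_real_derivative rho x) (at x)"
  using einterval_antiderivative[of "-\<infinity>" "\<infinity>" rho] ic by (auto simp: has_real_derivative_iff_has_vector_derivative)
 define th where "th t = G t - G a" for t
 have d: "(th has_real_derivative rho x) (at x)" for x
  unfolding th_def[abs_def] using G by (auto intro!: derivative_eq_intros)
 have F: "(LB x. rho x * indicator {s..t} x) = th t - th s" if "s <= t" for s t
  by (rule integral_FTC_Icc_real[OF that d ic])
 have tha: "th a = 0" by (simp add: th_def)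
 note rhoi = test_fun_integrable[OF tf]
 have AEa: "AE x in lborel. x \<noteq> a" by (rule AE_lborel_singleton)
 have left: "th t = 0" if "t < a" for t
 proof -
  have "(LB x. rho x * indicator {t..a} x) = (LB x::real. 0)"
  proof (rule integral_cong_AE)
   show "AE x in lborel. rho x * indicator {t..a} x = 0"
    using AEa by eventually_elim (use supp in \<open>force simp: indicator_def\<close>)
  qed (use rhoi in auto)
  thus ?thesis using F[of t a] that tha by simp
 qed
 have mid: "th t = (LB x. rho x * indicator {a..t} x)" if "a <= t" for t
  using F[OF that] tha by simp
 have right: "th t = 0" if "b < t" for t
 proof -
  have eq: "rho x * indicator {a..t} x = rho x" for x using supp[of x] that by (auto simp: indicator_def)
  show ?thesis using mid[of t] that ab unfolding eq int by simp
 qed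
 have "\<bar>th t\<bar> <= (LB t. \<bar>rho t\<bar>)" for t
 proof (cases "a <= t")
  case True
  have "\<bar>LB x. rho x * indicator {a..t} x\<bar> <= (LB t. \<bar>rho t\<bar>)"
   using rhoi by (intro integral_abs_bound_integral integrable_mult_indicator[of "{a..t}" lborel rho, simplified mult.commute real_scaleR_def] integrable_abs) (auto simp: indicator_def)
  thus ?thesis using mid[OF True] by simp
 next
  case False thus ?thesis using left[of t] by simp
 qed
 moreover have suppth: "a <= t \<and> t <= b" if "th t \<noteq> 0" for t
  using left[of t] right[of t] that by fastforce
 moreover have "test_fun th" unfolding test_fun_def
 proof (intro conjI smooth_antiderivative(1)[OF d rho] exI[of _ "max \<bar>a\<bar> \<bar>b\<bar>"] allI impI)
  fix z :: real assume "max \<bar>a\<bar> \<bar>b\<bar> < norm z" thus "th z = 0" using suppth[of z] by force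
 qed
 ultimately show ?thesis using smooth_antiderivative(2)[OF d rho] by (intro that)
qed

text \<open>Smallness of the distributional derivative as a measure on \<open>(0,dl)\<close>: the constant \<open>K\<close>
 plays the role of its total variation.\<close>

definition deriv_bound :: "(real => real) => real => real => bool" where
 "deriv_bound m dl K \<longleftrightarrow> (\<forall>th a b S. test_fun th --> 0 < a --> b < dl --> (\<forall>t. th t \<noteq> 0 --> a <= t \<and> t <= b) -->
   (\<forall>t. \<bar>th t\<bar> <= S) --> \<bar>LB t. dd 1 th t * m t\<bar> <= K * S)"

text \<open>Test with the primitive of the difference of the uniform densities on \<open>A\<close>
  and \<open>B\<close>. This difference has mean zero and \<open>L^1\<close> norm at most 2, so the
  primitive is bounded by 2, whereas its pairing with \<open>m\<close> is at least
  \<open>al - beta\<close>. The rest of the proof makes the density smooth while keeping mean zero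
  and a support inside the open interval.\<close>

lemma deriv_bound_gap:
 fixes m :: "real => real"
 assumes m[measurable]: "m \<in> Borel" and C: "!!t. \<bar>m t\<bar> <= C" and K: "deriv_bound m dl K" "0 <= K" and dl: "0 < dl"
  and A[measurable]: "A \<in> sets borel" "A \<subseteq> {0<..<dl}" "0 < measure lborel A" "!!t. t \<in> A ==> al <= m t"
  and B[measurable]: "B \<in> sets borel" "B \<subseteq> {0<..<dl}" "0 < measure lborel B" "!!t. t \<in> B ==> m t <= beta"
 shows "al - beta <= 2 * K"
proof -
 let ?t1 = "%a. {0..a} \<union> {dl - a..dl}"
 have C0: "0 <= C" using C[of 0] by linarith
 have mi: "L1 (%t. f t * m t)" if f: "L1 f" for f :: "real => real"
 proof (rule integrable_bound)
  show "L1 (%t. C * f t)" using f by simp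
  show "(%t. f t * m t) \<in> borel_measurable lborel" using f by (intro borel_measurable_times) auto
  have "\<bar>f t\<bar> * \<bar>m t\<bar> <= \<bar>f t\<bar> * C" for t using C by (intro mult_left_mono) auto
  thus "AE t in lborel. norm (f t * m t) <= norm (C * f t)"
   using C0 by (intro AE_I2) (simp add: abs_mult mult.commute)
 qed
 have fin: "emeasure lborel S < \<infinity>" if "S \<subseteq> {0<..<dl}" "S \<in> sets borel" for S
  using emeasure_mono[OF that(1), of lborel] dl by (auto simp: less_top[symmetric] top_unique)
 \<comment> \<open>Margins of width \<open>a\<close> at both ends have total length
   \<open>2 * a\<close>. What remains of \<open>A\<close> and \<open>B\<close> stays away from 0 and
   \<open>dl\<close>, as the supports in \<open>deriv_bound\<close> must.\<close>
 have shrink: "0 < measure lborel (S \<inter> {a<..<dl - a})" if S: "S \<in> sets borel" "S \<subseteq> {0<..<dl}" and a: "0 < a" "2 * a < measure lborel S" "a < dl" for S a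
 proof -
  have "measure lborel S <= measure lborel ((S \<inter> {a<..<dl - a}) \<union> (?t1 a))"
  proof (rule measure_mono_fmeasurable)
   show "S \<inter> {a<..<dl - a} \<union> (?t1 a) \<in> fmeasurable lborel"
    using S fin[of "S \<inter> {a<..<dl - a}"] by (intro fmeasurable.Un) (auto simp: fmeasurable_def emeasure_lborel_Icc_eq)
  qed (use S in auto)
  also have "\<dots> <= measure lborel (S \<inter> {a<..<dl - a}) + measure lborel (?t1 a)"
   using S by (intro measure_Un_le) auto
  also have "measure lborel (?t1 a) <= measure lborel {0..a} + measure lborel {dl - a..dl}"
   by (intro measure_Un_le) auto
  also have "\<dots> = 2 * a" using a by simp
  finally show ?thesis using a by linarith
 qed
 define a where "a = min (min (measure lborel A) (measure lborel B) / 4) (dl / 4)"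
 have a: "0 < a" "2 * a < measure lborel A" "2 * a < measure lborel B" "a < dl" "2 * a < dl"
  using A(3) B(3) dl unfolding a_def by linarith+
 define A' where "A' = A \<inter> {a<..<dl - a}"
 define B' where "B' = B \<inter> {a<..<dl - a}"
 have [measurable]: "A' \<in> sets borel" "B' \<in> sets borel" unfolding A'_def B'_def by measurable
 have pos: "0 < measure lborel A'" "0 < measure lborel B'"
  using shrink[of A a] shrink[of B a] A B a by (auto simp: A'_def B'_def)
 have finAB: "emeasure lborel A' < \<infinity>" "emeasure lborel B' < \<infinity>"
  using A B by (intro fin; auto simp: A'_def B'_def)+
 define rho where "rho t = indicator A' t / measure lborel A' - indicator B' t / measure lborel B'" for t
 have [measurable]: "rho \<in> Borel" unfolding rho_def[abs_def] by measurable
 have iA: "L1 (indicator A' :: real => real)" "L1 (indicator B' :: real => real)"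
  using finAB by (auto intro!: integrable_real_indicator)
 have rhoi: "L1 rho" unfolding rho_def using iA by auto
 have rhoint: "(LB t. rho t) = 0" unfolding rho_def using iA pos by simp
 have rhoabs: "(LB t. \<bar>rho t\<bar>) <= 2"
 proof -
  have "(LB t. \<bar>rho t\<bar>) <= (LB t. indicator A' t / measure lborel A' + indicator B' t / measure lborel B')"
  proof (rule integral_mono)
   show "\<bar>rho t\<bar> <= indicator A' t / measure lborel A' + indicator B' t / measure lborel B'" for t
    using pos abs_triangle_ineq4[of "indicator A' t / measure lborel A'" "indicator B' t / measure lborel B'"] by (simp add: rho_def)
  qed (use iA rhoi in auto)
  also have "\<dots> = 2" using iA pos by simp
  finally show ?thesis .
 qed
 have rhom: "al - beta <= (LB t. rho t * m t)"
 proof -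
  have im: "L1 (%t. indicator A' t * m t)" "L1 (%t. indicator B' t * m t)"
   by (intro mi iA)+
  have "(LB t. rho t * m t) = (LB t. indicator A' t * m t) / measure lborel A' - (LB t. indicator B' t * m t) / measure lborel B'"
   using im by (simp add: rho_def left_diff_distrib)
  moreover have "(LB t. indicator A' t * al) <= (LB t. indicator A' t * m t)"
  proof (rule integral_mono)
   show "indicator A' t * al <= indicator A' t * m t" for t using A(4)[of t] by (auto simp: indicator_def A'_def)
  qed (intro integrable_mult_left iA im)+
  hence "al <= (LB t. indicator A' t * m t) / measure lborel A'"
   using pos by (simp add: field_simps)
  moreover have "(LB t. indicator B' t * m t) <= (LB t. indicator B' t * beta)"
  proof (rule integral_mono)
   show "indicator B' t * m t <= indicator B' t * beta" for t using B(4)[of t] by (auto simp: indicator_def B'_def)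
  qed (intro integrable_mult_left iA im)+
  hence "(LB t. indicator B' t * m t) / measure lborel B' <= beta"
   using pos by (simp add: field_simps)
  ultimately show ?thesis by linarith
 qed
 \<comment> \<open>A weight that is positive in the interior. The density is written as
   \<open>phi * q\<close> and only \<open>q\<close> is approximated, so the smooth substitute
   inherits the support of \<open>phi\<close>.\<close>
 define phi where "phi t = flat_exp (t - a / 2) * flat_exp (dl - a / 2 - t)" for t
 have phis: "phi t \<noteq> 0 ==> a / 2 <= t \<and> t <= dl - a / 2" for t
  by (auto simp: phi_def flat_exp_def split: if_splits)
 have "smooth (%t. flat_exp ((1::real) \<bullet> t + - (a / 2)) * flat_exp ((-1::real) \<bullet> t + (dl - a / 2)))"
  by (intro smooth_mult smooth_real_comp(1) smooth_flat_exp)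
 hence phism: "smooth phi" by (simp add: phi_def[abs_def] algebra_simps)
 have phit: "test_fun phi" unfolding test_fun_def
 proof (intro conjI phism exI[of _ dl] allI impI)
  fix z :: real assume "dl < norm z" thus "phi z = 0" using phis[of z] a by force
 qed
 have phi0: "0 <= phi t" for t by (simp add: phi_def flat_exp_bounds)
 define c where "c = flat_exp (a / 2) * flat_exp (a / 2)"
 have c: "0 < c" unfolding c_def using a by (intro mult_pos_pos flat_exp_bounds) auto
 have cphi: "c <= phi t" if "a < t" "t < dl - a" for t
  unfolding c_def phi_def using that by (intro mult_mono mono_flat_exp flat_exp_bounds) auto
 note [measurable] = smooth_measurable[OF phism]
 define I where "I = (LB t. phi t)"
 have phii: "L1 phi" by (rule test_fun_integrable[OF phit])
 have I: "0 < I"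
 proof -
  have "(LB t. indicator A' t * c) <= I"
   unfolding I_def
  proof (rule integral_mono)
   show "indicator A' t * c <= phi t" for t using cphi[of t] phi0[of t] by (auto simp: indicator_def A'_def)
  qed (intro integrable_mult_left iA phii)+
  moreover have "0 < measure lborel A' * c" using pos c by simp
  ultimately show ?thesis by simp
 qed
 define q where "q t = rho t / max (phi t) c" for t
 have phiq: "phi t * q t = rho t" for t
 proof (cases "a < t \<and> t < dl - a")
  case True thus ?thesis using c cphi[of t] by (simp add: q_def)
 next
  case False hence "rho t = 0" by (auto simp: rho_def A'_def B'_def indicator_def)
  thus ?thesis by (simp add: q_def)
 qed
 have [measurable]: "q \<in> Borel" unfolding q_def[abs_def] by measurable
 have rhoB: "\<bar>rho t\<bar> <= 1 / measure lborel A' + 1 / measure lborel B'" for t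
 proof -
  have "0 < 1 / measure lborel A'" "0 < 1 / measure lborel B'" using pos by auto
  moreover have "rho t = (if t \<in> A' then 1 / measure lborel A' else 0) - (if t \<in> B' then 1 / measure lborel B' else 0)"
   by (simp add: rho_def)
  ultimately show ?thesis by (smt (verit))
 qed
 have qB: "\<bar>q t\<bar> <= (1 / measure lborel A' + 1 / measure lborel B') / c" for t
  unfolding q_def abs_divide using rhoB c pos by (intro frac_le) auto
 have main: "al - beta <= 2 * K + (2 * K + 2 * C) * eps" if eps: "0 < eps" for eps
 proof -
  obtain w where w: "smooth w" "(LB x. \<bar>phi x * (q x - w x)\<bar>) <= eps"
   using smooth_weighted_approx[of q, OF _ qB phit eps] by (metis \<open>q \<in> Borel\<close>)
  have phiw: "test_fun (%t. phi t * w t)" by (rule test_fun_mult1[OF phit w(1)])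
  note phiwi = test_fun_integrable[OF phiw]
  have e: "(LB t. \<bar>rho t - phi t * w t\<bar>) <= eps"
   using w(2) by (simp add: right_diff_distrib phiq)
  \<comment> \<open>The multiple of \<open>phi\<close> that restores mean zero after the
    approximation; it is small because \<open>rho\<close> itself has mean zero.\<close>
  define k where "k = (LB t. phi t * w t) / I"
  have kI: "\<bar>k\<bar> * I <= eps"
  proof -
   have "\<bar>k\<bar> * I = \<bar>LB t. rho t - phi t * w t\<bar>" using I phiwi rhoi rhoint by (simp add: k_def abs_mult)
   also have "\<dots> <= (LB t. \<bar>rho t - phi t * w t\<bar>)" by (rule integral_abs_bound)
   finally show ?thesis using e by linarith
  qed
  define rho' where "rho' t = phi t * (w t + (- k))" for t
  have sm': "smooth rho'" unfolding rho'_def[abs_def] by (intro smooth_intros phism w)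
  note [measurable] = smooth_measurable[OF sm']
  have s': "rho' t \<noteq> 0 ==> a / 2 <= t \<and> t <= dl - a / 2" for t using phis[of t] by (auto simp: rho'_def)
  have i': "(LB t. rho' t) = 0"
  proof -
   have "(LB t. rho' t) = (LB t. phi t * w t - k * phi t)"
    by (simp add: rho'_def algebra_simps)
   also have "\<dots> = (LB t. phi t * w t) - k * I" using phiwi phii by (simp add: I_def)
   finally show ?thesis using I by (simp add: k_def)
  qed
  have rho'i: "L1 rho'" unfolding rho'_def
   using integrable_diff[OF phiwi integrable_mult_right[OF phii, of k]] by (simp add: algebra_simps)
  have d': "(LB t. \<bar>rho' t - rho t\<bar>) <= 2 * eps"
  proof -
   have "(LB t. \<bar>rho' t - rho t\<bar>) <= (LB t. \<bar>rho t - phi t * w t\<bar> + \<bar>k\<bar> * phi t)"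
   proof (rule integral_mono)
    show "\<bar>rho' t - rho t\<bar> <= \<bar>rho t - phi t * w t\<bar> + \<bar>k\<bar> * phi t" for t
    proof -
     have "rho' t - rho t = - (rho t - phi t * w t) - k * phi t" by (simp add: rho'_def algebra_simps)
     moreover have "\<bar>k * phi t\<bar> = \<bar>k\<bar> * phi t" using phi0[of t] by (simp add: abs_mult)
     ultimately show ?thesis by linarith
    qed
   qed (use rhoi rho'i phiwi phii in auto)
   also have "\<dots> = (LB t. \<bar>rho t - phi t * w t\<bar>) + \<bar>k\<bar> * I" using rhoi phiwi phii by (simp add: I_def)
   finally show ?thesis using e kI by linarith
  qed
  have "a / 2 <= dl - a / 2" using a by simp
  then obtain th where th: "test_fun th" "dd 1 th = rho'" "!!t. th t \<noteq> 0 ==> a / 2 <= t \<and> t <= dl - a / 2" "!!t. \<bar>th t\<bar> <= (LB t. \<bar>rho' t\<bar>)"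
   using test_fun_antiderivative[OF sm' s' _ i'] by blast
  have "\<bar>LB t. dd 1 th t * m t\<bar> <= K * (LB t. \<bar>rho' t\<bar>)"
   using K(1)[unfolded deriv_bound_def, rule_format, of th "a / 2" "dl - a / 2"] th a by simp
  also have "(LB t. \<bar>rho' t\<bar>) <= (LB t. \<bar>rho t\<bar> + \<bar>rho' t - rho t\<bar>)"
   using rhoi rho'i by (intro integral_mono) auto
  also have "\<dots> = (LB t. \<bar>rho t\<bar>) + (LB t. \<bar>rho' t - rho t\<bar>)" using rhoi rho'i by simp
  also have "\<dots> <= 2 + 2 * eps" using rhoabs d' by linarith
  finally have 1: "\<bar>LB t. rho' t * m t\<bar> <= K * (2 + 2 * eps)" using K(2) th(2) by (simp add: mult_left_mono)
  have "(LB t. rho t * m t) - (LB t. rho' t * m t) = (LB t. (rho t - rho' t) * m t)"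
   using mi[OF rhoi] mi[OF rho'i] by (simp add: left_diff_distrib)
  also have "\<dots> <= (LB t. C * \<bar>rho' t - rho t\<bar>)"
  proof (rule integral_mono)
   show "(rho t - rho' t) * m t <= C * \<bar>rho' t - rho t\<bar>" for t
   proof -
    have "(rho t - rho' t) * m t <= \<bar>rho t - rho' t\<bar> * \<bar>m t\<bar>" by (simp add: abs_mult[symmetric])
    also have "\<dots> <= \<bar>rho t - rho' t\<bar> * C" using C by (intro mult_left_mono) auto
    finally show ?thesis by (simp add: mult.commute abs_minus_commute)
   qed
  qed (use mi[of "%t. rho t - rho' t"] rhoi rho'i in auto)
  also have "\<dots> <= C * (2 * eps)" using d' C0 by (simp add: mult_left_mono)
  finally show ?thesis using 1 rhom by (simp add: algebra_simps)
 qed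
 show ?thesis
 proof (rule field_le_epsilon)
  fix e :: real assume e: "0 < e"
  have p: "0 < 2 * K + 2 * C + 1" using K(2) C0 by linarith
  have "al - beta <= 2 * K + (2 * K + 2 * C) * (e / (2 * K + 2 * C + 1))" using p e by (intro main) simp
  also have "(2 * K + 2 * C) * (e / (2 * K + 2 * C + 1)) <= (2 * K + 2 * C + 1) * (e / (2 * K + 2 * C + 1))"
   using p e by (intro mult_right_mono) auto
  also have "\<dots> = e" using p by simp
  finally show "al - beta <= 2 * K + e" by linarith
 qed
qed

text \<open>Take \<open>c\<close> to be the essential infimum on the interval. Values up to
  \<open>c + e / 2\<close> occur on a set of positive measure, so by \<open>deriv_bound_gap\<close>
  values above \<open>c + 2 * K + e\<close> form a null set.\<close>

lemma deriv_bound_osc: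
 fixes m :: "real => real"
 assumes m[measurable]: "m \<in> Borel" and C: "!!t. \<bar>m t\<bar> <= C" and K: "deriv_bound m dl K" "0 <= K" and dl: "0 < dl" and e: "0 < e"
 shows "\<exists>c. AE t in lborel. 0 < t \<and> t < dl --> \<bar>m t - c\<bar> <= 2 * K + e"
proof -
 define S where "S = {beta. AE t in lborel. 0 < t \<and> t < dl --> beta <= m t}"
 have Cm: "- C \<in> S" unfolding S_def using C by (auto intro!: AE_I2 simp: abs_le_iff minus_le_iff)
 have bdd: "beta <= C" if "beta \<in> S" for beta
 proof -
  from AE_interval_exists[OF that[unfolded S_def mem_Collect_eq] dl] obtain t where "beta <= m t" by blast
  thus ?thesis using C[of t] by linarith
 qed
 define c where "c = Sup S"
 have bS: "bdd_above S" using bdd by (intro bdd_aboveI) auto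
 obtain beta0 where beta0: "beta0 \<in> S" "c - e / 2 < beta0"
  using less_cSupD[of S "c - e / 2"] Cm e unfolding c_def by force
 have low: "AE t in lborel. 0 < t \<and> t < dl --> c - e / 2 <= m t"
  using beta0(1) unfolding S_def mem_Collect_eq by eventually_elim (use beta0(2) in auto)
 have pos: "0 < measure lborel X" if "\<not> (AE t in lborel. t \<notin> X)" "X \<subseteq> {0<..<dl}" "X \<in> sets borel" for X
 proof -
  have "emeasure lborel X < \<infinity>" using emeasure_mono[OF that(2), of lborel] dl by (auto simp: less_top[symmetric] top_unique)
  moreover have "emeasure lborel X \<noteq> 0"
   using that AE_iff_null_sets[of X lborel] by (auto simp: null_sets_def)
  ultimately show ?thesis by (simp add: measure_def enn2real_positive_iff less_top pos2 zero_less_iff_neq_zero)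
 qed
 define B where "B = {t. 0 < t \<and> t < dl \<and> m t <= c + e / 2}"
 have B: "B \<in> sets borel" "B \<subseteq> {0<..<dl}" unfolding B_def by (measurable, auto)
 have Bpos: "0 < measure lborel B"
 proof (rule pos[OF _ B(2,1)])
  show "\<not> (AE t in lborel. t \<notin> B)"
  proof
   assume "AE t in lborel. t \<notin> B"
   hence "c + e / 2 \<in> S" unfolding S_def B_def by auto
   hence "c + e / 2 <= c" unfolding c_def by (rule cSup_upper[OF _ bS])
   thus False using e by simp
  qed
 qed
 define A where "A = {t. 0 < t \<and> t < dl \<and> c + 2 * K + e <= m t}"
 have A: "A \<in> sets borel" "A \<subseteq> {0<..<dl}" unfolding A_def by (measurable, auto)
 have "AE t in lborel. t \<notin> A"
 proof (rule ccontr)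
  assume "\<not> (AE t in lborel. t \<notin> A)"
  from pos[OF this A(2,1)] have "(c + 2 * K + e) - (c + e / 2) <= 2 * K"
   by (intro deriv_bound_gap[OF m C K dl A(1,2) _ _ B(1,2) Bpos]) (auto simp: A_def B_def)
  thus False using e by simp
 qed
 hence "AE t in lborel. 0 < t \<and> t < dl --> \<bar>m t - c\<bar> <= 2 * K + e"
  using low
 proof eventually_elim
  case (elim t) thus ?case using K(2) e by (auto simp: A_def abs_le_iff)
 qed
 thus ?thesis by blast
qed

lemma deriv_bound_ess_lim0:
 fixes m :: "real => real"
 assumes m: "m \<in> Borel" and C: "!!t. \<bar>m t\<bar> <= C"
  and K: "!!eps. 0 < eps ==> \<exists>dl>0. \<exists>K\<ge>0. K <= eps \<and> deriv_bound m dl K"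
 shows "\<exists>L. ess_lim0 m L"
proof (rule ess_lim0_Cauchy)
 fix eps :: real assume e: "0 < eps"
 then obtain dl K where 1: "0 < dl" "0 <= K" "K <= eps / 4" "deriv_bound m dl K" using K[of "eps / 4"] by auto
 from deriv_bound_osc[OF m C 1(4,2,1), of "eps / 2"] e obtain c where
  "AE t in lborel. 0 < t \<and> t < dl --> \<bar>m t - c\<bar> <= 2 * K + eps / 2" by auto
 hence "AE t in lborel. 0 < t \<and> t < dl --> \<bar>m t - c\<bar> <= eps"
  by eventually_elim (use 1(3) in auto)
 thus "\<exists>dl>0. \<exists>c. AE t in lborel. 0 < t \<and> t < dl --> \<bar>m t - c\<bar> <= eps" using 1(1) by blast
qed

section \<open>Weak traces\<close>

text \<open>A weak star essential limit of the slices in \<open>L^\<infinity>\<close>. The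
  exceptional set of times may depend on \<open>f\<close>; both functions are Borel and bounded
  everywhere, so that every single slice can be integrated.\<close>

definition weak_trace :: "(real \<times> 'a::euclidean_space => real) => ('a => real) => bool" where
 "weak_trace g h \<longleftrightarrow> g \<in> Borel \<and> (\<exists>C. \<forall>z. \<bar>g z\<bar> <= C) \<and>
   h \<in> Borel \<and> (\<exists>C. \<forall>x. \<bar>h x\<bar> <= C) \<and>
   (\<forall>f. L1 f --> ess_lim0 (%t. LB x. g (t, x) * f x) (LB x. h x * f x))"

lemma measurable_slice:
 assumes "g \<in> borel_measurable (borel :: (real \<times> 'a::euclidean_space) measure)"
 shows "(%x. g (t, x)) \<in> Borel"
proof -
 have "(%x::'a. (t, x)) \<in> borel \<rightarrow>\<^sub>M borel" by (intro borel_measurable_continuous_onI continuous_intros)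
 thus ?thesis using assms by (rule measurable_compose)
qed

lemma L1_mult:
 fixes f m :: "'a::euclidean_space => real"
 assumes f: "L1 f" and m: "m \<in> Borel" and C: "!!t. \<bar>m t\<bar> <= C"
 shows "L1 (%t. m t * f t)"
  and "\<bar>LB t. m t * f t\<bar> <= C * (LB t. \<bar>f t\<bar>)"
proof -
 have C0: "0 <= C" using C[of 0] by linarith
 have le: "\<bar>m t * f t\<bar> <= C * \<bar>f t\<bar>" for t using C by (simp add: abs_mult mult_right_mono)
 show i: "L1 (%t. m t * f t)"
 proof (rule integrable_bound)
  show "L1 (%t. C * f t)" using f by simp
  show "(%t. m t * f t) \<in> borel_measurable lborel" using f m by (intro borel_measurable_times) auto
  show "AE t in lborel. norm (m t * f t) <= norm (C * f t)"
   using C0 le by (intro AE_I2) (simp add: abs_mult)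
 qed
 have "\<bar>LB t. m t * f t\<bar> <= (LB t. C * \<bar>f t\<bar>)"
  using le i f by (intro integral_abs_bound_integral) auto
 thus "\<bar>LB t. m t * f t\<bar> <= C * (LB t. \<bar>f t\<bar>)" by simp
qed

lemma measurable_slice_integral:
 fixes g :: "real \<times> 'a::euclidean_space => real"
 assumes g: "g \<in> Borel" and f: "f \<in> Borel"
 shows "(%t. LB x. g (t, x) * f x) \<in> Borel"
proof -
 have [measurable]: "g \<in> borel_measurable (borel \<Otimes>\<^sub>M borel)" using g by (simp add: borel_prod)
 have [measurable]: "f \<in> Borel" by (rule f)
 show ?thesis by measurable
qed

lemma ess_lim0_L1_limit:
 fixes g :: "real \<times> 'a::euclidean_space => real"
 assumes g: "g \<in> Borel" and C: "!!z. \<bar>g z\<bar> <= C" and f: "L1 f"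
  and approx: "!!eps. 0 < eps ==> \<exists>f' L. L1 f' \<and> (LB x. \<bar>f x - f' x\<bar>) <= eps \<and> ess_lim0 (%t. LB x. g (t, x) * f' x) L"
 shows "\<exists>L. ess_lim0 (%t. LB x. g (t, x) * f x) L"
proof (rule ess_lim0_Cauchy)
 fix eps :: real assume e: "0 < eps"
 have C0: "0 <= C" using C[of 0] by linarith
 define eta where "eta = eps / (2 * (C + 1))"
 have eta: "0 < eta" "C * eta <= eps / 2" using e C0 by (auto simp: eta_def field_simps)
 obtain f' L where f': "L1 f'" "(LB x. \<bar>f x - f' x\<bar>) <= eta" "ess_lim0 (%t. LB x. g (t, x) * f' x) L"
  using approx[OF eta(1)] by blast
 obtain dl where d: "0 < dl" "AE t in lborel. 0 < t \<and> t < dl --> \<bar>(LB x. g (t, x) * f' x) - L\<bar> < eps / 2"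
  using f'(3) half_gt_zero[OF e] unfolding ess_lim0_def by blast
 have cl: "\<bar>(LB x. g (t, x) * f x) - (LB x. g (t, x) * f' x)\<bar> <= eps / 2" for t
 proof -
  note m = measurable_slice[OF g, of t]
  have "(LB x. g (t, x) * f x) - (LB x. g (t, x) * f' x) = (LB x. g (t, x) * (f x - f' x))"
   using L1_mult(1)[OF f m C] L1_mult(1)[OF f'(1) m C] by (simp add: right_diff_distrib)
  moreover have "\<bar>LB x. g (t, x) * (f x - f' x)\<bar> <= C * (LB x. \<bar>f x - f' x\<bar>)"
   using f f'(1) by (intro L1_mult(2) m C) auto
  moreover have "C * (LB x. \<bar>f x - f' x\<bar>) <= C * eta" using f'(2) C0 by (rule mult_left_mono)
  ultimately show ?thesis using eta(2) by linarith
 qed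
 have "AE t in lborel. 0 < t \<and> t < dl --> \<bar>(LB x. g (t, x) * f x) - L\<bar> <= eps"
  using d(2)
 proof eventually_elim
  case (elim t) thus ?case using cl[of t] by (smt (verit) field_sum_of_halves)
 qed
 thus "\<exists>dl>0. \<exists>c. AE t in lborel. 0 < t \<and> t < dl --> \<bar>(LB x. g (t, x) * f x) - c\<bar> <= eps" using d(1) by blast
qed

lemma ess_lim0_tendsto_unif:
 assumes "!!n. ess_lim0 (m n) (L n)" "L ----> K" and r: "r ----> 0" and le: "!!n t. \<bar>m n t - k t\<bar> <= r n"
 shows "ess_lim0 k (K :: real)"
 unfolding ess_lim0_def
proof (intro allI impI)
 fix eps :: real assume e: "0 < eps"
 have "\<forall>\<^sub>F n in sequentially. \<bar>L n - K\<bar> < eps / 4" using tendstoD[OF assms(2), of "eps / 4"] e by (simp add: dist_real_def)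
 moreover have "\<forall>\<^sub>F n in sequentially. r n < eps / 4" using order_tendstoD(2)[OF r, of "eps / 4"] e by simp
 ultimately have "\<forall>\<^sub>F n in sequentially. \<bar>L n - K\<bar> < eps / 4 \<and> r n < eps / 4" by eventually_elim auto
 then obtain n where n: "\<bar>L n - K\<bar> < eps / 4" "r n < eps / 4" unfolding eventually_sequentially by blast
 have e4: "0 < eps / 4" using e by simp
 obtain dl where d: "0 < dl" "AE t in lborel. 0 < t \<and> t < dl --> \<bar>m n t - L n\<bar> < eps / 4"
  using assms(1)[of n] e4 unfolding ess_lim0_def by blast
 have "AE t in lborel. 0 < t \<and> t < dl --> \<bar>k t - K\<bar> < eps"
  using d(2)
 proof eventually_elim
  case (elim t)
  show ?case
  proof
   assume "0 < t \<and> t < dl"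
   hence "\<bar>m n t - L n\<bar> < eps / 4" using elim by blast
   thus "\<bar>k t - K\<bar> < eps" using n le[of n t] by arith
  qed
 qed
 thus "\<exists>dl>0. AE t in lborel. 0 < t \<and> t < dl --> \<bar>k t - K\<bar> < eps" using d(1) by blast
qed

text \<open>The limits form a positive functional on \<open>L^1\<close> bounded by \<open>C\<close>,
  and \<open>h\<close> is its representing function. It is obtained from the Radon-Nikodym theorem:
  on indicators the functional gives a measure dominated by \<open>C\<close> times a finite
  reference measure.\<close>

lemma weak_trace_exists_nonneg:
 fixes g :: "real \<times> 'a::euclidean_space => real"
 assumes g: "g \<in> Borel" and C: "!!z. 0 <= g z" "!!z. g z <= C"
  and lim: "!!psi. test_fun psi ==> \<exists>L. ess_lim0 (%t. LB x. g (t, x) * psi x) L"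
 shows "\<exists>h. weak_trace g h"
proof -
 let ?t1 = "%f. %t. LB x. g (t, x) * f x"
 have C0: "0 <= C" using C(1)[of 0] C(2)[of 0] by linarith
 have Ca: "\<bar>g z\<bar> <= C" for z using C[of z] by simp
 note gs = measurable_slice[OF g]
 have lim1: "\<exists>L. ess_lim0 (?t1 f) L" if f: "L1 f" for f
 proof (rule ess_lim0_L1_limit[OF g Ca f])
  fix eps :: real assume "0 < eps"
  then obtain psi where psi: "test_fun psi" "(LB x. \<bar>f x - psi x\<bar>) < eps" using L1_approx_test_fun[OF f] by blast
  thus "\<exists>f' L. L1 f' \<and> (LB x. \<bar>f x - f' x\<bar>) <= eps \<and> ess_lim0 (%t. LB x. g (t, x) * f' x) L"
   using lim[OF psi(1)] test_fun_integrable[OF psi(1)] less_imp_le by blast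
 qed
 define L where "L f = (SOME L. ess_lim0 (?t1 f) L)" for f
 have L: "ess_lim0 (?t1 f) (L f)" if "L1 f" for f
  unfolding L_def using lim1[OF that] by (rule someI_ex)
 have Lu: "L f = K" if "L1 f" "ess_lim0 (?t1 f) K" for f K
  using ess_lim0_unique[OF L[OF that(1)] that(2)] .
 have gi: "L1 (%x. g (t, x) * f x)" if "L1 f" for f t
  by (rule L1_mult(1)[OF that gs Ca])
 have L_add: "L (%x. f x + f' x) = L f + L f'" if f: "L1 f" "L1 f'" for f f'
 proof (rule Lu)
  have "(%t. LB x. g (t, x) * (f x + f' x)) = (%t. (LB x. g (t, x) * f x) + (LB x. g (t, x) * f' x))"
   using gi[OF f(1)] gi[OF f(2)] by (simp add: distrib_left)
  thus "ess_lim0 (%t. LB x. g (t, x) * (f x + f' x)) (L f + L f')"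
   using ess_lim0_add[OF L[OF f(1)] L[OF f(2)]] by simp
 qed (use f in auto)
 have L_bound: "0 <= L f" "L f <= C * (LB x. f x)" if f: "L1 f" and f0: "!!x. 0 <= f x" for f
 proof -
  have "0 <= (LB x. g (t, x) * f x)" for t using C f0 by (intro integral_nonneg) auto
  thus "0 <= L f" by (intro ess_lim0_le[OF ess_lim0_const L[OF f]]) auto
  have "(LB x. g (t, x) * f x) <= C * (LB x. f x)" for t
   unfolding integral_mult_right_zero[symmetric] using gi[OF f] f C f0 by (intro integral_mono) (auto intro!: mult_right_mono)
  thus "L f <= C * (LB x. f x)" by (intro ess_lim0_le[OF L[OF f] ess_lim0_const]) auto
 qed
 \<comment> \<open>A strictly positive integrable weight: \<open>indicator A x * rho x\<close> is
   integrable for every Borel set \<open>A\<close>, so the functional can be evaluated on it and the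
   resulting measure is finite.\<close>
 obtain rho :: "'a => real" where rhom: "rho \<in> borel_measurable lborel" and rho: "!!x. 0 < rho x" "!!x. rho x <= 1" "L1 rho"
  using sigma_finite_measure.obtain_positive_integrable_function[OF sigma_finite_lborel] by blast
 have [measurable]: "rho \<in> Borel" using rhom by simp
 let ?r = "%A x. indicator A x * rho x"
 have ri: "L1 (?r A)" if "A \<in> sets borel" for A
  using integrable_mult_indicator[OF _ rho(3), of A] that by simp
 have r0: "0 <= ?r A x" for A x using rho(1)[of x] by (simp add: indicator_def less_imp_le)
 define nu where "nu = measure_of UNIV (sets (borel :: 'a measure)) (%A. ennreal (L (?r A)))"
 have sets_nu: "sets nu = sets borel" unfolding nu_def by (metis sets.sets_measure_of_eq sets_measure_of_conv space_borel)
 have sa: "sigma_algebra UNIV (sets (borel :: 'a measure))" using sets.sigma_algebra_axioms[of "borel :: 'a measure"] by simp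
 have em: "emeasure nu A = ennreal (L (?r A))" if A: "A \<in> sets borel" for A
  unfolding nu_def
 proof (rule emeasure_measure_of_sigma[OF sa _ _ A])
  have L0: "L (?r {}) = 0" by (rule Lu) (auto simp: ess_lim0_const)
  thus "positive (sets borel) (%A. ennreal (L (?r A)))" by (simp add: positive_def)
  \<comment> \<open>Finite additivity is linearity of the functional; continuity at the empty set
    comes from its bound by \<open>C\<close> times the integral.\<close>
  show "countably_additive (sets borel) (%A. ennreal (L (?r A)))"
  proof (rule sets.empty_continuous_imp_countably_additive[where M=borel])
   show "additive (sets borel) (%A. ennreal (L (?r A)))"
    unfolding additive_def using L_add L_bound(1) ri r0
    by (simp add: indicator_disj_union distrib_right ennreal_plus[symmetric] del: ennreal_plus)
   fix T :: "nat => 'a set" assume T: "range T \<subseteq> sets borel" "decseq T" "(\<Inter>i. T i) = {}"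
   have Tm: "T n \<in> sets borel" for n using T by auto
   have "(%n. LB x. ?r (T n) x) ----> (LB x::'a. 0)"
   proof (rule integral_dominated_convergence[where w=rho])
    show "AE x in lborel. (%n. ?r (T n) x) ----> 0"
     using tendsto_mult_left_zero[OF LIMSEQ_indicator_decseq[OF T(2), unfolded T(3), simplified]] by (intro AE_I2)
    show "AE x in lborel. norm (?r (T n) x) <= rho x" for n
     using rho(1) by (intro AE_I2) (auto simp: indicator_def less_imp_le)
   qed (use rho(3) Tm in auto)
   hence "(%n. C * (LB x. ?r (T n) x)) ----> 0" by (simp add: tendsto_mult_right_zero)
   from tendsto_sandwich[OF _ _ tendsto_const this, of "%n. L (?r (T n))"]
   have "(%n. L (?r (T n))) ----> 0" using L_bound[OF ri[OF Tm] r0] by simp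
   thus "(%n. ennreal (L (?r (T n)))) ----> 0" using tendsto_ennrealI[of _ 0] by simp
  qed (use L0 in \<open>simp_all add: positive_def\<close>)
 qed
 have lenu: "emeasure nu A <= (\<integral>\<^sup>+x\<in>A. ennreal (C * rho x) \<partial>lborel)" if A: "A \<in> sets borel" for A
 proof -
  have "L (?r A) <= C * (LB x. ?r A x)" by (rule L_bound(2)[OF ri[OF A] r0])
  also have "\<dots> = (LB x. C * ?r A x)" by simp
  finally have "ennreal (L (?r A)) <= ennreal (LB x. C * ?r A x)" by (rule ennreal_leI)
  also have "\<dots> = (\<integral>\<^sup>+x. ennreal (C * ?r A x) \<partial>lborel)"
   using ri[OF A] r0 C0 by (intro nn_integral_eq_integral[symmetric]) auto
  also have "\<dots> = (\<integral>\<^sup>+x\<in>A. ennreal (C * rho x) \<partial>lborel)"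
   by (intro nn_integral_cong) (auto simp: indicator_def)
  finally show ?thesis using em[OF A] by simp
 qed
 have "absolutely_continuous lborel nu"
  unfolding absolutely_continuous_def
 proof
  fix A :: "'a set" assume A: "A \<in> null_sets lborel"
  hence Ab: "A \<in> sets borel" by (auto simp: null_sets_def)
  have "(\<integral>\<^sup>+x\<in>A. ennreal (C * rho x) \<partial>lborel) = 0"
   using A by (simp add: nn_integral_null_set)
  thus "A \<in> null_sets nu" using lenu[OF Ab] Ab sets_nu by (auto simp: null_sets_def)
 qed
 then obtain F where F[measurable]: "F \<in> Borel" and dF: "density lborel F = nu"
  using sigma_finite_measure.Radon_Nikodym[OF sigma_finite_lborel, of nu] sets_nu by auto
 have Fle: "AE x in lborel. F x <= ennreal (C * rho x)"
 proof -
  define B where "B = {x. ennreal (C * rho x) < F x}"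
  have B[measurable]: "B \<in> sets borel" unfolding B_def by measurable
  have fin: "(\<integral>\<^sup>+x\<in>B. ennreal (C * rho x) \<partial>lborel) \<noteq> \<infinity>"
  proof -
   have "(\<integral>\<^sup>+x\<in>B. ennreal (C * rho x) \<partial>lborel) <= (\<integral>\<^sup>+x. ennreal (C * rho x) \<partial>lborel)"
    by (intro nn_integral_mono) (auto simp: indicator_def)
   also have "\<dots> = ennreal (LB x. C * rho x)" using rho(3) C0 by (intro nn_integral_eq_integral AE_I2 mult_nonneg_nonneg less_imp_le[OF rho(1)]) auto
   finally show ?thesis by (auto simp: top_unique)
  qed
  have "(\<integral>\<^sup>+x\<in>B. F x \<partial>lborel) <= (\<integral>\<^sup>+x\<in>B. ennreal (C * rho x) \<partial>lborel)"
   using lenu[OF B] unfolding dF[symmetric] by (subst (asm) emeasure_density) auto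
  moreover have "(\<integral>\<^sup>+x. (F x - ennreal (C * rho x)) * indicator B x \<partial>lborel) = (\<integral>\<^sup>+x\<in>B. F x \<partial>lborel) - (\<integral>\<^sup>+x\<in>B. ennreal (C * rho x) \<partial>lborel)"
  proof -
   have "(\<integral>\<^sup>+x. (F x - ennreal (C * rho x)) * indicator B x \<partial>lborel) = (\<integral>\<^sup>+x. F x * indicator B x - ennreal (C * rho x) * indicator B x \<partial>lborel)"
    by (intro nn_integral_cong) (auto simp: indicator_def)
   also have "\<dots> = (\<integral>\<^sup>+x\<in>B. F x \<partial>lborel) - (\<integral>\<^sup>+x\<in>B. ennreal (C * rho x) \<partial>lborel)"
    by (rule nn_integral_diff) (use fin in \<open>auto simp: B_def indicator_def less_imp_le\<close>)
   finally show ?thesis .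
  qed
  moreover have "(\<integral>\<^sup>+x\<in>B. F x \<partial>lborel) < top"
   using calculation(1) fin by (metis infinity_ennreal_def le_less_trans less_top)
  ultimately have "(\<integral>\<^sup>+x. (F x - ennreal (C * rho x)) * indicator B x \<partial>lborel) = 0"
   by (simp add: diff_eq_0_iff_ennreal)
  hence "AE x in lborel. (F x - ennreal (C * rho x)) * indicator B x = 0"
   by (subst (asm) nn_integral_0_iff_AE) auto
  thus ?thesis
  proof eventually_elim
   case (elim x)
   show ?case
   proof (rule ccontr)
    assume "\<not> F x <= ennreal (C * rho x)"
    hence "ennreal (C * rho x) < F x" by simp
    thus False using elim by (auto simp: B_def diff_eq_0_iff_ennreal not_less[symmetric])
   qed
  qed
 qed
 \<comment> \<open>Since \<open>F\<close> is at most \<open>C * rho\<close> almost everywhere, the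
   minimum changes \<open>h\<close> only on a null set but makes the bound hold at every
   point.\<close>
 define h where "h x = min C (enn2real (F x) / rho x)" for x
 have hm[measurable]: "h \<in> Borel" unfolding h_def[abs_def] by measurable
 have h0: "0 <= h x" "h x <= C" for x using C0 rho(1)[of x] by (auto simp: h_def)
 have ha: "\<bar>h x\<bar> <= C" for x using h0[of x] by simp
 have hF: "AE x in lborel. F x = ennreal (h x * rho x)"
  using Fle
 proof eventually_elim
  case (elim x)
  hence "F x < top" by (simp add: order_le_less_trans)
  hence Fx: "F x = ennreal (enn2real (F x))" by simp
  hence "ennreal (enn2real (F x)) <= ennreal (C * rho x)" using elim by simp
  hence "enn2real (F x) <= C * rho x" using C0 rho(1)[of x] by (subst (asm) ennreal_le_iff) auto
  hence "h x = enn2real (F x) / rho x" using rho(1)[of x] by (simp add: h_def min_def field_simps)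
  thus ?case using Fx rho(1)[of x] by simp
 qed
 have Lh: "L (?r A) = (LB x. h x * ?r A x)" if A[measurable]: "A \<in> sets borel" for A
 proof -
  have i: "L1 (%x. h x * ?r A x)" by (rule L1_mult(1)[OF ri[OF A] hm ha])
  have "ennreal (L (?r A)) = (\<integral>\<^sup>+x\<in>A. F x \<partial>lborel)"
   using em[OF A] unfolding dF[symmetric] by (subst (asm) emeasure_density) auto
  also have "\<dots> = (\<integral>\<^sup>+x. ennreal (h x * ?r A x) \<partial>lborel)"
   using hF by (intro nn_integral_cong_AE) (auto elim!: eventually_mono simp: indicator_def)
  also have "\<dots> = ennreal (LB x. h x * ?r A x)"
   using i h0 r0 by (intro nn_integral_eq_integral) auto
  finally show ?thesis
   using L_bound(1)[OF ri[OF A] r0] h0 r0 by (subst (asm) ennreal_inj) (auto intro!: integral_nonneg)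
 qed
 let ?mu = "density lborel (%x. ennreal (rho x))"
 have imu: "integrable ?mu q \<longleftrightarrow> L1 (%x. rho x * q x)" if "q \<in> Borel" for q :: "'a => real"
  using that rho(1) by (subst integrable_density) (auto intro: less_imp_le)
 \<comment> \<open>From indicators to all integrable functions: linearity first, then a limit whose
   errors are uniform in \<open>t\<close> because \<open>g\<close> is bounded by
   \<open>C\<close>.\<close>
 have step: "ess_lim0 (%t. LB x. g (t, x) * (rho x * q x)) (LB x. h x * (rho x * q x))"
  if "integrable ?mu q" for q :: "'a => real"
  using that
 proof (induction rule: integrable_induct)
  case (base A c)
  hence A: "A \<in> sets borel" by simp
  have eq: "(%x. k x * (rho x * (indicator A x *\<^sub>R c))) = (%x. c * (k x * ?r A x))" for k :: "'a => real"
   by (auto simp: fun_eq_iff)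
  show ?case
   using ess_lim0_cmult[OF L[OF ri[OF A]], of c] unfolding eq integral_mult_right_zero Lh[OF A] .
 next
  case (add f f')
  have m: "f \<in> Borel" "f' \<in> Borel" using add by auto
  have i: "L1 (%x. rho x * f x)" "L1 (%x. rho x * f' x)" using add imu m by auto
  have "(LB x. k x * (rho x * (f x + f' x))) = (LB x. k x * (rho x * f x)) + (LB x. k x * (rho x * f' x))"
   if "k \<in> Borel" "!!x. \<bar>k x\<bar> <= C" for k
   using L1_mult(1)[OF i(1) that] L1_mult(1)[OF i(2) that] by (simp add: distrib_left)
  thus ?case using ess_lim0_add[OF add.IH] gs Ca hm ha by simp
 next
  case (lim f s)
  have m[measurable]: "f \<in> Borel" "!!i. s i \<in> Borel" using lim by auto
  have fi: "L1 (%x. rho x * f x)" using lim imu m by auto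
  have si: "L1 (%x. rho x * s i x)" for i using lim imu m by auto
  define r where "r n = C * (LB x. \<bar>rho x * s n x - rho x * f x\<bar>)" for n
  have "(%n. LB x. \<bar>rho x * s n x - rho x * f x\<bar>) ----> (LB x::'a. 0)"
  proof (rule integral_dominated_convergence[where w="%x. 3 * \<bar>rho x * f x\<bar>"])
   show "AE x in lborel. (%n. \<bar>rho x * s n x - rho x * f x\<bar>) ----> 0"
   proof (intro AE_I2 tendsto_rabs_zero)
    fix x
    have "(%n. rho x * s n x - rho x * f x) ----> rho x * f x - rho x * f x"
     using lim.hyps(2)[of x] by (intro tendsto_intros) simp
    thus "(%n. rho x * s n x - rho x * f x) ----> 0" by simp
   qed
   show "AE x in lborel. norm \<bar>rho x * s n x - rho x * f x\<bar> <= 3 * \<bar>rho x * f x\<bar>" for n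
   proof (intro AE_I2)
    fix x
    have "\<bar>s n x\<bar> <= 2 * \<bar>f x\<bar>" using lim.hyps(3)[of x n] by simp
    hence "rho x * \<bar>s n x\<bar> <= rho x * (2 * \<bar>f x\<bar>)" using rho(1)[of x] by (intro mult_left_mono) auto
    moreover have "\<bar>rho x * s n x\<bar> = rho x * \<bar>s n x\<bar>" "\<bar>rho x * f x\<bar> = rho x * \<bar>f x\<bar>" using rho(1)[of x] by (simp_all add: abs_mult)
    ultimately show "norm \<bar>rho x * s n x - rho x * f x\<bar> <= 3 * \<bar>rho x * f x\<bar>"
     using abs_triangle_ineq4[of "rho x * s n x" "rho x * f x"] unfolding real_norm_def abs_abs by linarith
   qed
  qed (use fi in auto)
  from tendsto_mult[OF tendsto_const[of C] this]
  have r0: "r ----> 0" by (simp add: r_def[abs_def])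
  have cl: "\<bar>(LB x. k x * (rho x * s n x)) - (LB x. k x * (rho x * f x))\<bar> <= r n"
   if k: "k \<in> Borel" "!!x. \<bar>k x\<bar> <= C" for k n
  proof -
   have "(LB x. k x * (rho x * s n x)) - (LB x. k x * (rho x * f x)) = (LB x. k x * (rho x * s n x - rho x * f x))"
    using L1_mult(1)[OF si k] L1_mult(1)[OF fi k] by (simp add: right_diff_distrib)
   thus ?thesis unfolding r_def using L1_mult(2)[OF integrable_diff[OF si fi] k, of n] by simp
  qed
  have "(%n. (LB x. h x * (rho x * s n x)) - (LB x. h x * (rho x * f x))) ----> 0"
   by (rule Lim_null_comparison[OF _ r0]) (use cl[OF hm ha] in \<open>auto intro!: always_eventually\<close>)
  hence "(%n. LB x. h x * (rho x * s n x)) ----> (LB x. h x * (rho x * f x))" by (simp add: LIM_zero_iff)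
  thus ?case
   by (rule ess_lim0_tendsto_unif[OF lim.IH _ r0]) (rule cl[OF gs Ca])
 qed
 have "ess_lim0 (?t1 f) (LB x. h x * f x)" if f: "L1 f" for f
 proof -
  have eq: "rho x * (f x / rho x) = f x" for x using rho(1)[of x] by simp
  have [measurable]: "f \<in> Borel" using f by auto
  have m: "(%x. f x / rho x) \<in> Borel" by measurable
  have "integrable ?mu (%x. f x / rho x)" using f by (simp only: imu[OF m] eq)
  from step[OF this] show ?thesis unfolding eq .
 qed
 hence "weak_trace g h" unfolding weak_trace_def using g hm Ca ha by blast
 thus ?thesis by blast
qed

lemma weak_traceD:
 assumes "weak_trace g h"
 shows "g \<in> Borel" "h \<in> Borel" "\<exists>C. \<forall>z. \<bar>g z\<bar> <= C" "\<exists>C. \<forall>x. \<bar>h x\<bar> <= C"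
  "!!f. L1 f ==> ess_lim0 (%t. LB x. g (t, x) * f x) (LB x. h x * f x)"
 using assms unfolding weak_trace_def by blast+

lemma weak_trace_const: "weak_trace (%z. c) (%x. c)"
 unfolding weak_trace_def by (auto simp: ess_lim0_const)

lemma weak_trace_add:
 assumes "weak_trace g h" "weak_trace g' h'"
 shows "weak_trace (%z. g z + g' z) (%x. h x + h' x)"
proof -
 note d = weak_traceD[OF assms(1)] and d' = weak_traceD[OF assms(2)]
 obtain C C' where C: "!!z. \<bar>g z\<bar> <= C" "!!z. \<bar>g' z\<bar> <= C'" using d(3) d'(3) by blast
 obtain K K' where K: "!!z. \<bar>h z\<bar> <= K" "!!z. \<bar>h' z\<bar> <= K'" using d(4) d'(4) by blast
 have 1: "(%z. g z + g' z) \<in> Borel" "(%x. h x + h' x) \<in> Borel"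
  using d(1,2) d'(1,2) by (auto intro: borel_measurable_add)
 have 2: "\<bar>g z + g' z\<bar> <= C + C'" "\<bar>h x + h' x\<bar> <= K + K'" for z x
  using C(1)[of z] C(2)[of z] K(1)[of x] K(2)[of x] by linarith+
 have 3: "ess_lim0 (%t. LB x. (g (t, x) + g' (t, x)) * f x) (LB x. (h x + h' x) * f x)" if f: "L1 f" for f
 proof -
  have "(LB x. (g (t, x) + g' (t, x)) * f x) = (LB x. g (t, x) * f x) + (LB x. g' (t, x) * f x)" for t
   unfolding distrib_right
   by (intro integral_add L1_mult(1)[OF f measurable_slice] d d') (rule C)+
  moreover have "(LB x. (h x + h' x) * f x) = (LB x. h x * f x) + (LB x. h' x * f x)"
   unfolding distrib_right
   by (intro integral_add L1_mult(1)[OF f] d d') (rule K)+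
  ultimately show ?thesis using ess_lim0_add[OF d(5)[OF f] d'(5)[OF f]] by simp
 qed
 show ?thesis unfolding weak_trace_def using 1 2 3 by blast
qed

lemma weak_trace_cmult:
 assumes "weak_trace g h"
 shows "weak_trace (%z. c * g z) (%x. c * h x)"
proof -
 note d = weak_traceD[OF assms(1)]
 obtain C K where C: "!!z. \<bar>g z\<bar> <= C" "!!x. \<bar>h x\<bar> <= K" using d(3,4) by blast
 have 1: "(%z. c * g z) \<in> Borel" "(%x. c * h x) \<in> Borel"
  using d(1,2) by (auto intro: borel_measurable_times)
 have 2: "\<bar>c * g z\<bar> <= \<bar>c\<bar> * C" "\<bar>c * h x\<bar> <= \<bar>c\<bar> * K" for z x
  unfolding abs_mult by (intro mult_left_mono C; simp)+
 have 3: "ess_lim0 (%t. LB x. c * g (t, x) * f x) (LB x. c * h x * f x)" if f: "L1 f" for f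
  using ess_lim0_cmult[OF d(5)[OF f], of c] by (simp add: mult.assoc)
 show ?thesis unfolding weak_trace_def using 1 2 3 by blast
qed

lemma weak_trace_diff: "weak_trace g h ==> weak_trace g' h' ==> weak_trace (%z. g z - g' z) (%x. h x - h' x)"
 using weak_trace_add[OF _ weak_trace_cmult[of g' h' "-1"]] by simp

lemma weak_trace_exists:
 fixes g :: "real \<times> 'a::euclidean_space => real"
 assumes g: "g \<in> Borel" and C: "!!z. \<bar>g z\<bar> <= C"
  and lim: "!!psi. test_fun psi ==> \<exists>L. ess_lim0 (%t. LB x. g (t, x) * psi x) L"
 shows "\<exists>h. weak_trace g h"
proof -
 have "\<exists>h. weak_trace (%z. g z + C) h"
 proof (rule weak_trace_exists_nonneg)
  show "(%z. g z + C) \<in> Borel" using g by (intro borel_measurable_add) auto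
  show "0 <= g z + C" "g z + C <= 2 * C" for z using C[of z] by linarith+
  fix psi :: "'a => real" assume psi: "test_fun psi"
  obtain L where L: "ess_lim0 (%t. LB x. g (t, x) * psi x) L" using lim[OF psi] by blast
  note psii = test_fun_integrable[OF psi]
  have "(LB x. (g (t, x) + C) * psi x) = (LB x. g (t, x) * psi x) + (LB x. C * psi x)" for t
   unfolding distrib_right using psii C
   by (intro integral_add L1_mult(1)[OF psii measurable_slice[OF g], where C=C]) auto
  thus "\<exists>L. ess_lim0 (%t. LB x. (g (t, x) + C) * psi x) L"
   using ess_lim0_add[OF L ess_lim0_const] by auto
 qed
 then obtain h where "weak_trace (%z. g z + C) h" ..
 from weak_trace_diff[OF this weak_trace_const[of C]] show ?thesis by auto
qed

section \<open>Balance laws on the half space\<close>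

lemma smooth_snd_comp:
 fixes psi :: "'a::euclidean_space => real"
 assumes "smooth psi"
 shows "smooth (%z :: 'b::euclidean_space \<times> 'a. psi (snd z))"
  and "dd e (%z :: 'b \<times> 'a. psi (snd z)) = (%z. dd (snd e) psi (snd z))"
proof -
 have hd: "((%z :: 'b \<times> 'a. psi (snd z)) has_derivative (%e. dd (snd e) psi (snd z))) (at z)" if "smooth psi" for psi z
  by (rule has_derivative_compose[OF has_derivative_snd[OF has_derivative_ident] has_derivative_dir_deriv[OF smooth_differentiable[OF that]]])
 have dd: "dd e (%z :: 'b \<times> 'a. psi (snd z)) = (%z. dd (snd e) psi (snd z))" if "smooth psi" for psi e
  using dir_deriv_eq[OF hd[OF that]] by blast
 thus "dd e (%z :: 'b \<times> 'a. psi (snd z)) = (%z. dd (snd e) psi (snd z))" using assms by blast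
 have "Ck k (%z :: 'b \<times> 'a. psi (snd z))" if "smooth psi" for k psi
  using that
 proof (induction k arbitrary: psi)
  case 0
  show ?case using continuous_on_compose2[OF smooth_continuous[OF 0] continuous_on_snd[OF continuous_on_id]] by simp
 next
  case (Suc k)
  thus ?case using hd[OF Suc.prems] by (auto simp: dd[OF Suc.prems] differentiable_def intro: smooth_intros)
 qed
 thus "smooth (%z :: 'b \<times> 'a. psi (snd z))" using assms by (simp add: smooth_def)
qed

lemma smooth_fst_comp:
 fixes th :: "real => real"
 assumes "smooth th"
 shows "smooth (%z :: real \<times> 'a::euclidean_space. th (fst z))"
  and "dd e (%z :: real \<times> 'a. th (fst z)) = (%z. fst e * dd 1 th (fst z))" (is ?goalB)
proof -
 have eq: "(1, 0) \<bullet> z + 0 = fst z" for z :: "real \<times> 'a" by (simp add: inner_prod_def)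
 show "smooth (%z :: real \<times> 'a. th (fst z))"
  using smooth_real_comp(1)[OF assms, of "(1, 0) :: real \<times> 'a" 0] by (simp only: eq)
 show ?goalB
  using smooth_real_comp(2)[OF assms, of e "(1, 0) :: real \<times> 'a" 0] by (simp only: eq) (simp add: inner_prod_def)
qed

lemma dir_deriv_tensor:
 assumes "smooth th" "smooth psi"
 shows "dd (a, b) (%z. th (fst z) * psi (snd z)) = (%z. th (fst z) * dd b psi (snd z) + a * dd 1 th (fst z) * psi (snd z))"
 by (subst dir_deriv_mult) (auto intro: smooth_fst_comp smooth_snd_comp assms simp: smooth_fst_comp(2)[OF assms(1)] smooth_snd_comp(2)[OF assms(2)])

lemma test_fun_tensor:
 fixes th :: "real => real" and psi :: "'a::euclidean_space => real"
 assumes "test_fun th" "test_fun psi"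
 shows "test_fun (%z. th (fst z) * psi (snd z))"
proof -
 obtain R R' where R: "!!z. R < norm z ==> th z = 0" "!!z. R' < norm z ==> psi z = 0"
  using assms by (metis test_funE)
 have "th (fst z) * psi (snd z) = 0" if "R + R' < norm z" for z
 proof -
  have "norm z <= norm (fst z) + norm (snd z)" using norm_Pair_le[of "fst z" "snd z"] by simp
  hence "R < norm (fst z) \<or> R' < norm (snd z)" using that by linarith
  thus ?thesis using R by auto
 qed
 thus ?thesis
  unfolding test_fun_def using smooth_mult[OF smooth_fst_comp(1)[OF test_fun_smooth[OF assms(1)]] smooth_snd_comp(1)[OF test_fun_smooth[OF assms(2)]]] by blast
qed

lemma test_functionsI:
 assumes "test_fun phi" "closed S'" "S' \<subseteq> S" "!!z. phi z \<noteq> 0 ==> z \<in> S'"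
 shows "phi \<in> test_functions S"
proof -
 obtain R where R: "0 < R" "!!z. R < norm z ==> phi z = 0" using test_funE[OF assms(1)] by blast
 have "closure {z. phi z \<noteq> 0} \<subseteq> S'" using assms(2,4) by (intro closure_minimal) auto
 moreover have "closure {z. phi z \<noteq> 0} \<subseteq> cball 0 R"
  by (intro closure_minimal) (use R(2) in \<open>force simp: not_less[symmetric]\<close>)+
 hence "compact (closure {z. phi z \<noteq> 0})"
  by (metis bounded_cball bounded_subset compact_eq_bounded_closed closed_closure)
 ultimately show ?thesis using assms(1,3) unfolding test_functions_def test_fun_def smooth_def by blast
qed

text \<open>The two parts of the defect measure are measures on the whole space that charge only the
  half space, so functions that do not vanish at \<open>t = 0\<close> can be integrated directly.
  Finiteness is required on slabs \<open>{0<..T}\<close>, hence up to the boundary.\<close>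

locale balance_law =
 fixes v :: "real \<times> 'a::euclidean_space => real" and F :: "'k::finite => real \<times> 'a => real"
  and B :: "'k => 'k => real \<times> 'a => real" and e :: "'k => 'a" and P N :: "(real \<times> 'a) measure" and C :: real
 assumes vm[measurable]: "v \<in> Borel" and Fm[measurable]: "!!k. F k \<in> Borel"
  and Bm[measurable]: "!!k j. B k j \<in> Borel"
  and vC: "!!z. \<bar>v z\<bar> <= C" and FC: "!!k z. \<bar>F k z\<bar> <= C" and BC: "!!k j z. \<bar>B k j z\<bar> <= C"
  and setsP: "sets P = sets borel" and setsN: "sets N = sets borel"
  and finP: "!!T K. compact K ==> emeasure P ({0<..T} \<times> K) < \<infinity>"
  and finN: "!!T K. compact K ==> emeasure N ({0<..T} \<times> K) < \<infinity>"
  and nullP: "emeasure P (- half_space) = 0" and nullN: "emeasure N (- half_space) = 0"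
  and balance: "!!phi. phi \<in> test_functions half_space ==>
   (LB z. hs z * (v z * dd (1, 0) phi z + (\<Sum>k\<in>UNIV. F k z * dd (0, e k) phi z)
     + (\<Sum>k\<in>UNIV. \<Sum>j\<in>UNIV. B k j z * dd (0, e k) (dd (0, e j) phi) z))) = (LINT z|P. phi z) - (LINT z|N. phi z)"
begin

lemma C_nonneg: "0 <= C" using vC[of undefined] by linarith

definition slab_mass :: "real => real => real" where
 "slab_mass dl R = measure P ({0<..dl} \<times> cball 0 R) + measure N ({0<..dl} \<times> cball 0 R)"

lemma slab_sets: "{0<..dl :: real} \<times> cball (0::'a) R \<in> sets borel"
proof -
 have "{0<..dl} \<times> cball (0::'a) R \<in> sets ((borel :: real measure) \<Otimes>\<^sub>M (borel :: 'a measure))" by (intro pair_measureI) auto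
 thus ?thesis unfolding borel_prod .
qed

lemma slab_mass_nonneg: "0 <= slab_mass dl R" by (simp add: slab_mass_def)

text \<open>The slabs exclude \<open>t = 0\<close> and decrease to the empty set, so finiteness up
  to the boundary forces their mass to 0. Local finiteness in the open half space alone would not
  give this.\<close>

lemma slab_measure_tendsto:
 assumes Q: "sets Q = sets borel" "!!T K. compact K ==> emeasure Q ({0<..T} \<times> K) < \<infinity>"
 shows "(%n. measure Q ({0<..1 / real (Suc n)} \<times> cball (0::'a) R)) ----> 0"
proof -
 have "(%n. measure Q ({0<..1 / real (Suc n)} \<times> cball (0::'a) R)) ----> measure Q (\<Inter>n. {0<..1 / real (Suc n)} \<times> cball (0::'a) R)"
 proof (rule Lim_measure_decseq)
  show "range (%n. {0<..1 / real (Suc n)} \<times> cball (0::'a) R) \<subseteq> sets Q" using slab_sets Q(1) by auto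
  show "decseq (%n. {0<..1 / real (Suc n)} \<times> cball (0::'a) R)"
  proof (rule decseq_SucI)
   show "{0<..1 / real (Suc (Suc n))} \<times> cball (0::'a) R \<subseteq> {0<..1 / real (Suc n)} \<times> cball 0 R" for n
    using frac_le[of 1 1 "real (Suc n)" "real (Suc (Suc n))"] by (auto simp del: of_nat_Suc)
  qed
  show "emeasure Q ({0<..1 / real (Suc n)} \<times> cball (0::'a) R) \<noteq> \<infinity>" for n using Q(2)[of "cball 0 R"] by (simp add: less_top)
 qed
 moreover have "(\<Inter>n. {0<..1 / real (Suc n)} \<times> cball (0::'a) R) = {}"
 proof -
  have "\<exists>n. \<not> (0 < t \<and> t <= 1 / real (Suc n))" for t :: real
   using reals_Archimedean[of t] by (cases "0 < t") (auto simp: inverse_eq_divide not_le)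
  thus ?thesis by fastforce
 qed
 ultimately show ?thesis by simp
qed

lemma slab_mass_small: "0 < eps ==> \<exists>dl>0. slab_mass dl R < eps"
proof -
 assume e: "0 < eps"
 have "(%n. slab_mass (1 / real (Suc n)) R) ----> 0 + 0"
  unfolding slab_mass_def by (intro tendsto_add slab_measure_tendsto setsP setsN finP finN)
 hence "\<forall>\<^sub>F n in sequentially. slab_mass (1 / real (Suc n)) R < eps" using e by (intro order_tendstoD) auto
 then obtain n where "slab_mass (1 / real (Suc n)) R < eps" unfolding eventually_sequentially by blast
 thus ?thesis by (intro exI[of _ "1 / real (Suc n)"]) auto
qed

lemma bounded_slab_integral:
 assumes Q: "sets Q = sets borel" "!!T K. compact K ==> emeasure Q ({0<..T} \<times> K) < \<infinity>" "emeasure Q (- half_space) = 0"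
  and phi: "phi \<in> Borel" "!!z. \<bar>phi z\<bar> <= S" "!!z. phi z \<noteq> 0 ==> 0 < fst z ==> fst z <= dl \<and> norm (snd z) <= R"
 shows "integrable Q phi" "\<bar>LINT z|Q. phi z\<bar> <= S * measure Q ({0<..dl} \<times> cball (0::'a) R)"
proof -
 have S0: "0 <= S" using phi(2)[of undefined] by linarith
 let ?K = "{0<..dl} \<times> cball (0::'a) R"
 have K: "?K \<in> sets Q" using slab_sets Q(1) by auto
 have i: "integrable Q (%z. S * indicator ?K z)"
  using K Q(2)[of "cball 0 R"] by (intro integrable_mult_right integrable_real_indicator) auto
 have m: "phi \<in> borel_measurable Q" using phi(1) measurable_cong_sets[OF Q(1) refl] by blast
 have "- half_space \<in> null_sets Q" using Q by (auto simp: null_sets_def)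
 hence AEh: "AE z in Q. z \<in> half_space" using AE_not_in[of "- half_space" Q] by simp
 hence AE: "AE z in Q. \<bar>phi z\<bar> <= S * indicator ?K z"
 proof eventually_elim
  case (elim z)
  hence "0 < fst z" by (simp add: half_space_eq)
  thus ?case using phi(2)[of z] phi(3)[of z] S0 by (cases "phi z = 0") (auto simp: indicator_def mem_Times_iff dist_norm)
 qed
 show i2: "integrable Q phi"
  by (rule integrable_bound[OF i m]) (use AE in \<open>auto elim!: eventually_mono\<close>)
 have "\<bar>LINT z|Q. phi z\<bar> <= (LINT z|Q. \<bar>phi z\<bar>)" by (rule integral_abs_bound)
 also have "\<dots> <= (LINT z|Q. S * indicator ?K z)" using i2 i AE by (intro integral_mono_AE) auto
 also have "\<dots> = S * measure Q ?K" using K by simp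
 finally show "\<bar>LINT z|Q. phi z\<bar> <= S * measure Q ?K" .
qed

text \<open>For fixed \<open>psi\<close> the equation makes the time derivative of \<open>m\<close>
  a measure. On \<open>(0, dl)\<close> the fluxes contribute at most \<open>dl * (C * D)\<close>,
  all spatial derivatives falling on \<open>psi\<close>, and the defect contributes the mass of a
  slab; both tend to 0 with \<open>dl\<close>.\<close>

lemma weak_trace_ex: "\<exists>h. weak_trace v h"
proof (rule weak_trace_exists[OF vm vC])
 fix psi :: "'a => real" assume psi: "test_fun psi"
 define m where "m t = (LB x. v (t, x) * psi x)" for t
 note psii = test_fun_integrable[OF psi]
 have mm: "m \<in> Borel" unfolding m_def[abs_def] using psii by (intro measurable_slice_integral vm) auto
 have mC: "\<bar>m t\<bar> <= C * (LB x. \<bar>psi x\<bar>)" for t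
  unfolding m_def by (rule L1_mult(2)[OF psii measurable_slice[OF vm] vC])
 obtain R where R: "0 < R" "!!x. R < norm x ==> psi x = 0" using test_funE[OF psi] by blast
 obtain C1 where C1: "0 < C1" "!!x. \<bar>psi x\<bar> <= C1" using test_fun_bounded[OF psi] by blast
 define D where "D = (\<Sum>k\<in>UNIV. LB x. \<bar>dd (e k) psi x\<bar>) + (\<Sum>k\<in>UNIV. \<Sum>j\<in>UNIV. LB x. \<bar>dd (e k) (dd (e j) psi) x\<bar>)"
 have D0: "0 <= D" unfolding D_def by (intro add_nonneg_nonneg sum_nonneg) auto
 have key: "deriv_bound m dl (dl * (C * D) + C1 * slab_mass dl R)" if dl: "0 < dl" for dl
  unfolding deriv_bound_def
 proof (intro allI impI)
  fix th :: "real => real" and a b S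
  assume th: "test_fun th" "0 < a" "b < dl" "\<forall>t. th t \<noteq> 0 --> a <= t \<and> t <= b" "\<forall>t. \<bar>th t\<bar> <= S"
  have S0: "0 <= S" using th(5) abs_ge_zero order_trans by blast
  note ths = test_fun_smooth[OF th(1)] and psis = test_fun_smooth[OF psi]
  let ?phi = "%z. th (fst z) * psi (snd z)"
  have phit: "test_fun ?phi" by (rule test_fun_tensor[OF th(1) psi])
  have "closed {z :: real \<times> 'a. a <= fst z}" by (intro closed_Collect_le continuous_intros)
  hence phitest: "?phi \<in> test_functions half_space"
   by (rule test_functionsI[OF phit]) (use th(2,4) in \<open>auto simp: half_space_eq\<close>)
  have d1: "dd (1, 0) ?phi z = th (fst z) * dd 0 psi (snd z) + dd 1 th (fst z) * psi (snd z)" for z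
   by (simp add: dir_deriv_tensor[OF ths psis])
  have z0: "dd 0 psi x = 0" for x
   using linear_0[OF dir_deriv_linear[OF smooth_differentiable[OF psis, of x]]] .
  have d2: "dd (0, y) ?phi = (%z. th (fst z) * dd y psi (snd z))" for y
   by (simp add: dir_deriv_tensor[OF ths psis])
  have d3: "dd (0, y) (dd (0, y') ?phi) = (%z. th (fst z) * dd y (dd y' psi) (snd z))" for y y'
   unfolding d2 by (simp add: dir_deriv_tensor[OF ths smooth_dir_deriv[OF psis]])
  have td: "test_fun (%z. th (fst z) * psi' (snd z))" "test_fun (%z. dd 1 th (fst z) * psi' (snd z))" if "test_fun psi'" for psi' :: "'a => real"
   by (intro test_fun_tensor th(1) test_fun_dir_deriv that)+
  have hb: "\<bar>hs z * w z\<bar> <= C" if "!!z. \<bar>w z\<bar> <= C" for w and z :: "real \<times> 'a"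
   using that[of z] C_nonneg by (auto simp: indicator_def)
  have intg: "L1 (%z. hs z * w z * (th' (fst z) * psi' (snd z)))"
   if "test_fun (%z. th' (fst z) * psi' (snd z))" "w \<in> Borel" "!!z. \<bar>w z\<bar> <= C" for w th' and psi' :: "'a => real"

  proof (rule L1_mult(1)[OF test_fun_integrable[OF that(1)]])
   show "(%z. hs z * w z) \<in> Borel"
    using that(2) half_space_borel by (intro borel_measurable_times borel_measurable_indicator) auto
   show "\<bar>hs z * w z\<bar> <= C" for z by (rule hb) (rule that(3))
  qed
  define I1 where "I1 = (LB z. hs z * v z * (dd 1 th (fst z) * psi (snd z)))"
  define I2 where "I2 k = (LB z. hs z * F k z * (th (fst z) * dd (e k) psi (snd z)))" for k
  define I3 where "I3 k j = (LB z. hs z * B k j z * (th (fst z) * dd (e k) (dd (e j) psi) (snd z)))" for k j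
  have "(LB z. hs z * (v z * dd (1, 0) ?phi z + (\<Sum>k\<in>UNIV. F k z * dd (0, e k) ?phi z)
     + (\<Sum>k\<in>UNIV. \<Sum>j\<in>UNIV. B k j z * dd (0, e k) (dd (0, e j) ?phi) z))) =
   (LB z. hs z * v z * (dd 1 th (fst z) * psi (snd z)) + (\<Sum>k\<in>UNIV. hs z * F k z * (th (fst z) * dd (e k) psi (snd z)))
     + (\<Sum>k\<in>UNIV. \<Sum>j\<in>UNIV. hs z * B k j z * (th (fst z) * dd (e k) (dd (e j) psi) (snd z))))"
   unfolding d1 d3 unfolding d2 z0 by (intro integral_cong refl) (simp add: distrib_left sum_distrib_left mult.assoc)
  also have "\<dots> = I1 + (\<Sum>k\<in>UNIV. I2 k) + (\<Sum>k\<in>UNIV. \<Sum>j\<in>UNIV. I3 k j)"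
   unfolding I1_def I2_def I3_def
   using intg[OF td(2)[OF psi] vm vC] intg[OF td(1)[OF test_fun_dir_deriv[OF psi]] Fm FC] intg[OF td(1)[OF test_fun_dir_deriv[OF test_fun_dir_deriv[OF psi]]] Bm BC]
   by (simp add: integral_add integral_sum)
  finally have I1: "I1 = (LINT z|P. ?phi z) - (LINT z|N. ?phi z) - (\<Sum>k\<in>UNIV. I2 k) - (\<Sum>k\<in>UNIV. \<Sum>j\<in>UNIV. I3 k j)"
   using balance[OF phitest] by simp
  have Ib: "\<bar>LB z. hs z * w z * (th (fst z) * psi' (snd z))\<bar> <= C * (dl * S * (LB x. \<bar>psi' x\<bar>))"
   if psi': "test_fun psi'" and w: "w \<in> Borel" "!!z. \<bar>w z\<bar> <= C" for w and psi' :: "'a => real"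
  proof -
   have "\<bar>LB z. hs z * w z * (th (fst z) * psi' (snd z))\<bar> <= C * (LB z. \<bar>th (fst z) * psi' (snd z)\<bar>)"
    using w by (intro L1_mult(2)[where C=C] test_fun_integrable td psi' hb) measurable
   also have "(LB z. \<bar>th (fst z) * psi' (snd z)\<bar>) = (LB t. LB x. \<bar>th t * psi' x\<bar>)"
    using lborel_integral_prod(2)[OF integrable_abs[OF test_fun_integrable[OF td(1)[OF psi']]]] by simp
   also have "\<dots> = (LB t. \<bar>th t\<bar>) * (LB x. \<bar>psi' x\<bar>)"
    by (simp add: abs_mult)
   also have "\<dots> <= (dl * S) * (LB x. \<bar>psi' x\<bar>)"
   proof (intro mult_right_mono)
    have "(LB t. \<bar>th t\<bar>) <= (LB t. S * indicator {0..dl} t)"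
    proof (rule integral_mono)
     show "\<bar>th t\<bar> <= S * indicator {0..dl} t" for t
      using th(2-5) S0 by (cases "th t = 0") (force simp: indicator_def)+
    qed (use test_fun_integrable[OF th(1)] dl in \<open>auto intro!: integrable_mult_right integrable_real_indicator\<close>)
    thus "(LB t. \<bar>th t\<bar>) <= dl * S" using dl by (simp add: mult.commute)
   qed auto
   finally show ?thesis using C_nonneg by (simp add: mult_left_mono)
  qed
  have "\<bar>I1\<bar> <= C1 * S * measure P ({0<..dl} \<times> cball 0 R) + C1 * S * measure N ({0<..dl} \<times> cball 0 R)
    + (\<Sum>k\<in>UNIV. C * (dl * S * (LB x. \<bar>dd (e k) psi x\<bar>)))
    + (\<Sum>k\<in>UNIV. \<Sum>j\<in>UNIV. C * (dl * S * (LB x. \<bar>dd (e k) (dd (e j) psi) x\<bar>)))"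
  proof -
   have phib: "\<bar>?phi z\<bar> <= C1 * S" for z
    unfolding abs_mult mult.commute[of C1] using th(5) C1(2) S0 by (intro mult_mono) auto
   have phisupp: "fst z <= dl \<and> norm (snd z) <= R" if "?phi z \<noteq> 0" for z
    using that th(3,4) R(2)[of "snd z"] by (force simp: not_le[symmetric])
   note phim = bsupp_measurable[OF test_fun_bsupp[OF phit]]
   have p: "\<bar>LINT z|P. ?phi z\<bar> <= C1 * S * measure P ({0<..dl} \<times> cball 0 R)"
    by (rule bounded_slab_integral(2)[OF setsP finP nullP phim phib phisupp])
   have n: "\<bar>LINT z|N. ?phi z\<bar> <= C1 * S * measure N ({0<..dl} \<times> cball 0 R)"
    by (rule bounded_slab_integral(2)[OF setsN finN nullN phim phib phisupp])
   have s2: "\<bar>\<Sum>k\<in>UNIV. I2 k\<bar> <= (\<Sum>k\<in>UNIV. C * (dl * S * (LB x. \<bar>dd (e k) psi x\<bar>)))"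
    unfolding I2_def by (intro order_trans[OF sum_abs] sum_mono Ib test_fun_dir_deriv psi Fm FC)
   have s3: "\<bar>\<Sum>k\<in>UNIV. \<Sum>j\<in>UNIV. I3 k j\<bar> <= (\<Sum>k\<in>UNIV. \<Sum>j\<in>UNIV. C * (dl * S * (LB x. \<bar>dd (e k) (dd (e j) psi) x\<bar>)))"
    unfolding I3_def by (intro order_trans[OF sum_abs] sum_mono Ib test_fun_dir_deriv psi Bm BC)
   show ?thesis using I1 p n s2 s3 by linarith
  qed
  also have "\<dots> = (dl * (C * D) + C1 * slab_mass dl R) * S"
   unfolding D_def slab_mass_def by (simp add: sum_distrib_left[symmetric] distrib_left distrib_right mult_ac)
  finally have le: "\<bar>I1\<bar> <= (dl * (C * D) + C1 * slab_mass dl R) * S" .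
  have "I1 = (LB t. dd 1 th t * m t)"
  proof -
   have t0: "dd 1 th t = 0" if "t <= 0" for t
   proof (rule dir_deriv_zero[of "{..<a}"])
    show "th z = 0" if "z \<in> {..<a}" for z using that th(4) by force
   qed (use that th(2) in auto)
   have "I1 = (LB t. LB x. hs (t, x) * v (t, x) * (dd 1 th t * psi x))"
    unfolding I1_def using lborel_integral_prod(2)[OF intg[OF td(2)[OF psi] vm vC]] by simp
   also have "\<dots> = (LB t. LB x. dd 1 th t * (v (t, x) * psi x))"
    using t0 by (intro integral_cong refl) (auto simp: half_space_eq indicator_def not_less)
   also have "\<dots> = (LB t. dd 1 th t * m t)" by (simp add: m_def)
   finally show ?thesis .
  qed
  thus "\<bar>LB t. dd 1 th t * m t\<bar> <= (dl * (C * D) + C1 * slab_mass dl R) * S" using le by simp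
 qed
 show "\<exists>L. ess_lim0 (%t. LB x. v (t, x) * psi x) L"
  unfolding m_def[symmetric]
 proof (rule deriv_bound_ess_lim0[OF mm mC])
  fix eps :: real assume eps: "0 < eps"
  have "0 < eps / (2 * C1)" using eps C1 by simp
  then obtain dl1 where dl1: "0 < dl1" "slab_mass dl1 R < eps / (2 * C1)" using slab_mass_small by blast
  define dl where "dl = min dl1 (eps / (2 * (C * D + 1)))"
  have CD: "0 <= C * D" using C_nonneg D0 by simp
  have dl: "0 < dl" "dl <= dl1" "dl <= eps / (2 * (C * D + 1))" using dl1 eps CD by (auto simp: dl_def)
  have "slab_mass dl R <= slab_mass dl1 R"
   unfolding slab_mass_def
  proof (intro add_mono measure_mono_fmeasurable)
   show "{0<..dl1} \<times> cball 0 R \<in> fmeasurable P" "{0<..dl1} \<times> cball 0 R \<in> fmeasurable N"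
    using finP[of "cball 0 R"] finN[of "cball 0 R"] slab_sets setsP setsN by (auto simp: fmeasurable_def)
  qed (use dl slab_sets setsP setsN in auto)
  hence "C1 * slab_mass dl R <= eps / 2" using dl1(2) C1 mult_left_mono[of "slab_mass dl R" "eps / (2 * C1)" C1] by simp
  moreover have "dl * (C * D) <= eps / 2"
  proof -
   have "dl * (C * D) <= eps / (2 * (C * D + 1)) * (C * D)" using dl(3) CD by (intro mult_right_mono) auto
   also have "\<dots> <= eps / 2" using CD eps by (simp add: field_simps)
   finally show ?thesis .
  qed
  ultimately have "dl * (C * D) + C1 * slab_mass dl R <= eps" by simp
  moreover have "0 <= dl * (C * D) + C1 * slab_mass dl R"
   using dl C_nonneg D0 C1 slab_mass_nonneg by (intro add_nonneg_nonneg mult_nonneg_nonneg) auto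
  ultimately show "\<exists>dl>0. \<exists>K\<ge>0. K <= eps \<and> deriv_bound m dl K" using key[OF dl(1)] dl(1) by blast
 qed
qed

end

section \<open>Kernels concentrating at time zero\<close>

lemma ess_lim0_modify:
 assumes "ess_lim0 m L" and m[measurable]: "m \<in> Borel" and C: "!!t. \<bar>m t\<bar> <= C"
 obtains m' where "m' \<in> Borel" "!!t. \<bar>m' t\<bar> <= C + \<bar>L\<bar>" "AE t in lborel. m' t = m t"
  "(m' \<longlongrightarrow> L) (at_right 0)"
proof -
 have "\<exists>dl. \<forall>n. 0 < dl n \<and> (AE t in lborel. 0 < t \<and> t < dl n --> \<bar>m t - L\<bar> < 1 / real (Suc n))"
  by (rule choice) (use assms(1) in \<open>auto simp: ess_lim0_def simp del: of_nat_Suc\<close>)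
 then obtain dl where dl: "!!n. 0 < dl n" "!!n. AE t in lborel. 0 < t \<and> t < dl n --> \<bar>m t - L\<bar> < 1 / real (Suc n)" by blast
 define m' where "m' t = (if \<forall>n. 0 < t \<and> t < dl n --> \<bar>m t - L\<bar> < 1 / real (Suc n) then m t else L)" for t
 have "m' \<in> Borel" unfolding m'_def[abs_def] by measurable
 moreover have "\<bar>m' t\<bar> <= C + \<bar>L\<bar>" for t using C[of t] C[of 0] by (auto simp: m'_def)
 moreover have "AE t in lborel. \<forall>n. 0 < t \<and> t < dl n --> \<bar>m t - L\<bar> < 1 / real (Suc n)"
  unfolding AE_all_countable using dl(2) by blast
 hence "AE t in lborel. m' t = m t" by eventually_elim (simp add: m'_def)
 moreover have "(m' \<longlongrightarrow> L) (at_right 0)"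
 proof (rule tendstoI)
  fix eps :: real assume "0 < eps"
  then obtain n where n: "1 / real (Suc n) < eps" using nat_approx_posE by blast
  have "\<forall>\<^sub>F t in at_right 0. t \<in> {0<..<dl n}" by (rule eventually_at_right_real[OF dl(1)])
  thus "\<forall>\<^sub>F t in at_right 0. dist (m' t) L < eps"
  proof eventually_elim
   case (elim t)
   hence "\<bar>m' t - L\<bar> < eps" using n \<open>0 < eps\<close> by (auto simp: m'_def simp del: of_nat_Suc dest: spec[of _ n])
   thus ?case by (simp add: dist_real_def)
  qed
 qed
 ultimately show ?thesis using that by blast
qed

text \<open>A change on a null set turns the essential limit into a limit. After the substitution
  \<open>t = T * s\<close> the integrand converges pointwise and is dominated by a multiple of
  \<open>k\<close>.\<close>

lemma ess_lim0_kernel: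
 assumes lim: "ess_lim0 m L" and m: "m \<in> Borel" "!!t. \<bar>m t\<bar> <= C"
  and k: "L1 k" "!!t. t <= 0 ==> k t = 0"
 shows "((%T. (LB t. k (t / T) * m t) / T) \<longlongrightarrow> (LB t. k t) * L) (at_right 0)"
proof -
 obtain m' where m'[measurable]: "m' \<in> Borel" and b: "!!t. \<bar>m' t\<bar> <= C + \<bar>L\<bar>"
  and ae: "AE t in lborel. m' t = m t" and l: "(m' \<longlongrightarrow> L) (at_right 0)"
  using ess_lim0_modify[OF lim m] by blast
 have [measurable]: "k \<in> Borel" "m \<in> Borel" using k(1) m(1) by auto
 have eq: "(LB t. k (t / T) * m t) / T = (LB s. k s * m' (T * s))" if T: "0 < T" for T
 proof -
  have "(LB t. k (t / T) * m t) = (LB t. k (t / T) * m' t)"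
   using ae by (intro integral_cong_AE) auto
  also have "\<dots> = \<bar>T\<bar> *\<^sub>R (LB s. k ((0 + T * s) / T) * m' (0 + T * s))"
   using T by (intro lborel_integral_real_affine) auto
  finally show ?thesis using T by simp
 qed
 have "((%T. LB s. k s * m' (T * s)) \<longlongrightarrow> (LB t. k t * L)) (at_right 0)"
 proof (rule tendsto_at_right_sequentially[of 0 1])
  fix X :: "nat => real" assume X: "!!n. 0 < X n" "X ----> 0"
  show "(%n. LB s. k s * m' (X n * s)) ----> (LB t. k t * L)"
  proof (rule integral_dominated_convergence[where w="%s. (C + \<bar>L\<bar>) * \<bar>k s\<bar>"])
   show "AE s in lborel. (%n. k s * m' (X n * s)) ----> k s * L"
   proof (rule AE_I2)
    fix s
    show "(%n. k s * m' (X n * s)) ----> k s * L"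
    proof (cases "s <= 0")
     case False
     have "(%n. X n * s) ----> 0" using tendsto_mult_left_zero[OF X(2)] .
     moreover have "0 < X n * s" for n using X(1)[of n] False by simp
     hence "\<forall>\<^sub>F n in sequentially. X n * s \<in> {0<..} \<and> X n * s \<noteq> 0"
      by (intro always_eventually allI conjI) (simp, metis less_irrefl)
     ultimately have "filterlim (%n. X n * s) (at_right 0) sequentially" by (simp only: filterlim_at)
     from filterlim_compose[OF l this] show ?thesis by (intro tendsto_mult[OF tendsto_const])
    qed (simp add: k(2))
   qed
   show "AE s in lborel. norm (k s * m' (X n * s)) <= (C + \<bar>L\<bar>) * \<bar>k s\<bar>" for n
    using b by (auto simp: abs_mult mult.commute[of "\<bar>k _\<bar>"] intro!: mult_right_mono)
  qed (use k(1) in auto)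
 qed auto
 hence lim': "((%T. LB s. k s * m' (T * s)) \<longlongrightarrow> (LB t. k t) * L) (at_right 0)" by simp
 have ev: "EV T. (LB s. k s * m' (T * s)) = (LB t. k (t / T) * m t) / T"
  unfolding eventually_at_filter using eq by auto
 show ?thesis by (rule Lim_transform_eventually[OF lim' ev])
qed

text \<open>The cutoff \<open>flat_exp (n * t - 1)\<close> vanishes for \<open>t \<le> 1 / n\<close>
  and tends to 1 for positive \<open>t\<close>. Its time derivative is a rescaled probability
  density, which brings it into the scope of \<open>ess_lim0_kernel\<close>.\<close>

lemma flat_exp_deriv:
 shows "dd 1 flat_exp t \<ge> 0" "t < 0 ==> dd 1 flat_exp t = 0"
  "L1 (%t. dd 1 flat_exp (t - 1))" "(LB t. dd 1 flat_exp (t - 1)) = 1" (is ?goalD)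
proof -
 let ?t1 = "\<integral>\<^sup>+ t. ennreal (dd 1 flat_exp (t - 1)) \<partial>lborel"
 note d = smooth_real_deriv[OF smooth_flat_exp]
 have m: "mono_on UNIV flat_exp" by (auto intro!: mono_onI mono_flat_exp)
 show nn: "dd 1 flat_exp t \<ge> 0" for t using mono_on_imp_deriv_nonneg[OF m d] by auto
 show z: "t < 0 ==> dd 1 flat_exp t = 0" for t
  by (rule dir_deriv_zero[of "{..<0}"]) (auto simp: flat_exp_bounds)
 have [measurable]: "dd 1 flat_exp \<in> Borel"
  by (intro smooth_measurable smooth_dir_deriv smooth_flat_exp)
 have lim: "((%t. flat_exp (t - 1)) \<longlongrightarrow> 1) at_top"
 proof -
  have "((%t::real. exp (- inverse (t - 1))) \<longlongrightarrow> exp (- 0)) at_top"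
  proof (intro tendsto_exp tendsto_minus filterlim_compose[OF tendsto_inverse_0_at_top[OF filterlim_ident]])
   show "filterlim (%t::real. t - 1) at_top at_top"
    using filterlim_tendsto_add_at_top[OF tendsto_const[of "-1::real"] filterlim_ident] by (simp add: algebra_simps)
  qed
  moreover have "\<forall>\<^sub>F t::real in at_top. exp (- inverse (t - 1)) = flat_exp (t - 1)"
   using eventually_gt_at_top[of 1] by eventually_elim (simp add: flat_exp_def divide_inverse)
  ultimately show ?thesis using Lim_transform_eventually by fastforce
 qed
 have "?t1 = (\<integral>\<^sup>+ t. ennreal (dd 1 flat_exp (t - 1)) * indicator {0..} t \<partial>lborel)"
  by (intro nn_integral_cong) (auto simp: indicator_def z)
 also have "\<dots> = 1 - flat_exp (0 - 1)"
  by (rule nn_integral_FTC_atLeast[OF _ _ _ lim])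
   (auto intro!: DERIV_chain2[OF d, where Db=1, simplified] derivative_eq_intros nn)
 finally have *: "?t1 = 1" by (simp add: flat_exp_bounds)
 show i: "L1 (%t. dd 1 flat_exp (t - 1))"
  by (rule integrableI_nonneg) (use * nn in auto)
 show ?goalD
  using * nn by (subst integral_eq_nn_integral) auto
qed

text \<open>The time dependence of the test function costs a multiple of
  \<open>\<bar>t\<bar>\<close>, uniformly in \<open>x\<close> on its support, and this disappears in
  the limit; only the values at \<open>t = 0\<close> meet the trace.\<close>

lemma weak_trace_test_fun:
 fixes Ps :: "real \<times> 'a::euclidean_space => real"
 assumes h: "weak_trace g h" and Ps: "test_fun Ps"
 shows "ess_lim0 (%t. LB x. g (t, x) * Ps (t, x)) (LB x. h x * Ps (0, x))"
proof -
 note d = weak_traceD[OF h]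
 obtain C where C: "!!z. \<bar>g z\<bar> <= C" using d(3) by blast
 have C0: "0 <= C" using C[of undefined] by linarith
 obtain R where R: "0 < R" "!!z. R < norm z ==> Ps z = 0" using test_funE[OF Ps] by blast
 obtain K where K: "0 < K" "!!z. \<bar>dd (1, 0) Ps z\<bar> <= K"
  using test_fun_bounded[OF test_fun_dir_deriv[OF Ps]] by blast
 have slice0: "Ps (t, x) = 0" if "R < norm x" for t x
  using that norm_snd_le[of x t] by (intro R(2)) auto
 have Lip: "\<bar>Ps (t, x) - Ps (0, x)\<bar> <= K * indicator (cball 0 R) x * \<bar>t\<bar>" for t x
 proof (cases "norm x <= R")
  case True
  have "norm (Ps (t, x) - Ps (0, x)) <= K * norm (t - 0)"
   by (rule field_differentiable_bound[OF convex_UNIV])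
    (use K(2) in \<open>auto intro: test_fun_slice_t[OF test_fun_smooth[OF Ps]]\<close>)
  thus ?thesis using True by simp
 qed (use slice0 in auto)
 have sl: "bsupp (%x. Ps (t, x))" for t
 proof -
  have "(%x. Ps (t, x)) \<in> Borel" by (intro measurable_slice smooth_measurable test_fun_smooth Ps)
  moreover obtain B where "!!z. \<bar>Ps z\<bar> <= B" using test_fun_bounded[OF Ps] by blast
  ultimately show ?thesis unfolding bsupp_def using slice0 by blast
 qed
 have gi: "L1 (%x. g (t, x) * Ps (s, x))" for t s
  by (rule L1_mult(1)[OF bsupp_integrable[OF sl] measurable_slice[OF d(1)] C])
 define D where "D t = (LB x. g (t, x) * Ps (t, x)) - (LB x. g (t, x) * Ps (0, x))" for t
 have Db: "\<bar>D t\<bar> <= C * (K * measure lborel (cball (0::'a) R)) * \<bar>t\<bar>" for t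
 proof -
  have Dt: "D t = (LB x. g (t, x) * (Ps (t, x) - Ps (0, x)))"
   unfolding D_def by (subst integral_diff[symmetric]) (auto simp: gi right_diff_distrib)
  have "\<bar>D t\<bar> <= C * (LB x. \<bar>Ps (t, x) - Ps (0, x)\<bar>)"
   unfolding Dt by (rule L1_mult(2)[OF bsupp_integrable[OF bsupp_diff[OF sl sl]] measurable_slice[OF d(1)] C])
  also have "\<dots> <= C * (LB x. K * indicator (cball (0::'a) R) x * \<bar>t\<bar>)"
  proof (intro mult_left_mono[OF integral_mono C0])
   show "L1 (%x::'a. K * indicator (cball (0::'a) R) x * \<bar>t\<bar>)"
    by (intro integrable_mult_left integrable_mult_right integrable_real_indicator emeasure_bounded_finite) auto
  qed (use Lip bsupp_integrable[OF bsupp_abs[OF bsupp_diff[OF sl sl]]] in blast)+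
  also have "\<dots> = C * (K * measure lborel (cball (0::'a) R)) * \<bar>t\<bar>" by simp
  finally show ?thesis .
 qed
 have D0: "(D \<longlongrightarrow> 0) (at_right 0)"
 proof (rule Lim_null_comparison[where g="%t. C * (K * measure lborel (cball (0::'a) R)) * \<bar>t\<bar>"])
  show "((%t. C * (K * measure lborel (cball (0::'a) R)) * \<bar>t\<bar>) \<longlongrightarrow> 0) (at_right 0)"
   by (rule tendsto_mult_right_zero) (rule tendsto_rabs_zero, rule tendsto_ident_at)
 qed (use Db in simp)
 from ess_lim0_add[OF d(5)[OF bsupp_integrable[OF sl[of 0]]] ess_lim0_tendsto[OF D0]]
 show ?thesis by (simp add: D_def)
qed

section \<open>The law for test functions that reach the boundary\<close>

context balance_law
begin

text \<open>The product of \<open>Ps\<close> with a cutoff in time is admissible. Spatial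
  derivatives do not see the cutoff, while the time derivative that falls on it is a kernel
  concentrating at \<open>t = 0\<close> and leaves the trace term.\<close>

theorem level_equation:
 assumes h: "weak_trace v h" and Ps: "test_fun Ps"
 shows "(LB z. hs z * (v z * dd (1, 0) Ps z + (\<Sum>k\<in>UNIV. F k z * dd (0, e k) Ps z)
     + (\<Sum>k\<in>UNIV. \<Sum>j\<in>UNIV. B k j z * dd (0, e k) (dd (0, e j) Ps) z)))
   = (LINT z|P. Ps z) - (LINT z|N. Ps z) - (LB x. h x * Ps (0, x))"
proof -
 define Q where "Q Ps z = v z * dd (1, 0) Ps z + (\<Sum>k\<in>UNIV. F k z * dd (0, e k) Ps z)
     + (\<Sum>k\<in>UNIV. \<Sum>j\<in>UNIV. B k j z * dd (0, e k) (dd (0, e j) Ps) z)" for Ps z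
 define th where "th n z = flat_exp ((real n, 0) \<bullet> z + - 1)" for n :: nat and z :: "real \<times> 'a"
 have th: "th n z = flat_exp (real n * fst z - 1)" for n z by (simp add: th_def inner_prod_def)
 define th' where "th' n z = real n * dd 1 flat_exp (real n * fst z - 1)" for n :: nat and z :: "real \<times> 'a"
 have sm: "smooth (th n)" for n unfolding th_def[abs_def] by (rule smooth_real_comp(1)[OF smooth_flat_exp])
 have dd: "dd (a, b) (th n) = (%z. a * th' n z)" for a b n
  unfolding th_def[abs_def] smooth_real_comp(2)[OF smooth_flat_exp] by (simp add: th'_def inner_prod_def mult_ac)
 note Pss = test_fun_smooth[OF Ps]
 have dt: "dd (1, 0) (%z. th n z * Ps z) = (%z. th n z * dd (1, 0) Ps z + th' n z * Ps z)" for n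
  by (subst dir_deriv_mult) (auto simp: dd sm Pss)
 have dx: "dd (0, y) (%z. th n z * phi z) = (%z. th n z * dd (0, y) phi z)" if "smooth phi" for n y phi
  by (subst dir_deriv_mult) (auto simp: dd sm that)
 have Q: "Q (%z. th n z * Ps z) z = th n z * Q Ps z + v z * (th' n z * Ps z)" for n z
  unfolding Q_def dt dx[OF Pss] dx[OF smooth_dir_deriv[OF Pss]]
  by (simp add: distrib_left sum_distrib_left mult_ac)
 have tPs: "test_fun (%z. th n z * Ps z)" for n by (rule test_fun_mult2[OF Ps sm])
 have hb: "\<bar>hs z * w z\<bar> <= C" if "!!z. \<bar>w z\<bar> <= C" for w and z :: "real \<times> 'a"
  using that[of z] C_nonneg by (auto simp: indicator_def)
 have bi: "L1 (%z. w z * phi z)"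
  if "test_fun phi" "w \<in> Borel" "!!z. \<bar>w z\<bar> <= C" for w and phi :: "real \<times> 'a => real"
  by (rule L1_mult(1)[OF test_fun_integrable[OF that(1)] that(2,3)])
 have Qi: "L1 (Q phi)" if "test_fun phi" for phi
  unfolding Q_def[abs_def]
  by (intro integrable_add integrable_sum bi test_fun_dir_deriv that vm Fm Bm vC FC BC)
 have indi: "L1 (%z. hs z * q z)" if "L1 q" for q :: "real \<times> 'a => real"
  by (rule L1_mult(1)[OF that, of _ 1]) (auto simp: half_space_borel)
 have tlim: "(%n. th n z) ----> 1" if "z \<in> half_space" for z
  using flat_exp_tendsto_1[of "fst z"] that by (simp add: th half_space_eq)
 have thmm[measurable]: "th n \<in> Borel" for n by (rule smooth_measurable[OF sm])
 have thb: "0 <= th n z" "th n z <= 1" for n z by (auto simp: th flat_exp_bounds)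
 have lim1: "(%n. LB z. hs z * (th n z * Q Ps z)) ----> (LB z. hs z * Q Ps z)"
 proof (rule integral_dominated_convergence[where w="%z. \<bar>Q Ps z\<bar>"])
  have [measurable]: "Q Ps \<in> Borel" using Qi[OF Ps] by auto
  show "(%z. hs z * Q Ps z) \<in> borel_measurable lborel"
   "!!n. (%z. hs z * (th n z * Q Ps z)) \<in> borel_measurable lborel" by measurable
  show "AE z in lborel. (%n. hs z * (th n z * Q Ps z)) ----> hs z * Q Ps z"
  proof (rule AE_I2)
   fix z
   show "(%n. hs z * (th n z * Q Ps z)) ----> hs z * Q Ps z"
    using tendsto_mult[OF tlim[of z] tendsto_const[of "Q Ps z"]] by (cases "z \<in> half_space") auto
  qed
  show "AE z in lborel. norm (hs z * (th n z * Q Ps z)) <= \<bar>Q Ps z\<bar>" for n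
   using thb[of n] by (auto simp: abs_mult indicator_def intro!: mult_left_le_one_le)
 qed (use Qi[OF Ps] in auto)
 obtain R where R: "0 < R" "!!z. R < norm z ==> Ps z = 0" using test_funE[OF Ps] by blast
 obtain S where S: "0 < S" "!!z. \<bar>Ps z\<bar> <= S" using test_fun_bounded[OF Ps] by blast
 have Pssupp: "fst z <= R \<and> norm (snd z) <= R" if "Ps z \<noteq> 0" for z
  using that R(2)[of z] norm_fst_le[of "fst z" "snd z"] norm_snd_le[of "snd z" "fst z"] by fastforce
 have limQ: "(%n. LINT z|Q'. th n z * Ps z) ----> (LINT z|Q'. Ps z)"
  if Q': "sets Q' = sets borel" "!!T K. compact K ==> emeasure Q' ({0<..T} \<times> K) < \<infinity>" "emeasure Q' (- half_space) = 0" for Q'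
 proof -
  have m: "phi \<in> borel_measurable Q'" if "phi \<in> Borel" for phi :: "real \<times> 'a => real"
   using that measurable_cong_sets[OF Q'(1) refl] by blast
  have Psm: "Ps \<in> Borel" by (rule smooth_measurable[OF Pss])
  have i: "integrable Q' Ps" by (rule bounded_slab_integral(1)[OF Q' Psm S(2) Pssupp])
  have "- half_space \<in> null_sets Q'" using Q' by (auto simp: null_sets_def)
  hence AEh: "AE z in Q'. z \<in> half_space" using AE_not_in[of "- half_space" Q'] by simp
  show ?thesis
  proof (rule integral_dominated_convergence[where w="%z. \<bar>Ps z\<bar>"])
   show "AE z in Q'. (%n. th n z * Ps z) ----> Ps z"
    using AEh
   proof eventually_elim
    case (elim z)
    show ?case using tendsto_mult[OF tlim[OF elim] tendsto_const[of "Ps z"]] by simp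
   qed
   show "AE z in Q'. norm (th n z * Ps z) <= \<bar>Ps z\<bar>" for n
    using thb[of n] by (auto simp: abs_mult intro!: mult_left_le_one_le)
   show "Ps \<in> borel_measurable Q'" by (rule m[OF Psm])
   show "(%z. th n z * Ps z) \<in> borel_measurable Q'" for n by (intro m borel_measurable_times thmm Psm)
   show "integrable Q' (%z. \<bar>Ps z\<bar>)" by (rule integrable_abs[OF i])
  qed
 qed
 define m where "m t = (LB x. v (t, x) * Ps (t, x))" for t
 have ml: "ess_lim0 m (LB x. h x * Ps (0, x))" unfolding m_def[abs_def] by (rule weak_trace_test_fun[OF h Ps])
 have mm: "m \<in> Borel"
 proof -
  have "(%z. v z * Ps z) \<in> Borel" using smooth_measurable[OF Pss] by measurable
  from measurable_slice_integral[OF this, of "%_. 1"] show ?thesis by (simp add: m_def[abs_def])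
 qed
 have mb: "\<bar>m t\<bar> <= C * S * measure lborel (cball (0::'a) R)" for t
 proof -
  have sl: "L1 (%x. indicator (cball 0 R) x * Ps (t, x))"
  proof -
   have "L1 (%x. Ps (t, x) * indicator (cball (0::'a) R) x)"
    by (rule L1_mult(1)[OF _ measurable_slice[OF smooth_measurable[OF Pss]] S(2)])
     (auto intro!: integrable_real_indicator emeasure_bounded_finite)
   thus ?thesis by (simp add: mult.commute)
  qed
  have eq: "indicator (cball 0 R) x * Ps (t, x) = Ps (t, x)" for x using Pssupp[of "(t, x)"] by (auto simp: indicator_def)
  have "\<bar>m t\<bar> <= C * (LB x. \<bar>indicator (cball 0 R) x * Ps (t, x)\<bar>)"
   using L1_mult(2)[OF sl measurable_slice[OF vm] vC] by (simp add: m_def eq)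
  also have "\<dots> <= C * (LB x. S * indicator (cball (0::'a) R) x)"
  proof (intro mult_left_mono C_nonneg integral_mono integrable_abs sl)
   show "L1 (%x. S * indicator (cball (0::'a) R) x)"
    by (auto intro!: integrable_mult_right integrable_real_indicator emeasure_bounded_finite)
   show "\<bar>indicator (cball 0 R) x * Ps (t, x)\<bar> <= S * indicator (cball 0 R) x" for x
    using S by (auto simp: indicator_def)
  qed
  finally show ?thesis by (simp add: mult.assoc)
 qed
 have lim2: "(%n. LB z. hs z * (v z * (th' n z * Ps z))) ----> (LB x. h x * Ps (0, x))"
 proof -
  have r: "filterlim (%n. 1 / real (Suc n)) (at_right 0) sequentially"
   using LIMSEQ_Suc[OF lim_1_over_n[where 'a=real]] by (auto simp: filterlim_at simp del: of_nat_Suc)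
  have z: "dd 1 flat_exp (t - 1) = 0" if "t <= 0" for t using that by (intro flat_exp_deriv(2)) auto
  have "(%n. (LB t. dd 1 flat_exp (t / (1 / real (Suc n)) - 1) * m t) / (1 / real (Suc n)))
    ----> (LB t. dd 1 flat_exp (t - 1)) * (LB x. h x * Ps (0, x))"
   by (rule filterlim_compose[OF ess_lim0_kernel[OF ml mm mb flat_exp_deriv(3)] r]) (rule z)
  hence "(%n. LB t. real (Suc n) * dd 1 flat_exp (real (Suc n) * t - 1) * m t) ----> (LB x. h x * Ps (0, x))"
   by (simp only: mult.assoc integral_mult_right_zero) (simp add: flat_exp_deriv(4) mult.commute del: of_nat_Suc)
  moreover have "(LB z. hs z * (v z * (th' n z * Ps z))) = (LB t. real n * dd 1 flat_exp (real n * t - 1) * m t)" for n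
  proof -
   have "L1 (%z. v z * (th n z * dd (1, 0) Ps z + th' n z * Ps z))" "L1 (%z. v z * (th n z * dd (1, 0) Ps z))"
    using bi[OF test_fun_dir_deriv[OF tPs, of "(1, 0)" n] vm vC] bi[OF test_fun_mult2[OF test_fun_dir_deriv[OF Ps] sm] vm vC] by (simp_all add: dt)
   from integrable_diff[OF this] have "L1 (%z. v z * (th' n z * Ps z))" by (simp add: algebra_simps)
   from lborel_integral_prod(2)[OF indi[OF this]]
   have "(LB z. hs z * (v z * (th' n z * Ps z)))
     = (LB t. LB x. hs (t, x) * (v (t, x) * (th' n (t, x) * Ps (t, x))))" .
   also have "\<dots> = (LB t. LB x. real n * dd 1 flat_exp (real n * t - 1) * (v (t, x) * Ps (t, x)))"
   proof (intro integral_cong refl)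
    fix t :: real and x :: 'a
    have "dd 1 flat_exp (real n * t - 1) = 0" if "t <= 0"
    proof -
     have "real n * t <= 0" using that by (simp add: mult_nonneg_nonpos)
     thus ?thesis by (intro flat_exp_deriv(2)) auto
    qed
    thus "hs (t, x) * (v (t, x) * (th' n (t, x) * Ps (t, x))) = real n * dd 1 flat_exp (real n * t - 1) * (v (t, x) * Ps (t, x))"
     by (auto simp: indicator_def half_space_eq th'_def)
   qed
   also have "\<dots> = (LB t. real n * dd 1 flat_exp (real n * t - 1) * m t)" by (simp add: m_def)
   finally show ?thesis .
  qed
  ultimately show ?thesis by (intro iffD1[OF filterlim_sequentially_Suc[of "%n. LB z. hs z * (v z * (th' n z * Ps z))"]]) (simp only:)
 qed
 have eq: "(LB z. hs z * (th n z * Q Ps z)) + (LB z. hs z * (v z * (th' n z * Ps z)))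
   = (LINT z|P. th n z * Ps z) - (LINT z|N. th n z * Ps z)" if n: "1 <= n" for n
 proof -
  have "closed {z :: real \<times> 'a. 1 / real n <= fst z}" by (intro closed_Collect_le continuous_intros)
  moreover have "{z :: real \<times> 'a. 1 / real n <= fst z} \<subseteq> half_space"
  proof
   fix z :: "real \<times> 'a" assume "z \<in> {z. 1 / real n <= fst z}"
   moreover have "0 < 1 / real n" using n by simp
   ultimately show "z \<in> half_space" unfolding half_space_eq by (metis (mono_tags, lifting) less_le_trans mem_Collect_eq)
  qed
  moreover have "z \<in> {z. 1 / real n <= fst z}" if "th n z * Ps z \<noteq> 0" for z
  proof -
   have "0 < real n * fst z - 1" using that flat_exp_bounds(3)[of "real n * fst z - 1"] by (force simp: th)
   thus ?thesis using n by (simp add: field_simps)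
  qed
  ultimately have "(%z. th n z * Ps z) \<in> test_functions half_space" by (rule test_functionsI[OF tPs])
  from balance[OF this] have b: "(LB z. hs z * Q (%z. th n z * Ps z) z) = (LINT z|P. th n z * Ps z) - (LINT z|N. th n z * Ps z)"
   by (simp add: Q_def)
  have i1: "L1 (%z. th n z * Q Ps z)"
   by (rule L1_mult(1)[OF Qi[OF Ps] thmm, of _ 1]) (use thb in \<open>auto simp: abs_le_iff intro: order_trans[OF _ thb(1)]\<close>)
  have "L1 (%z. Q (%z. th n z * Ps z) z - th n z * Q Ps z)"
   by (intro integrable_diff Qi tPs i1)
  hence i2: "L1 (%z. v z * (th' n z * Ps z))" by (simp add: Q)
  show ?thesis
   unfolding b[symmetric] Q distrib_left
   by (rule integral_add[symmetric]; intro indi i1 i2)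
 qed
 have "(%n. (LINT z|P. th n z * Ps z) - (LINT z|N. th n z * Ps z)) ----> (LINT z|P. Ps z) - (LINT z|N. Ps z)"
  by (intro tendsto_diff limQ setsP setsN finP finN nullP nullN)
 moreover have "(%n. (LINT z|P. th n z * Ps z) - (LINT z|N. th n z * Ps z)) ----> (LB z. hs z * Q Ps z) + (LB x. h x * Ps (0, x))"
  by (rule Lim_transform_eventually[OF tendsto_add[OF lim1 lim2]]) (use eq in \<open>auto simp: eventually_sequentially intro!: exI[of _ 1]\<close>)
 ultimately have "(LB z. hs z * Q Ps z) + (LB x. h x * Ps (0, x)) = (LINT z|P. Ps z) - (LINT z|N. Ps z)"
  using LIMSEQ_unique by blast
 thus ?thesis by (simp add: Q_def)
qed

end

section \<open>Differences of Kruzhkov laws\<close>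

lemma quadratic_form_shift:
 fixes a :: "'d::finite => 'd => real"
 assumes sym: "!!k j. a k j = a j k"
 shows "(\<Sum>k\<in>UNIV. \<Sum>j\<in>UNIV. a k j * (x k + t * of_bool (k = i)) * (x j + t * of_bool (j = i))) =
   (\<Sum>k\<in>UNIV. \<Sum>j\<in>UNIV. a k j * x k * x j) + 2 * t * (\<Sum>j\<in>UNIV. a i j * x j) + t^2 * a i i"
proof -
 let ?t1 = "\<Sum>k\<in>UNIV. \<Sum>j\<in>UNIV. a k j * of_bool (k = i) * of_bool (j = i)"
 let ?t2 = "\<Sum>k\<in>UNIV. \<Sum>j\<in>UNIV. a k j * x j * of_bool (k = i)"
 let ?t3 = "\<Sum>k\<in>UNIV. \<Sum>j\<in>UNIV. a k j * x k * of_bool (j = i)"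
 have "(\<Sum>k\<in>UNIV. \<Sum>j\<in>UNIV. a k j * (x k + t * of_bool (k = i)) * (x j + t * of_bool (j = i))) =
   (\<Sum>k\<in>UNIV. \<Sum>j\<in>UNIV. a k j * x k * x j) + t * ?t2
   + t * ?t3 + t^2 * ?t1"
  unfolding sum_distrib_left sum.distrib[symmetric] by (intro sum.cong refl) (simp add: algebra_simps power2_eq_square)
 also have "?t2 = (\<Sum>j\<in>UNIV. a i j * x j)"
  by (subst sum.swap) (simp add: of_bool_def sum.delta if_distrib cong: if_cong)
 also have "?t3 = (\<Sum>j\<in>UNIV. a i j * x j)"
  by (simp add: of_bool_def sum.delta if_distrib sym[of _ i] cong: if_cong)
 also have "?t1 = a i i"
 proof -
  have "?t1 = (\<Sum>k\<in>UNIV. if k = i then (\<Sum>j\<in>UNIV. if j = i then a i i else 0) else 0)"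
   by (intro sum.cong refl) (auto intro!: sum.cong)
  thus ?thesis by simp
 qed
 finally show ?thesis by simp
qed

text \<open>Induction over the indices whose rows may be nonzero, completing the square in one
  variable at a time. Positivity is used twice: a vanishing diagonal entry forces its row to vanish,
  and the Schur complement is again semidefinite.\<close>

lemma psd_sum_of_squares:
 fixes a :: "'d::finite => 'd => real"
 assumes "finite S" "!!k j. a k j = a j k" "!!x. 0 <= (\<Sum>k\<in>UNIV. \<Sum>j\<in>UNIV. a k j * x k * x j)"
  and "!!k j. k \<notin> S ==> a k j = 0"
 shows "\<exists>s. (\<forall>l. l \<notin> S --> s l = (%_. 0)) \<and> (\<forall>k j. a k j = (\<Sum>l\<in>UNIV. s l k * s l j))"
 using assms
proof (induction S arbitrary: a rule: finite_induct)
 case empty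
 thus ?case by (intro exI[of _ "%_ _. 0"]) auto
next
 case (insert i S)
 note sym = insert.prems(1) and psd = insert.prems(2) and supp = insert.prems(3)
 define q where "q x = (\<Sum>k\<in>UNIV. \<Sum>j\<in>UNIV. a k j * x k * x j)" for x
 define c where "c x = (\<Sum>j\<in>UNIV. a i j * x j)" for x
 have shift: "0 <= q x + 2 * t * c x + t^2 * a i i" for x t
  using psd[of "%k. x k + t * of_bool (k = i)"] unfolding quadratic_form_shift[OF sym] q_def c_def .
 have aii: "0 <= a i i" using shift[of "%_. 0" 1] by (simp add: q_def c_def)
 show ?case
 proof (cases "a i i = 0")
  case True
  have "c x = 0" for x
  proof (rule ccontr)
   assume c: "c x \<noteq> 0"
   \<comment> \<open>With \<open>a i i = 0\<close> the form is affine in the shift \<open>t\<close>,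
     and this \<open>t\<close> gives it the value -1.\<close>
   have "0 <= q x + 2 * (- (q x + 1) / (2 * c x)) * c x" using shift[of x "- (q x + 1) / (2 * c x)"] True by simp
   also have "\<dots> = -1" using c by (simp add: field_simps)
   finally show False by simp
  qed
  hence "a i j = 0" for j
   using \<open>c (%k. of_bool (k = j)) = 0\<close> by (simp add: c_def of_bool_def if_distrib cong: if_cong)
  hence "a k j = 0" if "k \<notin> S" for k j using supp[of k j] that by auto
  then obtain s where s: "!!l. l \<notin> S ==> s l = (%_. 0)" "!!k j. a k j = (\<Sum>l\<in>UNIV. s l k * s l j)"
   using insert.IH[OF sym psd] by blast
  thus ?thesis by (intro exI[of _ s]) auto
 next
  case False
  hence pos: "0 < a i i" using aii by simp
  define a' where "a' k j = a k j - a i k * a i j / a i i" for k j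
  have "0 <= (\<Sum>k\<in>UNIV. \<Sum>j\<in>UNIV. a' k j * x k * x j)" for x
  proof -
   have "(\<Sum>k\<in>UNIV. \<Sum>j\<in>UNIV. a' k j * x k * x j) = q x - (c x)^2 / a i i"
    unfolding a'_def q_def c_def power2_eq_square sum_product sum_divide_distrib sum_subtractf[symmetric]
    by (intro sum.cong refl) (simp add: algebra_simps)
   \<comment> \<open>The shift by \<open>- c x / a i i\<close> minimises the form in the variable
     \<open>i\<close>, and the minimum is the form of the Schur complement.\<close>
   also have "\<dots> = q x + 2 * (- c x / a i i) * c x + (- c x / a i i)^2 * a i i"
    using pos by (simp add: field_simps power2_eq_square)
   finally show ?thesis using shift[of x "- c x / a i i"] by simp
  qed
  moreover have "a' k j = a' j k" for k j by (simp add: a'_def sym[of k j])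
  moreover have "a' k j = 0" if "k \<notin> S" for k j
  proof (cases "k = i")
   case True
   thus ?thesis using pos by (simp add: a'_def)
  next
   case False
   hence "a k m = 0" for m using that supp[of k m] by auto
   thus ?thesis using sym[of i k] by (simp add: a'_def)
  qed
  ultimately obtain s where s: "!!l. l \<notin> S ==> s l = (%_. 0)" "!!k j. a' k j = (\<Sum>l\<in>UNIV. s l k * s l j)"
   using insert.IH[of a'] by blast
  define s' where "s' = s(i := (%k. a i k / sqrt (a i i)))"
  have "(\<Sum>l\<in>UNIV. s' l k * s' l j) = a k j" for k j
  proof -
   have "(\<Sum>l\<in>UNIV. s' l k * s' l j) = s' i k * s' i j + (\<Sum>l\<in>UNIV - {i}. s' l k * s' l j)"
    by (rule sum.remove) auto
   also have "(\<Sum>l\<in>UNIV - {i}. s' l k * s' l j) = (\<Sum>l\<in>UNIV - {i}. s l k * s l j)"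
    by (intro sum.cong) (auto simp: s'_def)
   also have "\<dots> = a' k j"
    unfolding s(2) using sum.remove[of UNIV i "%l. s l k * s l j"] s(1)[OF insert.hyps(2)] by simp
   also have "s' i k * s' i j = a i k * a i j / a i i"
    using pos by (simp add: s'_def field_simps)
   finally show ?thesis by (simp add: a'_def)
  qed
  moreover have "\<forall>l. l \<notin> insert i S --> s' l = (%_. 0)" using s(1) by (auto simp: s'_def)
  ultimately show ?thesis by (intro exI[of _ s']) auto
 qed
qed

lemma positive_semidefinite_decompose:
 fixes M :: "real^'d^'d"
 assumes "positive_semidefinite M"
 obtains s :: "'d => real^'d" where "!!k j. M $ k $ j = (\<Sum>l\<in>UNIV. s l $ k * s l $ j)"
proof -
 have "\<exists>s :: 'd => 'd => real. (\<forall>l. l \<notin> UNIV --> s l = (%_. 0)) \<and> (\<forall>k j. M $ k $ j = (\<Sum>l\<in>UNIV. s l k * s l j))"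
 proof (rule psd_sum_of_squares[of UNIV "%k j. M $ k $ j"])
  show "M $ k $ j = M $ j $ k" for k j
   using assms unfolding positive_semidefinite_def transpose_def by (metis vec_lambda_beta)
  show "0 <= (\<Sum>k\<in>UNIV. \<Sum>j\<in>UNIV. M $ k $ j * x k * x j)" for x :: "'d => real"
  proof -
   have "0 <= (\<chi> k. x k) \<bullet> (M *v (\<chi> k. x k))" using assms by (simp add: positive_semidefinite_def)
   also have "\<dots> = (\<Sum>k\<in>UNIV. \<Sum>j\<in>UNIV. M $ k $ j * x k * x j)"
    by (simp add: inner_vec_def matrix_vector_mult_def sum_distrib_left mult_ac)
   finally show ?thesis .
  qed
 qed auto
 then obtain s :: "'d => 'd => real" where s: "!!k j. M $ k $ j = (\<Sum>l\<in>UNIV. s l k * s l j)" by blast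
 show ?thesis by (rule that[of "%l. \<chi> k. s l k"]) (simp add: s)
qed

text \<open>The dimension of the span over \<open>(p, p + eps)\<close> is an integer that cannot
  increase as \<open>eps\<close> decreases. Below the \<open>eps0\<close> at which it is minimal all
  intervals have the same span, so a basis can be picked from the curve arbitrarily close to
  \<open>p\<close> and still generates it on all of \<open>(p, p + eps0)\<close>. The
  \<open>g j\<close> are the dual coordinates, extended linearly to the whole space.\<close>

lemma curve_basis:
 fixes Ga :: "real => 'v::euclidean_space"
 obtains eps0 where "0 < eps0"
  "!!eps. 0 < eps ==> eps <= eps0 ==> \<exists>J g. finite J \<and> J \<subseteq> {p<..<p + eps} \<and> card J <= DIM('v) \<and>
    (\<forall>j\<in>J. linear (g j) \<and> (\<forall>i\<in>J. g j (Ga i) = of_bool (i = j))) \<and>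
    (\<forall>l\<in>{p<..<p + eps0}. Ga l = (\<Sum>j\<in>J. g j (Ga l) *\<^sub>R Ga j))"
proof -
 define d where "d eps = dim (Ga ` {p<..<p + eps})" for eps
 have "\<exists>eps0. 0 < eps0 \<and> (\<forall>eps. 0 < eps --> d eps0 <= d eps)"
  using ex_has_least_nat[of "%eps. 0 < eps" "1::real" d] by auto
 then obtain eps0 where eps0: "0 < eps0" "!!eps. 0 < eps ==> d eps0 <= d eps" by blast
 show ?thesis
 proof (rule that[OF eps0(1)])
  fix eps :: real assume eps: "0 < eps" "eps <= eps0"
  have sp: "span (Ga ` {p<..<p + eps}) = span (Ga ` {p<..<p + eps0})"
   by (rule dim_eq_span) (use eps eps0(2)[OF eps(1)] in \<open>auto simp: d_def\<close>)
  obtain Bv where Bv: "Bv \<subseteq> Ga ` {p<..<p + eps}" "independent Bv" "Ga ` {p<..<p + eps} \<subseteq> span Bv"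
   using maximal_independent_subset by blast
  obtain J where J: "J \<subseteq> {p<..<p + eps}" "inj_on Ga J" "Bv = Ga ` J"
   using subset_image_inj[of Bv Ga "{p<..<p + eps}"] Bv(1) by blast
  have fB: "finite Bv" "card Bv <= DIM('v)" using independent_bound[OF Bv(2)] by auto
  have fJ: "finite J" "card J <= DIM('v)"
   using fB J finite_image_iff card_image[OF J(2)] by (auto simp: finite_image_iff)
  have "\<exists>g. linear g \<and> (\<forall>x\<in>Bv. g x = (of_bool (x = Ga j) :: real))" for j
   using linear_independent_extend[OF Bv(2), of "%x. of_bool (x = Ga j) :: real"] by blast
  hence "\<exists>g. \<forall>j. linear (g j) \<and> (\<forall>x\<in>Bv. g j x = (of_bool (x = Ga j) :: real))" by (intro choice) auto
  then obtain g :: "real => 'v => real" where g: "!!j. linear (g j)" "!!j x. x \<in> Bv ==> g j x = of_bool (x = Ga j)" by blast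
  have gJ: "g j (Ga i) = of_bool (i = j)" if "i \<in> J" "j \<in> J" for i j
   using g(2)[of "Ga i" j] that J(2,3) by (auto simp: inj_on_eq_iff)
  have "Ga l = (\<Sum>j\<in>J. g j (Ga l) *\<^sub>R Ga j)" if l: "l \<in> {p<..<p + eps0}" for l
  proof -
   have lin: "linear (%x. \<Sum>j\<in>J. g j x *\<^sub>R Ga j)"
    by (intro linear_compose_sum ballI linear_compose_scale_right)
     (auto intro!: linearI simp: linear_add[OF g(1)] linear_scale[OF g(1)] algebra_simps)
   have "id x = (\<Sum>j\<in>J. g j x *\<^sub>R Ga j)" if x: "x \<in> span Bv" for x
   proof (rule linear_eq_on_span[OF linear_id lin _ x])
    fix y assume "y \<in> Bv"
    then obtain i where i: "i \<in> J" "y = Ga i" using J(3) by blast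
    have "(\<Sum>j\<in>J. g j y *\<^sub>R Ga j) = (\<Sum>j\<in>J. if j = i then Ga i else 0)"
     using i gJ[OF i(1)] by (intro sum.cong) auto
    thus "id y = (\<Sum>j\<in>J. g j y *\<^sub>R Ga j)" using i fJ(1) by simp
   qed
   moreover have "Ga l \<in> span (Ga ` {p<..<p + eps0})" using l by (intro span_base) auto
   hence "Ga l \<in> span Bv" unfolding sp[symmetric] using Bv(3) span_mono span_span by blast
   ultimately show ?thesis by simp
  qed
  thus "\<exists>J g. finite J \<and> J \<subseteq> {p<..<p + eps} \<and> card J <= DIM('v) \<and>
    (\<forall>j\<in>J. linear (g j) \<and> (\<forall>i\<in>J. g j (Ga i) = of_bool (i = j))) \<and>
    (\<forall>l\<in>{p<..<p + eps0}. Ga l = (\<Sum>j\<in>J. g j (Ga l) *\<^sub>R Ga j))"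
   using fJ J(1) g(1) gJ by (intro exI[of _ J] exI[of _ g]) blast
 qed
qed

section \<open>Difference quotients of Kruzhkov fluxes\<close>

definition kruzkov_diff :: "(real => 'v::real_vector) => real => real => real => 'v" where
 "kruzkov_diff G p kap y = (1 / (2 * kap)) *\<^sub>R (sgn (y - p) *\<^sub>R (G y - G p) - sgn (y - (p + kap)) *\<^sub>R (G y - G (p + kap)))"

text \<open>The quotient depends on \<open>y\<close> only through the projection of \<open>y\<close>
  to \<open>[p, p + kap]\<close>. The jumps of \<open>sgn\<close> thus disappear, continuity of
  \<open>G\<close> is inherited, and only the derivative of \<open>G\<close> on this short interval
  matters.\<close>

lemma kruzkov_diff_clamp:
 assumes "0 < kap"
 shows "kruzkov_diff G p kap y = (1 / (2 * kap)) *\<^sub>R ((G (max p (min y (p + kap))) - G p) - (G (p + kap) - G (max p (min y (p + kap)))))"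
proof -
 consider "y < p" | "y = p" | "p < y" "y < p + kap" | "y = p + kap" | "p + kap < y" by linarith
 thus ?thesis using assms by cases (auto simp: kruzkov_diff_def algebra_simps)
qed

lemma linear_kruzkov_diff:
 assumes "linear Q" shows "Q (kruzkov_diff G p kap y) = kruzkov_diff (%l. Q (G l)) p kap y"
 by (simp add: kruzkov_diff_def linear_scale[OF assms] linear_diff[OF assms])

lemma kruzkov_diff_bound:
 fixes G :: "real => real"
 assumes kap: "0 < kap" and G: "!!l. (G has_real_derivative G' l) (at l)" and le: "!!l. p <= l ==> l <= p + kap ==> \<bar>G' l\<bar> <= om"
 shows "\<bar>kruzkov_diff G p kap y\<bar> <= om / 2"
proof -
 define c where "c = max p (min y (p + kap))"
 have c: "p <= c" "c <= p + kap" using kap by (auto simp: c_def)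
 have mvt: "\<bar>G b - G a\<bar> <= om * (b - a)" if "p <= a" "a <= b" "b <= p + kap" for a b
 proof -
  have "norm (G b - G a) <= om * norm (b - a)"
   by (rule field_differentiable_bound[of "{p..p + kap}" G G'])
    (use that le in \<open>auto intro: has_field_derivative_at_within[OF G]\<close>)
  thus ?thesis using that by simp
 qed
 have "\<bar>(G c - G p) - (G (p + kap) - G c)\<bar> <= om * (c - p) + om * (p + kap - c)"
  using mvt[of p c] mvt[of c "p + kap"] c by linarith
 also have "\<dots> = om * kap" by (simp add: algebra_simps)
 finally have "\<bar>(G c - G p) - (G (p + kap) - G c)\<bar> / (2 * kap) <= om * kap / (2 * kap)"
  using kap by (intro divide_right_mono) auto
 thus ?thesis unfolding kruzkov_diff_clamp[OF kap] c_def[symmetric] using kap by (simp add: abs_mult)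
qed

text \<open>A linear functional that vanishes on all velocities of the interval vanishes on the
  difference quotient, by \<open>kruzkov_diff_bound\<close> with \<open>om = 0\<close>. It is
  applied to the components of a vector minus its expansion.\<close>

lemma kruzkov_diff_span:
 fixes G :: "real => 'v::euclidean_space"
 assumes kap: "0 < kap" and G: "!!l. (G has_vector_derivative Ga l) (at l)"
  and J: "!!j. j \<in> J ==> linear (g j)"
  and sp: "!!l. p <= l ==> l <= p + kap ==> Ga l = (\<Sum>j\<in>J. g j (Ga l) *\<^sub>R w j)"
 shows "kruzkov_diff G p kap y = (\<Sum>j\<in>J. g j (kruzkov_diff G p kap y) *\<^sub>R w j)"
proof (rule euclidean_eqI)
 fix b :: 'v assume "b \<in> Basis"
 define Q where "Q x = (x - (\<Sum>j\<in>J. g j x *\<^sub>R w j)) \<bullet> b" for x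
 have lin: "linear Q"
 proof (rule linearI)
  show "Q (x + y) = Q x + Q y" for x y
   unfolding Q_def by (simp add: linear_add[OF J] algebra_simps sum.distrib inner_sum_left cong: sum.cong)
  show "Q (r *\<^sub>R x) = r *\<^sub>R Q x" for r x
   unfolding Q_def by (simp add: linear_scale[OF J] algebra_simps inner_sum_left sum_distrib_left cong: sum.cong)
 qed
 have bl: "bounded_linear Q" using lin by (rule linear_conv_bounded_linear[THEN iffD1])
 have "((%l. Q (G l)) has_real_derivative Q (Ga l)) (at l)" for l
  using bounded_linear.has_vector_derivative[OF bl G] by (simp add: has_real_derivative_iff_has_vector_derivative)
 from kruzkov_diff_bound[OF kap this, of p 0 y]
 have "Q (kruzkov_diff G p kap y) = 0"
  using sp unfolding linear_kruzkov_diff[OF lin] by (simp add: Q_def)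
 thus "kruzkov_diff G p kap y \<bullet> b = (\<Sum>j\<in>J. g j (kruzkov_diff G p kap y) *\<^sub>R w j) \<bullet> b"
  by (simp add: Q_def inner_diff_left)
qed

section \<open>The damped transport equation\<close>

text \<open>The operator as it acts on test functions: on the exponential
  \<open>cis (- (xi \<bullet> z))\<close> it is multiplication by minus the symbol.\<close>

definition diff_op :: "'e::euclidean_space => ('l::finite => 'e) => ('e => real) => 'e => real" where
 "diff_op b s Ps z = dd b Ps z + (\<Sum>l\<in>UNIV. dd (s l) (dd (s l) Ps) z)"

lemma test_fun_sum: "finite I ==> (!!i. i \<in> I ==> test_fun (phi i)) ==> test_fun (%z. \<Sum>i\<in>I. phi i z)"
proof (induction I rule: finite_induct)
 case empty
 show ?case by (auto simp: test_fun_def intro: smooth_intros)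
qed (auto intro: test_fun_add)

lemma test_fun_diff_op: "test_fun Ps ==> test_fun (diff_op b s Ps)"
 unfolding diff_op_def[abs_def] by (intro test_fun_add test_fun_sum test_fun_dir_deriv) auto

lemma diff_op_mult:
 assumes "smooth rho" "smooth h"
 shows "diff_op b s (%z. rho z * h z) z = h z * diff_op b s rho z + rho z * diff_op b s h z + 2 * (\<Sum>l\<in>UNIV. dd (s l) rho z * dd (s l) h z)"
proof -
 note d = dir_deriv_mult[OF assms] dir_deriv_add[OF smooth_mult[OF assms(1) smooth_dir_deriv[OF assms(2)]] smooth_mult[OF smooth_dir_deriv[OF assms(1)] assms(2)]]
  dir_deriv_mult[OF assms(1) smooth_dir_deriv[OF assms(2)]] dir_deriv_mult[OF smooth_dir_deriv[OF assms(1)] assms(2)]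
 show ?thesis unfolding diff_op_def d
  by (simp add: algebra_simps sum.distrib sum_distrib_left sum_distrib_right)
qed

lemma diff_op_cos_sin:
 "diff_op b s (%z. cos (xi \<bullet> z)) z = - (xi \<bullet> b) * sin (xi \<bullet> z) - (\<Sum>l\<in>UNIV. (xi \<bullet> s l)^2) * cos (xi \<bullet> z)"
 "diff_op b s (%z. sin (xi \<bullet> z)) z = (xi \<bullet> b) * cos (xi \<bullet> z) - (\<Sum>l\<in>UNIV. (xi \<bullet> s l)^2) * sin (xi \<bullet> z)"
 unfolding diff_op_def smooth_cos_sin(3,4) dir_deriv_cmult[OF smooth_cos_sin(1)] dir_deriv_cmult[OF smooth_cos_sin(2)]
 by (simp_all add: power2_eq_square sum_distrib_left sum_distrib_right sum_negf mult_ac)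

text \<open>The product rule for a cutoff times an exponential, assembled from real and imaginary
  parts because test functions are real. Besides the symbol it leaves one term free of
  \<open>xi\<close> and one that is linear in \<open>s l \<bullet> xi\<close>.\<close>

lemma diff_op_cis:
 assumes "smooth rho"
 shows "cor (diff_op b s (%z. rho z * cos (xi \<bullet> z)) z) - \<i> * cor (diff_op b s (%z. rho z * sin (xi \<bullet> z)) z) =
  cis (- (xi \<bullet> z)) * (cor (diff_op b s rho z) - (cor (\<Sum>l\<in>UNIV. (s l \<bullet> xi)^2) + \<i> * cor (b \<bullet> xi)) * cor (rho z)
   - \<i> * cor (2 * (\<Sum>l\<in>UNIV. (s l \<bullet> xi) * dd (s l) rho z)))"
proof -
 define D where "D = (\<Sum>l\<in>UNIV. (s l \<bullet> xi) * dd (s l) rho z)"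
 have c: "(\<Sum>l\<in>UNIV. dd (s l) rho z * dd (s l) (%z. cos (xi \<bullet> z)) z) = - D * sin (xi \<bullet> z)"
  unfolding smooth_cos_sin(3) D_def by (simp add: sum_negf sum_distrib_left inner_commute mult_ac)
 have sn: "(\<Sum>l\<in>UNIV. dd (s l) rho z * dd (s l) (%z. sin (xi \<bullet> z)) z) = D * cos (xi \<bullet> z)"
  unfolding smooth_cos_sin(4) D_def by (simp add: sum_distrib_left inner_commute mult_ac)
 show ?thesis
  unfolding diff_op_mult[OF assms smooth_cos_sin(1)] diff_op_mult[OF assms smooth_cos_sin(2)] c sn diff_op_cos_sin D_def[symmetric]
  by (simp add: complex_eq_iff inner_commute algebra_simps)
qed

text \<open>The coefficients are constant, so tangential derivatives integrate to zero over the half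
  space, and only the unit time component of \<open>b\<close> leaves a boundary term.\<close>

lemma integral_diff_op:
 fixes Ps :: "real \<times> 'a::euclidean_space => real"
 assumes Ps: "test_fun Ps" and b: "fst b = 1" and s: "!!l. fst (s l) = 0"
 shows "(LB z. hs z * diff_op b s Ps z) = - (LB x. Ps (0, x))"
proof -
 have ii: "L1 (%z. hs z * g z)" if "test_fun g" for g :: "real \<times> 'a => real"
  by (rule L1_mult(1)[OF test_fun_integrable[OF that], of _ 1]) (auto simp: half_space_borel)
 have sl: "s l = (0, snd (s l))" for l using s[of l] by (simp add: prod_eq_iff)
 have bl: "dd b Ps z = dd (1, 0) Ps z + dd (0, snd b) Ps z" for z
  using linear_add[OF dir_deriv_linear[OF smooth_differentiable[OF test_fun_smooth[OF Ps]]], of "(1, 0)" "(0, snd b)" z] b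
  by (metis add.left_neutral add.right_neutral add_Pair prod.collapse)
 have "(LB z. hs z * diff_op b s Ps z) = (LB z. hs z * dd (1, 0) Ps z
   + hs z * dd (0, snd b) Ps z + (\<Sum>l\<in>UNIV. hs z * dd (0, snd (s l)) (dd (s l) Ps) z))"
  unfolding diff_op_def bl sl[symmetric] by (intro integral_cong refl) (simp add: distrib_left sum_distrib_left)
 also have "\<dots> = (LB z. hs z * dd (1, 0) Ps z) + (LB z. hs z * dd (0, snd b) Ps z)
   + (\<Sum>l\<in>UNIV. LB z. hs z * dd (0, snd (s l)) (dd (s l) Ps) z)"
  using ii[OF test_fun_dir_deriv[OF Ps]] ii[OF test_fun_dir_deriv[OF test_fun_dir_deriv[OF Ps]]]
  by (subst integral_add[OF integrable_add integrable_sum],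
    (simp only: integral_add integral_sum)+)
 also have "\<dots> = - (LB x. Ps (0, x))"
  by (simp only: integral_dir_deriv_t[OF Ps] integral_dir_deriv_x[OF Ps] integral_dir_deriv_x[OF test_fun_dir_deriv[OF Ps]]) simp
 finally show ?thesis .
qed

text \<open>One equation for several functions \<open>V j\<close>, each under its own linear
  operator, with initial density \<open>v0\<close> and finitely many weighted measures as source.
  For a Kruzhkov difference \<open>R\<close> has four elements: two levels times the two parts of
  the Jordan decomposition.\<close>

locale transport = symbols J b s
 for J :: "'j set" and b :: "'j => real \<times> 'a::euclidean_space" and s :: "'j => 'l::finite => real \<times> 'a" +
 fixes V :: "'j => real \<times> 'a => real" and v0 :: "'a => real" and C :: real
  and R :: "'r set" and c :: "'r => real" and Q :: "'r => (real \<times> 'a) measure"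
 assumes b1: "!!j. fst (b j) = 1" and s0: "!!j l. fst (s j l) = 0"
  and Vm[measurable]: "!!j. V j \<in> Borel" and VC: "!!j z. \<bar>V j z\<bar> <= C"
  and v0m[measurable]: "v0 \<in> Borel" and v0C: "!!x. \<bar>v0 x\<bar> <= C"
  and finR: "finite R" and setsQ: "!!r. r \<in> R ==> sets (Q r) = sets borel"
  and finQ: "!!r T K. r \<in> R ==> compact K ==> emeasure (Q r) ({0<..T} \<times> K) < \<infinity>"
  and nullQ: "!!r. r \<in> R ==> emeasure (Q r) (- half_space) = 0"
  and equation: "!!Ps. test_fun Ps ==>
   (LB z. hs z * (\<Sum>j\<in>J. V j z * diff_op (b j) (s j) Ps z)) =
   (\<Sum>r\<in>R. c r * (LINT z|Q r. Ps z)) - (LB x. v0 x * Ps (0, x))"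
begin

lemma C0: "0 <= C" using v0C[of undefined] by linarith

lemma Q_sigma_finite: assumes "r \<in> R" shows "sigma_finite_measure (Q r)"
proof (rule sigma_finite_measure.intro)
 define A where "A n = {0<..real n} \<times> cball (0::'a) (real n)" for n
 have sp: "space (Q r) = UNIV" using sets_eq_imp_space_eq[OF setsQ[OF assms]] by simp
 have "\<Union>(insert (- half_space) (range A)) = UNIV"
 proof -
  have "z \<in> \<Union>(insert (- half_space) (range A))"
for z
  proof (cases "z \<in> half_space")
   case True
   obtain n where "max (fst z) (norm (snd z)) <= real n" using real_arch_simple by blast
   hence "z \<in> A n" using True by (auto simp: A_def half_space_eq mem_Times_iff)
   thus ?thesis by blast
  qed auto
  thus ?thesis by blast
 qed
 moreover have "A n \<in> sets borel" for n
 proof -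
  have "A n \<in> sets ((borel :: real measure) \<Otimes>\<^sub>M (borel :: 'a measure))" unfolding A_def by (intro pair_measureI) auto
  thus ?thesis unfolding borel_prod .
 qed
 moreover have "emeasure (Q r) (A n) \<noteq> \<infinity>" for n
  using finQ[OF assms, of "cball 0 (real n)" "real n"] by (auto simp: A_def)
 ultimately show "\<exists>A. countable A \<and> A \<subseteq> sets (Q r) \<and> \<Union>A = space (Q r) \<and> (\<forall>a\<in>A. emeasure (Q r) a \<noteq> \<infinity>)"
  using setsQ[OF assms] nullQ[OF assms] by (intro exI[of _ "insert (- half_space) (range A)"]) (auto simp: sp half_space_borel)
qed

lemma Q_measurable: "r \<in> R ==> phi \<in> Borel ==> phi \<in> borel_measurable (Q r)"
 using measurable_cong_sets[OF setsQ refl] by blast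

lemma Q_integrable:
 assumes r: "r \<in> R" and phi: "bsupp phi" shows "integrable (Q r) phi"
proof -
 obtain B R where B: "0 < B" "0 < R" "!!x. \<bar>phi x\<bar> <= B" "!!x. R < norm x ==> phi x = 0" and m: "phi \<in> Borel"
  using bsuppE[OF phi] by blast
 let ?K = "{0<..R} \<times> cball (0::'a) R"
 have "?K \<in> sets ((borel :: real measure) \<Otimes>\<^sub>M (borel :: 'a measure))" by (intro pair_measureI) auto
 hence K: "?K \<in> sets (Q r)" unfolding borel_prod setsQ[OF r] .
 have i: "integrable (Q r) (%z. B * indicator ?K z)"
  using K finQ[OF r, of "cball 0 R"] by (intro integrable_mult_right integrable_real_indicator) auto
 have "- half_space \<in> null_sets (Q r)" using nullQ[OF r] setsQ[OF r] by (auto simp: null_sets_def half_space_borel)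
 hence "AE z in Q r. z \<in> half_space" using AE_not_in[of "- half_space" "Q r"] by simp
 hence "AE z in Q r. norm (phi z) <= B * indicator ?K z"
 proof eventually_elim
  case (elim z)
  show ?case
  proof (cases "phi z = 0")
   case False
   hence "norm z <= R" using B(4)[of z] by force
   hence "fst z <= R" "norm (snd z) <= R"
    using norm_fst_le[of "fst z" "snd z"] norm_snd_le[of "snd z" "fst z"] by auto
   thus ?thesis using elim B(3)[of z] by (auto simp: half_space_eq mem_Times_iff)
  qed (use B(1) in \<open>auto simp: indicator_def\<close>)
 qed
 thus ?thesis by (intro integrable_bound[OF i Q_measurable[OF r m]]) (auto elim!: eventually_mono)
qed

lemma AE_Q_half_space: "r \<in> R ==> AE z in Q r. z \<in> half_space"
 using AE_not_in[of "- half_space" "Q r"] nullQ setsQ by (auto simp: null_sets_def half_space_borel)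

text \<open>For smooth \<open>w\<close> the operator of index \<open>i\<close> satisfies an exact
  identity on the half space with initial density \<open>w (0, x)\<close>. Subtracting it replaces
  \<open>v0\<close>, which is only bounded and measurable, by \<open>v0 - w\<close>, which can be
  made small in \<open>L^1\<close>.\<close>

lemma shifted_equation:
 assumes Ps: "test_fun Ps" and w: "smooth w" and i: "i \<in> J"
 shows "L1 (%z. hs z * ((\<Sum>j\<in>J. V j z * diff_op (b j) (s j) Ps z) - diff_op (b i) (s i) (%z. Ps z * w z) z))" (is ?goalA)
  and "(LB z. hs z * ((\<Sum>j\<in>J. V j z * diff_op (b j) (s j) Ps z) - diff_op (b i) (s i) (%z. Ps z * w z) z)) =
   (\<Sum>r\<in>R. c r * (LINT z|Q r. Ps z)) - (LB x. (v0 x - w (0, x)) * Ps (0, x))"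
proof -
 have Psw: "test_fun (%z. Ps z * w z)" by (rule test_fun_mult1[OF Ps w])
 have hm: "L1 (%z. hs z * g z)" if "L1 g" for g :: "real \<times> 'a => real"
  by (rule L1_mult(1)[OF that, of _ 1]) (auto simp: half_space_borel)
 have i1: "L1 (%z. hs z * (\<Sum>j\<in>J. V j z * diff_op (b j) (s j) Ps z))"
  by (intro hm integrable_sum L1_mult(1)[where C=C] test_fun_integrable test_fun_diff_op Ps Vm VC)
 have i2: "L1 (%z. hs z * diff_op (b i) (s i) (%z. Ps z * w z) z)"
  by (intro hm test_fun_integrable test_fun_diff_op Psw)
 show ?goalA
  unfolding right_diff_distrib by (rule integrable_diff[OF i1 i2])
 have sl: "L1 (%x. g (0, x))" if g: "test_fun g" for g :: "real \<times> 'a => real"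
 proof -
  obtain R' where R': "!!z. R' < norm z ==> g z = 0" using test_funE[OF g] by blast
  obtain B where B: "!!z. \<bar>g z\<bar> <= B" using test_fun_bounded[OF g] by blast
  have "g (0, x) = 0" if "R' < norm x" for x using R'[of "(0, x)"] that by (simp add: norm_Pair)
  hence "bsupp (%x. g (0, x))"
   unfolding bsupp_def using B measurable_slice[OF smooth_measurable[OF test_fun_smooth[OF g]]] by blast
  thus ?thesis by (rule bsupp_integrable)
 qed
 have "(LB x. (v0 x - w (0, x)) * Ps (0, x)) = (LB x. v0 x * Ps (0, x)) - (LB x. Ps (0, x) * w (0, x))"
  using integral_diff[OF L1_mult(1)[OF sl[OF Ps] v0m v0C] sl[OF Psw]] by (simp add: algebra_simps)
 thus "(LB z. hs z * ((\<Sum>j\<in>J. V j z * diff_op (b j) (s j) Ps z) - diff_op (b i) (s i) (%z. Ps z * w z) z)) =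
   (\<Sum>r\<in>R. c r * (LINT z|Q r. Ps z)) - (LB x. (v0 x - w (0, x)) * Ps (0, x))"
  unfolding right_diff_distrib integral_diff[OF i1 i2] integral_diff_op[OF Psw b1 s0] equation[OF Ps] by simp
qed

end

section \<open>Damping and localisation\<close>

definition damping :: "real => real \<times> 'a::euclidean_space => real" where
 "damping T z = exp (- (fst z / T))"

lemma smooth_damping:
 shows "smooth (damping T :: real \<times> 'a::euclidean_space => real)"
  and "dd e (damping T :: real \<times> 'a => real) = (%z. - (fst e / T) * damping T z)" (is ?goalB)
proof -
 have eq: "damping T = (%z :: real \<times> 'a. exp ((- 1 / T, 0) \<bullet> z))"
  by (simp add: damping_def fun_eq_iff inner_prod_def)
 show "smooth (damping T :: real \<times> 'a => real)" unfolding eq by (rule smooth_exp)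
 show ?goalB
  unfolding eq smooth_exp(2) by (simp add: inner_prod_def)
qed

lemma damping_bounds: "0 < damping T z" "0 < T ==> z \<in> half_space ==> damping T z <= 1"
 by (auto simp: damping_def half_space_eq)

lemma damping_0 [simp]: "damping T (0, x) = 1" by (simp add: damping_def)

lemma dir_deriv_damping_mult:
 assumes "smooth rho" "fst e = 0"
 shows "dd e (%z. damping T z * rho z) = (%z. damping T z * dd e rho z)"
 by (subst dir_deriv_mult) (auto simp: smooth_damping assms)

text \<open>Damping commutes with the spatial derivatives, and the time derivative adds
  \<open>- 1 / T\<close>; on the frequency side the symbol is shifted by
  \<open>1 / T\<close>.\<close>

lemma diff_op_damping_mult:
 assumes "smooth rho" "fst b = 1" "!!l. fst (s l) = 0"
 shows "diff_op b s (%z. damping T z * rho z) z = damping T z * (diff_op b s rho z - rho z / T)"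
proof -
 have "dd b (%z. damping T z * rho z) z = damping T z * (dd b rho z - rho z / T)"
  by (subst dir_deriv_mult) (auto simp: smooth_damping assms algebra_simps)
 thus ?thesis
  unfolding diff_op_def dir_deriv_damping_mult[OF assms(1,3)] dir_deriv_damping_mult[OF smooth_dir_deriv[OF assms(1)] assms(3)]
  by (simp only: right_diff_distrib distrib_left sum_distrib_left)
qed

lemma bsupp_mult_test_fun:
 assumes "test_fun g" "m \<in> Borel" "!!z. \<bar>m z\<bar> <= C"
 shows "bsupp (%z. m z * g z)"
 using bsupp_mult[OF test_fun_bsupp[OF assms(1)] assms(2,3)] by (simp add: mult.commute)

lemma bsupp_half_space: "bsupp g ==> bsupp (%z. hs z * g z)"
 using bsupp_mult[of g "hs" 1] by (simp add: mult.commute half_space_borel)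

lemma integrable_cis_bsupp:
 "bsupp f ==> L1 (%z. cis (- (xi \<bullet> z)) * cor (f z))"
 by (intro integrable_cis_mult) (auto intro: bsupp_integrable)

context transport
begin

text \<open>The localised equation splits according to the derivatives that fall on the cutoff: none
  in \<open>Vt\<close>, one in \<open>gt\<close>, where a factor \<open>s j l \<bullet> xi\<close>
  remains, and the full operator in \<open>Nt\<close>. The smooth function \<open>w\<close> is
  treated as part of a second cutoff \<open>rho * w\<close>.\<close>

definition Vt :: "real => 'j => (real \<times> 'a => real) => (real \<times> 'a => real) => 'j => real \<times> 'a => real" where
 "Vt T i rho w j z = hs z * (V j z * (damping T z * rho z) - of_bool (j = i) * (damping T z * (rho z * w z)))"

definition Nt :: "real => 'j => (real \<times> 'a => real) => (real \<times> 'a => real) => real \<times> 'a => real" where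
 "Nt T i rho w z = hs z * (\<Sum>j\<in>J. V j z * (damping T z * diff_op (b j) (s j) rho z)
   - of_bool (j = i) * (damping T z * diff_op (b j) (s j) (%z. rho z * w z) z))"

definition gt :: "real => 'j => (real \<times> 'a => real) => (real \<times> 'a => real) => 'j => 'l => real \<times> 'a => real" where
 "gt T i rho w j l z = hs z * (2 * (V j z * (damping T z * dd (s j l) rho z)
   - of_bool (j = i) * (damping T z * dd (s j l) (%z. rho z * w z) z)))"

text \<open>The transform of a measure: the damped defect together with a layer on
  \<open>t = 0\<close> of density \<open>(v0 - w) * rho\<close>.\<close>

definition source :: "real => (real \<times> 'a => real) => (real \<times> 'a => real) => real \<times> 'a => complex" where
 "source T rho w xi = (\<Sum>r\<in>R. of_real (c r) * (LINT z|Q r. cis (- (xi \<bullet> z)) * of_real (damping T z * rho z)))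
   - (LB x. cis (- (xi \<bullet> (0, x))) * of_real ((v0 x - w (0, x)) * rho (0, x)))"

definition source_mass :: "real => (real \<times> 'a => real) => (real \<times> 'a => real) => real" where
 "source_mass T rho w = (\<Sum>r\<in>R. \<bar>c r\<bar> * (LINT z|Q r. \<bar>damping T z * rho z\<bar>)) + (LB x. \<bar>(v0 x - w (0, x)) * rho (0, x)\<bar>)"

lemma bsupp_terms:
 assumes rho: "test_fun rho" and w: "smooth w"
 shows "bsupp (Vt T i rho w j)" (is ?goalA) "bsupp (Nt T i rho w)" "bsupp (gt T i rho w j l)"
proof -
 have rhow: "test_fun (%z. rho z * w z)" by (rule test_fun_mult1[OF rho w])
 have 1: "bsupp (%z. V j z * (damping T z * g z) - of_bool (j = i) * (damping T z * h z))"
  if "test_fun g" "test_fun h" for g h j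
  by (intro bsupp_diff bsupp_mult_test_fun[where C=C] bsupp_cmult test_fun_bsupp test_fun_mult2 that smooth_damping Vm VC)
 show ?goalA "bsupp (Nt T i rho w)" "bsupp (gt T i rho w j l)"
  unfolding Vt_def[abs_def] Nt_def[abs_def] gt_def[abs_def]
  by (intro bsupp_half_space bsupp_sum bsupp_cmult 1 rho rhow test_fun_diff_op test_fun_dir_deriv)+
qed

lemma boundary_bsupp:
 fixes g :: "real \<times> 'a => real"
 assumes g: "test_fun g" and m: "m \<in> Borel" "!!x. g (0, x) \<noteq> 0 ==> \<bar>m x\<bar> <= B"
 shows "bsupp (%x. m x * g (0, x))"
proof -
 obtain R' where R': "!!z. R' < norm z ==> g z = 0" using test_funE[OF g] by blast
 obtain B' where B': "0 < B'" "!!z. \<bar>g z\<bar> <= B'" using test_fun_bounded[OF g] by blast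
 have "m x * g (0, x) = 0" if "R' < norm x" for x using R'[of "(0, x)"] that by (simp add: norm_Pair)
 moreover have "\<bar>m x * g (0, x)\<bar> <= \<bar>B\<bar> * B'" for x
 proof (cases "g (0, x) = 0")
  case False
  thus ?thesis unfolding abs_mult using m(2)[of x] B' by (intro mult_mono) auto
 qed (use B' in auto)
 moreover have "(%x. m x * g (0, x)) \<in> Borel"
  by (intro borel_measurable_times m(1) measurable_slice[OF smooth_measurable[OF test_fun_smooth[OF g]]])
 ultimately show ?thesis unfolding bsupp_def by blast
qed

lemma boundary_term:
 fixes rho w :: "real \<times> 'a => real"
 assumes rho: "test_fun rho" and w: "smooth w"
 shows "bsupp (%x. (v0 x - w (0, x)) * rho (0, x))"
proof -
 have "bsupp (%x. v0 x * rho (0, x))" by (rule boundary_bsupp[OF rho v0m v0C])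
 moreover have "bsupp (%x. 1 * (rho (0, x) * w (0, x)))"
  using boundary_bsupp[OF test_fun_mult1[OF rho w], of "%_. 1" 1] by simp
 ultimately show ?thesis using bsupp_diff by (fastforce simp: algebra_simps)
qed

lemma transform_identity_pointwise:
 assumes rho: "test_fun rho" and w: "smooth w" and i: "i \<in> J"
 defines "h Ps z \<equiv> hs z * ((\<Sum>j\<in>J. V j z * diff_op (b j) (s j) Ps z) - diff_op (b i) (s i) (%z. Ps z * w z) z)"
 shows "cor (h (%z. (damping T z * rho z) * cos (xi \<bullet> z)) z) - \<i> * cor (h (%z. (damping T z * rho z) * sin (xi \<bullet> z)) z) =
   - (\<Sum>j\<in>J. (symbol j xi + of_real (1 / T)) * (cis (- (xi \<bullet> z)) * of_real (Vt T i rho w j z))) + cis (- (xi \<bullet> z)) * of_real (Nt T i rho w z)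
   - \<i> * (\<Sum>j\<in>J. \<Sum>l\<in>UNIV. of_real (s j l \<bullet> xi) * (cis (- (xi \<bullet> z)) * of_real (gt T i rho w j l z)))"
proof (cases "z \<in> half_space")
 case True
 note rhos = test_fun_smooth[OF rho]
 have rhows: "smooth (%z. rho z * w z)" by (intro smooth_mult rhos w)
 \<comment> \<open>One formula serves both cutoffs: \<open>rho\<close>, with coefficient
   \<open>V j\<close>, and \<open>rho * w\<close>, with coefficient one at the index
   \<open>i\<close>.\<close>
 have L: "cor (diff_op (b j) (s j) (%z. (damping T z * g z) * cos (xi \<bullet> z)) z) - \<i> * cor (diff_op (b j) (s j) (%z. (damping T z * g z) * sin (xi \<bullet> z)) z) =
   cis (- (xi \<bullet> z)) * (cor (damping T z * diff_op (b j) (s j) g z) - (symbol j xi + of_real (1 / T)) * cor (damping T z * g z)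
   - \<i> * (\<Sum>l\<in>UNIV. cor (s j l \<bullet> xi) * cor (2 * (damping T z * dd (s j l) g z))))"
  if g: "smooth g" for j g
  unfolding diff_op_cis[OF smooth_mult[OF smooth_damping(1) g]] diff_op_damping_mult[OF g b1 s0] symbol_def dir_deriv_damping_mult[OF g s0]
  by (simp add: algebra_simps sum_distrib_left)
 define X where "X j g = cis (- (xi \<bullet> z)) * (cor (damping T z * diff_op (b j) (s j) g z) - (symbol j xi + of_real (1 / T)) * cor (damping T z * g z)
   - \<i> * (\<Sum>l\<in>UNIV. cor (s j l \<bullet> xi) * cor (2 * (damping T z * dd (s j l) g z))))" for j g
 have e: "(%z. damping T z * rho z * cos (xi \<bullet> z) * w z) = (%z. damping T z * (rho z * w z) * cos (xi \<bullet> z))"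
  "(%z. damping T z * rho z * sin (xi \<bullet> z) * w z) = (%z. damping T z * (rho z * w z) * sin (xi \<bullet> z))"
  by (simp_all add: mult_ac)
 have "cor (h (%z. (damping T z * rho z) * cos (xi \<bullet> z)) z) - \<i> * cor (h (%z. (damping T z * rho z) * sin (xi \<bullet> z)) z) =
   (\<Sum>j\<in>J. cor (V j z) * (cor (diff_op (b j) (s j) (%z. (damping T z * rho z) * cos (xi \<bullet> z)) z) - \<i> * cor (diff_op (b j) (s j) (%z. (damping T z * rho z) * sin (xi \<bullet> z)) z)))
   - (cor (diff_op (b i) (s i) (%z. (damping T z * (rho z * w z)) * cos (xi \<bullet> z)) z) - \<i> * cor (diff_op (b i) (s i) (%z. (damping T z * (rho z * w z)) * sin (xi \<bullet> z)) z))"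
  unfolding h_def e using True by (simp add: algebra_simps sum_subtractf sum_distrib_left)
 also have "\<dots> = (\<Sum>j\<in>J. cor (V j z) * X j rho) - X i (%z. rho z * w z)"
  unfolding L[OF rhos] L[OF rhows] X_def ..
 also have "X i (%z. rho z * w z) = (\<Sum>j\<in>J. of_bool (j = i) * X j (%z. rho z * w z))"
 proof -
  have "(\<Sum>j\<in>J. of_bool (j = i) * X j (%z. rho z * w z)) = (\<Sum>j\<in>J. if j = i then X i (%z. rho z * w z) else 0)"
   by (intro sum.cong) auto
  thus ?thesis using i finJ by simp
 qed
 also have "(\<Sum>j\<in>J. cor (V j z) * X j rho) - (\<Sum>j\<in>J. of_bool (j = i) * X j (%z. rho z * w z)) =
   (\<Sum>j\<in>J. cor (V j z) * X j rho - of_bool (j = i) * X j (%z. rho z * w z))"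
  by (rule sum_subtractf[symmetric])
 also have "\<dots> = (\<Sum>j\<in>J. - ((symbol j xi + of_real (1 / T)) * (cis (- (xi \<bullet> z)) * of_real (Vt T i rho w j z)))
   + cis (- (xi \<bullet> z)) * of_real (V j z * (damping T z * diff_op (b j) (s j) rho z) - of_bool (j = i) * (damping T z * diff_op (b j) (s j) (%z. rho z * w z) z))
   - \<i> * (\<Sum>l\<in>UNIV. of_real (s j l \<bullet> xi) * (cis (- (xi \<bullet> z)) * of_real (gt T i rho w j l z))))"
 proof (intro sum.cong refl)
  fix j
  define S where "S g = (\<Sum>l\<in>UNIV. cor (s j l \<bullet> xi) * cor (2 * (damping T z * dd (s j l) g z)))" for g
  have eq: "(\<Sum>l\<in>UNIV. cor (s j l \<bullet> xi) * (cis (- (xi \<bullet> z)) * of_real (gt T i rho w j l z))) =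
   cis (- (xi \<bullet> z)) * (cor (V j z) * S rho - of_bool (j = i) * S (%z. rho z * w z))"
   unfolding gt_def S_def using True by (simp add: sum_distrib_left sum_subtractf[symmetric] right_diff_distrib mult_ac)
  show "cor (V j z) * X j rho - of_bool (j = i) * X j (%z. rho z * w z) =
   - ((symbol j xi + of_real (1 / T)) * (cis (- (xi \<bullet> z)) * of_real (Vt T i rho w j z)))
   + cis (- (xi \<bullet> z)) * of_real (V j z * (damping T z * diff_op (b j) (s j) rho z) - of_bool (j = i) * (damping T z * diff_op (b j) (s j) (%z. rho z * w z) z))
   - \<i> * (\<Sum>l\<in>UNIV. of_real (s j l \<bullet> xi) * (cis (- (xi \<bullet> z)) * of_real (gt T i rho w j l z)))"
   unfolding eq unfolding X_def Vt_def S_def[symmetric] using True by (cases "j = i") (simp_all add: algebra_simps)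
 qed
 also have "\<dots> = - (\<Sum>j\<in>J. (symbol j xi + of_real (1 / T)) * (cis (- (xi \<bullet> z)) * of_real (Vt T i rho w j z))) + cis (- (xi \<bullet> z)) * of_real (Nt T i rho w z)
   - \<i> * (\<Sum>j\<in>J. \<Sum>l\<in>UNIV. of_real (s j l \<bullet> xi) * (cis (- (xi \<bullet> z)) * of_real (gt T i rho w j l z)))"
 proof -
  have "cis (- (xi \<bullet> z)) * of_real (Nt T i rho w z) = (\<Sum>j\<in>J. cis (- (xi \<bullet> z)) * of_real (V j z * (damping T z * diff_op (b j) (s j) rho z) - of_bool (j = i) * (damping T z * diff_op (b j) (s j) (%z. rho z * w z) z)))"
   unfolding Nt_def using True by (simp only: indicator_simps mult_1 of_real_sum sum_distrib_left)
  thus ?thesis by (simp only: sum_distrib_left sum.distrib sum_subtractf sum_negf)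
 qed
 finally show ?thesis .
qed (simp add: h_def Vt_def Nt_def gt_def)

lemma transform_identity:
 assumes rho: "test_fun rho" and w: "smooth w" and i: "i \<in> J"
 shows "source T rho w xi = - (\<Sum>j\<in>J. (symbol j xi + of_real (1 / T)) * ft (Vt T i rho w j) xi) + ft (Nt T i rho w) xi
    - \<i> * (\<Sum>j\<in>J. \<Sum>l\<in>UNIV. of_real (s j l \<bullet> xi) * ft (gt T i rho w j l) xi)"
proof -
 let ?t1 = "LB z. - (\<Sum>j\<in>J. (symbol j xi + of_real (1 / T)) * (cis (- (xi \<bullet> z)) * of_real (Vt T i rho w j z))) + cis (- (xi \<bullet> z)) * of_real (Nt T i rho w z)
   - \<i> * (\<Sum>j\<in>J. \<Sum>l\<in>UNIV. of_real (s j l \<bullet> xi) * (cis (- (xi \<bullet> z)) * of_real (gt T i rho w j l z)))"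
 let ?t2 = "%j. symbol j xi + of_real (1 / T)"
 define h where "h Ps z = hs z * ((\<Sum>j\<in>J. V j z * diff_op (b j) (s j) Ps z) - diff_op (b i) (s i) (%z. Ps z * w z) z)" for Ps and z :: "real \<times> 'a"
 define Psc Pss where "Psc = (%z. (damping T z * rho z) * cos (xi \<bullet> z))" and "Pss = (%z. (damping T z * rho z) * sin (xi \<bullet> z))"
 have t: "test_fun Psc" "test_fun Pss"
  unfolding Psc_def Pss_def by (intro test_fun_mult1 test_fun_mult2 rho smooth_damping smooth_cos_sin)+
 note sc = shifted_equation[OF t(1) w i, folded h_def] and ss = shifted_equation[OF t(2) w i, folded h_def]
 have cis: "cor (a * cos y) - \<i> * cor (a * sin y) = cis (- y) * cor a" for a y
  by (simp add: complex_eq_iff)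
 have QI: "cor (LINT z|Q r. Psc z) - \<i> * cor (LINT z|Q r. Pss z) = (LINT z|Q r. cis (- (xi \<bullet> z)) * of_real (damping T z * rho z))" if r: "r \<in> R" for r
 proof -
  note ic = Q_integrable[OF r test_fun_bsupp[OF t(1)]] and iq = Q_integrable[OF r test_fun_bsupp[OF t(2)]]
  have "cor (LINT z|Q r. Psc z) - \<i> * cor (LINT z|Q r. Pss z) = (LINT z|Q r. cor (Psc z) - \<i> * cor (Pss z))"
   using ic iq by (subst integral_diff) (auto simp: integral_complex_of_real)
  thus ?thesis unfolding Psc_def Pss_def cis .
 qed
 have bI: "cor (LB x. (v0 x - w (0, x)) * Psc (0, x)) - \<i> * cor (LB x. (v0 x - w (0, x)) * Pss (0, x)) =
   (LB x. cis (- (xi \<bullet> (0, x))) * of_real ((v0 x - w (0, x)) * rho (0, x)))"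
 proof -
  note ic = bsupp_integrable[OF boundary_term[OF t(1) w]] and iq = bsupp_integrable[OF boundary_term[OF t(2) w]]
  have "cor (LB x. (v0 x - w (0, x)) * Psc (0, x)) - \<i> * cor (LB x. (v0 x - w (0, x)) * Pss (0, x)) =
   (LB x. cor ((v0 x - w (0, x)) * Psc (0, x)) - \<i> * cor ((v0 x - w (0, x)) * Pss (0, x)))"
   unfolding integral_complex_of_real[symmetric] integral_mult_right_zero[symmetric]
   by (rule integral_diff[symmetric]) (use ic iq in \<open>auto simp del: of_real_mult of_real_diff\<close>)
  thus ?thesis unfolding Psc_def Pss_def damping_0 mult_1 mult.assoc[symmetric] cis .
 qed
 have "source T rho w xi = cor (LB z. h Psc z) - \<i> * cor (LB z. h Pss z)"
 proof -
  have "cor (LB z. h Psc z) - \<i> * cor (LB z. h Pss z) =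
   (\<Sum>r\<in>R. cor (c r) * (cor (LINT z|Q r. Psc z) - \<i> * cor (LINT z|Q r. Pss z)))
   - (cor (LB x. (v0 x - w (0, x)) * Psc (0, x)) - \<i> * cor (LB x. (v0 x - w (0, x)) * Pss (0, x)))"
   unfolding sc(2) ss(2) by (simp add: algebra_simps sum_subtractf sum_distrib_left)
  thus ?thesis unfolding bI source_def using QI by simp
 qed
 also have "\<dots> = (LB z. cor (h Psc z) - \<i> * cor (h Pss z))"
  unfolding integral_complex_of_real[symmetric] integral_mult_right_zero[symmetric]
  by (rule integral_diff[symmetric]) (use sc(1) ss(1) in \<open>auto intro!: integrable_mult_right\<close>)
 also have "\<dots> = ?t1"
  unfolding h_def Psc_def Pss_def transform_identity_pointwise[OF rho w i] ..
 also have "\<dots> = - (\<Sum>j\<in>J. (?t2 j) * ft (Vt T i rho w j) xi) + ft (Nt T i rho w) xi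
    - \<i> * (\<Sum>j\<in>J. \<Sum>l\<in>UNIV. of_real (s j l \<bullet> xi) * ft (gt T i rho w j l) xi)"
  unfolding ft_def
 proof -
  note I = integrable_cis_bsupp[OF bsupp_terms(1)[OF rho w]] integrable_cis_bsupp[OF bsupp_terms(2)[OF rho w]]
   integrable_cis_bsupp[OF bsupp_terms(3)[OF rho w]]
  note intros = integrable_add integrable_sum integrable_mult_right I
  have 1: "L1 (%z. \<Sum>j\<in>J. (?t2 j) * (cis (- (xi \<bullet> z)) * cor (Vt T i rho w j z)))"
   by (intro intros)
  have 2: "L1 (%z. \<i> * (\<Sum>j\<in>J. \<Sum>l\<in>UNIV. of_real (s j l \<bullet> xi) * (cis (- (xi \<bullet> z)) * cor (gt T i rho w j l z))))"
   by (intro intros)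
  have 3: "L1 (%z. \<Sum>l\<in>UNIV. of_real (s j l \<bullet> xi) * (cis (- (xi \<bullet> z)) * cor (gt T i rho w j l z)))" for j
   by (intro intros)
  have 4: "L1 (%z. - (\<Sum>j\<in>J. (?t2 j) * (cis (- (xi \<bullet> z)) * cor (Vt T i rho w j z))))"
   using 1 by simp
  show "?t1 =
   - (\<Sum>j\<in>J. (?t2 j) * (LB z. cis (- (xi \<bullet> z)) * of_real (Vt T i rho w j z))) + (LB z. cis (- (xi \<bullet> z)) * of_real (Nt T i rho w z))
    - \<i> * (\<Sum>j\<in>J. \<Sum>l\<in>UNIV. of_real (s j l \<bullet> xi) * (LB z. cis (- (xi \<bullet> z)) * of_real (gt T i rho w j l z)))"
   unfolding integral_diff[OF integrable_add[OF 4 I(2)] 2] integral_add[OF 4 I(2)]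
    integral_minus integral_mult_right_zero
   by (simp only: integral_sum integrable_mult_right[OF I(1)] integrable_mult_right[OF I(3)] 3 integral_mult_right_zero)
 qed
 finally show ?thesis .
qed

lemma source_transform:
 assumes rho: "test_fun rho" and w: "smooth w"
 shows "measure_transform (source T rho w) (source_mass T rho w)"
proof -
 have td: "test_fun (%z. damping T z * rho z)" by (rule test_fun_mult2[OF rho smooth_damping(1)])
 have q: "measure_transform (%xi. of_real (c r) * (LINT z|Q r. cis (- (xi \<bullet> z)) * cor (damping T z * rho z))) (\<bar>c r\<bar> * (LINT z|Q r. \<bar>damping T z * rho z\<bar>))"
  if r: "r \<in> R" for r
 proof -
  have "measure_transform (%xi. LINT z|Q r. cis (- (xi \<bullet> z)) * cor (damping T z * rho z)) (LINT z|Q r. cmod (cor (damping T z * rho z)))"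
   using Q_integrable[OF r test_fun_bsupp[OF td]]
   by (intro measure_transform_fourier Q_sigma_finite r Q_measurable) (auto simp del: of_real_mult)
  from measure_transform_cmult[OF this, of "of_real (c r)"] show ?thesis by (simp del: of_real_mult)
 qed
 have zero: "measure_transform (%_. 0) 0" by (auto simp: measure_transform_def)
 have qs: "measure_transform (%xi. \<Sum>r\<in>R. of_real (c r) * (LINT z|Q r. cis (- (xi \<bullet> z)) * cor (damping T z * rho z))) (\<Sum>r\<in>R. \<bar>c r\<bar> * (LINT z|Q r. \<bar>damping T z * rho z\<bar>))"
  using finR q by (induction R rule: finite_induct) (auto intro: zero measure_transform_add)
 have bd: "measure_transform (%xi. LB x. cis (- (xi \<bullet> (0, x))) * cor ((v0 x - w (0, x)) * rho (0, x))) (LB x. cmod (cor ((v0 x - w (0, x)) * rho (0, x))))"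
  using bsupp_integrable[OF boundary_term[OF rho w]]
  by (intro measure_transform_fourier sigma_finite_lborel)
   (auto simp del: of_real_mult of_real_diff intro!: borel_measurable_continuous_onI continuous_intros)
 from measure_transform_add[OF qs measure_transform_cmult[OF bd, of "-1"]]
 show ?thesis unfolding source_def[abs_def] source_mass_def by (simp del: of_real_mult of_real_diff)
qed

lemma source_mass_nonneg: "0 <= source_mass T rho w"
 unfolding source_mass_def by (intro add_nonneg_nonneg sum_nonneg mult_nonneg_nonneg) auto

lemma core_energy:
 assumes rho: "test_fun rho" and w: "smooth w" and i: "i \<in> J" and T: "0 < T"
  and B: "!!j z. \<bar>Vt T i rho w j z\<bar> <= B" "!!z. T * \<bar>Nt T i rho w z\<bar> <= B" "!!j l z. j \<in> J ==> sqrt T * \<bar>gt T i rho w j l z\<bar> <= B"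
 shows "(\<integral>\<^sup>+xi. ennreal (indicator (region i) xi * (cmod (ft (Vt T i rho w i) xi))^2) \<partial>lborel) <=
   ennreal (region_const * (source_mass T rho w * B * T + (\<Sum>j\<in>J - {i}. LB x. (Vt T i rho w j x)^2) + T^2 * (LB x. (Nt T i rho w x)^2)
    + T * (\<Sum>j\<in>J. \<Sum>l\<in>UNIV. LB x. (gt T i rho w j l x)^2)))"
 by (rule region_energy[OF T source_transform[OF rho w] source_mass_nonneg bsupp_terms(1)[OF rho w] B(1)
   bsupp_terms(2)[OF rho w] B(2) bsupp_terms(3)[OF rho w] B(3) transform_identity[OF rho w i] i])

end

section \<open>Energy of the deviation as the damping scale tends to zero\<close>

lemma ft_energy_split:
 fixes f g :: "'e::euclidean_space => real"
 assumes f: "bsupp f" and g: "bsupp g" and S: "S \<in> sets borel"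
  and E: "(\<integral>\<^sup>+xi. ennreal (indicator S xi * (cmod (ft g xi))^2) \<partial>lborel) <= ennreal E" "0 <= E"
  and D: "(LB x. (f x - g x)^2) <= D"
 shows "(\<integral>\<^sup>+xi. ennreal (indicator S xi * (cmod (ft f xi))^2) \<partial>lborel) <= ennreal (2 * E + 2 * (2 * pi) ^ DIM('e) * D)"
proof -
 let ?t1 = "%xi. cmod (ft (%x. f x - g x) xi)"
 let ?t2 = "%xi. indicator S xi * (cmod (ft g xi))^2"
 note fg = bsupp_diff[OF f g]
 have [measurable]: "ft f \<in> Borel" "ft g \<in> Borel" "ft (%x. f x - g x) \<in> Borel" "S \<in> sets borel"
  by (auto intro: borel_measurable_ft bsupp_measurable f g fg S)
 have D0: "0 <= D" by (rule order_trans[OF _ D]) simp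
 have pw: "indicator S xi * (cmod (ft f xi))^2 <= 2 * (?t2 xi) + 2 * (?t1 xi)^2" for xi
 proof -
  have "cmod (ft f xi) <= cmod (ft g xi) + cmod (ft (%x. f x - g x) xi)"
   using norm_triangle_ineq[of "ft g xi" "ft (%x. f x - g x) xi"] by (simp add: ft_diff[OF f g])
  hence "(cmod (ft f xi))^2 <= (cmod (ft g xi) + cmod (ft (%x. f x - g x) xi))^2" by (intro power_mono) auto
  also have "\<dots> <= 2 * (cmod (ft g xi))^2 + 2 * (?t1 xi)^2"
   using sum_squares_bound[of "cmod (ft g xi)" "cmod (ft (%x. f x - g x) xi)"] by (simp add: power2_sum)
  finally show ?thesis by (auto simp: indicator_def)
 qed
 have "(\<integral>\<^sup>+xi. ennreal (indicator S xi * (cmod (ft f xi))^2) \<partial>lborel) <=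
   (\<integral>\<^sup>+xi. 2 * ennreal (?t2 xi) + 2 * ennreal ((?t1 xi)^2) \<partial>lborel)"
 proof (intro nn_integral_mono)
  fix xi
  show "ennreal (indicator S xi * (cmod (ft f xi))^2) <= 2 * ennreal (?t2 xi) + 2 * ennreal ((?t1 xi)^2)"
   using ennreal_leI[OF pw[of xi]] by (simp add: ennreal_plus ennreal_mult)
 qed
 also have "\<dots> = 2 * (\<integral>\<^sup>+xi. ennreal (?t2 xi) \<partial>lborel) + 2 * (\<integral>\<^sup>+xi. ennreal ((?t1 xi)^2) \<partial>lborel)"
  by (subst nn_integral_add) (auto simp: nn_integral_cmult)
 also have "\<dots> <= 2 * ennreal E + 2 * ennreal ((2 * pi) ^ DIM('e) * D)"
  unfolding plancherel[OF fg] using E(1) D by (intro add_mono mult_left_mono ennreal_leI) auto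
 also have "\<dots> = ennreal (2 * E + 2 * (2 * pi) ^ DIM('e) * D)"
  using E(2) D0 by (simp add: ennreal_plus ennreal_mult mult.assoc)
 finally show ?thesis .
qed

lemma half_line_exp:
 assumes "0 < (a::real)"
 shows "L1 (%t. indicator {0<..} t * exp (- a * t))" (is ?goalA) "(LB t. indicator {0<..} t * exp (- a * t)) = 1 / a" (is ?goalB)
proof -
 have i: "L1 (%t::real. indicator {0<..} t * exp (- t))"
  using exponential_transform(1) by (simp only: complex_of_real_integrable_eq)
 have "(LB t. cmod (cor (indicator {0<..} t * exp (- t)))) = (LB t. indicator {0<..} t * exp (- t :: real))"
  unfolding norm_of_real by (intro integral_cong) auto
 hence v: "(LB t. indicator {0<..} t * exp (- t :: real)) = 1" using exponential_transform(2) by simp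
 have eq: "indicator {0<..} (0 + a * t) * exp (- (0 + a * t)) = indicator {0<..} t * exp (- a * t)" for t
  using assms by (simp add: indicator_def zero_less_mult_iff)
 show ?goalA
  using lborel_integrable_real_affine[OF i, of a 0] assms unfolding eq by simp
 show ?goalB
  using lborel_integral_real_affine[of a "%t. indicator {0<..} t * exp (- t)" 0] assms unfolding eq v by (simp add: field_simps)
qed

text \<open>The damping is squared, so the time integral is that of
  \<open>exp (- 2 * t / T)\<close>, which is \<open>T / 2\<close>.\<close>

lemma damped_tensor_le:
 fixes q :: "'a::euclidean_space => real"
 assumes T: "0 < T" and th: "th \<in> Borel" "!!t. \<bar>th t\<bar> <= 1"
  and q: "L1 q" "!!x. 0 <= q x"
 shows "L1 (%z. hs z * ((damping T z)^2 * ((th (fst z))^2 * q (snd z))))"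
  and "(LB z. hs z * ((damping T z)^2 * ((th (fst z))^2 * q (snd z)))) <= T / 2 * (LB x. q x)" (is ?goalB)
proof -
 let ?t1 = "%k. %z. (k (fst z) * (th (fst z))^2) * q (snd z)"
 let ?t2 = "%z. (damping T z)^2 * ((th (fst z))^2 * q (snd z))"
 have a: "0 < 2 / T" using T by simp
 define k where "k t = indicator {0<..} t * exp (- (2 / T) * t)" for t
 have [measurable]: "th \<in> Borel" "q \<in> Borel" using th q by auto
 have eq: "hs (t, x) * ((damping T (t, x))^2 * ((th (fst (t, x)))^2 * q (snd (t, x)))) = (k t * (th t)^2) * q x" for t x
  by (auto simp: k_def indicator_def half_space_eq damping_def exp_double[symmetric])
 have ki: "L1 (%t. k t * (th t)^2)"
  using L1_mult(1)[OF half_line_exp(1)[OF a], of "%t. (th t)^2" 1] th(2)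
  by (simp add: k_def mult.commute abs_square_le_1)
 have "integrable (lborel \<Otimes>\<^sub>M lborel) (?t1 k)"
 proof (rule lborel_pair.Fubini_integrable)
  show "(?t1 k) \<in> borel_measurable (lborel \<Otimes>\<^sub>M (lborel :: 'a measure))"
   unfolding k_def by measurable
  show "L1 (%t. LB x. norm (k (fst (t, x)) * (th (fst (t, x)))^2 * q (snd (t, x :: 'a))))"
   using integrable_mult_left[OF integrable_norm[OF ki], of "LB x. norm (q x)"] by (simp add: norm_mult abs_mult)
  show "AE t in lborel. L1 (%x :: 'a. k (fst (t, x)) * (th (fst (t, x)))^2 * q (snd (t, x)))"
   using q(1) by simp
 qed
 hence "L1 (?t1 k)" by (simp add: lborel_prod)
 moreover have "(?t1 k) = (%z. hs z * (?t2 z))"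
  by (rule ext) (use eq in \<open>metis prod.collapse\<close>)
 ultimately show i: "L1 (%z. hs z * (?t2 z))" by simp
 have "(LB z. hs z * (?t2 z)) = (LB t. k t * (th t)^2) * (LB x. q x)"
  unfolding lborel_integral_prod(2)[OF i] eq by simp
 also have "\<dots> <= (LB t. k t) * (LB x. q x)"
 proof (intro mult_right_mono integral_mono ki)
  show "L1 k" using half_line_exp(1)[OF a] unfolding k_def[abs_def] .
  show "k t * (th t)^2 <= k t" for t using th(2)[of t] by (auto simp: k_def abs_square_le_1 indicator_def mult_left_le)
  show "0 <= (LB x. q x)" using q(2) by simp
 qed
 also have "(LB t. k t) = T / 2" using half_line_exp(2)[OF a] by (simp add: k_def[abs_def])
 finally show ?goalB .
qed

text \<open>As \<open>T\<close> decreases the damping tends to 0 at every point of the half space.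
  This is applied to the defect measures, whose damped mass disappears, and to Lebesgue measure for
  the cross terms.\<close>

lemma damped_tendsto_0:
 assumes sets: "sets Q = sets (borel :: (real \<times> 'a::euclidean_space) measure)"
  and q: "integrable Q q" and AE: "AE z in Q. z \<notin> half_space --> q z = 0"
 shows "((%T. LINT z|Q. damping T z * q z) \<longlongrightarrow> 0) (at_right 0)"
proof (rule tendsto_at_right_sequentially[of 0 1])
 fix X :: "nat => real" assume X: "!!n. 0 < X n" "X ----> 0"
 have dm: "damping T \<in> borel_measurable Q" for T :: real
  using smooth_measurable[OF smooth_damping(1)] measurable_cong_sets[OF sets refl] by blast
 have "(%n. LINT z|Q. damping (X n) z * q z) ----> (LINT z|Q. 0)"
 proof (rule integral_dominated_convergence[where w="%z. \<bar>q z\<bar>"])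
  show "AE z in Q. (%n. damping (X n) z * q z) ----> 0"
   using AE
  proof eventually_elim
   case (elim z)
   show ?case
   proof (cases "z \<in> half_space")
    case True
    hence z: "0 < fst z" by (simp add: half_space_eq)
    have "filterlim (%n. inverse (X n)) at_top sequentially"
     by (rule filterlim_inverse_at_top[OF X(2)]) (use X(1) in auto)
    hence "filterlim (%n. fst z * inverse (X n)) at_top sequentially"
     by (rule filterlim_tendsto_pos_mult_at_top[OF tendsto_const z])
    hence "(%n. exp (- (fst z * inverse (X n)))) ----> 0"
     by (intro filterlim_compose[OF exp_at_bot] filterlim_compose[OF filterlim_uminus_at_bot_at_top])
    thus ?thesis by (intro tendsto_mult_left_zero) (simp add: damping_def divide_inverse)
   qed (use elim in auto)
  qed
  show "AE z in Q. norm (damping (X n) z * q z) <= \<bar>q z\<bar>" for n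
   using AE
  proof eventually_elim
   case (elim z)
   show ?case
   proof (cases "z \<in> half_space")
    case True
    thus ?thesis using damping_bounds(2)[OF X(1) True, of n] damping_bounds(1)[of "X n" z]
     by (auto simp: abs_mult intro!: mult_left_le_one_le)
   qed (use elim in auto)
  qed
  show "(%z. damping (X n) z * q z) \<in> borel_measurable Q" for n by (intro borel_measurable_times dm) (use q in auto)
 qed (use q in auto)
 thus "(%n. LINT z|Q. damping (X n) z * q z) ----> 0" by simp
qed auto

text \<open>Extension by zero to \<open>t \<le> 0\<close> makes the Fourier transform in all
  variables available; the trace is prolonged constantly in time.\<close>

definition deviation :: "(real => real) => ('a => real) => (real \<times> 'a::euclidean_space => real) => ('a => real) => real => real \<times> 'a => real" where
 "deviation th phi v v0 T z = hs z * (damping T z * (th (fst z) * phi (snd z)) * (v z - v0 (snd z)))"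

lemma snd_measurable: "h \<in> Borel ==> (%z :: real \<times> 'a::euclidean_space. h (snd z)) \<in> Borel"
 by (rule measurable_compose[OF borel_measurable_continuous_onI]) (intro continuous_intros)

lemma bsupp_deviation:
 assumes "test_fun th" "test_fun phi" "v \<in> Borel" "!!z. \<bar>v z\<bar> <= C" "v0 \<in> Borel" "!!x. \<bar>v0 x\<bar> <= C"
 shows "bsupp (deviation th phi v v0 T)"
proof -
 have t: "test_fun (%z. damping T z * (th (fst z) * phi (snd z)))"
  by (intro test_fun_mult2 test_fun_tensor assms smooth_damping)
 have "bsupp (%z. (damping T z * (th (fst z) * phi (snd z))) * (v z - v0 (snd z)))"
 proof (rule bsupp_mult[OF test_fun_bsupp[OF t]])
  show "(%z. v z - v0 (snd z)) \<in> Borel"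
   by (intro borel_measurable_diff assms snd_measurable)
  show "\<bar>v z - v0 (snd z)\<bar> <= 2 * C" for z using assms(4)[of z] assms(6)[of "snd z"] by linarith
 qed
 thus ?thesis unfolding deviation_def[abs_def] by (rule bsupp_half_space)
qed

context transport
begin

text \<open>The scale of comparison is \<open>T\<close>, the effective length in time. The distance
  of the \<open>V j\<close> from their models contributes terms of order \<open>om^2 * T\<close>;
  all others fall below \<open>eps * T\<close> once a smooth \<open>W\<close> near \<open>v0\<close>
  is fixed and \<open>T\<close> is small. \<open>W\<close> comes first because the cutoff terms
  contain its derivatives, for which there is no uniform bound.\<close>

lemma core_limit:
 fixes th :: "real => real" and phi :: "'a => real"
 assumes th: "test_fun th" "!!t. \<bar>th t\<bar> <= 1" and phi: "test_fun phi" and i: "i \<in> J"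
  and v: "v \<in> Borel" "!!z. \<bar>v z\<bar> <= C"
  and approx: "!!j z. j \<in> J ==> \<bar>V j z - of_bool (j = i) * v z\<bar> <= om" and eps: "0 < eps"
 shows "EV T. (\<integral>\<^sup>+xi. ennreal (indicator (region i) xi * (cmod (ft (deviation th phi v v0 T) xi))^2) \<partial>lborel)
  <= ennreal (T * ((region_const * card J + 2 * (2 * pi) ^ DIM(real \<times> 'a)) * (LB x. (phi x)^2) * om^2 + eps))"
proof -
 let ?t1 = "%W. LB x. (phi x)^2 * (W x - v0 x)^2"
 let ?t2 = "%z. (th (fst z))^2 * (phi (snd z))^2"
 define rho :: "real \<times> 'a => real" where "rho = (%z. th (fst z) * phi (snd z))"
 have rho: "test_fun rho" unfolding rho_def by (rule test_fun_tensor[OF th(1) phi])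
 define Phi where "Phi = (LB x. (phi x)^2)"
 obtain S where S: "0 < S" "!!x. \<bar>phi x\<bar> <= S" using test_fun_bounded[OF phi] by blast
 define P2 :: real where "P2 = (2 * pi) ^ DIM(real \<times> 'a)"
 define rc where "rc = region_const"
 have rc0: "0 <= rc" unfolding rc_def by (rule region_const_nonneg)
 have P20: "0 <= P2" unfolding P2_def by simp
 \<comment> \<open>It bounds \<open>Vt\<close> for every \<open>W\<close> that is at most
   \<open>C + 1\<close> in modulus on the support of \<open>phi\<close>. The additional 1 makes it
   positive, so the conditions on \<open>N\<close> and \<open>g\<close> hold for all small
   \<open>T\<close>.\<close>
 define B where "B = S * (2 * C + 1) + 1"
 have SC: "0 <= S * (2 * C + 1)" using S C0 by simp
 hence B1: "1 <= B" by (simp add: B_def)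
 \<comment> \<open>It majorises the coefficient of \<open>eta\<close> in the final estimate; with
   \<open>eta = eps / (2 * M)\<close> these terms use half of \<open>eps\<close>.\<close>
 define M where "M = 4 * rc * B + 2 * P2 * (S * (2 * C + 1)) + 1"
 have "0 <= 2 * P2 * (S * (2 * C + 1))" by (rule mult_nonneg_nonneg[OF _ SC]) (use P20 in simp)
 moreover have "0 <= 4 * rc * B" using rc0 B1 by simp
 ultimately have M: "0 < M" unfolding M_def by linarith
 define eta where "eta = eps / (2 * M)"
 have eta: "0 < eta" using eps M by (simp add: eta_def)
 obtain W where W: "smooth W" "!!x. phi x \<noteq> 0 ==> \<bar>W x\<bar> <= C + 1" "(LB x. \<bar>phi x * (v0 x - W x)\<bar>) <= eta"
  using smooth_weighted_approx[OF v0m v0C phi eta] by blast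
 define w :: "real \<times> 'a => real" where "w = (%z. W (snd z))"
 have w: "smooth w" unfolding w_def by (rule smooth_snd_comp(1)[OF W(1)])
 have rhow: "test_fun (%z. rho z * w z)" by (rule test_fun_mult1[OF rho w])
 have Wm[measurable]: "W \<in> Borel" by (rule smooth_measurable[OF W(1)])
 have phim[measurable]: "phi \<in> Borel" by (rule smooth_measurable[OF test_fun_smooth[OF phi]])
 have thmm[measurable]: "th \<in> Borel" by (rule smooth_measurable[OF test_fun_smooth[OF th(1)]])

 have phi2i: "L1 (%x. (phi x)^2)" by (intro bsupp_integrable bsupp_sq test_fun_bsupp phi)
 have phiW: "bsupp (%x. phi x * (v0 x - W x))"
 proof -
  have "bsupp (%x. phi x * v0 x)" by (rule bsupp_mult[OF test_fun_bsupp[OF phi] v0m v0C])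
  from bsupp_diff[OF this test_fun_bsupp[OF test_fun_mult1[OF phi W(1)]]] show ?thesis by (simp add: right_diff_distrib)
 qed
 \<comment> \<open>Closeness in \<open>L^1\<close> gives closeness in \<open>L^2\<close>, the
   difference being bounded by \<open>S * (2 * C + 1)\<close>.\<close>
 have phiW2: "(?t1 W) <= S * (2 * C + 1) * eta"
  "L1 (%x. (phi x)^2 * (W x - v0 x)^2)"
 proof -
  have eq: "(phi x)^2 * (W x - v0 x)^2 = (phi x * (v0 x - W x))^2" for x by (simp add: power_mult_distrib power2_commute)
  show i2: "L1 (%x. (phi x)^2 * (W x - v0 x)^2)"
   unfolding eq by (intro bsupp_integrable bsupp_sq phiW)
  have "(?t1 W) <= (LB x. S * (2 * C + 1) * \<bar>phi x * (v0 x - W x)\<bar>)"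
  proof (rule integral_mono[OF i2])
   show "L1 (%x. S * (2 * C + 1) * \<bar>phi x * (v0 x - W x)\<bar>)"
    by (intro integrable_mult_right integrable_abs bsupp_integrable phiW)
   fix x
   show "(phi x)^2 * (W x - v0 x)^2 <= S * (2 * C + 1) * \<bar>phi x * (v0 x - W x)\<bar>"
   proof (cases "phi x = 0")
    case False
    have "\<bar>v0 x - W x\<bar> <= 2 * C + 1" using W(2)[OF False] v0C[of x] by linarith
    hence "\<bar>phi x * (v0 x - W x)\<bar> <= S * (2 * C + 1)" unfolding abs_mult using S by (intro mult_mono) auto
    hence "\<bar>phi x * (v0 x - W x)\<bar> * \<bar>phi x * (v0 x - W x)\<bar> <= S * (2 * C + 1) * \<bar>phi x * (v0 x - W x)\<bar>"
     by (intro mult_right_mono) auto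
    thus ?thesis unfolding eq by (simp only: power2_eq_square abs_mult_self_eq)
   qed simp
  qed
  also have "\<dots> <= S * (2 * C + 1) * eta" unfolding integral_mult_right_zero using W(3) SC by (intro mult_left_mono)
  finally show "(?t1 W) <= S * (2 * C + 1) * eta" .
 qed

 \<comment> \<open>Majorants of the cutoff terms in which \<open>T\<close> no longer occurs. For
   \<open>gt\<close> the damping is kept as a further factor: its energy is multiplied by
   \<open>T\<close> only, so it must tend to 0, whereas that of \<open>Nt\<close> is multiplied by
   \<open>T^2\<close>.\<close>
 define n where "n z = (\<Sum>j\<in>J. C * \<bar>diff_op (b j) (s j) rho z\<bar> + \<bar>diff_op (b j) (s j) (%z. rho z * w z) z\<bar>)" for z
 define g0 where "g0 j l z = 2 * (C * \<bar>dd (s j l) rho z\<bar> + \<bar>dd (s j l) (%z. rho z * w z) z\<bar>)" for j l z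
 define g1 where "g1 z = (\<Sum>j\<in>J. \<Sum>l\<in>UNIV. g0 j l z)" for z
 have nb: "bsupp n" unfolding n_def[abs_def]
  by (intro bsupp_sum bsupp_add bsupp_cmult bsupp_abs test_fun_bsupp test_fun_diff_op rho rhow)
 have g0b: "bsupp (g0 j l)" for j l unfolding g0_def[abs_def]
  by (intro bsupp_add bsupp_cmult bsupp_abs test_fun_bsupp test_fun_dir_deriv rho rhow)
 have g1b: "bsupp g1" unfolding g1_def[abs_def] by (intro bsupp_sum g0b)
 obtain Bn where Bn: "0 < Bn" "!!z. \<bar>n z\<bar> <= Bn" using bsuppE[OF nb] by metis
 obtain Bg where Bg: "0 < Bg" "!!z. \<bar>g1 z\<bar> <= Bg" using bsuppE[OF g1b] by metis
 have g0n: "0 <= g0 j l z" for j l z unfolding g0_def using C0 by (intro mult_nonneg_nonneg add_nonneg_nonneg) auto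
 have nn: "0 <= n z" for z unfolding n_def using C0 by (intro sum_nonneg add_nonneg_nonneg mult_nonneg_nonneg) auto
 have g01: "g0 j l z <= g1 z" if "j \<in> J" for j l z
 proof -
  have "g0 j l z <= (\<Sum>l\<in>UNIV. g0 j l z)" by (rule member_le_sum) (auto simp: g0n)
  also have "\<dots> <= g1 z" unfolding g1_def by (rule member_le_sum[OF that]) (auto simp: g0n finJ intro: sum_nonneg)
  finally show ?thesis .
 qed
 have comb: "\<bar>V j z * x - of_bool (j = i) * y\<bar> <= C * \<bar>x\<bar> + \<bar>y\<bar>" for j z x y
 proof -
  have "\<bar>V j z * x\<bar> <= C * \<bar>x\<bar>" unfolding abs_mult using VC[of j z] by (rule mult_right_mono) simp
  thus ?thesis using abs_triangle_ineq4[of "V j z * x" y] by (cases "j = i") simp_all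

 qed
 have Nle: "\<bar>Nt T i rho w z\<bar> <= n z" if "0 < T" for T z
 proof (cases "z \<in> half_space")
  case True
  note d = damping_bounds(1)[of T z] damping_bounds(2)[OF that True]
  have "Nt T i rho w z = damping T z * (\<Sum>j\<in>J. V j z * diff_op (b j) (s j) rho z - of_bool (j = i) * diff_op (b j) (s j) (%z. rho z * w z) z)"
   unfolding Nt_def sum_distrib_left using True by (simp add: right_diff_distrib mult.left_commute)
  hence "\<bar>Nt T i rho w z\<bar> = damping T z * \<bar>\<Sum>j\<in>J. V j z * diff_op (b j) (s j) rho z - of_bool (j = i) * diff_op (b j) (s j) (%z. rho z * w z) z\<bar>"
   by (simp only: abs_mult abs_of_pos[OF d(1)])
  also have "\<dots> <= 1 * n z"
   unfolding n_def using d by (intro mult_mono order_trans[OF sum_abs] sum_mono comb) auto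
  finally show ?thesis by simp
 qed (simp add: Nt_def nn)
 have gle: "\<bar>gt T i rho w j l z\<bar> <= hs z * (damping T z * g0 j l z)" for T j l z
 proof (cases "z \<in> half_space")
  case True
  note d = damping_bounds(1)[of T z]
  have "\<bar>gt T i rho w j l z\<bar> = damping T z * (2 * \<bar>V j z * dd (s j l) rho z - of_bool (j = i) * dd (s j l) (%z. rho z * w z) z\<bar>)"
  proof -
   have "gt T i rho w j l z = damping T z * (2 * (V j z * dd (s j l) rho z - of_bool (j = i) * dd (s j l) (%z. rho z * w z) z))"
    unfolding gt_def using True by (simp add: algebra_simps)
   thus ?thesis using d by (simp only: abs_mult abs_of_pos[OF d] abs_numeral)
  qed
  also have "\<dots> <= damping T z * g0 j l z" unfolding g0_def using d comb by (intro mult_left_mono) auto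
  finally show ?thesis using True by simp
 qed (simp add: gt_def)
 have Vle: "\<bar>Vt T i rho w j z\<bar> <= B" if "0 < T" for T j z
 proof (cases "z \<in> half_space \<and> phi (snd z) \<noteq> 0")
  case True
  hence z: "z \<in> half_space" "phi (snd z) \<noteq> 0" by auto
  note d = damping_bounds(1)[of T z] damping_bounds(2)[OF that z(1)]
  have "Vt T i rho w j z = (damping T z * rho z) * (V j z - of_bool (j = i) * w z)"
   unfolding Vt_def using True by (simp add: algebra_simps)
  moreover have "\<bar>damping T z * rho z\<bar> <= 1 * (1 * S)"
   unfolding abs_mult rho_def using d th(2)[of "fst z"] S by (intro mult_mono) auto
  moreover have "\<bar>V j z - of_bool (j = i) * w z\<bar> <= 2 * C + 1"
   using VC[of j z] W(2)[OF z(2)] C0 unfolding w_def by (cases "j = i") auto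
  ultimately have "\<bar>Vt T i rho w j z\<bar> <= S * (2 * C + 1)"
   using S C0 by (auto simp only: abs_mult intro!: mult_mono)
  thus ?thesis by (simp add: B_def)
 next
  case False
  hence "Vt T i rho w j z = 0" by (auto simp: Vt_def rho_def)
  thus ?thesis using B1 by simp
 qed

 define G where "G T = (\<Sum>j\<in>J. \<Sum>l\<in>UNIV. LB z. damping T z * (hs z * (g0 j l z)^2))" for T
 have Glim: "(G \<longlongrightarrow> 0) (at_right 0)"
 proof -
  have "((%T. LB z. damping T z * (hs z * (g0 j l z)^2)) \<longlongrightarrow> 0) (at_right 0)" for j l
   by (rule damped_tendsto_0) (use bsupp_integrable[OF bsupp_half_space[OF bsupp_sq[OF g0b[of j l]]]] in simp_all)
  hence "(G \<longlongrightarrow> (\<Sum>j\<in>J. \<Sum>l\<in>(UNIV :: 'l set). 0)) (at_right 0)"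
   unfolding G_def[abs_def] by (intro tendsto_sum)
  thus ?thesis by simp
 qed
 have mlim: "((%T. source_mass T rho w) \<longlongrightarrow> (LB x. \<bar>(v0 x - w (0, x)) * rho (0, x)\<bar>)) (at_right 0)"
 proof -
  have "((%T. \<bar>c r\<bar> * (LINT z|Q r. \<bar>damping T z * rho z\<bar>)) \<longlongrightarrow> \<bar>c r\<bar> * 0) (at_right 0)" if r: "r \<in> R" for r
  proof (intro tendsto_mult tendsto_const)
   have "((%T. LINT z|Q r. damping T z * \<bar>rho z\<bar>) \<longlongrightarrow> 0) (at_right 0)"
    by (rule damped_tendsto_0[OF setsQ[OF r]])
     (use AE_Q_half_space[OF r] in \<open>auto intro: Q_integrable[OF r] test_fun_bsupp[OF rho] elim!: eventually_mono\<close>)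
   thus "((%T. LINT z|Q r. \<bar>damping T z * rho z\<bar>) \<longlongrightarrow> 0) (at_right 0)"
    by (simp add: abs_mult abs_of_pos[OF damping_bounds(1)])
  qed
  hence "((%T. source_mass T rho w) \<longlongrightarrow> (\<Sum>r\<in>R. \<bar>c r\<bar> * 0) + (LB x. \<bar>(v0 x - w (0, x)) * rho (0, x)\<bar>)) (at_right 0)"
   unfolding source_mass_def by (intro tendsto_add tendsto_sum tendsto_const)
  thus ?thesis by simp
 qed
 have m0: "(LB x. \<bar>(v0 x - w (0, x)) * rho (0, x)\<bar>) <= eta"
 proof -
  have "(LB x. \<bar>(v0 x - w (0, x)) * rho (0, x)\<bar>) <= (LB x. \<bar>phi x * (v0 x - W x)\<bar>)"
  proof (rule integral_mono)
   show "L1 (%x. \<bar>(v0 x - w (0, x)) * rho (0, x)\<bar>)"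
    by (intro integrable_abs bsupp_integrable boundary_term rho w)
   show "L1 (%x. \<bar>phi x * (v0 x - W x)\<bar>)" by (intro integrable_abs bsupp_integrable phiW)
   show "\<bar>(v0 x - w (0, x)) * rho (0, x)\<bar> <= \<bar>phi x * (v0 x - W x)\<bar>" for x
    using mult_right_mono[OF th(2)[of 0], of "\<bar>phi x * (v0 x - W x)\<bar>"] by (simp add: w_def rho_def abs_mult mult_ac)
  qed
  thus ?thesis using W(3) by linarith
 qed
 define N2 where "N2 = (LB z. (n z)^2)"
 have N20: "0 <= N2" by (simp add: N2_def)
 have Phi0: "0 <= Phi" by (simp add: Phi_def)

 have main: "(\<integral>\<^sup>+xi. ennreal (indicator (region i) xi * (cmod (ft (deviation th phi v v0 T) xi))^2) \<partial>lborel)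
   <= ennreal (2 * (rc * (2 * eta * B * T + card J * (om^2 * (T / 2 * Phi)) + T^2 * N2 + T * G T)) + 2 * P2 * (T * om^2 * Phi + T * (S * (2 * C + 1) * eta)))"
  if T: "0 < T" "T * Bn <= B" "sqrt T * Bg <= B" "source_mass T rho w <= 2 * eta" for T
 proof -
  define E where "E = rc * (2 * eta * B * T + card J * (om^2 * (T / 2 * Phi)) + T^2 * N2 + T * G T)"
  have G0: "0 <= G T" unfolding G_def by (intro sum_nonneg integral_nonneg) (auto simp: damping_def)
  have E0: "0 <= E" unfolding E_def using rc0 eta B1 T(1) N20 G0 Phi0 by (intro mult_nonneg_nonneg add_nonneg_nonneg) auto
  have "(\<integral>\<^sup>+xi. ennreal (indicator (region i) xi * (cmod (ft (Vt T i rho w i) xi))^2) \<partial>lborel) <=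
    ennreal (region_const * (source_mass T rho w * B * T + (\<Sum>j\<in>J - {i}. LB x. (Vt T i rho w j x)^2) + T^2 * (LB x. (Nt T i rho w x)^2)
    + T * (\<Sum>j\<in>J. \<Sum>l\<in>UNIV. LB x. (gt T i rho w j l x)^2)))"
  proof (rule core_energy[OF rho w i T(1)])
   show "\<bar>Vt T i rho w j z\<bar> <= B" for j z by (rule Vle[OF T(1)])
   show "T * \<bar>Nt T i rho w z\<bar> <= B" for z
    using order_trans[OF mult_left_mono[of "\<bar>Nt T i rho w z\<bar>" Bn T] T(2)] Nle[OF T(1), of z] Bn(2)[of z] T(1) by auto
   show "sqrt T * \<bar>gt T i rho w j l z\<bar> <= B" if True: "j \<in> J" for j l z
   proof -
    have "hs z * (damping T z * g0 j l z) <= 1 * g1 z"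
     using damping_bounds[of T z] T(1) g01[OF True, of l z] g0n[of j l z] order_trans[OF g0n[of j l z] g01[OF True, of l z]]
     by (cases "z \<in> half_space") (auto intro: order_trans[OF mult_left_le_one_le])
    hence "\<bar>gt T i rho w j l z\<bar> <= Bg" using gle[of T j l z] Bg(2)[of z] by linarith
    from order_trans[OF mult_left_mono[OF this, of "sqrt T"] T(3)] T(1) show ?thesis by simp
   qed
  qed
  also have "\<dots> <= ennreal E"
   unfolding E_def rc_def
  proof (rule ennreal_leI, rule mult_left_mono[OF _ region_const_nonneg], intro add_mono)
   show "source_mass T rho w * B * T <= 2 * eta * B * T" using T B1 by (intro mult_right_mono) auto
   have "(LB x. (Vt T i rho w j x)^2) <= om^2 * (T / 2 * Phi)" if j: "j \<in> J - {i}" for j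
   proof -
    have "(LB x. (Vt T i rho w j x)^2) <= (LB z. om^2 * (hs z * ((damping T z)^2 * (?t2 z))))"
    proof (rule integral_mono)
     show "L1 (%x. (Vt T i rho w j x)^2)" by (intro bsupp_integrable bsupp_sq bsupp_terms rho w)
     show "L1 (%z. om^2 * (hs z * ((damping T z)^2 * (?t2 z))))"
      by (intro integrable_mult_right damped_tensor_le(1) T(1) th thmm phi2i) auto
     show "(Vt T i rho w j z)^2 <= om^2 * (hs z * ((damping T z)^2 * (?t2 z)))" for z
     proof -
      have "\<bar>V j z\<bar> <= om" using approx[of j z] j by auto
      hence "(V j z)^2 <= om^2" using abs_le_square_iff[of "V j z" om] by auto
      moreover have "(Vt T i rho w j z)^2 = (V j z)^2 * (hs z * ((damping T z)^2 * (?t2 z)))"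
       using j by (auto simp: Vt_def rho_def power_mult_distrib indicator_def)
      ultimately show ?thesis by (auto intro!: mult_right_mono mult_nonneg_nonneg)
     qed
    qed
    also have "\<dots> <= om^2 * (T / 2 * Phi)"
     unfolding integral_mult_right_zero Phi_def by (intro mult_left_mono damped_tensor_le(2) T(1) th thmm phi2i) auto
    finally show ?thesis .
   qed
   hence "(\<Sum>j\<in>J - {i}. LB x. (Vt T i rho w j x)^2) <= (\<Sum>j\<in>J - {i}. om^2 * (T / 2 * Phi))" by (rule sum_mono)
   also have "\<dots> <= card J * (om^2 * (T / 2 * Phi))"
    using T(1) Phi0 card_mono[OF finJ, of "J - {i}"] by (auto intro!: mult_right_mono mult_nonneg_nonneg)
   finally show "(\<Sum>j\<in>J - {i}. LB x. (Vt T i rho w j x)^2) <= card J * (om^2 * (T / 2 * Phi))" .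
   have "(LB x. (Nt T i rho w x)^2) <= N2"
    unfolding N2_def
   proof (rule integral_mono)
    show "(Nt T i rho w z)^2 <= (n z)^2" for z using Nle[OF T(1), of z] nn[of z] by (simp add: abs_le_square_iff[symmetric])
   qed (intro bsupp_integrable[OF bsupp_sq] bsupp_terms rho w nb)+
   thus "T^2 * (LB x. (Nt T i rho w x)^2) <= T^2 * N2" by (intro mult_left_mono) auto
   have "(LB x. (gt T i rho w j l x)^2) <= (LB z. damping T z * (hs z * (g0 j l z)^2))" for j l
   proof (rule integral_mono)
    show "L1 (%x. (gt T i rho w j l x)^2)" by (intro bsupp_integrable bsupp_sq bsupp_terms rho w)
    have di: "L1 (%z. (hs z * damping T z) * (g0 j l z)^2)"
    proof (rule L1_mult(1)[OF bsupp_integrable[OF bsupp_sq[OF g0b]]])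
     show "(%z. hs z * damping T z) \<in> Borel"
      using smooth_measurable[OF smooth_damping(1)] by (intro borel_measurable_times borel_measurable_indicator half_space_borel) auto
     show "\<bar>hs z * damping T z\<bar> <= 1" for z :: "real \<times> 'a"
      using damping_bounds[of T z] T(1) by (auto simp: indicator_def)
    qed
    thus "L1 (%z. damping T z * (hs z * (g0 j l z)^2))" by (simp add: mult_ac)
    show "(gt T i rho w j l z)^2 <= damping T z * (hs z * (g0 j l z)^2)" for z
    proof (cases "z \<in> half_space")
     case True
     note d = damping_bounds(1)[of T z] damping_bounds(2)[OF T(1) True]
     have "(gt T i rho w j l z)^2 <= (damping T z * g0 j l z)^2"
      using gle[of T j l z] True d g0n[of j l z] by (intro power2_le_iff_abs_le[THEN iffD2]) auto
     also have "\<dots> <= damping T z * (g0 j l z)^2"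
      unfolding power_mult_distrib using d by (intro mult_right_mono) (auto simp: power2_eq_square mult_left_le_one_le)
     finally show ?thesis using True by simp
    qed (simp add: gt_def)
   qed
   thus "T * (\<Sum>j\<in>J. \<Sum>l\<in>UNIV. LB x. (gt T i rho w j l x)^2) <= T * G T"
    unfolding G_def using T(1) by (intro mult_left_mono sum_mono) auto
  qed
  finally have E: "(\<integral>\<^sup>+xi. ennreal (indicator (region i) xi * (cmod (ft (Vt T i rho w i) xi))^2) \<partial>lborel) <= ennreal E" .
  \<comment> \<open>From \<open>Vt\<close> back to the deviation: the model error \<open>om\<close>
    and the error of \<open>W\<close> are added in \<open>L^2\<close>, and the time integral
    supplies the factor \<open>T / 2\<close>.\<close>
  have D: "(LB z. (deviation th phi v v0 T z - Vt T i rho w i z)^2) <= T * om^2 * Phi + T * (S * (2 * C + 1) * eta)"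
  proof -
   let ?k = "%q z. hs z * ((damping T z)^2 * ((th (fst z))^2 * q (snd z)))"
   define q where "q x = 2 * om^2 * (phi x)^2 + 2 * ((phi x)^2 * (W x - v0 x)^2)" for x
   have qi: "L1 q" unfolding q_def[abs_def] by (intro integrable_add integrable_mult_right phi2i phiW2)
   have "(LB z. (deviation th phi v v0 T z - Vt T i rho w i z)^2) <= (LB z. ?k q z)"
   proof (rule integral_mono)
    show "L1 (%z. (deviation th phi v v0 T z - Vt T i rho w i z)^2)"
     by (intro bsupp_integrable bsupp_sq bsupp_diff bsupp_deviation[where C=C] bsupp_terms rho w th phi v v0m v0C)
    show "L1 (?k q)" by (rule damped_tensor_le(1)[OF T(1) thmm th(2) qi]) (simp add: q_def)
    show "(deviation th phi v v0 T z - Vt T i rho w i z)^2 <= ?k q z" for z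
    proof (cases "z \<in> half_space")
     case True
     have "deviation th phi v v0 T z - Vt T i rho w i z = (damping T z * (th (fst z) * phi (snd z))) * ((v z - V i z) + (W (snd z) - v0 (snd z)))"
      using True by (simp add: deviation_def Vt_def rho_def w_def algebra_simps)
     hence "(deviation th phi v v0 T z - Vt T i rho w i z)^2 = (damping T z * (th (fst z) * phi (snd z)))^2 * ((v z - V i z) + (W (snd z) - v0 (snd z)))^2"
      by (simp add: power_mult_distrib)
     also have "\<dots> <= (damping T z * (th (fst z) * phi (snd z)))^2 * (2 * om^2 + 2 * (W (snd z) - v0 (snd z))^2)"
     proof (intro mult_left_mono)
      have "\<bar>v z - V i z\<bar> <= om" using approx[OF i, of z] by (simp add: abs_minus_commute)
      hence "(v z - V i z)^2 <= om^2" using abs_le_square_iff[of "v z - V i z" om] by auto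
      thus "((v z - V i z) + (W (snd z) - v0 (snd z)))^2 <= 2 * om^2 + 2 * (W (snd z) - v0 (snd z))^2"
       using sum_squares_bound[of "v z - V i z" "W (snd z) - v0 (snd z)"] by (simp add: power2_sum)
     qed simp
     also have "\<dots> = ?k q z" using True by (simp add: q_def power_mult_distrib algebra_simps)
     finally show ?thesis .
    qed (simp add: deviation_def Vt_def)
   qed
   also have "\<dots> <= T / 2 * (LB x. q x)" by (rule damped_tensor_le(2)[OF T(1) thmm th(2) qi]) (simp add: q_def)
   also have "(LB x. q x) = 2 * om^2 * Phi + 2 * (?t1 W)"
    unfolding q_def Phi_def by (subst integral_add) (auto intro: phi2i phiW2)
   also have "T / 2 * (2 * om^2 * Phi + 2 * (?t1 W)) = T * om^2 * Phi + T * (?t1 W)"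
    by (simp add: algebra_simps)
   also have "\<dots> <= T * om^2 * Phi + T * (S * (2 * C + 1) * eta)" using phiW2(1) T(1) by (intro add_left_mono mult_left_mono) auto
   finally show ?thesis .
  qed
  show ?thesis
   using ft_energy_split[OF bsupp_deviation[OF th(1) phi v v0m v0C] bsupp_terms(1)[OF rho w] region_measurable E E0 D]
   unfolding E_def[symmetric] P2_def by simp
 qed
 have e1: "EV T. T * Bn <= B"
 proof -
  have "((%T::real. T * Bn) \<longlongrightarrow> 0 * Bn) (at_right 0)" by (intro tendsto_mult tendsto_const tendsto_ident_at)
  from order_tendstoD(2)[OF this, of B] B1 show ?thesis by (auto elim!: eventually_mono)
 qed
 have e2: "EV T. sqrt T * Bg <= B"
 proof -
  have "((%T::real. sqrt T * Bg) \<longlongrightarrow> sqrt 0 * Bg) (at_right 0)" by (intro tendsto_mult tendsto_const tendsto_real_sqrt tendsto_ident_at)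
  from order_tendstoD(2)[OF this, of B] B1 show ?thesis by (auto elim!: eventually_mono)
 qed
 have e3: "EV T. source_mass T rho w <= 2 * eta"
  using order_tendstoD(2)[OF mlim, of "2 * eta"] m0 eta by (auto elim!: eventually_mono)
 have e4: "EV T. 2 * rc * (T * N2 + G T) <= eps / 2"
 proof -
  have "((%T. 2 * rc * (T * N2 + G T)) \<longlongrightarrow> 2 * rc * (0 * N2 + 0)) (at_right 0)"
   by (intro tendsto_mult tendsto_add tendsto_const tendsto_ident_at Glim)
  from order_tendstoD(2)[OF this, of "eps / 2"] eps show ?thesis by (auto elim!: eventually_mono)
 qed
 have e0: "EV T. (0::real) < T" by (simp add: eventually_at_filter)
 show ?thesis
  using e0 e1 e2 e3 e4
 proof eventually_elim
  case (elim T)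
  have "M * eta = eps / 2" using M by (simp add: eta_def)
  moreover have "4 * rc * B * eta + 2 * P2 * (S * (2 * C + 1)) * eta <= M * eta" unfolding M_def using eta by (simp add: distrib_right)
  ultimately have "4 * rc * B * eta + 2 * P2 * (S * (2 * C + 1)) * eta + 2 * rc * (T * N2 + G T) <= eps" using elim(5) by linarith
  hence Y: "T * (4 * rc * B * eta + 2 * P2 * (S * (2 * C + 1)) * eta + 2 * rc * (T * N2 + G T)) <= T * eps"
   using elim(1) by (intro mult_left_mono) auto
  have X: "2 * (rc * (2 * eta * B * T + card J * (om^2 * (T / 2 * Phi)) + T^2 * N2 + T * G T)) + 2 * P2 * (T * om^2 * Phi + T * (S * (2 * C + 1) * eta)) =
   T * ((rc * card J + 2 * P2) * Phi * om^2) + T * (4 * rc * B * eta + 2 * P2 * (S * (2 * C + 1)) * eta + 2 * rc * (T * N2 + G T))"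
   by (simp add: algebra_simps power2_eq_square)
  have "2 * (rc * (2 * eta * B * T + card J * (om^2 * (T / 2 * Phi)) + T^2 * N2 + T * G T)) + 2 * P2 * (T * om^2 * Phi + T * (S * (2 * C + 1) * eta))
    <= T * ((rc * card J + 2 * P2) * Phi * om^2 + eps)"
   unfolding X distrib_left[of T _ eps] using Y by (rule add_left_mono)
  from order_trans[OF main[OF elim(1-4)] ennreal_leI[OF this]]
  show ?case unfolding rc_def P2_def Phi_def .
 qed
qed

end

section \<open>Averages near the boundary\<close>

text \<open>The weight is the square of the one in \<open>deviation\<close>, so energies of
  deviations are such averages. Division is by \<open>T\<close> and not by the total weight, hence
  the factors 1/2 below.\<close>

definition avg :: "(real => real) => ('a::euclidean_space => real) => (real \<times> 'a => real) => real => real" where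
 "avg th phi g T = (LB z. hs z * ((damping T z)^2 * ((th (fst z))^2 * (phi (snd z))^2)) * g z) / T"

locale averaging =
 fixes th :: "real => real" and phi :: "'a::euclidean_space => real"
 assumes th: "test_fun th" "!!t. \<bar>th t\<bar> <= 1" and phi: "test_fun phi"
begin

lemma thmm[measurable]: "th \<in> Borel" by (rule smooth_measurable[OF test_fun_smooth[OF th(1)]])

lemma phim[measurable]: "phi \<in> Borel" by (rule smooth_measurable[OF test_fun_smooth[OF phi]])

lemma phi2i: "L1 (%x. (phi x)^2)" by (intro bsupp_integrable bsupp_sq test_fun_bsupp phi)

definition mass :: real where "mass = (LB x. (phi x)^2)"

lemma mass_nonneg: "0 <= mass" by (simp add: mass_def)

definition weight :: "real => real \<times> 'a => real" where
 "weight T z = hs z * ((damping T z)^2 * ((th (fst z))^2 * (phi (snd z))^2))"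

lemma avg_weight: "avg th phi g T = (LB z. weight T z * g z) / T"
 by (simp add: avg_def weight_def)

lemma weight_nonneg: "0 <= weight T z" by (simp add: weight_def)

lemma weight_integrable: "0 < T ==> L1 (weight T)"
 unfolding weight_def[abs_def] by (rule damped_tensor_le(1)[OF _ thmm th(2) phi2i]) auto

lemma weight_mult_integrable:
 assumes "0 < T" "g \<in> Borel" "!!z. \<bar>g z\<bar> <= C"
 shows "L1 (%z. weight T z * g z)"
 using L1_mult(1)[OF weight_integrable[OF assms(1)] assms(2,3)] by (simp add: mult.commute)

lemma avg_mono:
 assumes T: "0 < T" and g: "g \<in> Borel" "!!z. \<bar>g z\<bar> <= C" and h: "h \<in> Borel" "!!z. \<bar>h z\<bar> <= D"
  and le: "!!z. g z <= h z"
 shows "avg th phi g T <= avg th phi h T"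
 unfolding avg_weight
 by (intro divide_right_mono integral_mono weight_mult_integrable[OF T g] weight_mult_integrable[OF T h] mult_left_mono le weight_nonneg)
  (use T in auto)

lemma avg_add:
 assumes T: "0 < T" and g: "g \<in> Borel" "!!z. \<bar>g z\<bar> <= C" and h: "h \<in> Borel" "!!z. \<bar>h z\<bar> <= D"
 shows "avg th phi (%z. g z + h z) T = avg th phi g T + avg th phi h T"
 unfolding avg_weight distrib_left integral_add[OF weight_mult_integrable[OF T g] weight_mult_integrable[OF T h]]
 by (rule add_divide_distrib)

lemma avg_cmult: "avg th phi (%z. c * g z) T = c * avg th phi g T"
 unfolding avg_weight by (simp add: mult.left_commute)

lemma avg_snd:
 assumes T: "0 < T" and q: "q \<in> Borel" "!!x. 0 <= q x" "!!x. q x <= C"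
 shows "avg th phi (%z. q (snd z)) T <= (LB x. (phi x)^2 * q x) / 2"
proof -
 have i: "L1 (%x. (phi x)^2 * q x)"
  using L1_mult(1)[OF phi2i q(1), of C] q(2,3) by (simp add: mult.commute)
 have "(LB z. weight T z * q (snd z)) <= T / 2 * (LB x. (phi x)^2 * q x)"
  using damped_tensor_le(2)[OF T thmm th(2) i] q(2) by (simp add: weight_def mult.assoc)
 thus ?thesis unfolding avg_weight using T by (simp add: field_simps)
qed

lemma avg_const: assumes "0 < T" "0 <= c" shows "avg th phi (%z. c) T <= c * mass / 2"
proof -
 have "avg th phi (%z. c) T <= (LB x. (phi x)^2 * c) / 2"
  using avg_snd[OF assms(1), of "%_. c" c] assms(2) by simp
 thus ?thesis by (simp add: mass_def mult.commute)
qed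

text \<open>In time the average is taken against the rescaled kernel \<open>exp (- 2 * s)\<close> on
  the half-line, of integral 1/2, and the factor \<open>th\<close> tends to its value at 0.\<close>

lemma avg_ess_lim0:
 assumes g: "g \<in> Borel" and C: "!!z. \<bar>g z\<bar> <= C" and L: "ess_lim0 (%t. LB x. g (t, x) * (phi x)^2) L"
 shows "((%T. avg th phi g T) \<longlongrightarrow> (th 0)^2 * L / 2) (at_right 0)"
proof -
 define m where "m t = (LB x. g (t, x) * (phi x)^2)" for t
 have mm: "m \<in> Borel"
  unfolding m_def[abs_def] by (rule measurable_slice_integral[OF g]) measurable
 have mb: "\<bar>m t\<bar> <= C * mass" for t
  unfolding m_def mass_def using L1_mult(2)[OF phi2i measurable_slice[OF g] C] by simp
 have CM: "0 <= C * mass" using mb[of 0] by linarith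
 have th1: "(th t)^2 <= 1" for t unfolding abs_square_le_1 by (rule th(2))
 have ml: "ess_lim0 (%t. (th t)^2 * m t) ((th 0)^2 * L)"
 proof -
  have "((%t. ((th t)^2 - (th 0)^2) * m t) \<longlongrightarrow> 0) (at_right 0)"
  proof (rule Lim_null_comparison)
   have "(th \<longlongrightarrow> th 0) (at_right 0)"
    by (rule tendsto_within_subset[OF isContD[OF DERIV_isCont[OF smooth_real_deriv[OF test_fun_smooth[OF th(1)]]]] subset_UNIV])
   from tendsto_mult[OF tendsto_rabs[OF tendsto_diff[OF tendsto_power[OF this, of 2] tendsto_const[of "(th 0)^2"]]] tendsto_const[of "C * mass"]]
   show "((%t. \<bar>(th t)^2 - (th 0)^2\<bar> * (C * mass)) \<longlongrightarrow> 0) (at_right 0)" by simp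
   show "\<forall>\<^sub>F t in at_right 0. norm (((th t)^2 - (th 0)^2) * m t) <= \<bar>(th t)^2 - (th 0)^2\<bar> * (C * mass)"
    using mb by (auto simp: abs_mult intro!: always_eventually mult_left_mono)
  qed
  from ess_lim0_add[OF ess_lim0_tendsto[OF this] ess_lim0_cmult[OF L, of "(th 0)^2"]]
  show ?thesis by (simp add: m_def[symmetric] algebra_simps)
 qed
 have "\<bar>(th t)^2 * m t\<bar> <= 1 * (C * mass)" for t
  unfolding abs_mult using mb[of t] th1[of t] by (intro mult_mono) auto
 hence mb': "\<bar>(th t)^2 * m t\<bar> <= C * mass" for t by simp
 have mm': "(%t. (th t)^2 * m t) \<in> Borel" using mm by measurable
 define k where "k t = indicator {0<..} t * exp (- 2 * t)" for t :: real
 have ki: "L1 k" "(LB t. k t) = 1 / 2" using half_line_exp[of 2] by (simp_all add: k_def[abs_def])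
 have lim: "((%T. (LB t. k (t / T) * ((th t)^2 * m t)) / T) \<longlongrightarrow> (LB t. k t) * ((th 0)^2 * L)) (at_right 0)"
  by (rule ess_lim0_kernel[OF ml mm' mb' ki(1)]) (simp add: k_def)
 have eq: "avg th phi g T = (LB t. k (t / T) * ((th t)^2 * m t)) / T" if T: "0 < T" for T
 proof -
  have "(LB z. weight T z * g z) = (LB t. LB x. weight T (t, x) * g (t, x))"
   by (rule lborel_integral_prod(2)[OF weight_mult_integrable[OF T g C]])
  also have "\<dots> = (LB t. LB x. (k (t / T) * (th t)^2) * (g (t, x) * (phi x)^2))"
   using T by (intro integral_cong refl)
    (auto simp: weight_def k_def half_space_eq indicator_def damping_def exp_double[symmetric] zero_less_divide_iff)
  also have "\<dots> = (LB t. k (t / T) * ((th t)^2 * m t))" by (simp add: m_def mult.assoc)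
  finally show ?thesis by (simp add: avg_weight)
 qed
 have "EV T. (LB t. k (t / T) * ((th t)^2 * m t)) / T = avg th phi g T"
  unfolding eventually_at_filter using eq by auto
 from Lim_transform_eventually[OF lim this] show ?thesis by (simp add: ki(2))
qed

lemma avg_weak_trace:
 assumes "weak_trace g h"
 shows "((%T. avg th phi g T) \<longlongrightarrow> (th 0)^2 * (LB x. (phi x)^2 * h x) / 2) (at_right 0)"
 using weak_traceD(3)[OF assms] avg_ess_lim0[OF weak_traceD(1)[OF assms] _ weak_traceD(5)[OF assms phi2i]]
 by (auto simp: mult.commute)

text \<open>Young's inequality \<open>\<bar>g\<bar> \<le> g^2 / eta + eta\<close> under the average,
  in place of the Cauchy-Schwarz inequality: energies control \<open>L^1\<close> averages.\<close>

lemma avg_abs_le_square: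
 assumes T: "0 < T" and g: "g \<in> Borel" "!!z. \<bar>g z\<bar> <= C" and eta: "0 < eta"
 shows "avg th phi (%z. \<bar>g z\<bar>) T <= avg th phi (%z. (g z)^2) T / eta + eta * mass / 2"
proof -
 have C2: "(g z)^2 <= C^2" for z using abs_le_square_iff[of "g z" C] g(2)[of z] by auto
 have gm[measurable]: "g \<in> Borel" by (rule g)
 have b2: "\<bar>1 / eta * (g z)^2\<bar> <= 1 / eta * C^2" for z using C2[of z] eta by (simp add: divide_right_mono)
 have "avg th phi (%z. \<bar>g z\<bar>) T <= avg th phi (%z. 1 / eta * (g z)^2 + eta) T"
 proof (rule avg_mono[OF T])
  show "\<bar>1 / eta * (g z)^2 + eta\<bar> <= 1 / eta * C^2 + eta" for z using b2[of z] eta by linarith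
  show "\<bar>g z\<bar> <= 1 / eta * (g z)^2 + eta" for z
  proof -
   have "2 * \<bar>g z\<bar> * eta <= (g z)^2 + eta^2" using sum_squares_bound[of "\<bar>g z\<bar>" eta] by simp
   hence "\<bar>g z\<bar> * eta <= (g z)^2 + eta^2" using eta mult_nonneg_nonneg[of "\<bar>g z\<bar>" eta] by linarith
   thus ?thesis using eta by (simp add: field_simps power2_eq_square)
  qed
 qed (use g in auto)
 also have "\<dots> = 1 / eta * avg th phi (%z. (g z)^2) T + avg th phi (%z. eta) T"
  unfolding avg_cmult[symmetric] by (rule avg_add[OF T _ b2, where D=eta]) (use eta in auto)
 also have "\<dots> <= avg th phi (%z. (g z)^2) T / eta + eta * mass / 2" using avg_const[OF T, of eta] eta by simp
 finally show ?thesis .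
qed

lemma deviation_avg:
 "0 < T ==> (LB z. (deviation th phi v v0 T z)^2) = T * avg th phi (%z. (v z - v0 (snd z))^2) T"
 by (simp add: avg_def deviation_def power_mult_distrib mult.assoc power2_eq_square[of "indicator _ _"] indicator_inter_arith[symmetric])

end

section \<open>Order relations between weak traces\<close>

lemma weak_trace_nonneg:
 assumes h: "weak_trace g h" and g: "!!z. 0 <= g z"
 shows "AE x in lborel. 0 <= h x"
proof -
 note d = weak_traceD[OF h]
 have hm[measurable]: "h \<in> Borel" by (rule d(2))
 have "AE x in lborel. norm x <= real n --> 0 <= h x" for n
 proof -
  define S where "S = {x. norm x <= real n \<and> h x < 0}"
  have S[measurable]: "S \<in> sets borel" unfolding S_def by measurable
  have fS: "emeasure lborel S < \<infinity>" by (rule emeasure_bounded_finite) (auto simp: S_def bounded_iff)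
  have Si: "L1 (indicator S :: 'a => real)" using fS by (intro integrable_real_indicator) auto
  have hS: "L1 (%x. h x * indicator S x)"
   using d(4) L1_mult(1)[OF Si hm] by blast
  have "0 <= (LB x. h x * indicator S x)"
   by (rule ess_lim0_le[OF ess_lim0_const d(5)[OF Si]]) (auto intro!: integral_nonneg simp: g)
  moreover have "(LB x. - (h x * indicator S x)) \<ge> 0" by (rule integral_nonneg_AE) (auto simp: S_def indicator_def)
  ultimately have "(LB x. - (h x * indicator S x)) = 0" by simp
  hence "AE x in lborel. - (h x * indicator S x) = 0"
   by (subst (asm) integral_nonneg_eq_0_iff_AE) (use hS in \<open>auto simp: S_def indicator_def\<close>)
  thus ?thesis
  proof eventually_elim
   case (elim x)
   hence "x \<notin> S \<or> h x = 0" by (auto simp: indicator_def split: if_splits)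
   thus ?case unfolding S_def by auto
  qed
 qed
 hence "AE x in lborel. \<forall>n::nat. norm x <= real n --> 0 <= h x" unfolding AE_all_countable by blast
 thus ?thesis
 proof eventually_elim
  case (elim x)
  thus ?case using real_arch_simple[of "norm x"] by blast
 qed
qed

lemma weak_trace_le:
 assumes "weak_trace g h" "weak_trace g' h'" "!!z. g z <= g' z + c"
 shows "AE x in lborel. h x <= h' x + c"
proof -
 have "weak_trace (%z. (g' z + c) - g z) (%x. (h' x + c) - h x)"
  by (intro weak_trace_diff weak_trace_add weak_trace_const assms(1,2))
 from weak_trace_nonneg[OF this] assms(3) show ?thesis by (auto simp: algebra_simps elim!: eventually_mono)
qed

section \<open>Levels of Kruzhkov laws\<close>

text \<open>For positive \<open>kap\<close> it equals -1/2 below \<open>p\<close>, 1/2 above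
  \<open>p + kap\<close>, and is affine in between. It is the first component of
  \<open>kruzkov_diff\<close> along the flux curve.\<close>

definition level_diff :: "real => real => real => real" where
 "level_diff p kap y = (\<bar>y - p\<bar> - \<bar>y - (p + kap)\<bar>) / (2 * kap)"

lemma level_diff_bound: "0 < kap ==> \<bar>level_diff p kap y\<bar> <= 1 / 2"
 unfolding level_diff_def by (auto simp: abs_if field_simps)

lemma level_diff_mono:
 assumes "0 < kap" "p <= q" shows "level_diff q kap y <= level_diff p kap y"
 unfolding level_diff_def using assms by (intro divide_right_mono) auto

text \<open>Beyond \<open>q + kap\<close> the right side has reached its maximum 1/2. Otherwise
  \<open>y\<close> has passed at most the fraction \<open>dl\<close> of the long interval, and the
  left side is at most \<open>dl - 1/2\<close>. A short interval near the left end thus dominates a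
  long one up to \<open>dl\<close>.\<close>

lemma level_diff_compare:
 assumes kap: "0 < kap" "0 < kap'" and dl: "0 <= dl" and pq: "p <= q" "q + kap - p <= dl * kap'"
 shows "level_diff p kap' y <= level_diff q kap y + dl"
proof (cases "q + kap <= y")
 case True
 hence "level_diff q kap y = 1 / 2" using kap by (simp add: level_diff_def)
 thus ?thesis using level_diff_bound[OF kap(2), of p y] dl by linarith
next
 case False
 have "\<bar>y - p\<bar> - \<bar>y - (p + kap')\<bar> <= 2 * (dl * kap') - kap'" using False pq kap mult_nonneg_nonneg[OF dl, of kap'] by (smt (verit))
 hence "level_diff p kap' y <= (2 * (dl * kap') - kap') / (2 * kap')"
  unfolding level_diff_def using kap by (intro divide_right_mono) auto
 also have "\<dots> = dl - 1 / 2" using kap by (simp add: field_simps)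
 finally show ?thesis using level_diff_bound[OF kap(1), of q y] by linarith
qed

lemma level_diff_min:
 assumes "0 < kap" shows "min y (p + kap) - min y p = kap * (level_diff p kap y + 1 / 2)"
 using assms by (auto simp: level_diff_def field_simps min_def abs_if)

text \<open>One trace is fixed for each level. Traces of level differences and of truncations are
  linear combinations of these, so the identities between them hold at every point and not only
  almost everywhere.\<close>

definition level_trace :: "(real \<times> 'a::euclidean_space => real) => real => 'a => real" where
 "level_trace u l = (SOME h. weak_trace (%z. \<bar>u z - l\<bar>) h)"

definition ld_trace :: "(real \<times> 'a::euclidean_space => real) => real => real => 'a => real" where
 "ld_trace u p kap x = (level_trace u p x - level_trace u (p + kap) x) / (2 * kap)"

context balance_law
begin

lemma integrand_integrable:
 assumes "test_fun Ps"
 shows "L1 (%z. hs z * (v z * dd (1, 0) Ps z + (\<Sum>k\<in>UNIV. F k z * dd (0, e k) Ps z)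
     + (\<Sum>k\<in>UNIV. \<Sum>j\<in>UNIV. B k j z * dd (0, e k) (dd (0, e j) Ps) z)))"
proof -
 have "L1 (%z. v z * dd (1, 0) Ps z + (\<Sum>k\<in>UNIV. F k z * dd (0, e k) Ps z)
     + (\<Sum>k\<in>UNIV. \<Sum>j\<in>UNIV. B k j z * dd (0, e k) (dd (0, e j) Ps) z))"
  by (intro integrable_add integrable_sum L1_mult(1)[where C=C]
    test_fun_integrable test_fun_dir_deriv assms vm Fm Bm vC FC BC)
 thus ?thesis by (rule L1_mult(1)[where C=1]) (auto simp: half_space_borel)
qed

end

section \<open>Fluxes paired with derivatives of test functions\<close>

definition pairing :: "(real \<times> (real^'d) => real) => real \<times> (real^'d) => real \<times> (real^'d) \<times> (real^'d^'d) => real" where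
 "pairing Ps z Y = fst Y * dd (1, 0) Ps z + (\<Sum>k\<in>UNIV. fst (snd Y) $ k * dd (0, axis k 1) Ps z)
   + (\<Sum>k\<in>UNIV. \<Sum>j\<in>UNIV. snd (snd Y) $ k $ j * dd (0, axis k 1) (dd (0, axis j 1) Ps) z)"

lemma linear_pairing: "linear (pairing Ps z)"
 by (rule linearI) (simp_all add: pairing_def algebra_simps sum.distrib sum_distrib_left)

lemma dir_deriv_axis:
 fixes Ps :: "real \<times> (real^'d) => real"
 assumes "smooth Ps"
 shows "dd (t, y) Ps z = t * dd (1, 0) Ps z + (\<Sum>k\<in>UNIV. y $ k * dd (0, axis k 1) Ps z)"
proof -
 note l = dir_deriv_linear[OF smooth_differentiable[OF assms], of z]
 have "(t, y) = t *\<^sub>R (1, 0) + (\<Sum>k\<in>UNIV. (y $ k) *\<^sub>R (0 :: real, axis k 1 :: real^'d))"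
 proof -
  have "(\<Sum>k\<in>UNIV. (y $ k) *\<^sub>R (0 :: real, axis k 1 :: real^'d)) = (0, \<Sum>k\<in>UNIV. (y $ k) *\<^sub>R axis k 1)"
   by (simp add: sum_prod)
  also have "(\<Sum>k\<in>UNIV. (y $ k) *\<^sub>R axis k 1) = y"
   using basis_expansion[of y] by (simp add: scalar_mult_eq_scaleR)
  finally show ?thesis by simp
 qed
 thus ?thesis by (simp only: linear_add[OF l] linear_sum[OF l] linear_scale[OF l] real_scaleR_def)
qed

lemma dir_deriv_sum:
 "finite I ==> (!!i. i \<in> I ==> smooth (phi i)) ==> dd e (%z. \<Sum>i\<in>I. c i * phi i z) = (%z. \<Sum>i\<in>I. c i * dd e (phi i) z)"
proof (induction I rule: finite_induct)
 case empty
 show ?case by (intro ext dir_deriv_eq) simp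
next
 case (insert i I)
 have s: "smooth (%z. c i * phi i z)" "smooth (%z. \<Sum>i\<in>I. c i * phi i z)"
  using insert.prems by (auto intro!: smooth_intros)
 show ?case
  unfolding sum.insert[OF insert.hyps] dir_deriv_add[OF s] dir_deriv_cmult[OF insert.prems[OF insertI1]]
  using insert.IH[OF insert.prems] by simp
qed

text \<open>Writing the matrix as a sum of squares turns the second order part into squares of
  directional derivatives, the form in which the symbol visibly has nonnegative real part.\<close>

lemma pairing_generator:
 fixes Ps :: "real \<times> (real^'d) => real" and s :: "'d => real^'d"
 assumes Ps: "smooth Ps" and a: "!!k j. a $ k $ j = (\<Sum>l\<in>UNIV. s l $ k * s l $ j)"
 shows "pairing Ps z (1, beta, a) = diff_op (1, beta) (%l. (0, s l)) Ps z"
proof -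
 have d1: "dd (0, y) Phi z = (\<Sum>k\<in>UNIV. y $ k * dd (0, axis k 1) Phi z)" if "smooth Phi" for y z and Phi :: "real \<times> (real^'d) => real"
  using dir_deriv_axis[OF that, of 0 y z] unfolding mult_zero_left add_0_left .
 have d2: "dd (0, s l) (dd (0, s l) Ps) z = (\<Sum>k\<in>UNIV. \<Sum>j\<in>UNIV. s l $ k * s l $ j * dd (0, axis k 1) (dd (0, axis j 1) Ps) z)" for l
 proof -
  have f: "dd (0, s l) Ps = (%z. \<Sum>j\<in>UNIV. s l $ j * dd (0, axis j 1) Ps z)" by (rule ext, rule d1[OF Ps])
  have e: "dd e (%z. \<Sum>j\<in>UNIV. s l $ j * dd (0, axis j 1) Ps z) = (%z. \<Sum>j\<in>UNIV. s l $ j * dd e (dd (0, axis j 1) Ps) z)" for e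
   by (rule dir_deriv_sum[OF finite smooth_dir_deriv[OF Ps]])
  show ?thesis
   by (subst d1[OF smooth_dir_deriv[OF Ps]]) (simp only: f e sum_distrib_left mult.assoc)
 qed
 show ?thesis
  unfolding pairing_def diff_op_def d2 dir_deriv_axis[OF Ps, of 1 beta] fst_conv snd_conv a sum_distrib_right
  by (subst (2) sum.swap, subst (3) sum.swap) simp
qed

locale kruzkov_levels =
 fixes f f' :: "real => real^'d" and A A' :: "real => real^'d^'d" and u :: "real \<times> (real^'d) => real" and M :: real
  and P N :: "real => (real \<times> (real^'d)) measure"
 assumes f: "!!l. (f has_vector_derivative f' l) (at l)" "continuous_on UNIV f'"
  and A: "!!l. (A has_vector_derivative A' l) (at l)" "continuous_on UNIV A'"
  and psd: "!!l. positive_semidefinite (A' l)"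
  and um: "u \<in> Borel" and uM: "!!z. \<bar>u z\<bar> <= M"
  and law: "!!l. \<exists>C. balance_law (%z. \<bar>u z - l\<bar>) (%k z. (sgn (u z - l) *\<^sub>R (f (u z) - f l)) $ k)
    (%k j z. (sgn (u z - l) *\<^sub>R (A (u z) - A l)) $ k $ j) (%k. axis k 1) (P l) (N l) C"
begin

definition curve :: "real => real \<times> (real^'d) \<times> (real^'d^'d)" where "curve l = (l, f l, A l)"

definition velocity :: "real => real \<times> (real^'d) \<times> (real^'d^'d)" where "velocity l = (1, f' l, A' l)"

lemma curve_deriv: "(curve has_vector_derivative velocity l) (at l)"
 unfolding curve_def[abs_def] velocity_def
 by (intro has_vector_derivative_Pair f A) (auto simp: has_vector_derivative_def intro!: derivative_eq_intros)

lemma velocity_continuous: "continuous_on UNIV velocity"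
 unfolding velocity_def[abs_def] by (intro continuous_intros f A)

lemma curve_continuous: "continuous_on UNIV curve"
 by (intro differentiable_imp_continuous_on) (auto simp: differentiable_on_def intro: differentiableI_vector[OF curve_deriv])

lemma level_trace: "weak_trace (%z. \<bar>u z - l\<bar>) (level_trace u l)"
proof -
 obtain C where "balance_law (%z. \<bar>u z - l\<bar>) (%k z. (sgn (u z - l) *\<^sub>R (f (u z) - f l)) $ k)
    (%k j z. (sgn (u z - l) *\<^sub>R (A (u z) - A l)) $ k $ j) (%k. axis k 1) (P l) (N l) C" using law by blast
 from balance_law.weak_trace_ex[OF this] show ?thesis unfolding level_trace_def by (rule someI_ex)
qed

lemma ld_trace: "weak_trace (%z. level_diff p kap (u z)) (ld_trace u p kap)"
 using weak_trace_cmult[OF weak_trace_diff[OF level_trace level_trace], of "1 / (2 * kap)" p "p + kap"]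
 by (simp add: level_diff_def ld_trace_def[abs_def])

lemma kruzkov_diff_curve: "fst (kruzkov_diff curve p kap y) = level_diff p kap y"
 unfolding kruzkov_diff_def curve_def level_diff_def by (simp add: abs_sgn mult.commute)

lemma kruzkov_diff_measurable:
 assumes "0 < kap" "linear g"
 shows "(%z. g (kruzkov_diff curve p kap (u z)) :: real) \<in> Borel"
proof -
 have "continuous_on UNIV (%y. g (kruzkov_diff curve p kap y))"
  unfolding kruzkov_diff_clamp[OF assms(1)]
  by (intro linear_continuous_on_compose[OF _ assms(2)] continuous_intros continuous_on_compose2[OF curve_continuous]) auto
 thus ?thesis by (intro measurable_compose[OF um] borel_measurable_continuous_onI)
qed

lemma level_pairing:
 assumes Ps: "test_fun Ps"
 shows "L1 (%z. hs z * pairing Ps z (sgn (u z - l) *\<^sub>R (curve (u z) - curve l)))" (is ?goalA)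
  and "(LB z. hs z * pairing Ps z (sgn (u z - l) *\<^sub>R (curve (u z) - curve l)))
   = (LINT z|P l. Ps z) - (LINT z|N l. Ps z) - (LB x. level_trace u l x * Ps (0, x))" (is ?goalB)
proof -
 let ?t1 = "%z. sgn (u z - l) *\<^sub>R (curve (u z) - curve l)"
 obtain C where C: "balance_law (%z. \<bar>u z - l\<bar>) (%k z. (sgn (u z - l) *\<^sub>R (f (u z) - f l)) $ k)
    (%k j z. (sgn (u z - l) *\<^sub>R (A (u z) - A l)) $ k $ j) (%k. axis k 1) (P l) (N l) C" using law by blast
 have e: "fst (?t1 z) = \<bar>u z - l\<bar>"
  "fst (snd (?t1 z)) = sgn (u z - l) *\<^sub>R (f (u z) - f l)"
  "snd (snd (?t1 z)) = sgn (u z - l) *\<^sub>R (A (u z) - A l)" for z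
  by (simp_all add: curve_def abs_sgn mult.commute)
 show ?goalA
  unfolding pairing_def e by (rule balance_law.integrand_integrable[OF C Ps])
 show ?goalB
  unfolding pairing_def e by (rule balance_law.level_equation[OF C level_trace Ps])
qed

lemma level_trace_integrable:
 fixes Ps :: "real \<times> (real^'d) => real"
 assumes Ps: "test_fun Ps" shows "L1 (%x. level_trace u l x * Ps (0, x))"
proof -
 obtain R where R: "!!z. R < norm z ==> Ps z = 0" using test_funE[OF Ps] by blast
 obtain S where S: "!!z. \<bar>Ps z\<bar> <= S" using test_fun_bounded[OF Ps] by blast
 have "Ps (0, x) = 0" if "R < norm x" for x using R[of "(0, x)"] that by (simp add: norm_Pair)
 hence "bsupp (%x. Ps (0, x))"
  unfolding bsupp_def using S measurable_slice[OF smooth_measurable[OF test_fun_smooth[OF Ps]]] by blast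
 thus ?thesis
  using weak_traceD(2,4)[OF level_trace] L1_mult(1)[OF bsupp_integrable] by blast
qed

lemma difference_pairing:
 assumes Ps: "test_fun Ps"
 shows "(LB z. hs z * pairing Ps z (kruzkov_diff curve p kap (u z))) =
  1 / (2 * kap) * ((LINT z|P p. Ps z) - (LINT z|N p. Ps z) - ((LINT z|P (p + kap). Ps z) - (LINT z|N (p + kap). Ps z)))
   - (LB x. ld_trace u p kap x * Ps (0, x))"
proof -
 note L = linear_pairing[of Ps]
 have tr: "(LB x. ld_trace u p kap x * Ps (0, x)) = 1 / (2 * kap) * ((LB x. level_trace u p x * Ps (0, x)) - (LB x. level_trace u (p + kap) x * Ps (0, x)))"
  unfolding integral_diff[OF level_trace_integrable[OF Ps] level_trace_integrable[OF Ps], symmetric]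
   integral_mult_right_zero[symmetric] ld_trace_def
  by (intro integral_cong refl) (simp add: diff_divide_distrib left_diff_distrib)
 have "(LB z. hs z * pairing Ps z (kruzkov_diff curve p kap (u z))) =
  (LB z. 1 / (2 * kap) * (hs z * pairing Ps z (sgn (u z - p) *\<^sub>R (curve (u z) - curve p))
   - hs z * pairing Ps z (sgn (u z - (p + kap)) *\<^sub>R (curve (u z) - curve (p + kap)))))"
  unfolding kruzkov_diff_def linear_scale[OF L] linear_diff[OF L]
  by (intro integral_cong refl) (simp add: right_diff_distrib)
 also have "\<dots> = 1 / (2 * kap) * (((LINT z|P p. Ps z) - (LINT z|N p. Ps z) - (LB x. level_trace u p x * Ps (0, x)))
  - ((LINT z|P (p + kap). Ps z) - (LINT z|N (p + kap). Ps z) - (LB x. level_trace u (p + kap) x * Ps (0, x))))"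
  unfolding integral_mult_right_zero integral_diff[OF level_pairing(1)[OF Ps] level_pairing(1)[OF Ps]] level_pairing(2)[OF Ps] ..
 finally show ?thesis unfolding tr by (simp only: right_diff_distrib)
qed


text \<open>The difference quotient lies in the span of the velocities at the base points, so its
  pairing with a test function is a combination of their operators with coefficients
  \<open>g j\<close>. In the index \<open>r\<close> the first entry selects the level
  \<open>p\<close> and the second the positive part; the sign is plus when they agree.\<close>

lemma transport_instance:
 fixes g :: "real => real \<times> (real^'d) \<times> (real^'d^'d) => real" and s :: "real => 'd => real^'d"
 assumes J: "finite J" "!!j. j \<in> J ==> linear (g j)" and kap: "0 < kap"
  and sp: "!!l. p <= l ==> l <= p + kap ==> velocity l = (\<Sum>j\<in>J. g j (velocity l) *\<^sub>R velocity j)"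
  and s: "!!j k m. A' j $ k $ m = (\<Sum>l\<in>UNIV. s j l $ k * s j l $ m)"
  and C: "!!j y. j \<in> J ==> \<bar>g j (kruzkov_diff curve p kap y)\<bar> <= C" "!!x. \<bar>ld_trace u p kap x\<bar> <= C" "0 <= C"
 shows "transport J (%j. (1, f' j)) (%j l. (0, s j l)) (%j z. if j \<in> J then g j (kruzkov_diff curve p kap (u z)) else 0)
  (ld_trace u p kap) C (UNIV :: (bool \<times> bool) set) (%r. (if fst r = snd r then 1 else - 1) / (2 * kap))
  (%r. (if snd r then P else N) (if fst r then p else p + kap))"
proof (intro transport.intro symbols.intro transport_axioms.intro)
 show "(%z. if j \<in> J then g j (kruzkov_diff curve p kap (u z)) else 0) \<in> Borel" for j
  using kruzkov_diff_measurable[OF kap J(2)] by (cases "j \<in> J") auto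
 show "ld_trace u p kap \<in> Borel" using weak_traceD(2)[OF ld_trace] .
 have PN: "sets (P l) = sets borel" "sets (N l) = sets borel" "compact K ==> emeasure (P l) ({0<..T} \<times> K) < \<infinity>"
  "compact K ==> emeasure (N l) ({0<..T} \<times> K) < \<infinity>" "emeasure (P l) (- half_space) = 0" "emeasure (N l) (- half_space) = 0" for l T K
 proof -
  obtain C where b: "balance_law (%z. \<bar>u z - l\<bar>) (%k z. (sgn (u z - l) *\<^sub>R (f (u z) - f l)) $ k)
    (%k j z. (sgn (u z - l) *\<^sub>R (A (u z) - A l)) $ k $ j) (%k. axis k 1) (P l) (N l) C" using law by blast
  note b = balance_law.setsP[OF b] balance_law.setsN[OF b] balance_law.finP[OF b] balance_law.finN[OF b] balance_law.nullP[OF b] balance_law.nullN[OF b]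
  show "sets (P l) = sets borel" "sets (N l) = sets borel" "compact K ==> emeasure (P l) ({0<..T} \<times> K) < \<infinity>"
  "compact K ==> emeasure (N l) ({0<..T} \<times> K) < \<infinity>" "emeasure (P l) (- half_space) = 0" "emeasure (N l) (- half_space) = 0"
   by (fact b | rule b; assumption)+
 qed
 show "sets ((if snd r then P else N) (if fst r then p else p + kap)) = sets borel" for r :: "bool \<times> bool" using PN by simp
 show "emeasure ((if snd r then P else N) (if fst r then p else p + kap)) ({0<..T} \<times> K) < \<infinity>" if "compact K" for r :: "bool \<times> bool" and T K
  using PN(3,4)[OF that] by simp
 show "emeasure ((if snd r then P else N) (if fst r then p else p + kap)) (- half_space) = 0" for r :: "bool \<times> bool" using PN by simp
 fix Ps :: "real \<times> (real^'d) => real" assume Ps: "test_fun Ps"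
 have eq: "(\<Sum>j\<in>J. (if j \<in> J then g j (kruzkov_diff curve p kap (u z)) else 0) * diff_op (1, f' j) (%l. (0, s j l)) Ps z)
   = pairing Ps z (kruzkov_diff curve p kap (u z))" for z
 proof -
  have "pairing Ps z (kruzkov_diff curve p kap (u z)) = pairing Ps z (\<Sum>j\<in>J. g j (kruzkov_diff curve p kap (u z)) *\<^sub>R velocity j)"
   using arg_cong[OF kruzkov_diff_span[OF kap curve_deriv J(2) sp], where f="pairing Ps z"] .
  also have "\<dots> = (\<Sum>j\<in>J. g j (kruzkov_diff curve p kap (u z)) * pairing Ps z (velocity j))"
   by (simp add: linear_sum[OF linear_pairing] linear_scale[OF linear_pairing])
  finally show ?thesis by (simp add: velocity_def pairing_generator[OF test_fun_smooth[OF Ps] s])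
 qed
 show "(LB z. hs z * (\<Sum>j\<in>J. (if j \<in> J then g j (kruzkov_diff curve p kap (u z)) else 0) * diff_op (1, f' j) (%l. (0, s j l)) Ps z))
   = (\<Sum>r\<in>UNIV. (if fst r = snd r then 1 else - 1) / (2 * kap) * (LINT z|(if snd r then P else N) (if fst r then p else p + kap). Ps z))
    - (LB x. ld_trace u p kap x * Ps (0, x))"
  unfolding eq difference_pairing[OF Ps] UNIV_Times_UNIV[symmetric] UNIV_bool by (simp add: algebra_simps)
qed (use J C in auto)

lemma continuous_bound_right:
 fixes h :: "real => real"
 assumes "continuous_on UNIV h" "\<bar>h i\<bar> < (om::real)"
 shows "\<exists>kap>0. \<forall>l. i <= l \<and> l <= i + kap --> \<bar>h l\<bar> <= om"
proof -
 have "0 < om - \<bar>h i\<bar>" using assms(2) by simp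
 then obtain d where d: "0 < d" "!!l. dist l i < d ==> dist (h l) (h i) < om - \<bar>h i\<bar>"
  using assms(1) unfolding continuous_on_iff by blast
 have "\<bar>h l\<bar> <= om" if "i <= l" "l <= i + d / 2" for l
  using d(2)[of l] that d(1) by (auto simp: dist_real_def)
 thus ?thesis using d(1) by (intro exI[of _ "d / 2"]) auto
qed

end

section \<open>Averaged smallness of level differences\<close>

locale levels_averaging = kruzkov_levels f f' A A' u M P N + averaging th phi
 for f f' :: "real => real^'d" and A A' :: "real => real^'d^'d" and u :: "real \<times> (real^'d) => real" and M :: real
  and P N :: "real => (real \<times> (real^'d)) measure" and th :: "real => real" and phi :: "real^'d => real"
begin

abbreviation "ldev p kap == deviation th phi (%z. level_diff p kap (u z)) (ld_trace u p kap)"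

text \<open>It controls the \<open>L^2\<close> distance between deviations at neighbouring levels:
  level differences are ordered in the level, so an integral suffices where a norm would be
  expected.\<close>

definition trace_mass :: "real => real => real" where
 "trace_mass p kap = (LB x. (phi x)^2 * ld_trace u p kap x)"

lemma ld_trace_integrable: "L1 (%x. (phi x)^2 * ld_trace u p kap x)"
 using weak_traceD(2,4)[OF ld_trace, of p kap] L1_mult(1)[OF phi2i] by (metis (no_types, lifting) mult.commute integrable_cong)

lemma trace_mass_le:
 assumes "!!y. level_diff p kap y <= level_diff q kap' y + c"
 shows "trace_mass p kap <= trace_mass q kap' + c * mass"
proof -
 have "trace_mass p kap <= (LB x. (phi x)^2 * ld_trace u q kap' x + c * (phi x)^2)"
  unfolding trace_mass_def
 proof (rule integral_mono_AE)
  show "L1 (%x. (phi x)^2 * ld_trace u q kap' x + c * (phi x)^2)"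
   by (intro integrable_add ld_trace_integrable integrable_mult_right phi2i)
  have "AE x in lborel. ld_trace u p kap x <= ld_trace u q kap' x + c"
   by (rule weak_trace_le[OF ld_trace ld_trace assms])
  thus "AE x in lborel. (phi x)^2 * ld_trace u p kap x <= (phi x)^2 * ld_trace u q kap' x + c * (phi x)^2"
  proof eventually_elim
   case (elim x)
   from mult_left_mono[OF this, of "(phi x)^2"] show ?case by (simp add: distrib_left mult.commute)
  qed
 qed (rule ld_trace_integrable)
 also have "\<dots> = trace_mass q kap' + c * mass"
  unfolding trace_mass_def mass_def
  by (subst integral_add) (auto intro: ld_trace_integrable integrable_mult_right phi2i)
 finally show ?thesis .
qed

text \<open>By monotonicity in the level the difference \<open>d\<close> takes values in
  \<open>[0, 1]\<close>, so its square is at most \<open>d\<close>. The energy is thereby bounded by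
  quantities linear in \<open>d\<close> and its trace, whose limits the weak trace provides.\<close>

lemma level_difference_average:
 assumes kap: "0 < kap" and pq: "p <= q" and c: "trace_mass p kap - trace_mass q kap < c"
 shows "EV T. (LB z. (ldev p kap T z
   - ldev q kap T z)^2) <= T * (2 * c)"
proof -
 let ?t1 = "%q. trace_mass p kap - trace_mass q kap"
 define d where "d z = level_diff p kap (u z) - level_diff q kap (u z)" for z
 define d0 where "d0 x = ld_trace u p kap x - ld_trace u q kap x" for x
 have wt: "weak_trace d d0" unfolding d_def[abs_def] d0_def[abs_def] by (intro weak_trace_diff ld_trace)
 have d: "0 <= d z" "d z <= 1" for z
  using level_diff_mono[OF kap pq, of "u z"] level_diff_bound[OF kap, of p "u z"] level_diff_bound[OF kap, of q "u z"] by (auto simp: d_def)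
 have "AE x in lborel. 0 <= d0 x" by (rule weak_trace_nonneg[OF wt d(1)])
 moreover have "AE x in lborel. d0 x <= 0 + 1" by (rule weak_trace_le[OF wt weak_trace_const]) (use d in simp)
 ultimately have d0: "AE x in lborel. 0 <= d0 x \<and> d0 x <= 1" by eventually_elim auto
 have [measurable]: "d \<in> Borel" "d0 \<in> Borel" using weak_traceD(1,2)[OF wt] by auto
 \<comment> \<open>The trace of \<open>d\<close> lies in \<open>[0, 1]\<close> only almost
   everywhere; the clipped copy obeys the bounds at every point.\<close>
 define e0 where "e0 x = min 1 (max 0 (d0 x))" for x
 have e0[measurable]: "e0 \<in> Borel" unfolding e0_def[abs_def] by measurable
 have e0b: "0 <= e0 x" "e0 x <= 1" for x by (auto simp: e0_def)
 have e0d: "AE x in lborel. e0 x = d0 x" using d0 by eventually_elim (auto simp: e0_def)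
 have m0: "(LB x. (phi x)^2 * d0 x) = trace_mass p kap - trace_mass q kap"
  unfolding d0_def right_diff_distrib trace_mass_def by (rule integral_diff; rule ld_trace_integrable)
 have e2: "(LB x. (phi x)^2 * (e0 x)^2) <= trace_mass p kap - trace_mass q kap"
 proof -
  have i: "L1 (%x. q x * (phi x)^2)" if "q \<in> Borel" "!!x. \<bar>q x\<bar> <= 1" for q
   by (rule L1_mult(1)[OF phi2i that])
  have "(LB x. (e0 x)^2 * (phi x)^2) <= (LB x. e0 x * (phi x)^2)"
  proof (intro integral_mono i mult_right_mono)
   show "\<bar>(e0 x)^2\<bar> <= 1" "\<bar>e0 x\<bar> <= 1" for x using e0b[of x] by (auto simp: abs_square_le_1)
   show "(e0 x)^2 <= e0 x" for x using e0b[of x] by (simp add: power2_eq_square mult_left_le)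
  qed auto
  also have "\<dots> = (LB x. (phi x)^2 * d0 x)"
   by (rule integral_cong_AE) (use e0d in \<open>auto elim!: eventually_mono\<close>)
  finally show ?thesis unfolding m0 by (simp add: mult.commute)
 qed
 have lim: "((%T. avg th phi d T) \<longlongrightarrow> (th 0)^2 * (?t1 q) / 2) (at_right 0)"
  using avg_weak_trace[OF wt] unfolding m0 .
 have c0: "0 <= trace_mass p kap - trace_mass q kap" by (rule order_trans[OF _ e2]) simp
 have "(th 0)^2 * (?t1 q) / 2 < c / 2"
 proof -
  have "(th 0)^2 * (?t1 q) <= 1 * (?t1 q)"
   using c0 th(2)[of 0] by (intro mult_right_mono) (auto simp: abs_square_le_1)
  thus ?thesis using c by simp
 qed
 from order_tendstoD(2)[OF lim this]
 have ev: "EV T. avg th phi d T < c / 2" .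
 have "EV T. (0::real) < T" by (simp add: eventually_at_filter)
 thus ?thesis
  using ev
 proof eventually_elim
  case (elim T)
  have dm: "L1 (%z. weight T z * ((d z)^2))"
   using d by (intro weight_mult_integrable[OF elim(1), where C=1]) (auto simp: abs_square_le_1)
  have em: "(%z :: real \<times> (real^'d). (e0 (snd z))^2) \<in> Borel"
   by (rule snd_measurable[where h="%x. (e0 x)^2"]) measurable
  have eb: "\<bar>(e0 x)^2\<bar> <= 1" for x using e0b[of x] by (auto simp: abs_square_le_1)
  have e0z: "AE z in lborel. e0 (snd z) = d0 (snd (z :: real \<times> (real^'d)))"
  proof -
   have "AE z in lborel \<Otimes>\<^sub>M lborel. e0 (snd z) = d0 (snd (z :: real \<times> (real^'d)))"
   proof (rule lborel_pair.AE_pair_measure)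
    show "{z \<in> space (lborel \<Otimes>\<^sub>M lborel). e0 (snd z) = d0 (snd (z :: real \<times> (real^'d)))} \<in> sets (lborel \<Otimes>\<^sub>M lborel)" by measurable
   qed (use e0d in auto)
   thus ?thesis unfolding lborel_prod .
  qed
  have "(LB z. (ldev p kap T z
   - ldev q kap T z)^2) = (LB z. weight T z * (d z - d0 (snd z))^2)"
  proof (intro integral_cong refl)
   fix z
   have "ldev p kap T z - ldev q kap T z
    = hs z * (damping T z * (th (fst z) * phi (snd z))) * (d z - d0 (snd z))"
    by (simp add: deviation_def d_def d0_def algebra_simps)
   thus "(ldev p kap T z - ldev q kap T z)^2
    = weight T z * (d z - d0 (snd z))^2"
    by (auto simp: weight_def power_mult_distrib indicator_def)
  qed
  also have "\<dots> = (LB z. weight T z * (d z - e0 (snd z))^2)"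
  proof (rule integral_cong_AE)
   have [measurable]: "weight T \<in> Borel" using weight_integrable[OF elim(1)] by auto
   have [measurable]: "(%z :: real \<times> (real^'d). d0 (snd z)) \<in> Borel" "(%z :: real \<times> (real^'d). e0 (snd z)) \<in> Borel"
    by (intro snd_measurable; measurable)+
   show "(%z. weight T z * (d z - d0 (snd z))^2) \<in> borel_measurable lborel" "(%z. weight T z * (d z - e0 (snd z))^2) \<in> borel_measurable lborel"
    by measurable
  qed (use e0z in \<open>auto elim!: eventually_mono\<close>)
  also have "\<dots> <= (LB z. 2 * (weight T z * d z) + 2 * (weight T z * (e0 (snd z))^2))"
  proof (rule integral_mono)
   show "L1 (%z. weight T z * (d z - e0 (snd z))^2)"
   proof (rule weight_mult_integrable[OF elim(1), where C=1])
    show "(%z. (d z - e0 (snd z))^2) \<in> Borel"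
     by (intro borel_measurable_power borel_measurable_diff snd_measurable e0) measurable
    show "\<bar>(d z - e0 (snd z))^2\<bar> <= 1" for z using d[of z] e0b[of "snd z"] by (auto simp: abs_square_le_1 abs_if)
   qed
   show "L1 (%z. 2 * (weight T z * d z) + 2 * (weight T z * (e0 (snd z))^2))"
    using d eb by (intro integrable_add integrable_mult_right weight_mult_integrable[OF elim(1), where C=1] em) auto
   show "weight T z * (d z - e0 (snd z))^2 <= 2 * (weight T z * d z) + 2 * (weight T z * (e0 (snd z))^2)" for z
   proof -
    have "(d z - e0 (snd z))^2 <= 2 * (d z)^2 + 2 * (e0 (snd z))^2"
     using sum_squares_bound[of "d z" "- e0 (snd z)"] by (simp add: power2_diff)
    also have "(d z)^2 <= d z" using d[of z] by (simp add: power2_eq_square mult_left_le)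
    finally have "(d z - e0 (snd z))^2 <= 2 * d z + 2 * (e0 (snd z))^2" by simp
    from mult_left_mono[OF this weight_nonneg] show ?thesis by (simp add: algebra_simps)
   qed
  qed
  also have "\<dots> = 2 * (T * avg th phi d T) + 2 * (T * avg th phi (%z. (e0 (snd z))^2) T)"
  proof -
   have 1: "L1 (%z. 2 * (weight T z * d z))" "L1 (%z. 2 * (weight T z * (e0 (snd z))^2))"
    using d eb by (intro integrable_mult_right weight_mult_integrable[OF elim(1), where C=1] em; auto)+
   show ?thesis unfolding integral_add[OF 1] avg_weight using elim(1) by simp
  qed
  also have "\<dots> <= 2 * (T * (c / 2)) + 2 * (T * (c / 2))"
  proof -
   have "avg th phi (%z. (e0 (snd z))^2) T <= (LB x. (phi x)^2 * (e0 x)^2) / 2"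
    by (rule avg_snd[OF elim(1), where q="%x. (e0 x)^2" and C=1]) (use eb in auto)
   hence "avg th phi (%z. (e0 (snd z))^2) T <= c / 2" using e2 c by simp
   thus ?thesis using elim by (intro add_mono mult_left_mono) auto
  qed
  also have "\<dots> = T * (2 * c)" by simp
  finally show ?case .
 qed
qed


text \<open>On the region of \<open>i\<close> the deviation at \<open>p\<close> is replaced by the
  one at level \<open>i\<close>, at a price \<open>c\<close> by
  \<open>level_difference_average\<close>; the latter is small there by \<open>core_limit\<close>.
  The parameters are fixed in the order \<open>c\<close>, \<open>kap1\<close>, \<open>J\<close>,
  \<open>om\<close>, \<open>kap\<close>, each depending on those before it.\<close>

lemma averaged_L2:
 assumes eps: "0 < eps"
 shows "\<exists>kap0>0. \<forall>kap. 0 < kap \<and> kap < kap0 --> (\<forall>\<^sub>F T in at_right 0.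
   (LB z. (ldev p kap T z)^2) <= T * eps)"
proof -
 define P2 :: real where "P2 = (2 * pi) ^ DIM(real \<times> (real^'d))"
 have P2: "0 < P2" by (simp add: P2_def)
 \<comment> \<open>A bound for the number of base points that is known before they are chosen. This
   breaks a circle: \<open>c\<close> contains the bound, and how close to \<open>p\<close> the
   points must lie depends on \<open>c\<close>.\<close>
 define m where "m = real (DIM(real \<times> (real^'d) \<times> (real^'d^'d)))"
 have m: "0 < m" unfolding m_def by (simp only: of_nat_0_less_iff DIM_positive)
 define c where "c = eps / (8 * m)"
 have c: "0 < c" using eps m by (simp add: c_def)
 define dl where "dl = c / (2 * (1 + mass))"
 have ms: "0 < 1 + mass" using mass_nonneg by simp
 have dl: "0 < dl" using c ms by (simp add: dl_def)
 have dlm: "dl + dl * mass < c"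
 proof -
  have "dl + dl * mass = dl * (1 + mass)" by (simp add: distrib_left)
  also have "\<dots> = c / 2" using ms unfolding dl_def times_divide_eq_left by (subst frac_eq_eq) auto
  finally show ?thesis using c by simp
 qed
 \<comment> \<open>At \<open>p\<close> the mass is at most the supremum \<open>S\<close> for every
   step. A step \<open>kap1\<close> that nearly attains \<open>S\<close> bounds the mass at nearby
   levels from below through \<open>level_diff_compare\<close>. So moving from \<open>p\<close> to
   such a level loses less than \<open>c\<close>.\<close>
 define S where "S = (SUP kap\<in>{0<..}. trace_mass p kap)"
 have bdd: "bdd_above (trace_mass p ` {0<..})"
 proof (rule bdd_aboveI2)
  fix kap :: real assume "kap \<in> {0<..}"
  hence "level_diff p kap y <= level_diff p 1 y + 1" for y
   using level_diff_bound[of kap p y] level_diff_bound[of 1 p y] by auto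
  from trace_mass_le[OF this] show "trace_mass p kap <= trace_mass p 1 + 1 * mass" .
 qed
 have Sup: "trace_mass p kap <= S" if "0 < kap" for kap unfolding S_def by (rule cSUP_upper[OF _ bdd]) (use that in simp)
 have "\<exists>kap1\<in>{0<..}. S - dl < trace_mass p kap1"
  using less_cSUP_iff[OF _ bdd, of "S - dl"] dl unfolding S_def[symmetric] by auto
 then obtain kap1 where kap1: "0 < kap1" "S - dl < trace_mass p kap1"
  by auto
 have tm: "trace_mass p kap - trace_mass i kap < c" if "0 < kap" "p <= i" "i + kap - p <= dl * kap1" for i kap
 proof -
  have "trace_mass p kap1 <= trace_mass i kap + dl * mass"
   by (rule trace_mass_le[OF level_diff_compare]) (use that kap1 dl in auto)
  thus ?thesis using Sup[OF that(1)] kap1(2) dlm by linarith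
 qed
 obtain eps0 where eps0: "0 < eps0" "!!eps. 0 < eps ==> eps <= eps0 ==> \<exists>J g. finite J \<and> J \<subseteq> {p<..<p + eps} \<and> card J <= DIM(real \<times> (real^'d) \<times> (real^'d^'d)) \<and>
    (\<forall>j\<in>J. linear (g j) \<and> (\<forall>i\<in>J. g j (velocity i) = of_bool (i = j))) \<and>
    (\<forall>l\<in>{p<..<p + eps0}. velocity l = (\<Sum>j\<in>J. g j (velocity l) *\<^sub>R velocity j))"
  by (rule curve_basis[where p=p and Ga=velocity]) (erule that, simp)
 \<comment> \<open>Base points within \<open>dl * kap1 / 2\<close> of \<open>p\<close> leave the
   other half of \<open>dl * kap1\<close> for the step \<open>kap\<close>.\<close>
 define eps' where "eps' = min eps0 (dl * kap1 / 2)"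
 have "0 < eps'" "eps' <= eps0" using eps0 dl kap1 by (auto simp: eps'_def)
 from eps0(2)[OF this] obtain J g where J: "finite J" "J \<subseteq> {p<..<p + eps'}" "card J <= DIM(real \<times> (real^'d) \<times> (real^'d^'d))"
  and g: "!!j. j \<in> J ==> linear (g j)" "!!i j. i \<in> J ==> j \<in> J ==> g j (velocity i) = of_bool (i = j)"
  and sp: "!!l. l \<in> {p<..<p + eps0} ==> velocity l = (\<Sum>j\<in>J. g j (velocity l) *\<^sub>R velocity j)" by blast
 have Jne: "J \<noteq> {}"
 proof
  assume "J = {}"
  hence "velocity (p + eps0 / 2) = 0" using sp[of "p + eps0 / 2"] eps0(1) by simp
  thus False by (simp add: velocity_def zero_prod_def)
 qed
 have Ji: "p < i" "i < p + eps0" "i - p < dl * kap1 / 2" if "i \<in> J" for i using subsetD[OF J(2) that] by (auto simp: eps'_def)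
 have cJ: "real (card J) <= m" using J(3) by (simp only: m_def of_nat_le_iff)
 have "\<exists>s :: 'd => real^'d. \<forall>k n. A' j $ k $ n = (\<Sum>l\<in>UNIV. s l $ k * s l $ n)" for j
  by (rule positive_semidefinite_decompose[OF psd[of j]]) blast
 then obtain s :: "real => 'd => real^'d" where s: "!!j k n. A' j $ k $ n = (\<Sum>l\<in>UNIV. s j l $ k * s j l $ n)" by metis
 have sym: "symbols J" by unfold_locales (rule J(1))
 define b :: "real => real \<times> (real^'d)" where "b = (%j. (1, f' j))"
 define sg :: "real => 'd => real \<times> (real^'d)" where "sg = (%j l. (0, s j l))"
 define rc where "rc = symbols.region_const TYPE(real \<times> (real^'d)) TYPE('d) J"
 define K where "K = (rc * card J + 2 * P2) * mass"
 have K: "0 <= K" unfolding K_def rc_def using symbols.region_const_nonneg[OF sym] P2 mass_nonneg by (intro mult_nonneg_nonneg add_nonneg_nonneg) auto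
 \<comment> \<open>\<open>q\<close> is the share of each region in one half of \<open>eps\<close>,
   up to constants, and \<open>om\<close> is adapted to it. The other half of \<open>eps\<close> is
   spent on the change of level through \<open>c\<close>.\<close>
 define q where "q = eps * P2 / (4 * (card J + 1))"
 have q: "0 < q" using eps P2 by (simp add: q_def)
 define om where "om = sqrt (q / (2 * (K + 1)))"
 have om: "0 < om" using q K by (simp add: om_def)
 have Kom: "K * om^2 + q / 2 <= q"
 proof -
  have "K * om^2 = K * (q / (2 * (K + 1)))" using q K by (simp add: om_def)
  also have "\<dots> <= (K + 1) * (q / (2 * (K + 1)))" using q K by (intro mult_right_mono) auto
  also have "\<dots> = q / 2" using K by (simp add: field_simps)
  finally show ?thesis by simp
 qed
 \<comment> \<open>It vanishes at the velocity of the base point \<open>i\<close>, because the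
   \<open>g j\<close> are dual coordinates and every velocity has first component 1. By continuity
   it is at most \<open>om\<close> just to the right of \<open>i\<close>, so at this level the
   component of index \<open>i\<close> is nearly the level difference and the others are nearly
   0.\<close>
 define Qf where "Qf i j Y = g j Y - of_bool (j = i) * fst Y" for i j Y
 have Qlin: "linear (Qf i j)" if "j \<in> J" for i j
  by (rule linearI) (simp_all add: Qf_def linear_add[OF g(1)[OF that]] linear_scale[OF g(1)[OF that]] algebra_simps)
 have "\<exists>kap>0. \<forall>l. i <= l \<and> l <= i + kap --> \<bar>Qf i j (velocity l)\<bar> <= om" if ij: "i \<in> J" "j \<in> J" for i j
 proof (rule continuous_bound_right)
  show "continuous_on UNIV (%l. Qf i j (velocity l))"
   by (rule linear_continuous_on_compose[OF velocity_continuous Qlin[OF ij(2)]])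
  show "\<bar>Qf i j (velocity i)\<bar> < om" using g(2)[OF ij] om by (auto simp: Qf_def velocity_def)
 qed
 then obtain k where k: "!!i j. i \<in> J ==> j \<in> J ==> 0 < k i j" "!!i j l. i \<in> J ==> j \<in> J ==> i <= l ==> l <= i + k i j ==> \<bar>Qf i j (velocity l)\<bar> <= om"
  by metis
 \<comment> \<open>Three kinds of constraints on the step: the comparison of levels, the interval on
   which \<open>J\<close> generates the velocities, and the continuity bounds for
   \<open>Qf\<close>.\<close>
 define Z where "Z = insert (dl * kap1 / 2) ((%i. p + eps0 - i) ` J \<union> (%(i, j). k i j) ` (J \<times> J))"
 have Zi: "dl * kap1 / 2 \<in> Z" "i \<in> J ==> p + eps0 - i \<in> Z" "i \<in> J ==> j \<in> J ==> k i j \<in> Z" for i j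
  unfolding Z_def by (blast, blast, force)
 have Z: "finite Z" "Z \<noteq> {}" "!!x. x \<in> Z ==> 0 < x" using J(1) k(1) Ji mult_pos_pos[OF dl kap1(1)] by (auto simp: Z_def)
 show ?thesis
 proof (intro exI[of _ "Min Z"] conjI allI impI)
  show "0 < Min Z" using Z by simp
  fix kap assume "0 < kap \<and> kap < Min Z"
  hence kap: "0 < kap" "!!x. x \<in> Z ==> kap < x" using Z by auto
  let ?dev = "%i T. ldev i kap T"
  have dev: "bsupp (?dev i T)" for i T
  proof -
   obtain C where C: "!!x. \<bar>ld_trace u i kap x\<bar> <= C" using weak_traceD(4)[OF ld_trace] by blast
   show ?thesis
    by (rule bsupp_deviation[OF th(1) phi weak_traceD(1)[OF ld_trace] _ weak_traceD(2)[OF ld_trace], where C="max C (1 / 2)"])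
     (use C level_diff_bound[OF kap(1)] in \<open>auto simp: le_max_iff_disj\<close>)
  qed
  have core: "EV T. (\<integral>\<^sup>+xi. ennreal (indicator (symbols.region J b sg i) xi * (cmod (ft (?dev i T) xi))^2) \<partial>lborel)
    <= ennreal (T * (K * om^2 + q / 2))" if i: "i \<in> J" for i
  proof -
   have kb: "\<bar>g j (kruzkov_diff curve i kap y) - of_bool (j = i) * level_diff i kap y\<bar> <= om" if j: "j \<in> J" for j y
   proof -
    have "\<bar>Qf i j (kruzkov_diff curve i kap y)\<bar> <= om / 2"
     unfolding linear_kruzkov_diff[OF Qlin[OF j]]
    proof (rule kruzkov_diff_bound[OF kap(1)])
     show "((%l. Qf i j (curve l)) has_real_derivative Qf i j (velocity l)) (at l)" for l
      using bounded_linear.has_vector_derivative[OF Qlin[OF j, THEN linear_conv_bounded_linear[THEN iffD1]] curve_deriv]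
      by (simp add: has_real_derivative_iff_has_vector_derivative)
     show "\<bar>Qf i j (velocity l)\<bar> <= om" if "i <= l" "l <= i + kap" for l
      using k(2)[OF i j that(1)] that(2) kap(2)[OF Zi(3)[OF i j]] by simp
    qed
    thus ?thesis using om by (simp add: Qf_def kruzkov_diff_curve)
   qed
   obtain C where C: "!!x. \<bar>ld_trace u i kap x\<bar> <= C" using weak_traceD(4)[OF ld_trace] by blast
   define C' where "C' = max C (om + 1 / 2)"
   have gC: "\<bar>g j (kruzkov_diff curve i kap y)\<bar> <= C'" if "j \<in> J" for j y
    using kb[OF that, of y] level_diff_bound[OF kap(1), of i y] by (cases "j = i") (auto simp: C'_def le_max_iff_disj)
   have tr: "transport J b sg (%j z. if j \<in> J then g j (kruzkov_diff curve i kap (u z)) else 0)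
    (ld_trace u i kap) C' (UNIV :: (bool \<times> bool) set) (%r. (if fst r = snd r then 1 else - 1) / (2 * kap))
    (%r. (if snd r then P else N) (if fst r then i else i + kap))"
    unfolding b_def sg_def
   proof (rule transport_instance[OF J(1) g(1) kap(1) _ s gC])
    show "velocity l = (\<Sum>j\<in>J. g j (velocity l) *\<^sub>R velocity j)" if "i <= l" "l <= i + kap" for l
     using that Ji(1)[OF i] kap(2)[OF Zi(2)[OF i]] by (intro sp) auto
    show "\<bar>ld_trace u i kap x\<bar> <= C'" for x using C[of x] by (simp add: C'_def le_max_iff_disj)
   qed (use om in \<open>auto simp: C'_def le_max_iff_disj\<close>)
   have "EV T. (\<integral>\<^sup>+xi. ennreal (indicator (symbols.region J b sg i) xi * (cmod (ft (?dev i T) xi))^2) \<partial>lborel)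
    <= ennreal (T * ((rc * card J + 2 * (2 * pi) ^ DIM(real \<times> (real^'d))) * (LB x. (phi x)^2) * om^2 + q / 2))"
    unfolding rc_def
   proof (rule transport.core_limit[OF tr th phi i weak_traceD(1)[OF ld_trace]])
    show "\<bar>level_diff i kap (u z)\<bar> <= C'" for z using level_diff_bound[OF kap(1), of i "u z"] om by (auto simp: C'_def le_max_iff_disj)
   qed (use kb q in auto)
   thus ?thesis by (simp only: K_def P2_def mass_def)
  qed
  have diff: "EV T. (LB z. (?dev p T z - ?dev i T z)^2) <= T * (2 * c)" if i: "i \<in> J" for i
   by (rule level_difference_average[OF kap(1) _ tm[OF kap(1)]]) (use Ji[OF i] kap(2)[OF Zi(1)] in auto)
  have e1: "EV T. \<forall>i\<in>J. (\<integral>\<^sup>+xi. ennreal (indicator (symbols.region J b sg i) xi * (cmod (ft (?dev i T) xi))^2) \<partial>lborel)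
    <= ennreal (T * (K * om^2 + q / 2))" by (rule eventually_ball_finite[OF J(1)]) (use core in blast)
  have e2: "EV T. \<forall>i\<in>J. (LB z. (?dev p T z - ?dev i T z)^2) <= T * (2 * c)"
   by (rule eventually_ball_finite[OF J(1)]) (use diff in blast)
  have "EV T. (0::real) < T" by (simp add: eventually_at_filter)
  thus "EV T. (LB z. (?dev p T z)^2) <= T * eps"
   using e1 e2
  proof eventually_elim
   case (elim T)
   define X where "X = 2 * (T * (K * om^2 + q / 2)) + 2 * P2 * (T * (2 * c))"
   have T0: "0 <= T * (K * om^2 + q / 2)" using elim(1) K q by (intro mult_nonneg_nonneg add_nonneg_nonneg) auto
   have X0: "0 <= X" unfolding X_def using K q P2 c elim(1) by (intro add_nonneg_nonneg mult_nonneg_nonneg) auto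
   have [measurable]: "ft (?dev p T) \<in> Borel" by (rule borel_measurable_ft[OF bsupp_measurable[OF dev]])
   have [measurable]: "symbols.region J b sg i \<in> sets borel" for i by (rule symbols.region_measurable[OF sym])
   have "ennreal (P2 * (LB z. (?dev p T z)^2)) = (\<integral>\<^sup>+xi. ennreal ((cmod (ft (?dev p T) xi))^2) \<partial>lborel)"
    unfolding plancherel[OF dev] P2_def ..
   also have "\<dots> <= (\<integral>\<^sup>+xi. (\<Sum>i\<in>J. ennreal (indicator (symbols.region J b sg i) xi * (cmod (ft (?dev p T) xi))^2)) \<partial>lborel)"
   proof (rule nn_integral_mono)
    fix xi
    obtain i where i: "i \<in> J" "xi \<in> symbols.region J b sg i" using symbols.region_cover[OF sym Jne] by blast
    hence "ennreal ((cmod (ft (?dev p T) xi))^2) = ennreal (indicator (symbols.region J b sg i) xi * (cmod (ft (?dev p T) xi))^2)" by simp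
    also have "\<dots> <= (\<Sum>i\<in>J. ennreal (indicator (symbols.region J b sg i) xi * (cmod (ft (?dev p T) xi))^2))"
     by (rule member_le_sum[OF i(1)]) (auto simp: J(1))
    finally show "ennreal ((cmod (ft (?dev p T) xi))^2) <= (\<Sum>i\<in>J. ennreal (indicator (symbols.region J b sg i) xi * (cmod (ft (?dev p T) xi))^2))" .
   qed
   also have "\<dots> = (\<Sum>i\<in>J. \<integral>\<^sup>+xi. ennreal (indicator (symbols.region J b sg i) xi * (cmod (ft (?dev p T) xi))^2) \<partial>lborel)"
    by (rule nn_integral_sum) measurable
   also have "\<dots> <= (\<Sum>i\<in>J. ennreal X)"
    unfolding X_def P2_def
    by (intro sum_mono ft_energy_split[OF dev dev symbols.region_measurable[OF sym]]) (use elim T0 in auto)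
   also have "\<dots> = ennreal (card J * X)" using X0 by (simp add: ennreal_mult ennreal_of_nat_eq_real_of_nat)
   finally have "P2 * (LB z. (?dev p T z)^2) <= card J * X"
    using X0 by (simp add: ennreal_le_iff)
   also have "\<dots> <= P2 * (T * eps)"
   proof -
    have 1: "card J * (2 * (T * (K * om^2 + q / 2))) <= P2 * (T * eps) / 2"
    proof -
     have "card J * (2 * (T * (K * om^2 + q / 2))) <= (card J + 1) * (2 * (T * q))"
      using Kom elim(1) T0 by (intro mult_mono mult_left_mono) auto
     also have "\<dots> = P2 * (T * eps) / 2" by (simp add: q_def field_simps)
     finally show ?thesis .
    qed
    have 2: "card J * (2 * P2 * (T * (2 * c))) <= P2 * (T * eps) / 2"
    proof -
     have "card J * (2 * P2 * (T * (2 * c))) <= m * (2 * P2 * (T * (2 * c)))"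
      using cJ P2 elim(1) c by (intro mult_right_mono) auto
     also have "\<dots> = P2 * (T * eps) / 2" using m by (simp add: c_def field_simps)
     finally show ?thesis .
    qed
    show ?thesis using 1 2 unfolding X_def distrib_left by linarith
   qed
   finally show ?case using P2 by simp
  qed
 qed
qed

end

section \<open>Distance to the trace\<close>

context levels_averaging
begin

text \<open>It comes from \<open>min u y = (u + y - \<bar>u - y\<bar>) / 2\<close> together with
  \<open>u = \<bar>u - (- M)\<bar> - M\<close>, valid because \<open>u\<close> is at least
  \<open>- M\<close>.\<close>

definition clip_trace :: "real => real^'d => real" where
 "clip_trace y x = (level_trace u (- M) x - M + y - level_trace u y x) / 2"

lemma M0: "0 <= M" using uM[of undefined] by linarith

lemma clip_trace: "weak_trace (%z. min (u z) y) (clip_trace y)"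
proof -
 let ?t1 = "%x. 1 / 2 * ((level_trace u (- M) x + (y - M)) - level_trace u y x)"
 have "weak_trace (%z. 1 / 2 * ((\<bar>u z - (- M)\<bar> + (y - M)) - \<bar>u z - y\<bar>)) ?t1"
  by (intro weak_trace_cmult weak_trace_diff weak_trace_add weak_trace_const level_trace)
 moreover have "1 / 2 * ((\<bar>u z - (- M)\<bar> + (y - M)) - \<bar>u z - y\<bar>) = min (u z) y" for z
  using abs_le_D2[OF uM[of z]] by (auto simp: min_def abs_if)
 moreover have "?t1 = clip_trace y"
  by (simp add: clip_trace_def fun_eq_iff)
 ultimately show ?thesis by (simp only:)
qed

lemma clip_trace_step: "clip_trace (p + kap) x - clip_trace p x = kap * (ld_trace u p kap x + 1 / 2)" if "0 < kap"
 using that by (simp add: clip_trace_def ld_trace_def field_simps)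

definition dist_avg :: "real => real => real" where
 "dist_avg y T = avg th phi (%z. \<bar>min (u z) y - clip_trace y (snd z)\<bar>) T"

lemma trace_deviation:
 assumes "weak_trace g h"
 shows "(%z :: real \<times> (real^'d). \<bar>g z - h (snd z)\<bar>) \<in> Borel" (is ?goalA) "\<exists>C. \<forall>z. \<bar>g z - h (snd z)\<bar> <= C"
proof -
 note d = weak_traceD[OF assms]
 show ?goalA
  by (intro borel_measurable_abs borel_measurable_diff d(1) snd_measurable d(2))
 obtain C K where "!!z. \<bar>g z\<bar> <= C" "!!x. \<bar>h x\<bar> <= K" using d(3,4) by blast
 hence "\<bar>g z - h (snd z)\<bar> <= C + K" for z by (rule order_trans[OF abs_triangle_ineq4 add_mono])
 thus "\<exists>C. \<forall>z. \<bar>g z - h (snd z)\<bar> <= C" by blast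
qed

lemma avg_triangle:
 assumes T: "0 < T" and tr: "weak_trace g h" "weak_trace g' h'"
  and r: "r \<in> Borel" "!!z. \<bar>r z\<bar> <= D"
  and le: "!!z. \<bar>g z - h (snd z)\<bar> <= \<bar>g' z - h' (snd z)\<bar> + r z"
 shows "avg th phi (%z. \<bar>g z - h (snd z)\<bar>) T <= avg th phi (%z. \<bar>g' z - h' (snd z)\<bar>) T + avg th phi r T"
proof -
 obtain C C' where C: "!!z. \<bar>g z - h (snd z)\<bar> <= C" "!!z. \<bar>g' z - h' (snd z)\<bar> <= C'"
  using trace_deviation(2)[OF tr(1)] trace_deviation(2)[OF tr(2)] by blast
 have "avg th phi (%z. \<bar>g z - h (snd z)\<bar>) T <= avg th phi (%z. \<bar>g' z - h' (snd z)\<bar> + r z) T"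
 proof (rule avg_mono[OF T trace_deviation(1)[OF tr(1)]])
  show "(%z. \<bar>g' z - h' (snd z)\<bar> + r z) \<in> Borel" by (intro borel_measurable_add trace_deviation(1)[OF tr(2)] r)
  show "\<bar>\<bar>g z - h (snd z)\<bar>\<bar> <= C" for z using C(1)[of z] by simp
  show "\<bar>\<bar>g' z - h' (snd z)\<bar> + r z\<bar> <= C' + D" for z using C(2)[of z] r(2)[of z] by linarith
 qed (rule le)
 also have "\<dots> = avg th phi (%z. \<bar>g' z - h' (snd z)\<bar>) T + avg th phi r T"
  by (rule avg_add[OF T trace_deviation(1)[OF tr(2)] _ r]) (use C in simp)
 finally show ?thesis .
qed

text \<open>Raising the truncation level by \<open>kap\<close> adds \<open>kap\<close> times the
  level difference plus 1/2, and the trace changes in the same way, so the distance grows by at most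
  \<open>kap * \<bar>r z\<bar>\<close>. The energy bound \<open>eta * eps / 2\<close> is tuned to
  Young's inequality with parameter \<open>eta\<close>.\<close>

lemma dist_avg_step:
 assumes eps: "0 < eps"
 shows "\<exists>kap0>0. \<forall>kap. 0 < kap \<and> kap < kap0 --> (EV T. dist_avg (p + kap) T <= dist_avg p T + kap * eps)"
proof -
 define eta where "eta = eps / (mass + 1)"
 have ms: "0 < mass + 1" using mass_nonneg by simp
 have eta: "0 < eta" using eps ms by (simp add: eta_def)
 have "eta * mass <= eta * (mass + 1)" using eta by (intro mult_left_mono) auto
 hence etam: "eta * mass <= eps" using ms by (simp add: eta_def)
 have "0 < eta * eps / 2" using eta eps by simp
 from averaged_L2[OF this, of p] obtain kap0 where kap0: "0 < kap0" "!!kap. 0 < kap ==> kap < kap0 ==> \<forall>\<^sub>F T in at_right 0.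
   (LB z. (ldev p kap T z)^2) <= T * (eta * eps / 2)" by blast
 show ?thesis
 proof (intro exI[of _ kap0] conjI allI impI)
  fix kap assume "0 < kap \<and> kap < kap0"
  hence kap: "0 < kap" "kap < kap0" by auto
  have "EV T. (0::real) < T" by (simp add: eventually_at_filter)
  thus "EV T. dist_avg (p + kap) T <= dist_avg p T + kap * eps"
   using kap0(2)[OF kap]
  proof eventually_elim
   case (elim T)
   define r where "r z = level_diff p kap (u z) - ld_trace u p kap (snd z)" for z
   obtain C where C: "!!z. \<bar>r z\<bar> <= C" using trace_deviation(2)[OF ld_trace] unfolding r_def by blast
   have rm: "r \<in> Borel" unfolding r_def[abs_def]
    by (intro borel_measurable_diff weak_traceD(1)[OF ld_trace] snd_measurable weak_traceD(2)[OF ld_trace])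
   have "avg th phi (%z. (r z)^2) T <= eta * eps / 2"
    using elim unfolding deviation_avg[OF elim(1)] r_def by simp
   hence "avg th phi (%z. (r z)^2) T / eta <= eps / 2" using eta by (simp add: field_simps)
   hence ravg: "avg th phi (%z. \<bar>r z\<bar>) T <= eps" using avg_abs_le_square[OF elim(1) rm C eta] etam by linarith
   have "dist_avg (p + kap) T <= dist_avg p T + avg th phi (%z. kap * \<bar>r z\<bar>) T"
    unfolding dist_avg_def
   proof (rule avg_triangle[OF elim(1) clip_trace clip_trace])
    show "(%z. kap * \<bar>r z\<bar>) \<in> Borel" using rm by measurable
    show "\<bar>kap * \<bar>r z\<bar>\<bar> <= kap * C" for z using C[of z] kap(1) by (simp add: abs_mult)
    fix z
    have "(min (u z) (p + kap) - clip_trace (p + kap) (snd z)) - (min (u z) p - clip_trace p (snd z)) = kap * r z"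
     using level_diff_min[OF kap(1), of "u z" p] clip_trace_step[OF kap(1), of p "snd z"] by (simp add: r_def algebra_simps)
    moreover have "\<bar>kap * r z\<bar> = kap * \<bar>r z\<bar>" using kap(1) by (simp add: abs_mult)
    ultimately show "\<bar>min (u z) (p + kap) - clip_trace (p + kap) (snd z)\<bar> <= \<bar>min (u z) p - clip_trace p (snd z)\<bar> + kap * \<bar>r z\<bar>"
     by linarith
   qed
   also have "\<dots> <= dist_avg p T + kap * eps" unfolding avg_cmult using ravg kap(1) by simp
   finally show ?case .
  qed
 qed (rule kap0)
qed

text \<open>A crude growth rate, but valid for every \<open>T\<close> and every pair of levels. It
  carries the estimate from a level just below the supremum to the supremum itself, which
  \<open>dist_avg_step\<close> cannot do since its admissible step depends on the starting
  level.\<close>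

lemma dist_avg_Lipschitz:
 assumes T: "0 < T" and y: "y <= y'"
 shows "dist_avg y' T <= dist_avg y T + (y' - y) * mass"
proof -
 define w where "w x = \<bar>clip_trace y' x - clip_trace y x\<bar>" for x
 have "AE x in lborel. clip_trace y x <= clip_trace y' x + 0" "AE x in lborel. clip_trace y' x <= clip_trace y x + (y' - y)"
  by (rule weak_trace_le[OF clip_trace clip_trace]; use y in auto)+
 hence w: "AE x in lborel. w x <= y' - y" by eventually_elim (auto simp: w_def)
 have wm[measurable]: "w \<in> Borel" unfolding w_def[abs_def] using weak_traceD(2)[OF clip_trace] by measurable
 obtain K K' where "!!x. \<bar>clip_trace y x\<bar> <= K" "!!x. \<bar>clip_trace y' x\<bar> <= K'" using weak_traceD(4)[OF clip_trace] by metis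
 hence wb: "w x <= K' + K" for x unfolding w_def by (rule order_trans[OF abs_triangle_ineq4 add_mono, rotated])
 have w0: "0 <= w x" for x by (simp add: w_def)
 have wz: "(%z :: real \<times> (real^'d). w (snd z)) \<in> Borel" by (rule snd_measurable[OF wm])
 have "dist_avg y' T <= dist_avg y T + avg th phi (%z. w (snd z) + (y' - y)) T"
  unfolding dist_avg_def
 proof (rule avg_triangle[OF T clip_trace clip_trace])
  show "(%z :: real \<times> (real^'d). w (snd z) + (y' - y)) \<in> Borel" using wz by measurable
  show "\<bar>w (snd z) + (y' - y)\<bar> <= K' + K + (y' - y)" for z :: "real \<times> (real^'d)" using wb[of "snd z"] w0[of "snd z"] y by simp
  show "\<bar>min (u z) y' - clip_trace y' (snd z)\<bar> <= \<bar>min (u z) y - clip_trace y (snd z)\<bar> + (w (snd z) + (y' - y))" for z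
   using y unfolding w_def by linarith
 qed
 also have "avg th phi (%z. w (snd z) + (y' - y)) T = avg th phi (%z. w (snd z)) T + avg th phi (%z. y' - y) T"
  by (rule avg_add[OF T wz, where C="K' + K" and D="y' - y"]) (use wb w0 y in auto)
 also have "avg th phi (%z. w (snd z)) T <= (y' - y) * mass / 2"
 proof -
  have "avg th phi (%z. w (snd z)) T <= (LB x. (phi x)^2 * w x) / 2" by (rule avg_snd[OF T wm w0 wb])
  also have "(LB x. (phi x)^2 * w x) <= (LB x. (y' - y) * (phi x)^2)"
  proof (rule integral_mono_AE)
   have "L1 (%x. w x * (phi x)^2)" by (rule L1_mult(1)[OF phi2i wm, where C="K' + K"]) (use wb w0 in simp)
   thus "L1 (%x. (phi x)^2 * w x)" by (simp add: mult.commute)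
   show "AE x in lborel. (phi x)^2 * w x <= (y' - y) * (phi x)^2"
    using w by eventually_elim (auto simp: mult.commute[of "y' - y"] intro!: mult_left_mono)
  qed (intro integrable_mult_right phi2i)
  finally show ?thesis by (simp add: mass_def)
 qed
 also have "avg th phi (%z. y' - y) T <= (y' - y) * mass / 2" using avg_const[OF T, of "y' - y"] y by simp
 finally show ?thesis by (simp add: mult.commute)
qed

text \<open>At the bottom of the range both the truncation and its trace are the constant
  \<open>- M\<close>.\<close>

lemma dist_avg_start: "dist_avg (- M) T = 0"
proof -
 have "min (u z) (- M) = - M" for z using uM[of z] by (auto simp: min_def abs_le_iff)
 hence "\<bar>min (u z) (- M) - clip_trace (- M) x\<bar> = 0" for z x by (simp add: clip_trace_def)
 thus ?thesis unfolding dist_avg_def avg_def by (simp only: mult_zero_right) simp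
qed

text \<open>A continuity argument in the truncation level: the growth rate of the averaged distance is
 arbitrarily small at every level by \<open>dist_avg_step\<close>.\<close>

lemma dist_avg_small:
 assumes eps: "0 < eps" and eta: "0 < eta"
 shows "EV T. dist_avg M T <= eps * (M + M) + eta"
proof -
 define ok where "ok y \<longleftrightarrow> (\<forall>eta>0. EV T. dist_avg y T <= eps * (y + M) + eta)" for y
 define Y where "Y = {y. - M <= y \<and> y <= M \<and> ok y}"
 define s where "s = Sup Y"
 have "- M \<in> Y" using M0 by (auto simp: Y_def ok_def dist_avg_start)
 hence Yne: "Y \<noteq> {}" by blast
 have bdd: "bdd_above Y" by (rule bdd_aboveI[of _ M]) (simp add: Y_def)
 have s: "- M <= s" "s <= M" unfolding s_def
  using cSup_upper[OF \<open>- M \<in> Y\<close> bdd] cSup_least[OF Yne, of M] by (auto simp: Y_def)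
 have ev0: "EV T. (0::real) < T" by (simp add: eventually_at_filter)
 have oks: "ok s"
  unfolding ok_def
 proof (intro allI impI)
  fix eta :: real assume eta: "0 < eta"
  have ms: "0 < mass + 1" using mass_nonneg by simp
  have "s - eta / (2 * (mass + 1)) < Sup Y" using eta ms by (simp add: s_def)
  then obtain y where y: "y \<in> Y" "s - eta / (2 * (mass + 1)) < y" using less_cSup_iff[OF Yne bdd] by blast
  have ys: "y <= s" unfolding s_def by (rule cSup_upper[OF y(1) bdd])
  have "(s - y) * mass <= eta / (2 * (mass + 1)) * (mass + 1)" using y(2) ys mass_nonneg by (intro mult_mono) auto
  also have "\<dots> = eta / 2" using ms by (simp add: field_simps)
  finally have sy: "(s - y) * mass <= eta / 2" .
  have "EV T. dist_avg y T <= eps * (y + M) + eta / 2" using y(1) eta by (auto simp: Y_def ok_def)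
  with ev0 show "EV T. dist_avg s T <= eps * (s + M) + eta"
  proof eventually_elim
   case (elim T)
   have "eps * (y + M) <= eps * (s + M)" using eps ys by simp
   thus ?case using dist_avg_Lipschitz[OF elim(1) ys] sy elim(2) by linarith
  qed
 qed
 have "s = M"
 proof (rule ccontr)
  assume "s \<noteq> M"
  hence sM: "s < M" using s by simp
  obtain kap0 where kap0: "0 < kap0" "!!kap. 0 < kap ==> kap < kap0 ==> EV T. dist_avg (s + kap) T <= dist_avg s T + kap * eps"
   using dist_avg_step[OF eps, of s] by blast
  define kap where "kap = min (kap0 / 2) (M - s)"
  have kap: "0 < kap" "kap < kap0" "s + kap <= M" using kap0(1) sM by (auto simp: kap_def)
  have "ok (s + kap)"
   unfolding ok_def
  proof (intro allI impI)
   fix eta :: real assume "0 < eta"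
   hence "EV T. dist_avg s T <= eps * (s + M) + eta" using oks by (simp add: ok_def)
   with kap0(2)[OF kap(1,2)] show "EV T. dist_avg (s + kap) T <= eps * (s + kap + M) + eta"
    by eventually_elim (simp add: algebra_simps)
  qed
  hence "s + kap \<in> Y" using s kap by (auto simp: Y_def)
  hence "s + kap <= s" unfolding s_def by (rule cSup_upper[OF _ bdd])
  thus False using kap(1) by simp
 qed
 thus ?thesis using oks eta by (simp add: ok_def)
qed

text \<open>Vanishing averages alone give convergence only along suitable times. What is missing is
  that the distances to \<open>u0\<close> have an essential limit. To see this, \<open>u0\<close> is
  rounded to a function with finitely many values; on each of its level sets the distance of
  \<open>u\<close> to a constant has a weak trace. The averages then identify the limit as
  0.\<close>

lemma slice_distance_ess_lim0:
 assumes th0: "th 0 \<noteq> 0"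
 shows "ess_lim0 (%t. LB x. \<bar>u (t, x) - clip_trace M x\<bar> * (phi x)^2) 0"
proof -
 define u0 where "u0 = clip_trace M"
 have um': "min (u z) M = u z" for z using uM[of z] by (auto simp: min_def abs_le_iff)
 have tr: "weak_trace u u0" unfolding u0_def using clip_trace[of M] by (simp add: um')
 have u0m[measurable]: "u0 \<in> Borel" by (rule weak_traceD(2)[OF tr])
 obtain B where B: "!!x. \<bar>u0 x\<bar> <= B" using weak_traceD(4)[OF tr] by blast
 define m where "m t = (LB x. \<bar>u (t, x) - u0 x\<bar> * (phi x)^2)" for t
 have gm: "(%z. \<bar>u z - u0 (snd z)\<bar>) \<in> Borel" by (rule trace_deviation(1)[OF tr])
 have gb: "\<bar>\<bar>u z - u0 (snd z)\<bar>\<bar> <= M + B" for z using uM[of z] B[of "snd z"] by linarith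
 have i: "L1 (%x. \<bar>u (t, x) - h x\<bar> * (phi x)^2)" if "h \<in> Borel" "!!x. \<bar>h x\<bar> <= D" for t h D
 proof (rule L1_mult(1)[OF phi2i])
  show "(%x. \<bar>u (t, x) - h x\<bar>) \<in> Borel"
   by (intro borel_measurable_abs borel_measurable_diff measurable_slice[OF um] that)
  show "\<bar>\<bar>u (t, x) - h x\<bar>\<bar> <= M + D" for x using uM[of "(t, x)"] that(2)[of x] by linarith
 qed
 have "\<exists>L. ess_lim0 m L"
 proof (rule ess_lim0_Cauchy)
  fix eps :: real assume eps: "0 < eps"
  \<comment> \<open>Rounding \<open>u0\<close> to multiples of \<open>1 / real (Suc n)\<close>
    changes the weighted integral by at most \<open>mass / real (Suc n)\<close>, hence by at most
    \<open>eps / 2\<close>.\<close>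
  obtain n where n: "2 * mass / eps < real (Suc n)"
   using reals_Archimedean2 by (metis of_nat_less_iff lessI less_trans)
  define a where "a x = \<lfloor>real (Suc n) * u0 x\<rfloor>" for x
  define I where "I = {- \<lceil>real (Suc n) * (B + 1)\<rceil>..\<lceil>real (Suc n) * (B + 1)\<rceil>}"
  have aI: "a x \<in> I" for x
  proof -
   have "\<bar>real (Suc n) * u0 x\<bar> <= real (Suc n) * B" unfolding abs_mult using B[of x] by (intro mult_mono) auto
   hence "\<bar>real (Suc n) * u0 x\<bar> + 1 <= real (Suc n) * (B + 1)" by (simp add: algebra_simps)
   thus ?thesis unfolding I_def a_def by (simp add: abs_le_iff) linarith
  qed
  define h where "h x = of_int (a x) / real (Suc n)" for x
  have hm[measurable]: "h \<in> Borel" unfolding h_def[abs_def] a_def[abs_def] by measurable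
  have hu: "\<bar>u0 x - h x\<bar> <= 1 / real (Suc n)" for x
  proof -
   have "\<bar>real (Suc n) * u0 x - of_int (a x)\<bar> <= 1" unfolding a_def by linarith
   hence "\<bar>real (Suc n) * u0 x - of_int (a x)\<bar> / real (Suc n) <= 1 / real (Suc n)" by (intro divide_right_mono) auto
   moreover have "u0 x - h x = (real (Suc n) * u0 x - of_int (a x)) / real (Suc n)" unfolding h_def by (simp add: diff_divide_distrib)
   ultimately show ?thesis by (simp add: abs_divide)
  qed
  have hb: "\<bar>h x\<bar> <= B + 1" for x
  proof -
   have "1 / real (Suc n) <= 1" by simp
   thus ?thesis using hu[of x] B[of x] by linarith
  qed
  have am: "{x. a x = k} \<in> sets borel" for k unfolding a_def[abs_def] by measurable
  have Ai: "L1 (%x. indicator {x. a x = k} x * (phi x)^2)" for k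
   by (rule L1_mult(1)[OF phi2i, where C=1]) (use am in \<open>auto\<close>)
  have eq: "(LB x. \<bar>u (t, x) - h x\<bar> * (phi x)^2) = (\<Sum>k\<in>I. LB x. \<bar>u (t, x) - of_int k / real (Suc n)\<bar> * (indicator {x. a x = k} x * (phi x)^2))" for t
  proof -
   have ik: "L1 (%x. \<bar>u (t, x) - of_int k / real (Suc n)\<bar> * (indicator {x. a x = k} x * (phi x)^2))" for k
   proof (rule L1_mult(1)[OF Ai])
    show "(%x. \<bar>u (t, x) - of_int k / real (Suc n)\<bar>) \<in> Borel"
     by (intro borel_measurable_abs borel_measurable_diff measurable_slice[OF um] borel_measurable_const)
    show "\<bar>\<bar>u (t, x) - of_int k / real (Suc n)\<bar>\<bar> <= M + \<bar>of_int k / real (Suc n)\<bar>" for x using uM[of "(t, x)"] by linarith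
   qed
   have "\<bar>u (t, x) - h x\<bar> * (phi x)^2 = (\<Sum>k\<in>I. \<bar>u (t, x) - of_int k / real (Suc n)\<bar> * (indicator {x. a x = k} x * (phi x)^2))" for x
   proof -
    have "(\<Sum>k\<in>I. \<bar>u (t, x) - of_int k / real (Suc n)\<bar> * (indicator {x. a x = k} x * (phi x)^2)) =
     (\<Sum>k\<in>I. if k = a x then \<bar>u (t, x) - h x\<bar> * (phi x)^2 else 0)"
     by (intro sum.cong) (auto simp: h_def)
    also have "\<dots> = \<bar>u (t, x) - h x\<bar> * (phi x)^2" using aI[of x] by (simp add: I_def)
    finally show ?thesis ..
   qed
   thus ?thesis by (simp only: integral_sum[OF ik])
  qed
  define L where "L = (\<Sum>k\<in>I. LB x. level_trace u (of_int k / real (Suc n)) x * (indicator {x. a x = k} x * (phi x)^2))"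
  have "ess_lim0 (%t. LB x. \<bar>u (t, x) - h x\<bar> * (phi x)^2) L"
   unfolding eq L_def by (intro ess_lim0_sum weak_traceD(5)[OF level_trace] Ai)
  then obtain dl where dl: "0 < dl" "AE t in lborel. 0 < t \<and> t < dl --> \<bar>(LB x. \<bar>u (t, x) - h x\<bar> * (phi x)^2) - L\<bar> < eps / 2"
   unfolding ess_lim0_def using eps by (meson half_gt_zero)
  have close: "\<bar>m t - (LB x. \<bar>u (t, x) - h x\<bar> * (phi x)^2)\<bar> <= eps / 2" for t
  proof -
   have ii: "L1 (%x. \<bar>u (t, x) - u0 x\<bar> * (phi x)^2 - \<bar>u (t, x) - h x\<bar> * (phi x)^2)"
    by (intro integrable_diff i[OF u0m B] i[OF hm hb])
   have "\<bar>m t - (LB x. \<bar>u (t, x) - h x\<bar> * (phi x)^2)\<bar> = \<bar>LB x. \<bar>u (t, x) - u0 x\<bar> * (phi x)^2 - \<bar>u (t, x) - h x\<bar> * (phi x)^2\<bar>"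
    unfolding m_def integral_diff[OF i[OF u0m B] i[OF hm hb]] ..
   also have "\<dots> <= (LB x. \<bar>\<bar>u (t, x) - u0 x\<bar> * (phi x)^2 - \<bar>u (t, x) - h x\<bar> * (phi x)^2\<bar>)" by (rule integral_abs_bound)
   also have "\<dots> <= (LB x. 1 / real (Suc n) * (phi x)^2)"
   proof (intro integral_mono integrable_abs ii integrable_mult_right phi2i)
    fix x
    have "\<bar>\<bar>u (t, x) - u0 x\<bar> - \<bar>u (t, x) - h x\<bar>\<bar> <= 1 / real (Suc n)" using hu[of x] by linarith
    from mult_right_mono[OF this, of "(phi x)^2"]
    show "\<bar>\<bar>u (t, x) - u0 x\<bar> * (phi x)^2 - \<bar>u (t, x) - h x\<bar> * (phi x)^2\<bar> <= 1 / real (Suc n) * (phi x)^2"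
     by (simp add: left_diff_distrib[symmetric] abs_mult)
   qed
   also have "\<dots> = mass / real (Suc n)" by (simp add: mass_def)
   also have "\<dots> <= eps / 2"
   proof -
    have "2 * mass < real (Suc n) * eps" using n eps by (simp add: divide_less_eq del: of_nat_Suc)
    thus ?thesis by (simp add: divide_le_eq mult.commute del: of_nat_Suc)
   qed
   finally show ?thesis .
  qed
  show "\<exists>dl>0. \<exists>c. AE t in lborel. 0 < t \<and> t < dl --> \<bar>m t - c\<bar> <= eps"
  proof (rule exI[of _ dl], rule conjI[OF dl(1)], rule exI[of _ L])
   show "AE t in lborel. 0 < t \<and> t < dl --> \<bar>m t - L\<bar> <= eps"
    using dl(2)
   proof eventually_elim
    case (elim t)
    show ?case using elim close[of t] by (smt (verit) field_sum_of_halves)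
   qed
  qed
 qed
 then obtain L where L: "ess_lim0 m L" by blast
 have lim: "((%T. dist_avg M T) \<longlongrightarrow> (th 0)^2 * L / 2) (at_right 0)"
  unfolding dist_avg_def um' u0_def[symmetric]
  by (rule avg_ess_lim0[OF gm gb]) (use L in \<open>simp add: m_def[abs_def]\<close>)
 have "(th 0)^2 * L / 2 <= eps" if "0 < eps" for eps
 proof (rule tendsto_upperbound[OF lim])
  have e: "0 < eps / (2 * (2 * M + 1))" "0 < eps / 2" using that M0 by auto
  have "eps / (2 * (2 * M + 1)) * (M + M) <= eps / (2 * (2 * M + 1)) * (2 * M + 1)" using e(1) by (intro mult_left_mono) auto
  also have "\<dots> = eps / 2" using M0 unfolding times_divide_eq_left by (subst frac_eq_eq) auto
  finally show "EV T. dist_avg M T <= eps"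
   using dist_avg_small[OF e] by (auto elim!: eventually_mono)
 qed simp
 hence "(th 0)^2 * L / 2 <= 0" by (rule field_le_epsilon[of _ 0, simplified])
 moreover have "0 <= L"
  by (rule ess_lim0_le[OF ess_lim0_const L]) (simp add: m_def)
 ultimately have "L = 0" using th0 by (auto simp: mult_le_0_iff)
 thus ?thesis using L by (simp add: m_def[abs_def] u0_def)
qed

end

section \<open>The strong trace\<close>

lemma borel_bounded_version:
 fixes u :: "real \<times> 'a::euclidean_space => real"
 assumes "Linfty_on half_space u"
 obtains v M where "v \<in> Borel" "!!z. \<bar>v z\<bar> <= M" "AE z in lborel. z \<in> half_space --> u z = v z"
  "(%z. if z \<in> half_space then u z else 0) \<in> borel_measurable lebesgue"
proof -
 let ?u = "%z. if z \<in> half_space then u z else 0"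
 have hs: "half_space \<in> sets (lebesgue :: (real \<times> 'a) measure)" using half_space_borel by simp
 have um: "?u \<in> borel_measurable lebesgue"
  using assms unfolding Linfty_on_def by (simp add: borel_measurable_if[OF hs])
 then obtain g where g: "g \<in> borel_measurable lborel" "AE z in lborel. ?u z = g z"
  using completion_ex_borel_measurable_real by blast
 obtain M where "AE z in lebesgue_on half_space. \<bar>u z\<bar> <= M" using assms unfolding Linfty_on_def by blast
 hence M: "AE z in lborel. z \<in> half_space --> \<bar>u z\<bar> <= M"
  using hs by (simp add: AE_restrict_space_iff AE_completion_iff)
 define v where "v z = max (- \<bar>M\<bar>) (min (g z) \<bar>M\<bar>)" for z
 have "v \<in> Borel" using g(1) unfolding v_def[abs_def] by simp
 moreover have "\<bar>v z\<bar> <= \<bar>M\<bar>" for z by (auto simp: v_def)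
 moreover have "AE z in lborel. z \<in> half_space --> u z = v z"
  using g(2) M by eventually_elim (auto simp: v_def)
 ultimately show ?thesis using that um by blast
qed

lemma half_space_integral_borel:
 fixes u v psi :: "real \<times> 'a::euclidean_space => real" and g :: "real => real"
 assumes v: "v \<in> Borel" and uv: "AE z in lborel. z \<in> half_space --> u z = v z"
  and um: "(%z. if z \<in> half_space then u z else 0) \<in> borel_measurable lebesgue"
  and g: "g \<in> Borel" and psi: "psi \<in> Borel"
 shows "(LINT z:half_space|lebesgue. g (u z) * psi z) = (LB z. hs z * (g (v z) * psi z))"
proof -
 let ?t1 = "%z. g (if z \<in> half_space then u z else 0) * psi z"
 note [measurable] = v g psi
 have hs: "half_space \<in> sets (lebesgue :: (real \<times> 'a) measure)" using half_space_borel by simp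
 have bl: "h \<in> borel_measurable lebesgue" if "h \<in> Borel" for h :: "real \<times> 'a => real"
  using that by (intro measurable_completion) simp
 have "(LINT z:half_space|lebesgue. g (u z) * psi z) = (LINT z|lebesgue. hs z * (?t1 z))"
  unfolding set_lebesgue_integral_def by (intro integral_cong refl) simp
 also have "\<dots> = (LINT z|lebesgue. hs z * (g (v z) * psi z))"
 proof (rule integral_cong_AE)
  show "(%z. hs z * (?t1 z)) \<in> borel_measurable lebesgue"
   using hs by (intro borel_measurable_times borel_measurable_indicator bl[OF psi] measurable_compose[OF um g])
  show "(%z. hs z * (g (v z) * psi z)) \<in> borel_measurable lebesgue"
   using half_space_borel by (intro bl) measurable
  show "AE z in lebesgue. hs z * (?t1 z) = hs z * (g (v z) * psi z)"
   using AE_completion[OF uv] by eventually_elim (auto simp: indicator_def)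
 qed
 also have "\<dots> = (LB z. hs z * (g (v z) * psi z))"
  by (rule integral_completion) (use half_space_borel in measurable)
 finally show ?thesis .
qed

lemma test_fun_of_test_functions:
 assumes "psi \<in> test_functions S" shows "test_fun psi"
proof -
 have "bounded (closure {z. psi z \<noteq> 0})" using assms by (auto simp: test_functions_def intro: compact_imp_bounded)
 then obtain R where R: "!!z. z \<in> closure {z. psi z \<noteq> 0} ==> norm z <= R" unfolding bounded_iff by blast
 have "psi z = 0" if "R < norm z" for z
  using R[of z] that closure_subset[of "{z. psi z \<noteq> 0}"] by force
 thus ?thesis using assms unfolding test_fun_def test_functions_def smooth_def by blast
qed

text \<open>The identity map is here the inclusion of the half space, so the image measure is the
  extension by zero to the whole space.\<close>

lemma radon_distr:
 fixes nu :: "(real \<times> 'a::euclidean_space) signed_measure"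
 assumes "nu \<in> radon_half_space" and Q: "Q = fst nu \<or> Q = snd nu"
 defines "P \<equiv> distr Q borel (%z. z)"
 shows "sets P = sets borel" (is ?goalA) "compact K ==> emeasure P ({0<..T} \<times> K) < \<infinity>" "emeasure P (- half_space) = 0" (is ?goalC)
  "psi \<in> Borel ==> (LINT z|P. psi z) = (LINT z|Q. (psi z :: real))"
proof -
 have s: "sets Q = sets (restrict_space borel half_space)" using assms(1) Q by (auto simp: radon_half_space_def)
 hence sp: "space Q = half_space" using sets_eq_imp_space_eq[OF s] by (simp add: space_restrict_space)
 have idm: "(%z. z) \<in> Q \<rightarrow>\<^sub>M borel"
  using measurable_restrict_space1[OF measurable_ident_sets[OF refl]] measurable_cong_sets[OF s refl] by (auto simp: id_def)
 have em: "emeasure P S = emeasure Q (S \<inter> half_space)" if "S \<in> sets borel" for S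
  unfolding P_def using emeasure_distr[OF idm that] by (simp add: sp)
 show ?goalA by (simp add: P_def)
 show ?goalC using em[of "- half_space"] half_space_borel by simp
 show "(LINT z|P. psi z) = (LINT z|Q. psi z)" if "psi \<in> Borel"
  for psi :: "real \<times> 'a => real"
  unfolding P_def using integral_distr[OF idm that] .
 show "emeasure P ({0<..T} \<times> K) < \<infinity>" if K: "compact K"
 proof (cases "0 < T")
  case True
  have KT: "{0<..T} \<times> K \<in> sets borel"
  proof -
   have "{0<..T} \<times> K \<in> sets ((borel :: real measure) \<Otimes>\<^sub>M (borel :: 'a measure))"
    using K by (intro pair_measureI) (auto intro: borel_compact)
   thus ?thesis unfolding borel_prod .
  qed
  have "({0<..T} \<times> K) \<inter> half_space = {0<..T} \<times> K" by (auto simp: half_space_def)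
  moreover have "emeasure Q ({0<..T} \<times> K) <= variation nu ({0<..T} \<times> K)"
   using Q by (auto simp: variation_def)
  moreover have "variation nu ({0<..T} \<times> K) < \<infinity>" using assms(1) True K by (auto simp: radon_half_space_def)
  ultimately show ?thesis using em[OF KT] by (auto simp: less_top intro: order.strict_trans1)
 next
  case False
  hence "{0<..T} \<times> K = {}" by auto
  thus ?thesis by (simp only: emeasure_empty) simp
 qed
qed

text \<open>Only the values of \<open>f\<close> and \<open>A\<close> on the compact range of the
  bounded representative matter, and continuity bounds them there. The integrals see
  \<open>u\<close> only up to null sets, so the distributional identity passes to
  \<open>v\<close>.\<close>

lemma quasi_solution_balance_law:
 fixes f :: "real => real^'d" and A :: "real => real^'d^'d" and u v :: "real \<times> (real^'d) => real"
 assumes f: "continuous_on UNIV f" and A: "continuous_on UNIV A"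
  and v: "v \<in> Borel" "!!z. \<bar>v z\<bar> <= M" and uv: "AE z in lborel. z \<in> half_space --> u z = v z"
  and um: "(%z. if z \<in> half_space then u z else 0) \<in> borel_measurable lebesgue"
  and gamma: "gamma \<in> radon_half_space"
  and eq: "!!psi. psi \<in> test_functions half_space ==> dist_dt (%z. \<bar>u z - l\<bar>) psi
      + dist_div (%z. sgn (u z - l) *\<^sub>R (f (u z) - f l)) psi
      - dist_D2 (%z. sgn (u z - l) *\<^sub>R (A (u z) - A l)) psi = - signed_integral gamma psi"
 shows "\<exists>C. balance_law (%z. \<bar>v z - l\<bar>) (%k z. (sgn (v z - l) *\<^sub>R (f (v z) - f l)) $ k)
    (%k j z. (sgn (v z - l) *\<^sub>R (A (v z) - A l)) $ k $ j) (%k. axis k 1) (distr (fst gamma) borel (%z. z)) (distr (snd gamma) borel (%z. z)) C"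
proof -
 let ?t1 = "%psi. LB z. hs z * (\<bar>v z - l\<bar> * dd (1, 0) psi z
   + (\<Sum>k\<in>UNIV. (sgn (v z - l) *\<^sub>R (f (v z) - f l)) $ k * dd (0, axis k 1) psi z)
   + (\<Sum>k\<in>UNIV. \<Sum>j\<in>UNIV. (sgn (v z - l) *\<^sub>R (A (v z) - A l)) $ k $ j * dd (0, axis k 1) (dd (0, axis j 1) psi) z))"
 let ?t2 = "%z. sgn (v z - l) *\<^sub>R (f (v z) - f l)"
 let ?t3 = "%z. sgn (v z - l) *\<^sub>R (A (v z) - A l)"
 have bd: "\<exists>B. \<forall>z. norm (h (v z)) <= B" if "continuous_on UNIV h" for h :: "real => 'b::real_normed_vector"
 proof -
  have "bounded (h ` {- M..M})"
   by (intro compact_imp_bounded compact_continuous_image continuous_on_subset[OF that]) auto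
  then obtain B where B: "!!y. y \<in> {- M..M} ==> norm (h y) <= B" unfolding bounded_iff by blast
  have "v z \<in> {- M..M}" for z using v(2)[of z] by (auto simp: abs_le_iff)
  thus ?thesis using B by blast
 qed
 obtain Bv where Bv: "!!z. \<bar>v z - l\<bar> <= Bv" using bd[OF continuous_on_diff[OF continuous_on_id continuous_on_const], of l] unfolding real_norm_def by blast
 obtain Bf where Bf: "!!z. norm (f (v z) - f l) <= Bf" using bd[OF continuous_on_diff[OF f continuous_on_const]] by blast
 obtain BA where BA: "!!z. norm (A (v z) - A l) <= BA" using bd[OF continuous_on_diff[OF A continuous_on_const]] by blast
 define C where "C = max Bv (max Bf BA)"
 have sg: "norm (sgn y *\<^sub>R w) <= norm w" for y :: real and w :: "'b::real_normed_vector"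
  by (cases y "0::real" rule: linorder_cases) auto
 have bv: "\<bar>\<bar>v z - l\<bar>\<bar> <= C" for z using Bv[of z] by (simp add: C_def)
 have bF: "\<bar>(?t2 z) $ k\<bar> <= C" for z k
  using order_trans[OF order_trans[OF component_le_norm_cart sg] Bf[of z]] unfolding C_def le_max_iff_disj by blast
 have bA: "\<bar>(?t3 z) $ k $ j\<bar> <= C" for z k j
  using order_trans[OF order_trans[OF order_trans[OF component_le_norm_cart Finite_Cartesian_Product.norm_nth_le] sg] BA[of z]]
  unfolding C_def le_max_iff_disj by blast
 have mv: "(%y. \<bar>y - l\<bar>) \<in> Borel" by measurable
 have mf: "(%y. (sgn (y - l) *\<^sub>R (f y - f l)) $ k) \<in> Borel" for k
 proof -
  have [measurable]: "(%y. (f y - f l) $ k) \<in> Borel"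
   by (intro borel_measurable_continuous_onI continuous_intros f)
  show ?thesis unfolding vector_scaleR_component by measurable
 qed
 have mA: "(%y. (sgn (y - l) *\<^sub>R (A y - A l)) $ k $ j) \<in> Borel" for k j
 proof -
  have [measurable]: "(%y. (A y - A l) $ k $ j) \<in> Borel"
   by (intro borel_measurable_continuous_onI continuous_intros A)
  show ?thesis unfolding vector_scaleR_component by measurable
 qed
 note cv = measurable_compose[OF v(1)]
 show ?thesis
 proof (intro exI[of _ C] balance_law.intro radon_distr(1-3)[OF gamma] disjI1[OF refl] disjI2[OF refl] bv bF bA cv mv mf mA)
  fix psi :: "real \<times> (real^'d) => real" assume psi: "psi \<in> test_functions half_space"
  have t: "test_fun psi" by (rule test_fun_of_test_functions[OF psi])
  have m: "psi' \<in> Borel" if "test_fun psi'" for psi' :: "real \<times> (real^'d) => real"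
   by (rule bsupp_measurable[OF test_fun_bsupp[OF that]])
  note td = test_fun_dir_deriv[OF t] and tdd = test_fun_dir_deriv[OF test_fun_dir_deriv[OF t]]
  note I = half_space_integral_borel[OF v(1) uv um]
  have intg: "L1 (%z. hs z * (w z * psi' z))"
   if "test_fun psi'" "w \<in> Borel" "!!z. \<bar>w z\<bar> <= C" for w psi' :: "real \<times> (real^'d) => real"
   by (rule L1_mult(1)[OF L1_mult(1)[OF test_fun_integrable[OF that(1)] that(2,3)], where C=1])
    (auto simp: half_space_borel)
  note iv = intg[OF td cv[OF mv] bv] and iF = intg[OF td cv[OF mf] bF] and iA = intg[OF tdd cv[OF mA] bA]
  have "signed_integral gamma psi = (LB z. hs z * (\<bar>v z - l\<bar> * dd (1, 0) psi z))
   + (\<Sum>k\<in>UNIV. LB z. hs z * ((?t2 z) $ k * dd (0, axis k 1) psi z))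
   + (\<Sum>k\<in>UNIV. \<Sum>j\<in>UNIV. LB z. hs z * ((?t3 z) $ k $ j * dd (0, axis k 1) (dd (0, axis j 1) psi) z))"
   using eq[OF psi] unfolding dist_dt_def dist_div_def dist_D2_def I[OF mv m[OF td]] I[OF mf m[OF td]] I[OF mA m[OF tdd]] by simp
  also have "\<dots> = (LB z. hs z * (\<bar>v z - l\<bar> * dd (1, 0) psi z)
   + (\<Sum>k\<in>UNIV. hs z * ((?t2 z) $ k * dd (0, axis k 1) psi z))
   + (\<Sum>k\<in>UNIV. \<Sum>j\<in>UNIV. hs z * ((?t3 z) $ k $ j * dd (0, axis k 1) (dd (0, axis j 1) psi) z)))"
   by (subst integral_add[OF integrable_add integrable_sum],
    (simp only: integral_add integral_sum iv iF iA integrable_sum)+)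
  also have "\<dots> = (?t1 psi)"
   by (simp only: distrib_left sum_distrib_left)
  finally show "(?t1 psi)
   = (LINT z|distr (fst gamma) borel (%z. z). psi z) - (LINT z|distr (snd gamma) borel (%z. z). psi z)"
   unfolding radon_distr(4)[OF gamma disjI1[OF refl] m[OF t]] radon_distr(4)[OF gamma disjI2[OF refl] m[OF t]] signed_integral_def ..
 qed
qed

text \<open>One set of times has to serve all \<open>K\<close>. Countably many bumps and countably
  many rates \<open>1 / real (Suc k)\<close> produce a single null set of exceptional times, and for
  each relatively compact \<open>K\<close> some bump is bounded below on its closure.\<close>

lemma strong_trace_of_ess_lim0:
 fixes u :: "real \<times> 'a::euclidean_space => real"
 assumes v: "v \<in> Borel" "!!z. \<bar>v z\<bar> <= M" and uv: "AE z in lborel. z \<in> half_space --> u z = v z"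
  and h: "h \<in> Borel" "!!x. \<bar>h x\<bar> <= B"
  and lim: "!!n. ess_lim0 (%t. LB x. \<bar>v (t, x) - h x\<bar> * (bump (real (Suc n)) x)^2) 0"
 shows "strong_trace u h"
proof -
 define m where "m n t = (LB x. \<bar>v (t, x) - h x\<bar> * (bump (real (Suc n)) x)^2)" for n t
 have "\<exists>dl. 0 < dl \<and> (AE t in lborel. 0 < t \<and> t < dl --> \<bar>m n t - 0\<bar> < 1 / real (Suc k))" for n k
  using lim[of n] unfolding ess_lim0_def m_def[symmetric] by auto
 then obtain dl where dl: "!!n k. 0 < dl n k" "!!n k. AE t in lborel. 0 < t \<and> t < dl n k --> \<bar>m n t - 0\<bar> < 1 / real (Suc k)"
  by metis
 \<comment> \<open>Agreement of the slices almost everywhere makes those of \<open>u\<close>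
   integrable at every time in \<open>E\<close>; at other times they need not even be measurable.
   For the rates, membership turns the almost everywhere estimates into inequalities at the given
   time.\<close>
 define E where "E = {t. 0 < t \<and> (AE x in lborel. u (t, x) = v (t, x)) \<and> (\<forall>n k. t < dl n k --> \<bar>m n t\<bar> < 1 / real (Suc k))}"
 have "AE z in lborel \<Otimes>\<^sub>M lborel. z \<in> half_space --> u z = v z" using uv unfolding lborel_prod .
 hence "AE t in lborel. AE x in lborel. (t, x) \<in> half_space --> u (t, x) = v (t, x)" by (rule lborel_pair.AE_pair)
 moreover have "AE t in lborel. \<forall>n k. 0 < t \<and> t < dl n k --> \<bar>m n t - 0\<bar> < 1 / real (Suc k)"
  unfolding AE_all_countable using dl(2) by blast
 ultimately have "AE t in lborel. 0 < t --> t \<in> E"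
  by eventually_elim (auto simp: E_def half_space_eq)
 then obtain N where N: "N \<in> null_sets lborel" "{t. \<not> (0 < t --> t \<in> E)} \<subseteq> N" unfolding eventually_ae_filter by auto
 have Enull: "{0<..} - E \<in> null_sets lebesgue"
  by (rule null_sets_completion_subset[OF _ null_sets_completionI[OF N(1)]]) (use N(2) in auto)
 have vm: "(%x. \<bar>v (t, x) - h x\<bar>) \<in> Borel" "(%x. v (t, x) - h x) \<in> Borel" for t
  by (intro borel_measurable_abs borel_measurable_diff measurable_slice[OF v(1)] h)+
 have vb: "\<bar>v (t, x) - h x\<bar> <= M + B" for t x using v(2)[of "(t, x)"] h(2)[of x] by linarith
 have main: "(%x. u (t, x) - h x) absolutely_integrable_on K"
  "(LINT x:K|lebesgue. \<bar>u (t, x) - h x\<bar>) = (LINT x|lebesgue. indicator K x * \<bar>v (t, x) - h x\<bar>)"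
  "integrable lebesgue (%x. indicator K x * \<bar>v (t, x) - h x\<bar>)"
  if K: "K \<in> sets lebesgue" "compact (closure K)" and t: "t \<in> E" for K t
 proof -
  have Kb: "bounded K" using K(2) compact_imp_bounded bounded_subset closure_subset by blast
  have Kf: "emeasure lebesgue K < \<infinity>" using fmeasurableD2[OF bounded_set_imp_lmeasurable[OF Kb K(1)]] by (simp add: less_top)
  have iK: "integrable lebesgue (indicator K :: 'a => real)" using Kf K(1) by (intro integrable_real_indicator) auto
  have bl: "w \<in> borel_measurable lebesgue" if "w \<in> Borel" for w :: "'a => real"
   using that by (intro measurable_completion) simp
  have i: "integrable lebesgue (%x. indicator K x * w x)" if "w \<in> Borel" "!!x. \<bar>w x\<bar> <= M + B" for w
  proof (rule integrable_bound[OF integrable_mult_right[OF iK, of "M + B"]])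
   show "(%x. indicator K x * w x) \<in> borel_measurable lebesgue"
    using K(1) by (intro borel_measurable_times borel_measurable_indicator bl that(1))
   show "AE x in lebesgue. norm (indicator K x * w x) <= norm ((M + B) * indicator K x)"
    using order_trans[OF that(2) abs_ge_self] by (intro AE_I2) (auto simp: indicator_def)
  qed
  show "integrable lebesgue (%x. indicator K x * \<bar>v (t, x) - h x\<bar>)" by (rule i[OF vm(1)]) (use vb in simp)
  have "(%x. v (t, x) - h x) absolutely_integrable_on K"
   unfolding set_integrable_def using i[OF vm(2) vb] by simp
  moreover have "negligible {x. u (t, x) \<noteq> v (t, x)}"
   using t unfolding E_def by (auto simp: negligible_iff_null_sets eventually_ae_filter null_sets_completion_iff2)
  ultimately show ai: "(%x. u (t, x) - h x) absolutely_integrable_on K"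
   by (rule absolutely_integrable_spike) auto
  have "AE x in lborel. u (t, x) = v (t, x)" using t by (simp add: E_def)
  hence "AE x in lebesgue. u (t, x) = v (t, x)" by (rule AE_completion)
  thus "(LINT x:K|lebesgue. \<bar>u (t, x) - h x\<bar>) = (LINT x|lebesgue. indicator K x * \<bar>v (t, x) - h x\<bar>)"
   unfolding set_lebesgue_integral_def
  proof (intro integral_cong_AE)
   have "(%x. \<bar>u (t, x) - h x\<bar>) absolutely_integrable_on K" using absolutely_integrable_abs[OF ai] by simp
   thus "(%x. indicator K x *\<^sub>R \<bar>u (t, x) - h x\<bar>) \<in> borel_measurable lebesgue"
    unfolding set_integrable_def by (rule borel_measurable_integrable)
   show "(%x. indicator K x * \<bar>v (t, x) - h x\<bar>) \<in> borel_measurable lebesgue"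
    using i[OF vm(1)] vb by (intro borel_measurable_integrable) simp
  qed (auto elim!: eventually_mono)
 qed
 have conv: "((%t. LINT x:K|lebesgue. \<bar>u (t, x) - h x\<bar>) \<longlongrightarrow> 0) (at 0 within E)"
  if K: "K \<in> sets lebesgue" "compact (closure K)" for K
 proof -
  obtain R where R: "!!x. x \<in> closure K ==> norm x <= R" using compact_imp_bounded[OF K(2)] unfolding bounded_iff by blast
  obtain n where n: "R < real n" using reals_Archimedean2 by blast
  define phi :: "'a => real" where "phi = bump (real (Suc n))"
  have phit: "test_fun phi" unfolding phi_def by (rule test_fun_bump) simp
  have "\<exists>c>0. \<forall>x\<in>closure K. c <= (phi x)^2"
  proof (cases "K = {}")
   case False
   have "continuous_on (closure K) (%x. (phi x)^2)"
    by (intro continuous_intros continuous_on_subset[OF smooth_continuous[OF test_fun_smooth[OF phit]]]) auto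
   from continuous_attains_inf[OF K(2) _ this] False obtain x0 where x0: "x0 \<in> closure K" "!!x. x \<in> closure K ==> (phi x0)^2 <= (phi x)^2" by auto
   have "0 < phi x0" unfolding phi_def by (rule bump_pos) (use R[OF x0(1)] n in simp)
   thus ?thesis using x0(2) by (intro exI[of _ "(phi x0)^2"]) auto
  qed (auto intro: exI[of _ 1])
  then obtain c where c: "0 < c" "!!x. x \<in> closure K ==> c <= (phi x)^2" by blast
  have le: "c * (LINT x:K|lebesgue. \<bar>u (t, x) - h x\<bar>) <= m n t" if t: "t \<in> E" for t
  proof -
   have bi: "L1 (%x. \<bar>v (t, x) - h x\<bar> * (phi x)^2)"
    by (rule L1_mult(1)[OF bsupp_integrable[OF bsupp_sq[OF test_fun_bsupp[OF phit]]] vm(1), where C="M + B"])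
     (use vb in simp)
   hence bm: "(%x. \<bar>v (t, x) - h x\<bar> * (phi x)^2) \<in> borel_measurable lborel" by auto
   have "c * (LINT x|lebesgue. indicator K x * \<bar>v (t, x) - h x\<bar>) = (LINT x|lebesgue. c * (indicator K x * \<bar>v (t, x) - h x\<bar>))" by simp
   also have "\<dots> <= (LINT x|lebesgue. \<bar>v (t, x) - h x\<bar> * (phi x)^2)"
   proof (rule integral_mono)
    show "integrable lebesgue (%x. c * (indicator K x * \<bar>v (t, x) - h x\<bar>))" by (intro integrable_mult_right main(3)[OF K t])
    show "integrable lebesgue (%x. \<bar>v (t, x) - h x\<bar> * (phi x)^2)" using bi bm by (simp add: integrable_completion)
    show "c * (indicator K x * \<bar>v (t, x) - h x\<bar>) <= \<bar>v (t, x) - h x\<bar> * (phi x)^2" for x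
     using mult_left_mono[OF c(2)[of x], of "\<bar>v (t, x) - h x\<bar>"] closure_subset[of K] by (auto simp: indicator_def mult.commute)
   qed
   also have "\<dots> = m n t" unfolding m_def phi_def[symmetric] by (rule integral_completion[OF bm])
   finally show ?thesis unfolding main(2)[OF K t] .
  qed
  show ?thesis
  proof (rule tendstoI)
   fix eps :: real assume eps: "0 < eps"
   hence "0 < c * eps" using c by simp
   then obtain k where k: "1 / real (Suc k) < c * eps" using nat_approx_posE by blast
   show "\<forall>\<^sub>F t in at 0 within E. dist (LINT x:K|lebesgue. \<bar>u (t, x) - h x\<bar>) 0 < eps"
    unfolding eventually_at
   proof (intro exI[of _ "dl n k"] conjI ballI impI dl(1))
    fix t assume t: "t \<in> E" "t \<noteq> 0 \<and> dist t 0 < dl n k"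
    hence "\<bar>m n t\<bar> < 1 / real (Suc k)" by (auto simp: E_def dist_real_def)
    hence "c * (LINT x:K|lebesgue. \<bar>u (t, x) - h x\<bar>) < c * eps" using le[OF t(1)] k by linarith
    moreover have "0 <= (LINT x:K|lebesgue. \<bar>u (t, x) - h x\<bar>)"
     unfolding set_lebesgue_integral_def by (rule integral_nonneg_AE) simp
    ultimately show "dist (LINT x:K|lebesgue. \<bar>u (t, x) - h x\<bar>) 0 < eps" using c(1) by (simp add: dist_real_def)
   qed
  qed
 qed
 show ?thesis
  unfolding strong_trace_def by (rule exI[of _ E]) (use Enull main(1) conv in \<open>auto simp: E_def\<close>)
qed

theorem theorem4:
  fixes f :: "real \<Rightarrow> real^'d"
    and A :: "real \<Rightarrow> real^'d^'d"
    and u :: "real \<times> (real^'d) \<Rightarrow> real"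
  assumes "f C1_differentiable_on UNIV"
    and "A C1_differentiable_on UNIV"
    and "\<And>l. transpose (A l) = A l"
    and "\<And>l. positive_semidefinite (vector_derivative A (at l))"
    and "Linfty_on half_space u"
    and "quasi_solution f A u"
  shows "\<exists>u0. Linfty_on UNIV u0 \<and> strong_trace u u0"
proof -
 obtain f' where f: "!!l. (f has_vector_derivative f' l) (at l)" "continuous_on UNIV f'"
  using assms(1) unfolding C1_differentiable_on_def by auto
 obtain A' where A: "!!l. (A has_vector_derivative A' l) (at l)" "continuous_on UNIV A'"
  using assms(2) unfolding C1_differentiable_on_def by auto
 have psd: "positive_semidefinite (A' l)" for l
  using assms(4)[of l] vector_derivative_at[OF A(1)] by simp
 have cont: "continuous_on UNIV f" "continuous_on UNIV A"
  using f(1) A(1) by (auto intro!: continuous_at_imp_continuous_on has_vector_derivative_continuous)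
 obtain v M where v: "v \<in> Borel" "!!z. \<bar>v z\<bar> <= M" "AE z in lborel. z \<in> half_space --> u z = v z"
  "(%z. if z \<in> half_space then u z else 0) \<in> borel_measurable lebesgue"
  by (rule borel_bounded_version[OF assms(5)]) (erule that; assumption)
 obtain gamma where gamma: "!!l. gamma l \<in> radon_half_space"
  and eq: "!!l psi. psi \<in> test_functions half_space ==> dist_dt (%z. \<bar>u z - l\<bar>) psi
      + dist_div (%z. sgn (u z - l) *\<^sub>R (f (u z) - f l)) psi
      - dist_D2 (%z. sgn (u z - l) *\<^sub>R (A (u z) - A l)) psi = - signed_integral (gamma l) psi"
  using assms(6) unfolding quasi_solution_def by blast
 interpret kruzkov_levels f f' A A' v M "%l. distr (fst (gamma l)) borel (%z. z)" "%l. distr (snd (gamma l)) borel (%z. z)"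
  by (intro kruzkov_levels.intro f A psd v quasi_solution_balance_law[OF cont v gamma eq])
 \<comment> \<open>The candidate does not involve the cutoffs, so it is the same for every
   \<open>n\<close>. At the level \<open>M\<close> truncation does nothing, and this is the weak
   trace of \<open>v\<close> itself.\<close>
 define u0 where "u0 = levels_averaging.clip_trace v M M"
 have av: "averaging (bump 1) (bump (real (Suc n)) :: real^'d => real)" for n
  by unfold_locales (auto intro: test_fun_bump simp: bump_nonneg bump_le_1)
 have la: "levels_averaging f f' A A' v M (%l. distr (fst (gamma l)) borel (%z. z)) (%l. distr (snd (gamma l)) borel (%z. z)) (bump 1) (bump (real (Suc n)))" for n
  by (intro levels_averaging.intro kruzkov_levels_axioms av)
 have tr: "weak_trace (%z. min (v z) M) u0" unfolding u0_def by (rule levels_averaging.clip_trace[OF la])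
 obtain B where B: "!!x. \<bar>u0 x\<bar> <= B" using weak_traceD(4)[OF tr] by blast
 have "bump 1 (0::real) \<noteq> 0" using bump_pos[of "0::real" 1] by simp
 from levels_averaging.slice_distance_ess_lim0[OF la this]
 have "strong_trace u u0"
  unfolding u0_def[symmetric] by (rule strong_trace_of_ess_lim0[OF v(1-3) weak_traceD(2)[OF tr] B])
 moreover have "u0 \<in> borel_measurable (lebesgue_on UNIV)"
  by (intro measurable_restrict_space1 measurable_completion) (use weak_traceD(2)[OF tr] in simp)
 hence "Linfty_on UNIV u0" unfolding Linfty_on_def using B by auto
 ultimately show ?thesis by blast
qed

end
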